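(* All polygons commute in the diagram formed by the categories $\mathbf{ALG},\mathbf{RBA},\mathbf{DIF},\mathbf{DRB},\mathbf{ALG}^{\mathbf T},\mathbf{ALG}_{\mathbf C},\mathbf{RBA}_{\mathbf C'},\mathbf{DIF}^{\mathbf T'},(\mathbf{ALG}^{\mathbf T})_{\widetilde{\mathbf C}},(\mathbf{ALG}_{\mathbf C})^{\widetilde{\mathbf T}}$ and the functors between them; that is, the following equalities of functors hold: (1) $U^{\mathbf T}K=U$; (2) $V_{\mathbf C}H=V$; (3) $V'_{\mathbf C'}H'=V'$; (4) $V_{\widetilde{\mathbf C}}\widetilde K=KV'_{\mathbf C'}$; (5) $U'^{\mathbf T'}K'=U'$; (6) $U^{\widetilde{\mathbf T}}\widetilde H=HU'^{\mathbf T'}$; (7) $V_{\mathbf C}U^{\widetilde{\mathbf T}}\Phi=U^{\mathbf T}V_{\widetilde{\mathbf C}}$; (8) $\Phi\widetilde KH'=\widetilde HK'$; and hence also $UV'=VU'$ for the outer polygon. Here all the functors labelled $U$ or $V$ (with any decoration) are forgetful functors; each of the functors $U,U',U^{\mathbf T},U'^{\mathbf T'},U^{\widetilde{\mathbf T}}$ has a left adjoint, each of the functors $V,V',V_{\mathbf C},V'_{\mathbf C'},V_{\widetilde{\mathbf C}}$ has a right adjoint, and these adjunctions generate the monads and comonads of the diagram ($U,U^{\mathbf T}$ generate $\mathbf T$; $U',U'^{\mathbf T'}$ generate $\mathbf T'$; $U^{\widetilde{\mathbf T}}$ generates $\widetilde{\mathbf T}$; $V,V_{\mathbf C}$ generate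 $\mathbf C$; $V',V'_{\mathbf C'}$ generate $\mathbf C'$; $V_{\widetilde{\mathbf C}}$ generates $\widetilde{\mathbf C}$). The functors $K,K',\widetilde K,H,H',\widetilde H$ are isomorphisms of categories.
   Context: Fix a commutative ring $\mathbf k$ with identity and $\lambda\in\mathbf k$. All algebras are commutative $\mathbf k$-algebras with identity, algebra homomorphisms preserve the identity, and tensor products are over $\mathbf k$. $\mathbf{ALG}$ is the category of such algebras; $\mathbb N=\{0,1,2,\dots\}$. Below, superscripts on a category denote categories of algebras over a monad and subscripts denote categories of coalgebras over a comonad. A Rota-Baxter operator on an algebra $R$ is a $\mathbf k$-linear $P:R\to R$ with $P(x)P(y)=P(xP(y))+P(yP(x))+\lambda P(xy)$. A $\lambda$-derivation on $R$ is a $\mathbf k$-linear $d:R\to R$ with $d(xy)=d(x)y+xd(y)+\lambda d(x)d(y)$ and $d(\mathbf 1_R)=0$. $\mathbf{RBA}$, $\mathbf{DIF}$, $\mathbf{DRB}$ are the categories of pairs $(R,P)$ with $P$ a Rota-Baxter operator, pairs $(R,d)$ with $d$ a $\lambda$-derivation, and triples $(R,d,P)$ with $d$ a $\lambda$-derivation, $P$ a Rota-Baxter operator and $d\circ P=\mathrm{id}_R$; morphisms are algebra homomorphisms commuting with the operators. Forgetful functors: $U:\mathbf{RBA}\to\mathbf{ALG}$, $V:\mathbf{DIF}\to\mathbf{ALG}$, $U':\mathbf{DRB}\to\mathbf{DIF}$, $V':\mathbf{DRB}\to\mathbf{RBA}$. For an algebra $A$, $\mathrm{Sha}(A)=\bigoplus_{i\ge1}A^{\otimes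 i}$ with product $\diamond$ defined for $\mathfrak a=a_0\otimes\cdots\otimes a_m$, $\mathfrak b=b_0\otimes\cdots\otimes b_n$ by: $\mathfrak a\diamond\mathfrak b=a_0b_0\otimes b_1\otimes\cdots\otimes b_n$ if $m=0$; $\mathfrak a\diamond\mathfrak b=a_0b_0\otimes a_1\otimes\cdots\otimes a_m$ if $n=0$; and, if $m,n>0$, $\mathfrak a\diamond\mathfrak b=(a_0b_0)\otimes\big((a_1\otimes\cdots\otimes a_m)\diamond(\mathbf 1_A\otimes b_1\otimes\cdots\otimes b_n)+(\mathbf 1_A\otimes a_1\otimes\cdots\otimes a_m)\diamond(b_1\otimes\cdots\otimes b_n)+\lambda(a_1\otimes\cdots\otimes a_m)\diamond(b_1\otimes\cdots\otimes b_n)\big)$; and $P_A(x_0\otimes\cdots\otimes x_n)=\mathbf 1_A\otimes x_0\otimes\cdots\otimes x_n$. It is known that $(\mathrm{Sha}(A),P_A)$ with the inclusion $\eta_A:A\to\mathrm{Sha}(A)$ is the free Rota-Baxter algebra on $A$. For a Rota-Baxter algebra $(R,P)$ put $\mathrm{ev}_{(R,P)}:\mathrm{Sha}(R)\to R$, $a_0\otimes\cdots\otimes a_n\mapsto a_0P(a_1P(\cdots P(a_n)\cdots))$ (the counit). Monad $\mathbf T=\langle T,\eta,\mu\rangle$ on $\mathbf{ALG}$: $T(A)=\mathrm{Sha}(A)$ (with $\mathrm{Sha}(\varphi)$ applying $\varphi$ to each tensor factor), $\mu_A=\mathrm{ev}_{(\mathrm{Sha}(A),P_A)}$. For $(A,d)\in\mathbf{DIF}$,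 define the linear map $\widehat d$ on $\mathrm{Sha}(A)$ by $\widehat d(x_0)=d(x_0)$ and, for $n\ge1$, $\widehat d(x_0\otimes\cdots\otimes x_n)=d(x_0)\otimes x_1\otimes\cdots\otimes x_n+x_0x_1\otimes x_2\otimes\cdots\otimes x_n+\lambda d(x_0)x_1\otimes x_2\otimes\cdots\otimes x_n$; it is known that $(\mathrm{Sha}(A),\widehat d,P_A)$ with the inclusion of $A$ is the free differential Rota-Baxter algebra on $(A,d)$. Monad $\mathbf T'=\langle T',\eta',\mu'\rangle$ on $\mathbf{DIF}$: $T'(A,d)=(\mathrm{Sha}(A),\widehat d)$, $\eta'_{(A,d)}=\eta_A$, $\mu'_{(A,d)}=\mu_A$. $A^{\mathbb N}$ is the algebra of all functions $\mathbb N\to A$ with the product $(fg)(n)=\sum_{k=0}^n\sum_{j=0}^{n-k}\binom nk\binom{n-k}j\lambda^kf(n-j)g(k+j)$; $h^{\mathbb N}(f)(n)=h(f(n))$; $\partial_A(f)(n)=f(n+1)$. Comonad $\mathbf C=\langle C,\varepsilon,\delta\rangle$ on $\mathbf{ALG}$: $C(A)=A^{\mathbb N}$, $C(h)=h^{\mathbb N}$, $\varepsilon_A(f)=f(0)$, $(\delta_A(f)(m))(n)=f(m+n)$ (from the right adjoint $A\mapsto(A^{\mathbb N},\partial_A)$ of $V$). For a Rota-Baxter operator $P$ on $A$: $\widetilde P(f)(0)=P(f(0))$, $\widetilde P(f)(n)=f(n-1)$ for $n\ge1$. Comonad $\mathbf C'=\langle C',\varepsilon',\delta'\rangle$ on $\mathbf{RBA}$: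 $C'(A,P)=(A^{\mathbb N},\widetilde P)$, $\varepsilon'_{(A,P)}=\varepsilon_A$, $\delta'_{(A,P)}=\delta_A$ (from the right adjoint $(A,P)\mapsto(A^{\mathbb N},\partial_A,\widetilde P)$ of $V'$). $\beta_A:(\mathrm{Sha}(A^{\mathbb N}),P_{A^{\mathbb N}})\to((\mathrm{Sha}(A))^{\mathbb N},\widetilde{P_A})$ is the unique Rota-Baxter algebra homomorphism with $\beta_A\circ\eta_{A^{\mathbb N}}=(\eta_A)^{\mathbb N}$; $\beta:TC\to CT$ is a mixed distributive law. It induces a comonad $\widetilde{\mathbf C}$ on $\mathbf{ALG}^{\mathbf T}$, $\widetilde C\langle A,h\rangle=\langle A^{\mathbb N},h^{\mathbb N}\circ\beta_A\rangle$, with counit $\varepsilon_A$ and comultiplication $\delta_A$, and a monad $\widetilde{\mathbf T}$ on $\mathbf{ALG}_{\mathbf C}$, $\widetilde T\langle A,f\rangle=\langle\mathrm{Sha}(A),\beta_A\circ\mathrm{Sha}(f)\rangle$, with unit $\eta_A$ and multiplication $\mu_A$. Forgetful functors of (co)algebra categories: $U^{\mathbf T}:\mathbf{ALG}^{\mathbf T}\to\mathbf{ALG}$, $V_{\mathbf C}:\mathbf{ALG}_{\mathbf C}\to\mathbf{ALG}$, $U'^{\mathbf T'}:\mathbf{DIF}^{\mathbf T'}\to\mathbf{DIF}$, $V'_{\mathbf C'}:\mathbf{RBA}_{\mathbf C'}\to\mathbf{RBA}$, $V_{\widetilde{\mathbf C}}:(\mathbf{ALG}^{\mathbf T})_{\widetilde{\mathbf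 C}}\to\mathbf{ALG}^{\mathbf T}$, $U^{\widetilde{\mathbf T}}:(\mathbf{ALG}_{\mathbf C})^{\widetilde{\mathbf T}}\to\mathbf{ALG}_{\mathbf C}$. Other functors (each the identity on underlying algebra homomorphisms), where for a $\lambda$-derivation $d$ on $R$, $\tilde d:R\to R^{\mathbb N}$ is $(\tilde d(a))(n)=d^{(n)}(a)$: $K:\mathbf{RBA}\to\mathbf{ALG}^{\mathbf T}$, $K(R,P)=\langle R,\mathrm{ev}_{(R,P)}\rangle$; $H:\mathbf{DIF}\to\mathbf{ALG}_{\mathbf C}$, $H(R,d)=\langle R,\tilde d\rangle$; $H':\mathbf{DRB}\to\mathbf{RBA}_{\mathbf C'}$, $H'(R,d,P)=\langle(R,P),\tilde d\rangle$; $K':\mathbf{DRB}\to\mathbf{DIF}^{\mathbf T'}$, $K'(R,d,P)=\langle(R,d),\mathrm{ev}_{(R,P)}\rangle$; $\widetilde K:\mathbf{RBA}_{\mathbf C'}\to(\mathbf{ALG}^{\mathbf T})_{\widetilde{\mathbf C}}$, $\widetilde K\langle(R,P),f\rangle=\langle K(R,P),K(f)\rangle=\langle\langle R,\mathrm{ev}_{(R,P)}\rangle,f\rangle$; $\widetilde H:\mathbf{DIF}^{\mathbf T'}\to(\mathbf{ALG}_{\mathbf C})^{\widetilde{\mathbf T}}$, $\widetilde H\langle(R,d),h\rangle=\langle H(R,d),H(h)\rangle=\langle\langle R,\tilde d\rangle,h\rangle$; $\Phi:(\mathbf{ALG}^{\mathbf T})_{\widetilde{\mathbf C}}\to(\mathbf{ALG}_{\mathbf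 C})^{\widetilde{\mathbf T}}$, $\Phi\langle\langle A,h\rangle,f\rangle=\langle\langle A,f\rangle,h\rangle$ (an isomorphism of categories). *)

theory Defs
  imports "HOL-Algebra.Module" "HOL-Library.FuncSet" "HOL-Library.Nat_Bijection"
begin

section \<open>Categories, functors, adjunctions, (co)monads\<close>

record ('o, 'm) cat =
  Obj :: "'o set"
  Arr :: "'m set"
  Dom :: "'m \<Rightarrow> 'o"
  Cod :: "'m \<Rightarrow> 'o"
  Idn :: "'o \<Rightarrow> 'm"
  Cmp :: "'m \<Rightarrow> 'm \<Rightarrow> 'm" (infixr \<open>\<bullet>\<index>\<close> 75)

locale category =
  fixes C :: "('o, 'm) cat" (structure)
  assumes dom_obj: "f \<in> Arr C \<Longrightarrow> Dom C f \<in> Obj C"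
    and cod_obj: "f \<in> Arr C \<Longrightarrow> Cod C f \<in> Obj C"
    and idn_arr: "A \<in> Obj C \<Longrightarrow> Idn C A \<in> Arr C \<and> Dom C (Idn C A) = A \<and> Cod C (Idn C A) = A"
    and cmp_arr: "\<lbrakk>f \<in> Arr C; g \<in> Arr C; Cod C f = Dom C g\<rbrakk>
        \<Longrightarrow> g \<bullet> f \<in> Arr C \<and> Dom C (g \<bullet> f) = Dom C f \<and> Cod C (g \<bullet> f) = Cod C g"
    and cmp_idn: "f \<in> Arr C \<Longrightarrow> f \<bullet> Idn C (Dom C f) = f \<and> Idn C (Cod C f) \<bullet> f = f"
    and cmp_assoc: "\<lbrakk>f \<in> Arr C; g \<in> Arr C; h \<in> Arr C; Cod C f = Dom C g; Cod C g = Dom C h\<rbrakk>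
        \<Longrightarrow> (h \<bullet> g) \<bullet> f = h \<bullet> (g \<bullet> f)"

record ('o1, 'm1, 'o2, 'm2) fnctr =
  ob :: "'o1 \<Rightarrow> 'o2"
  ar :: "'m1 \<Rightarrow> 'm2"

definition is_functor ::
  "('o1, 'm1) cat \<Rightarrow> ('o2, 'm2) cat \<Rightarrow> ('o1, 'm1, 'o2, 'm2) fnctr \<Rightarrow> bool" where
  "is_functor C D F \<longleftrightarrow> category C \<and> category D \<and>
     (\<forall>A\<in>Obj C. ob F A \<in> Obj D \<and> ar F (Idn C A) = Idn D (ob F A)) \<and>
     (\<forall>f\<in>Arr C. ar F f \<in> Arr D \<and> Dom D (ar F f) = ob F (Dom C f)
                 \<and> Cod D (ar F f) = ob F (Cod C f)) \<and>
     (\<forall>f\<in>Arr C. \<forall>g\<in>Arr C. Cod C f = Dom C g \<longrightarrow>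
        ar F (g \<bullet>\<^bsub>C\<^esub> f) = ar F g \<bullet>\<^bsub>D\<^esub> ar F f)"

definition idf :: "('o, 'm, 'o, 'm) fnctr" where
  "idf = \<lparr>ob = (\<lambda>A. A), ar = (\<lambda>f. f)\<rparr>"

definition fcomp ::
  "('o2, 'm2, 'o3, 'm3) fnctr \<Rightarrow> ('o1, 'm1, 'o2, 'm2) fnctr \<Rightarrow> ('o1, 'm1, 'o3, 'm3) fnctr"
  (infixl \<open>\<circ>\<^sub>F\<close> 55) where
  "G \<circ>\<^sub>F F = \<lparr>ob = ob G \<circ> ob F, ar = ar G \<circ> ar F\<rparr>"

text \<open>Equality of functors from \<open>C\<close> to \<open>D\<close>: values outside \<open>C\<close> are irrelevant.\<close>

definition functor_eq ::
  "('o1, 'm1) cat \<Rightarrow> ('o2, 'm2) cat \<Rightarrow> ('o1, 'm1, 'o2, 'm2) fnctr \<Rightarrow> ('o1, 'm1, 'o2, 'm2) fnctr \<Rightarrow> bool"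
  where
  "functor_eq C D F G \<longleftrightarrow> is_functor C D F \<and> is_functor C D G \<and>
     (\<forall>A\<in>Obj C. ob F A = ob G A) \<and> (\<forall>f\<in>Arr C. ar F f = ar G f)"

definition is_iso_of_categories ::
  "('o1, 'm1) cat \<Rightarrow> ('o2, 'm2) cat \<Rightarrow> ('o1, 'm1, 'o2, 'm2) fnctr \<Rightarrow> bool" where
  "is_iso_of_categories C D F \<longleftrightarrow> is_functor C D F \<and>
     (\<exists>G. is_functor D C G \<and> functor_eq C C (G \<circ>\<^sub>F F) idf \<and> functor_eq D D (F \<circ>\<^sub>F G) idf)"

definition nat_trans ::
  "('o1, 'm1) cat \<Rightarrow> ('o2, 'm2) cat \<Rightarrow> ('o1, 'm1, 'o2, 'm2) fnctr \<Rightarrow> ('o1, 'm1, 'o2, 'm2) fnctr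
    \<Rightarrow> ('o1 \<Rightarrow> 'm2) \<Rightarrow> bool" where
  "nat_trans C D F G \<tau> \<longleftrightarrow> is_functor C D F \<and> is_functor C D G \<and>
     (\<forall>A\<in>Obj C. \<tau> A \<in> Arr D \<and> Dom D (\<tau> A) = ob F A \<and> Cod D (\<tau> A) = ob G A) \<and>
     (\<forall>f\<in>Arr C. ar G f \<bullet>\<^bsub>D\<^esub> \<tau> (Dom C f) = \<tau> (Cod C f) \<bullet>\<^bsub>D\<^esub> ar F f)"

text \<open>\<open>F : C \<rightarrow> D\<close> is left adjoint to \<open>G : D \<rightarrow> C\<close> with unit \<open>\<eta>\<close> and counit \<open>\<epsilon>\<close>.\<close>

definition adjunction ::
  "('o1, 'm1) cat \<Rightarrow> ('o2, 'm2) cat \<Rightarrow> ('o1, 'm1, 'o2, 'm2) fnctr \<Rightarrow> ('o2, 'm2, 'o1, 'm1) fnctr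
    \<Rightarrow> ('o1 \<Rightarrow> 'm1) \<Rightarrow> ('o2 \<Rightarrow> 'm2) \<Rightarrow> bool" where
  "adjunction C D F G \<eta> \<epsilon> \<longleftrightarrow> is_functor C D F \<and> is_functor D C G \<and>
     nat_trans C C idf (G \<circ>\<^sub>F F) \<eta> \<and> nat_trans D D (F \<circ>\<^sub>F G) idf \<epsilon> \<and>
     (\<forall>A\<in>Obj C. \<epsilon> (ob F A) \<bullet>\<^bsub>D\<^esub> ar F (\<eta> A) = Idn D (ob F A)) \<and>
     (\<forall>B\<in>Obj D. ar G (\<epsilon> B) \<bullet>\<^bsub>C\<^esub> \<eta> (ob G B) = Idn C (ob G B))"

record ('o, 'm) monad =
  mfun :: "('o, 'm, 'o, 'm) fnctr"
  munit :: "'o \<Rightarrow> 'm"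
  mmult :: "'o \<Rightarrow> 'm"

record ('o, 'm) comonad =
  wfun :: "('o, 'm, 'o, 'm) fnctr"
  wcounit :: "'o \<Rightarrow> 'm"
  wcomult :: "'o \<Rightarrow> 'm"

text \<open>\<open>G : D \<rightarrow> C\<close> has a left adjoint, and the adjunction generates the monad \<open>M\<close> on \<open>C\<close>.\<close>

definition left_adjoint_generates ::
  "('o2, 'm2) cat \<Rightarrow> ('o1, 'm1) cat \<Rightarrow> ('o2, 'm2, 'o1, 'm1) fnctr \<Rightarrow> ('o1, 'm1) monad \<Rightarrow> bool" where
  "left_adjoint_generates D C G M \<longleftrightarrow>
     (\<exists>F \<eta> \<epsilon>. adjunction C D F G \<eta> \<epsilon> \<and> functor_eq C C (mfun M) (G \<circ>\<^sub>F F) \<and>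
        (\<forall>A\<in>Obj C. munit M A = \<eta> A \<and> mmult M A = ar G (\<epsilon> (ob F A))))"

text \<open>\<open>V : D \<rightarrow> C\<close> has a right adjoint, and the adjunction generates the comonad \<open>W\<close> on \<open>C\<close>.\<close>

definition right_adjoint_generates ::
  "('o2, 'm2) cat \<Rightarrow> ('o1, 'm1) cat \<Rightarrow> ('o2, 'm2, 'o1, 'm1) fnctr \<Rightarrow> ('o1, 'm1) comonad \<Rightarrow> bool" where
  "right_adjoint_generates D C V W \<longleftrightarrow>
     (\<exists>R \<eta> \<epsilon>. adjunction D C V R \<eta> \<epsilon> \<and> functor_eq C C (wfun W) (V \<circ>\<^sub>F R) \<and>
        (\<forall>A\<in>Obj C. wcounit W A = \<epsilon> A \<and> wcomult W A = ar V (\<eta> (ob R A))))"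

type_synonym ('o, 'm) struct_obj = "'o \<times> 'm"
type_synonym ('o, 'm) struct_arr = "('o \<times> 'm) \<times> 'm \<times> ('o \<times> 'm)"

definition struct_cat ::
  "('o, 'm) cat \<Rightarrow> ('o \<times> 'm) set \<Rightarrow> ('o \<times> 'm \<Rightarrow> 'o \<times> 'm \<Rightarrow> 'm \<Rightarrow> bool)
    \<Rightarrow> (('o, 'm) struct_obj, ('o, 'm) struct_arr) cat" where
  "struct_cat C X mors =
     \<lparr>Obj = X,
      Arr = {(x, f, y). x \<in> X \<and> y \<in> X \<and> f \<in> Arr C \<and> Dom C f = fst x \<and> Cod C f = fst y \<and> mors x y f},
      Dom = fst,
      Cod = (\<lambda>g. snd (snd g)),
      Idn = (\<lambda>x. (x, Idn C (fst x), x)),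
      Cmp = (\<lambda>g f. (fst f, fst (snd g) \<bullet>\<^bsub>C\<^esub> fst (snd f), snd (snd g)))\<rparr>"

text \<open>Eilenberg--Moore categories of algebras over a monad and of coalgebras over a comonad.\<close>

definition alg_cat ::
  "('o, 'm) cat \<Rightarrow> ('o, 'm) monad \<Rightarrow> (('o, 'm) struct_obj, ('o, 'm) struct_arr) cat" where
  "alg_cat C M = struct_cat C
     {(A, h). A \<in> Obj C \<and> h \<in> Arr C \<and> Dom C h = ob (mfun M) A \<and> Cod C h = A \<and>
        h \<bullet>\<^bsub>C\<^esub> munit M A = Idn C A \<and> h \<bullet>\<^bsub>C\<^esub> ar (mfun M) h = h \<bullet>\<^bsub>C\<^esub> mmult M A}
     (\<lambda>(A, h) (B, k) f. f \<bullet>\<^bsub>C\<^esub> h = k \<bullet>\<^bsub>C\<^esub> ar (mfun M) f)"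

definition coalg_cat ::
  "('o, 'm) cat \<Rightarrow> ('o, 'm) comonad \<Rightarrow> (('o, 'm) struct_obj, ('o, 'm) struct_arr) cat" where
  "coalg_cat C W = struct_cat C
     {(A, h). A \<in> Obj C \<and> h \<in> Arr C \<and> Dom C h = A \<and> Cod C h = ob (wfun W) A \<and>
        wcounit W A \<bullet>\<^bsub>C\<^esub> h = Idn C A \<and> ar (wfun W) h \<bullet>\<^bsub>C\<^esub> h = wcomult W A \<bullet>\<^bsub>C\<^esub> h}
     (\<lambda>(A, h) (B, k) f. k \<bullet>\<^bsub>C\<^esub> f = ar (wfun W) f \<bullet>\<^bsub>C\<^esub> h)"

text \<open>The parameters of the two forgetful functors only serve to record their domain.\<close>

definition forget_alg ::
  "('o, 'm) cat \<Rightarrow> ('o, 'm) monad \<Rightarrow> (('o, 'm) struct_obj, ('o, 'm) struct_arr, 'o, 'm) fnctr" where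
  "forget_alg C M = \<lparr>ob = fst, ar = (\<lambda>(x, f, y). f)\<rparr>"

definition forget_coalg ::
  "('o, 'm) cat \<Rightarrow> ('o, 'm) comonad \<Rightarrow> (('o, 'm) struct_obj, ('o, 'm) struct_arr, 'o, 'm) fnctr" where
  "forget_coalg C W = \<lparr>ob = fst, ar = (\<lambda>(x, f, y). f)\<rparr>"

text \<open>The functor \<open>\<langle>X, f\<rangle> \<mapsto> \<langle>F X, F f\<rangle>\<close> induced by \<open>F\<close> on categories of (co)algebras.\<close>

definition lift_functor ::
  "('o1, 'm1, 'o2, 'm2) fnctr \<Rightarrow>
    (('o1, 'm1) struct_obj, ('o1, 'm1) struct_arr, ('o2, 'm2) struct_obj, ('o2, 'm2) struct_arr) fnctr" where
  "lift_functor F =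
     \<lparr>ob = (\<lambda>(A, h). (ob F A, ar F h)),
      ar = (\<lambda>((A, h), f, (B, k)). ((ob F A, ar F h), ar F f, (ob F B, ar F k)))\<rparr>"


section \<open>The tensor algebra \<open>Sha(A)\<close> with the mixable shuffle product\<close>

text \<open>
  The module \<open>Sha(A)\<close>, the direct sum of the \<open>A\<^sup>\<otimes>\<^sup>i\<close> for \<open>i \<ge> 1\<close>, is the free \<open>k\<close>-module on the
  nonempty words over \<open>A\<close> modulo multilinearity. The relations preserve the length of words, so
  this quotient is the direct sum of the separate tensor powers.
\<close>

definition formal_sums :: "('k, 'n) ring_scheme \<Rightarrow> ('k, 'a) module \<Rightarrow> ('a list \<Rightarrow> 'k) set" where
  "formal_sums k A = {f. range f \<subseteq> carrier k \<and> finite {w. f w \<noteq> \<zero>\<^bsub>k\<^esub>} \<and>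
     (\<forall>w. f w \<noteq> \<zero>\<^bsub>k\<^esub> \<longrightarrow> w \<noteq> [] \<and> set w \<subseteq> carrier A)}"

definition single :: "('k, 'n) ring_scheme \<Rightarrow> 'a list \<Rightarrow> 'a list \<Rightarrow> 'k" where
  "single k w = (\<lambda>v. if v = w then \<one>\<^bsub>k\<^esub> else \<zero>\<^bsub>k\<^esub>)"

inductive_set null_sums :: "('k, 'n) ring_scheme \<Rightarrow> ('k, 'a) module \<Rightarrow> ('a list \<Rightarrow> 'k) set"
  for k :: "('k, 'n) ring_scheme" and A :: "('k, 'a) module" where
  null_zero: "(\<lambda>w. \<zero>\<^bsub>k\<^esub>) \<in> null_sums k A"
| null_plus: "\<lbrakk>f \<in> null_sums k A; g \<in> null_sums k A\<rbrakk> \<Longrightarrow> (\<lambda>w. f w \<oplus>\<^bsub>k\<^esub> g w) \<in> null_sums k A"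
| null_scale: "\<lbrakk>c \<in> carrier k; f \<in> null_sums k A\<rbrakk> \<Longrightarrow> (\<lambda>w. c \<otimes>\<^bsub>k\<^esub> f w) \<in> null_sums k A"
| null_add: "\<lbrakk>set u \<subseteq> carrier A; set v \<subseteq> carrier A; a \<in> carrier A; b \<in> carrier A\<rbrakk> \<Longrightarrow>
    (\<lambda>w. single k (u @ (a \<oplus>\<^bsub>A\<^esub> b) # v) w \<ominus>\<^bsub>k\<^esub>
         (single k (u @ a # v) w \<oplus>\<^bsub>k\<^esub> single k (u @ b # v) w)) \<in> null_sums k A"
| null_smult: "\<lbrakk>set u \<subseteq> carrier A; set v \<subseteq> carrier A; a \<in> carrier A; c \<in> carrier k\<rbrakk> \<Longrightarrow>
    (\<lambda>w. single k (u @ (c \<odot>\<^bsub>A\<^esub> a) # v) w \<ominus>\<^bsub>k\<^esub> c \<otimes>\<^bsub>k\<^esub> single k (u @ a # v) w) \<in> null_sums k A"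

definition coset :: "('k, 'n) ring_scheme \<Rightarrow> ('k, 'a) module \<Rightarrow> ('a list \<Rightarrow> 'k) \<Rightarrow> ('a list \<Rightarrow> 'k) set" where
  "coset k A f = {g \<in> formal_sums k A. (\<lambda>w. g w \<ominus>\<^bsub>k\<^esub> f w) \<in> null_sums k A}"

definition rep :: "('a list \<Rightarrow> 'k) set \<Rightarrow> 'a list \<Rightarrow> 'k" where
  "rep X = (SOME f. f \<in> X)"

text \<open>Only the \<open>k\<close>-module structure; the ring multiplication and unit are supplied in \<open>sha\<close>.\<close>

definition sha_module :: "('k, 'n) ring_scheme \<Rightarrow> ('k, 'a) module \<Rightarrow> ('k, ('a list \<Rightarrow> 'k) set) module" where
  "sha_module k A =
     \<lparr>carrier = coset k A ` formal_sums k A,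
      monoid.mult = (\<lambda>_ _. undefined),
      one = undefined,
      zero = coset k A (\<lambda>w. \<zero>\<^bsub>k\<^esub>),
      add = (\<lambda>X Y. coset k A (\<lambda>w. rep X w \<oplus>\<^bsub>k\<^esub> rep Y w)),
      smult = (\<lambda>c X. coset k A (\<lambda>w. c \<otimes>\<^bsub>k\<^esub> rep X w))\<rparr>"

text \<open>\<open>pure_tensor k A [x\<^sub>0, \<dots>, x\<^sub>n]\<close> is \<open>x\<^sub>0 \<otimes> \<dots> \<otimes> x\<^sub>n\<close>.\<close>

definition pure_tensor :: "('k, 'n) ring_scheme \<Rightarrow> ('k, 'a) module \<Rightarrow> 'a list \<Rightarrow> ('a list \<Rightarrow> 'k) set" where
  "pure_tensor k A w = coset k A (single k w)"

text \<open>The linear map into \<open>M\<close> whose value at the pure tensor of a word \<open>w\<close> is \<open>\<phi> w\<close>, for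
  \<open>\<phi>\<close> multilinear in the letters of the word.\<close>

definition lin_ext ::
  "('k, 'n) ring_scheme \<Rightarrow> ('k, 'b) module \<Rightarrow> ('a list \<Rightarrow> 'b) \<Rightarrow> ('a list \<Rightarrow> 'k) set \<Rightarrow> 'b" where
  "lin_ext k M \<phi> X = (\<Oplus>\<^bsub>M\<^esub>w\<in>{w. rep X w \<noteq> \<zero>\<^bsub>k\<^esub>}. rep X w \<odot>\<^bsub>M\<^esub> \<phi> w)"

definition prepend ::
  "('k, 'n) ring_scheme \<Rightarrow> ('k, 'a) module \<Rightarrow> 'a \<Rightarrow> ('a list \<Rightarrow> 'k) set \<Rightarrow> ('a list \<Rightarrow> 'k) set" where
  "prepend k A a = lin_ext k (sha_module k A) (\<lambda>w. pure_tensor k A (a # w))"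

fun shuffle_word ::
  "('k, 'n) ring_scheme \<Rightarrow> 'k \<Rightarrow> ('k, 'a) module \<Rightarrow> 'a list \<Rightarrow> 'a list \<Rightarrow> ('a list \<Rightarrow> 'k) set" where
  "shuffle_word k lam A [a0] (b0 # bs) = pure_tensor k A ((a0 \<otimes>\<^bsub>A\<^esub> b0) # bs)"
| "shuffle_word k lam A (a0 # a1 # as) [b0] = pure_tensor k A ((a0 \<otimes>\<^bsub>A\<^esub> b0) # a1 # as)"
| "shuffle_word k lam A (a0 # a1 # as) (b0 # b1 # bs) = prepend k A (a0 \<otimes>\<^bsub>A\<^esub> b0)
     (shuffle_word k lam A (a1 # as) (\<one>\<^bsub>A\<^esub> # b1 # bs)
      \<oplus>\<^bsub>sha_module k A\<^esub> shuffle_word k lam A (\<one>\<^bsub>A\<^esub> # a1 # as) (b1 # bs)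
      \<oplus>\<^bsub>sha_module k A\<^esub> lam \<odot>\<^bsub>sha_module k A\<^esub> shuffle_word k lam A (a1 # as) (b1 # bs))"
| "shuffle_word k lam A [] _ = undefined"
| "shuffle_word k lam A _ [] = undefined"

definition sha :: "('k, 'n) ring_scheme \<Rightarrow> 'k \<Rightarrow> ('k, 'a) module \<Rightarrow> ('k, ('a list \<Rightarrow> 'k) set) module" where
  "sha k lam A = (sha_module k A)
     \<lparr>monoid.mult := (\<lambda>X Y. lin_ext k (sha_module k A)
        (\<lambda>u. lin_ext k (sha_module k A) (\<lambda>v. shuffle_word k lam A u v) Y) X),
      one := pure_tensor k A [\<one>\<^bsub>A\<^esub>]\<rparr>"

definition sha_P ::
  "('k, 'n) ring_scheme \<Rightarrow> ('k, 'a) module \<Rightarrow> ('a list \<Rightarrow> 'k) set \<Rightarrow> ('a list \<Rightarrow> 'k) set" where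
  "sha_P k A = prepend k A \<one>\<^bsub>A\<^esub>"

definition sha_map ::
  "('k, 'n) ring_scheme \<Rightarrow> ('k, 'b) module \<Rightarrow> ('a \<Rightarrow> 'b) \<Rightarrow> ('a list \<Rightarrow> 'k) set \<Rightarrow> ('b list \<Rightarrow> 'k) set" where
  "sha_map k B \<phi> = lin_ext k (sha_module k B) (\<lambda>w. pure_tensor k B (map \<phi> w))"

fun ev_word :: "('k, 'a) module \<Rightarrow> ('a \<Rightarrow> 'a) \<Rightarrow> 'a list \<Rightarrow> 'a" where
  "ev_word R P [] = undefined"
| "ev_word R P [a] = a"
| "ev_word R P (a # b # w) = a \<otimes>\<^bsub>R\<^esub> P (ev_word R P (b # w))"

definition ev :: "('k, 'n) ring_scheme \<Rightarrow> ('k, 'a) module \<Rightarrow> ('a \<Rightarrow> 'a) \<Rightarrow> ('a list \<Rightarrow> 'k) set \<Rightarrow> 'a" where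
  "ev k R P = lin_ext k R (ev_word R P)"

fun sha_d_word ::
  "('k, 'n) ring_scheme \<Rightarrow> 'k \<Rightarrow> ('k, 'a) module \<Rightarrow> ('a \<Rightarrow> 'a) \<Rightarrow> 'a list \<Rightarrow> ('a list \<Rightarrow> 'k) set" where
  "sha_d_word k lam A d [] = undefined"
| "sha_d_word k lam A d [x0] = pure_tensor k A [d x0]"
| "sha_d_word k lam A d (x0 # x1 # xs) =
     pure_tensor k A (d x0 # x1 # xs)
     \<oplus>\<^bsub>sha_module k A\<^esub> pure_tensor k A ((x0 \<otimes>\<^bsub>A\<^esub> x1) # xs)
     \<oplus>\<^bsub>sha_module k A\<^esub> lam \<odot>\<^bsub>sha_module k A\<^esub> pure_tensor k A ((d x0 \<otimes>\<^bsub>A\<^esub> x1) # xs)"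

definition sha_d ::
  "('k, 'n) ring_scheme \<Rightarrow> 'k \<Rightarrow> ('k, 'a) module \<Rightarrow> ('a \<Rightarrow> 'a)
    \<Rightarrow> ('a list \<Rightarrow> 'k) set \<Rightarrow> ('a list \<Rightarrow> 'k) set" where
  "sha_d k lam A d = lin_ext k (sha_module k A) (sha_d_word k lam A d)"


section \<open>The algebra \<open>A\<^sup>\<nat>\<close>\<close>

definition seq_alg :: "('k, 'n) ring_scheme \<Rightarrow> 'k \<Rightarrow> ('k, 'a) module \<Rightarrow> ('k, nat \<Rightarrow> 'a) module" where
  "seq_alg k lam A =
     \<lparr>carrier = {f. range f \<subseteq> carrier A},
      monoid.mult = (\<lambda>f g n. \<Oplus>\<^bsub>A\<^esub>i\<in>{0..n}. \<Oplus>\<^bsub>A\<^esub>j\<in>{0..n-i}.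
         [((n choose i) * ((n - i) choose j))] \<cdot>\<^bsub>A\<^esub>
           ((lam [^]\<^bsub>k\<^esub> i) \<odot>\<^bsub>A\<^esub> (f (n - j) \<otimes>\<^bsub>A\<^esub> g (i + j)))),
      one = (\<lambda>n. if n = 0 then \<one>\<^bsub>A\<^esub> else \<zero>\<^bsub>A\<^esub>),
      zero = (\<lambda>n. \<zero>\<^bsub>A\<^esub>),
      add = (\<lambda>f g n. f n \<oplus>\<^bsub>A\<^esub> g n),
      smult = (\<lambda>c f n. c \<odot>\<^bsub>A\<^esub> f n)\<rparr>"

text \<open>The Rota-Baxter operator on \<open>A\<^sup>\<nat>\<close> induced by \<open>P\<close>.\<close>

definition seq_P :: "('a \<Rightarrow> 'a) \<Rightarrow> (nat \<Rightarrow> 'a) \<Rightarrow> nat \<Rightarrow> 'a" where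
  "seq_P P f n = (if n = 0 then P (f 0) else f (n - 1))"


section \<open>The base ring, the weight and the universe\<close>

text \<open>
  All algebras have their carrier in one type \<open>'u\<close>, which plays the role of a universe. It has to
  be closed under the formation of \<open>Sha(A)\<close> and \<open>A\<^sup>\<nat>\<close>; this is expressed by injections into \<open>'u\<close>
  of the sequences over \<open>'u\<close> and of the finitely supported \<open>k\<close>-valued functions on words over
  \<open>'u\<close>. Along these injections \<open>A\<^sup>\<nat>\<close> and \<open>Sha(A)\<close> are transported into \<open>'u\<close>.
\<close>

record ('k, 'u) setting =
  base :: "'k ring"
  weight :: 'k
  seq_code :: "(nat \<Rightarrow> 'u) \<Rightarrow> 'u"
  sum_code :: "('u list \<Rightarrow> 'k) \<Rightarrow> 'u"

definition valid_setting :: "('k, 'u) setting \<Rightarrow> bool" where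
  "valid_setting S \<longleftrightarrow> cring (base S) \<and> weight S \<in> carrier (base S) \<and> inj (seq_code S) \<and>
     inj_on (sum_code S) {f. range f \<subseteq> carrier (base S) \<and> finite {w. f w \<noteq> \<zero>\<^bsub>base S\<^esub>}}"

text \<open>Such universes exist for every base ring and weight, and can be chosen to contain a copy of
  any given type \<open>'x\<close>.\<close>

lemma valid_setting_exists:
  fixes k :: "'k ring"
  assumes k: "cring k" and lam: "lam \<in> carrier k"
  shows "(\<exists>S :: ('k, nat \<Rightarrow> 'k + 'x + nat) setting.
            valid_setting S \<and> base S = k \<and> weight S = lam)
         \<and> (\<exists>e :: 'x \<Rightarrow> (nat \<Rightarrow> 'k + 'x + nat). inj e)"
proof -
  define sc :: "(nat \<Rightarrow> nat \<Rightarrow> 'k + 'x + nat) \<Rightarrow> nat \<Rightarrow> 'k + 'x + nat"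
    where "sc = (\<lambda>F n. F (fst (prod_decode n)) (snd (prod_decode n)))"
  have sc: "inj sc"
  proof (rule injI)
    fix F G assume e: "sc F = sc G"
    show "F = G"
    proof (intro ext)
      fix i j
      from e have "sc F (prod_encode (i, j)) = sc G (prod_encode (i, j))" by simp
      thus "F i j = G i j" by (simp add: sc_def)
    qed
  qed
  define lc :: "(nat \<Rightarrow> 'k + 'x + nat) list \<Rightarrow> nat \<Rightarrow> 'k + 'x + nat"
    where "lc = (\<lambda>w. sc (\<lambda>n. if n = 0 then (\<lambda>_. Inr (Inr (length w)))
                    else if n - 1 < length w then w ! (n - 1) else (\<lambda>_. Inr (Inr 0))))"
  have lc: "inj lc"
  proof (rule injI)
    fix v w assume "lc v = lc w"
    then have e: "(\<lambda>n. if n = 0 then (\<lambda>_. Inr (Inr (length v)))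
                    else if n - 1 < length v then v ! (n - 1) else (\<lambda>_. Inr (Inr 0)))
        = (\<lambda>n. if n = 0 then (\<lambda>_. Inr (Inr (length w)))
                    else if n - 1 < length w then w ! (n - 1) else (\<lambda>_::nat. Inr (Inr 0 :: 'x + nat) :: 'k + 'x + nat))"
      unfolding lc_def by (rule injD[OF sc])
    have l: "length v = length w" using fun_cong[OF fun_cong[OF e, of 0], of 0] by simp
    show "v = w"
    proof (rule nth_equalityI[OF l])
      fix i assume "i < length v"
      thus "v ! i = w ! i" using fun_cong[OF e, of "Suc i"] l by simp
    qed
  qed
  define pc :: "(nat \<Rightarrow> 'k + 'x + nat) list \<times> 'k \<Rightarrow> nat \<Rightarrow> 'k + 'x + nat"
    where "pc = (\<lambda>(w, c). lc [lc w, \<lambda>_. Inl c])"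
  have pc: "inj pc"
  proof (rule injI)
    fix p q assume "pc p = pc q"
    then have "[lc (fst p), \<lambda>_. Inl (snd p)] = [lc (fst q), \<lambda>_. Inl (snd q)]"
      unfolding pc_def case_prod_beta by (rule injD[OF lc])
    then have "lc (fst p) = lc (fst q)" "snd p = snd q" by (simp_all add: fun_eq_iff)
    then show "p = q" by (simp add: prod_eq_iff injD[OF lc])
  qed
  define A where "A = {f :: (nat \<Rightarrow> 'k + 'x + nat) list \<Rightarrow> 'k. finite {w. f w \<noteq> \<zero>\<^bsub>k\<^esub>}}"
  define gl where "gl = (\<lambda>f :: (nat \<Rightarrow> 'k + 'x + nat) list \<Rightarrow> 'k.
      SOME ps. set ps = (\<lambda>w. (w, f w)) ` {w. f w \<noteq> \<zero>\<^bsub>k\<^esub>})"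
  have gl: "set (gl f) = (\<lambda>w. (w, f w)) ` {w. f w \<noteq> \<zero>\<^bsub>k\<^esub>}" if "f \<in> A" for f
  proof -
    have "finite ((\<lambda>w. (w, f w)) ` {w. f w \<noteq> \<zero>\<^bsub>k\<^esub>})" using that unfolding A_def by simp
    then have "\<exists>ps. set ps = (\<lambda>w. (w, f w)) ` {w. f w \<noteq> \<zero>\<^bsub>k\<^esub>}" by (rule finite_list)
    then show ?thesis unfolding gl_def by (rule someI_ex)
  qed
  have glinj: "inj_on gl A"
  proof (rule inj_onI)
    fix f g assume f: "f \<in> A" and g: "g \<in> A" and e: "gl f = gl g"
    have s: "(\<lambda>w. (w, f w)) ` {w. f w \<noteq> \<zero>\<^bsub>k\<^esub>} = (\<lambda>w. (w, g w)) ` {w. g w \<noteq> \<zero>\<^bsub>k\<^esub>}"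
      using gl[OF f] gl[OF g] e by simp
    show "f = g"
    proof
      fix w
      have "(w, f w) \<in> (\<lambda>w. (w, g w)) ` {w. g w \<noteq> \<zero>\<^bsub>k\<^esub>}" if "f w \<noteq> \<zero>\<^bsub>k\<^esub>"
        using that by (simp flip: s)
      moreover have "(w, g w) \<in> (\<lambda>w. (w, f w)) ` {w. f w \<noteq> \<zero>\<^bsub>k\<^esub>}" if "g w \<noteq> \<zero>\<^bsub>k\<^esub>"
        using that by (simp add: s)
      ultimately show "f w = g w" by fastforce
    qed
  qed
  define tc where "tc = (\<lambda>f. lc (map pc (gl f)))"
  have tc: "inj_on tc A"
  proof (rule inj_onI)
    fix f g assume f: "f \<in> A" and g: "g \<in> A" and "tc f = tc g"
    then have "map pc (gl f) = map pc (gl g)" unfolding tc_def by (intro injD[OF lc])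
    then have "gl f = gl g" by (rule map_injective[OF _ pc])
    then show "f = g" by (rule inj_onD[OF glinj _ f g])
  qed
  have "inj (\<lambda>x::'x. \<lambda>_::nat. Inr (Inl x) :: 'k + 'x + nat)"
    by (rule injI) (auto simp: fun_eq_iff)
  moreover have "valid_setting \<lparr>base = k, weight = lam, seq_code = sc, sum_code = tc\<rparr>"
    unfolding valid_setting_def using k lam sc by (auto intro: inj_on_subset[OF tc] simp: A_def)
  ultimately show ?thesis by (metis setting.select_convs(1,2))
qed

text \<open>Transport of an algebra, resp. of an endomap of its carrier, along an injection \<open>e\<close> of the
  carrier.\<close>

definition image_alg :: "('a \<Rightarrow> 'b) \<Rightarrow> ('k, 'a) module \<Rightarrow> ('k, 'b) module" where
  "image_alg e M = (let dec = inv_into (carrier M) e in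
     \<lparr>carrier = e ` carrier M,
      monoid.mult = (\<lambda>x y. e (dec x \<otimes>\<^bsub>M\<^esub> dec y)),
      one = e \<one>\<^bsub>M\<^esub>,
      zero = e \<zero>\<^bsub>M\<^esub>,
      add = (\<lambda>x y. e (dec x \<oplus>\<^bsub>M\<^esub> dec y)),
      smult = (\<lambda>c x. e (c \<odot>\<^bsub>M\<^esub> dec x))\<rparr>)"

definition image_map :: "('a \<Rightarrow> 'b) \<Rightarrow> ('k, 'a) module \<Rightarrow> ('a \<Rightarrow> 'a) \<Rightarrow> 'b \<Rightarrow> 'b" where
  "image_map e M p = (\<lambda>x\<in>e ` carrier M. e (p (inv_into (carrier M) e x)))"

definition enc_sha :: "('k, 'u) setting \<Rightarrow> ('u list \<Rightarrow> 'k) set \<Rightarrow> 'u" where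
  "enc_sha S X = sum_code S (rep X)"

definition Sha :: "('k, 'u) setting \<Rightarrow> ('k, 'u) module \<Rightarrow> ('k, 'u) module" where
  "Sha S A = image_alg (enc_sha S) (sha (base S) (weight S) A)"

definition dec_sha :: "('k, 'u) setting \<Rightarrow> ('k, 'u) module \<Rightarrow> 'u \<Rightarrow> ('u list \<Rightarrow> 'k) set" where
  "dec_sha S A = inv_into (carrier (sha (base S) (weight S) A)) (enc_sha S)"

definition Seq :: "('k, 'u) setting \<Rightarrow> ('k, 'u) module \<Rightarrow> ('k, 'u) module" where
  "Seq S A = image_alg (seq_code S) (seq_alg (base S) (weight S) A)"

definition dec_seq :: "('k, 'u) setting \<Rightarrow> ('k, 'u) module \<Rightarrow> 'u \<Rightarrow> nat \<Rightarrow> 'u" where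
  "dec_seq S A = inv_into (carrier (seq_alg (base S) (weight S) A)) (seq_code S)"


section \<open>The categories of algebras, Rota-Baxter and differential algebras\<close>

text \<open>
  Operators and homomorphisms are \<open>undefined\<close> outside the carrier, so that equality of operators
  and of homomorphisms means equality on the carrier. A morphism is a triple of its source, its
  underlying map and its target.
\<close>

definition linear_op :: "('k, 'n) ring_scheme \<Rightarrow> ('k, 'a) module \<Rightarrow> ('a \<Rightarrow> 'a) \<Rightarrow> bool" where
  "linear_op k R p \<longleftrightarrow> p \<in> carrier R \<rightarrow>\<^sub>E carrier R \<and>
     (\<forall>x\<in>carrier R. \<forall>y\<in>carrier R. p (x \<oplus>\<^bsub>R\<^esub> y) = p x \<oplus>\<^bsub>R\<^esub> p y) \<and>
     (\<forall>c\<in>carrier k. \<forall>x\<in>carrier R. p (c \<odot>\<^bsub>R\<^esub> x) = c \<odot>\<^bsub>R\<^esub> p x)"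

definition rota_baxter :: "('k, 'n) ring_scheme \<Rightarrow> 'k \<Rightarrow> ('k, 'a) module \<Rightarrow> ('a \<Rightarrow> 'a) \<Rightarrow> bool" where
  "rota_baxter k lam R P \<longleftrightarrow> linear_op k R P \<and>
     (\<forall>x\<in>carrier R. \<forall>y\<in>carrier R.
        P x \<otimes>\<^bsub>R\<^esub> P y = P (x \<otimes>\<^bsub>R\<^esub> P y) \<oplus>\<^bsub>R\<^esub> P (y \<otimes>\<^bsub>R\<^esub> P x) \<oplus>\<^bsub>R\<^esub> lam \<odot>\<^bsub>R\<^esub> P (x \<otimes>\<^bsub>R\<^esub> y))"

definition weighted_derivation ::
  "('k, 'n) ring_scheme \<Rightarrow> 'k \<Rightarrow> ('k, 'a) module \<Rightarrow> ('a \<Rightarrow> 'a) \<Rightarrow> bool" where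
  "weighted_derivation k lam R d \<longleftrightarrow> linear_op k R d \<and>
     (\<forall>x\<in>carrier R. \<forall>y\<in>carrier R.
        d (x \<otimes>\<^bsub>R\<^esub> y) = d x \<otimes>\<^bsub>R\<^esub> y \<oplus>\<^bsub>R\<^esub> x \<otimes>\<^bsub>R\<^esub> d y \<oplus>\<^bsub>R\<^esub> lam \<odot>\<^bsub>R\<^esub> (d x \<otimes>\<^bsub>R\<^esub> d y)) \<and>
     d \<one>\<^bsub>R\<^esub> = \<zero>\<^bsub>R\<^esub>"

definition alg_hom ::
  "('k, 'n) ring_scheme \<Rightarrow> ('k, 'a) module \<Rightarrow> ('k, 'b) module \<Rightarrow> ('a \<Rightarrow> 'b) set" where
  "alg_hom k A B = {f \<in> ring_hom A B. f \<in> extensional (carrier A) \<and>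
     (\<forall>c\<in>carrier k. \<forall>x\<in>carrier A. f (c \<odot>\<^bsub>A\<^esub> x) = c \<odot>\<^bsub>B\<^esub> f x)}"

type_synonym ('x, 'u) mor = "'x \<times> ('u \<Rightarrow> 'u) \<times> 'x"

definition concrete_cat ::
  "'x set \<Rightarrow> ('x \<Rightarrow> 'u set) \<Rightarrow> ('x \<Rightarrow> 'x \<Rightarrow> ('u \<Rightarrow> 'u) set) \<Rightarrow> ('x, ('x, 'u) mor) cat" where
  "concrete_cat X car mors =
     \<lparr>Obj = X,
      Arr = {(x, f, y). x \<in> X \<and> y \<in> X \<and> f \<in> mors x y},
      Dom = fst,
      Cod = (\<lambda>g. snd (snd g)),
      Idn = (\<lambda>x. (x, (\<lambda>a\<in>car x. a), x)),
      Cmp = (\<lambda>g f. (fst f, compose (car (fst f)) (fst (snd g)) (fst (snd f)), snd (snd g)))\<rparr>"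

type_synonym ('k, 'u) alg = "('k, 'u) module"
type_synonym ('k, 'u) opalg = "('k, 'u) module \<times> ('u \<Rightarrow> 'u)"
type_synonym ('k, 'u) op2alg = "('k, 'u) module \<times> ('u \<Rightarrow> 'u) \<times> ('u \<Rightarrow> 'u)"

definition ALG :: "('k, 'u) setting \<Rightarrow> (('k, 'u) alg, (('k, 'u) alg, 'u) mor) cat" where
  "ALG S = concrete_cat {A. algebra (base S) A} carrier (alg_hom (base S))"

definition RBA :: "('k, 'u) setting \<Rightarrow> (('k, 'u) opalg, (('k, 'u) opalg, 'u) mor) cat" where
  "RBA S = concrete_cat
     {(R, P). algebra (base S) R \<and> rota_baxter (base S) (weight S) R P}
     (\<lambda>(R, P). carrier R)
     (\<lambda>(R, P) (R', P'). {f \<in> alg_hom (base S) R R'. \<forall>x\<in>carrier R. f (P x) = P' (f x)})"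

definition DIF :: "('k, 'u) setting \<Rightarrow> (('k, 'u) opalg, (('k, 'u) opalg, 'u) mor) cat" where
  "DIF S = concrete_cat
     {(R, d). algebra (base S) R \<and> weighted_derivation (base S) (weight S) R d}
     (\<lambda>(R, d). carrier R)
     (\<lambda>(R, d) (R', d'). {f \<in> alg_hom (base S) R R'. \<forall>x\<in>carrier R. f (d x) = d' (f x)})"

definition DRB :: "('k, 'u) setting \<Rightarrow> (('k, 'u) op2alg, (('k, 'u) op2alg, 'u) mor) cat" where
  "DRB S = concrete_cat
     {(R, d, P). algebra (base S) R \<and> weighted_derivation (base S) (weight S) R d \<and>
        rota_baxter (base S) (weight S) R P \<and> (\<forall>x\<in>carrier R. d (P x) = x)}
     (\<lambda>(R, d, P). carrier R)
     (\<lambda>(R, d, P) (R', d', P'). {f \<in> alg_hom (base S) R R'.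
        \<forall>x\<in>carrier R. f (d x) = d' (f x) \<and> f (P x) = P' (f x)})"

text \<open>The functor given by \<open>\<phi>\<close> on objects that does not change underlying maps.\<close>

definition same_map :: "('x \<Rightarrow> 'y) \<Rightarrow> ('x, ('x, 'u) mor, 'y, ('y, 'u) mor) fnctr" where
  "same_map \<phi> = \<lparr>ob = \<phi>, ar = (\<lambda>(x, f, y). (\<phi> x, f, \<phi> y))\<rparr>"

definition U_RBA :: "(('k, 'u) opalg, (('k, 'u) opalg, 'u) mor, ('k, 'u) alg, (('k, 'u) alg, 'u) mor) fnctr" where
  "U_RBA = same_map (\<lambda>(R, P). R)"

definition V_DIF :: "(('k, 'u) opalg, (('k, 'u) opalg, 'u) mor, ('k, 'u) alg, (('k, 'u) alg, 'u) mor) fnctr" where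
  "V_DIF = same_map (\<lambda>(R, d). R)"

definition U'_DRB :: "(('k, 'u) op2alg, (('k, 'u) op2alg, 'u) mor, ('k, 'u) opalg, (('k, 'u) opalg, 'u) mor) fnctr" where
  "U'_DRB = same_map (\<lambda>(R, d, P). (R, d))"

definition V'_DRB :: "(('k, 'u) op2alg, (('k, 'u) op2alg, 'u) mor, ('k, 'u) opalg, (('k, 'u) opalg, 'u) mor) fnctr" where
  "V'_DRB = same_map (\<lambda>(R, d, P). (R, P))"


section \<open>The monads \<open>T\<close>, \<open>T'\<close> and the comonads \<open>C\<close>, \<open>C'\<close>\<close>

text \<open>The free Rota-Baxter algebra \<open>(Sha(A), P\<^sub>A)\<close> and the object \<open>(Sha(A), d)\<close> of \<open>DIF\<close>.\<close>

definition free_RBA :: "('k, 'u) setting \<Rightarrow> ('k, 'u) alg \<Rightarrow> ('k, 'u) opalg" where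
  "free_RBA S A =
     (Sha S A, image_map (enc_sha S) (sha (base S) (weight S) A) (sha_P (base S) A))"

definition Sha_DIF :: "('k, 'u) setting \<Rightarrow> ('k, 'u) opalg \<Rightarrow> ('k, 'u) opalg" where
  "Sha_DIF S = (\<lambda>(A, d).
     (Sha S A, image_map (enc_sha S) (sha (base S) (weight S) A) (sha_d (base S) (weight S) A d)))"

definition eta :: "('k, 'u) setting \<Rightarrow> ('k, 'u) alg \<Rightarrow> 'u \<Rightarrow> 'u" where
  "eta S A = (\<lambda>a\<in>carrier A. enc_sha S (pure_tensor (base S) A [a]))"

definition evaluation :: "('k, 'u) setting \<Rightarrow> ('k, 'u) opalg \<Rightarrow> 'u \<Rightarrow> 'u" where
  "evaluation S = (\<lambda>(R, P). \<lambda>x\<in>carrier (Sha S R). ev (base S) R P (dec_sha S R x))"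

definition Sha_map :: "('k, 'u) setting \<Rightarrow> ('k, 'u) alg \<Rightarrow> ('k, 'u) alg \<Rightarrow> ('u \<Rightarrow> 'u) \<Rightarrow> 'u \<Rightarrow> 'u" where
  "Sha_map S A B f = (\<lambda>x\<in>carrier (Sha S A). enc_sha S (sha_map (base S) B f (dec_sha S A x)))"

definition monad_T :: "('k, 'u) setting \<Rightarrow> (('k, 'u) alg, (('k, 'u) alg, 'u) mor) monad" where
  "monad_T S =
     \<lparr>mfun = \<lparr>ob = Sha S, ar = (\<lambda>(A, f, B). (Sha S A, Sha_map S A B f, Sha S B))\<rparr>,
      munit = (\<lambda>A. (A, eta S A, Sha S A)),
      mmult = (\<lambda>A. (Sha S (Sha S A), evaluation S (free_RBA S A), Sha S A))\<rparr>"

definition monad_T' :: "('k, 'u) setting \<Rightarrow> (('k, 'u) opalg, (('k, 'u) opalg, 'u) mor) monad" where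
  "monad_T' S =
     \<lparr>mfun = \<lparr>ob = Sha_DIF S,
              ar = (\<lambda>(X, f, Y). (Sha_DIF S X, Sha_map S (fst X) (fst Y) f, Sha_DIF S Y))\<rparr>,
      munit = (\<lambda>X. (X, eta S (fst X), Sha_DIF S X)),
      mmult = (\<lambda>X. (Sha_DIF S (Sha_DIF S X), evaluation S (free_RBA S (fst X)), Sha_DIF S X))\<rparr>"

definition Seq_map :: "('k, 'u) setting \<Rightarrow> ('k, 'u) alg \<Rightarrow> ('u \<Rightarrow> 'u) \<Rightarrow> 'u \<Rightarrow> 'u" where
  "Seq_map S A h = (\<lambda>x\<in>carrier (Seq S A). seq_code S (\<lambda>n. h (dec_seq S A x n)))"

definition Seq_RBA :: "('k, 'u) setting \<Rightarrow> ('k, 'u) opalg \<Rightarrow> ('k, 'u) opalg" where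
  "Seq_RBA S = (\<lambda>(A, P).
     (Seq S A, image_map (seq_code S) (seq_alg (base S) (weight S) A) (seq_P P)))"

definition seq_counit :: "('k, 'u) setting \<Rightarrow> ('k, 'u) alg \<Rightarrow> 'u \<Rightarrow> 'u" where
  "seq_counit S A = (\<lambda>x\<in>carrier (Seq S A). dec_seq S A x 0)"

definition seq_comult :: "('k, 'u) setting \<Rightarrow> ('k, 'u) alg \<Rightarrow> 'u \<Rightarrow> 'u" where
  "seq_comult S A = (\<lambda>x\<in>carrier (Seq S A).
     seq_code S (\<lambda>m. seq_code S (\<lambda>n. dec_seq S A x (m + n))))"

definition comonad_C :: "('k, 'u) setting \<Rightarrow> (('k, 'u) alg, (('k, 'u) alg, 'u) mor) comonad" where
  "comonad_C S =
     \<lparr>wfun = \<lparr>ob = Seq S, ar = (\<lambda>(A, h, B). (Seq S A, Seq_map S A h, Seq S B))\<rparr>,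
      wcounit = (\<lambda>A. (Seq S A, seq_counit S A, A)),
      wcomult = (\<lambda>A. (Seq S A, seq_comult S A, Seq S (Seq S A)))\<rparr>"

definition comonad_C' :: "('k, 'u) setting \<Rightarrow> (('k, 'u) opalg, (('k, 'u) opalg, 'u) mor) comonad" where
  "comonad_C' S =
     \<lparr>wfun = \<lparr>ob = Seq_RBA S,
              ar = (\<lambda>(X, h, Y). (Seq_RBA S X, Seq_map S (fst X) h, Seq_RBA S Y))\<rparr>,
      wcounit = (\<lambda>X. (Seq_RBA S X, seq_counit S (fst X), X)),
      wcomult = (\<lambda>X. (Seq_RBA S X, seq_comult S (fst X), Seq_RBA S (Seq_RBA S X)))\<rparr>"


section \<open>The distributive law and the induced (co)monads\<close>

definition beta :: "('k, 'u) setting \<Rightarrow> ('k, 'u) alg \<Rightarrow> (('k, 'u) alg, 'u) mor" where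
  "beta S A = ar U_RBA (THE b. b \<in> Arr (RBA S) \<and>
     Dom (RBA S) b = free_RBA S (Seq S A) \<and> Cod (RBA S) b = Seq_RBA S (free_RBA S A) \<and>
     ar U_RBA b \<bullet>\<^bsub>ALG S\<^esub> munit (monad_T S) (Seq S A) = ar (wfun (comonad_C S)) (munit (monad_T S) A))"

abbreviation ALG_T where "ALG_T S \<equiv> alg_cat (ALG S) (monad_T S)"
abbreviation ALG_C where "ALG_C S \<equiv> coalg_cat (ALG S) (comonad_C S)"
abbreviation DIF_T' where "DIF_T' S \<equiv> alg_cat (DIF S) (monad_T' S)"
abbreviation RBA_C' where "RBA_C' S \<equiv> coalg_cat (RBA S) (comonad_C' S)"

text \<open>Objects and arrows of \<open>ALG_T S\<close> and likewise of \<open>ALG_C S\<close>.\<close>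

type_synonym ('k, 'u) talg = "(('k, 'u) alg, (('k, 'u) alg, 'u) mor) struct_obj"
type_synonym ('k, 'u) tmor = "(('k, 'u) alg, (('k, 'u) alg, 'u) mor) struct_arr"

definition Ct_ob :: "('k, 'u) setting \<Rightarrow> ('k, 'u) talg \<Rightarrow> ('k, 'u) talg" where
  "Ct_ob S = (\<lambda>(A, h). (ob (wfun (comonad_C S)) A, ar (wfun (comonad_C S)) h \<bullet>\<^bsub>ALG S\<^esub> beta S A))"

definition comonad_Ct :: "('k, 'u) setting \<Rightarrow> (('k, 'u) talg, ('k, 'u) tmor) comonad" where
  "comonad_Ct S =
     \<lparr>wfun = \<lparr>ob = Ct_ob S, ar = (\<lambda>(X, f, Y). (Ct_ob S X, ar (wfun (comonad_C S)) f, Ct_ob S Y))\<rparr>,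
      wcounit = (\<lambda>X. (Ct_ob S X, wcounit (comonad_C S) (fst X), X)),
      wcomult = (\<lambda>X. (Ct_ob S X, wcomult (comonad_C S) (fst X), Ct_ob S (Ct_ob S X)))\<rparr>"

definition Tt_ob :: "('k, 'u) setting \<Rightarrow> ('k, 'u) talg \<Rightarrow> ('k, 'u) talg" where
  "Tt_ob S = (\<lambda>(A, f). (ob (mfun (monad_T S)) A, beta S A \<bullet>\<^bsub>ALG S\<^esub> ar (mfun (monad_T S)) f))"

definition monad_Tt :: "('k, 'u) setting \<Rightarrow> (('k, 'u) talg, ('k, 'u) tmor) monad" where
  "monad_Tt S =
     \<lparr>mfun = \<lparr>ob = Tt_ob S, ar = (\<lambda>(X, f, Y). (Tt_ob S X, ar (mfun (monad_T S)) f, Tt_ob S Y))\<rparr>,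
      munit = (\<lambda>X. (X, munit (monad_T S) (fst X), Tt_ob S X)),
      mmult = (\<lambda>X. (Tt_ob S (Tt_ob S X), mmult (monad_T S) (fst X), Tt_ob S X))\<rparr>"

abbreviation ALG_T_Ct where "ALG_T_Ct S \<equiv> coalg_cat (ALG_T S) (comonad_Ct S)"
abbreviation ALG_C_Tt where "ALG_C_Tt S \<equiv> alg_cat (ALG_C S) (monad_Tt S)"

abbreviation U_T where "U_T S \<equiv> forget_alg (ALG S) (monad_T S)"
abbreviation V_C where "V_C S \<equiv> forget_coalg (ALG S) (comonad_C S)"
abbreviation U'_T' where "U'_T' S \<equiv> forget_alg (DIF S) (monad_T' S)"
abbreviation V'_C' where "V'_C' S \<equiv> forget_coalg (RBA S) (comonad_C' S)"
abbreviation V_Ct where "V_Ct S \<equiv> forget_coalg (ALG_T S) (comonad_Ct S)"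
abbreviation U_Tt where "U_Tt S \<equiv> forget_alg (ALG_C S) (monad_Tt S)"


section \<open>The comparison functors\<close>

definition orbit_map :: "('k, 'u) setting \<Rightarrow> ('k, 'u) alg \<Rightarrow> ('u \<Rightarrow> 'u) \<Rightarrow> 'u \<Rightarrow> 'u" where
  "orbit_map S R d = (\<lambda>a\<in>carrier R. seq_code S (\<lambda>n. (d ^^ n) a))"

text \<open>The functor \<open>X \<mapsto> \<langle>F X, s X\<rangle>\<close>, equal to \<open>F\<close> on underlying morphisms.\<close>

definition add_struct ::
  "('o1, 'm1) cat \<Rightarrow> ('o1, 'm1, 'o2, 'm2) fnctr \<Rightarrow> ('o1 \<Rightarrow> 'm2)
    \<Rightarrow> ('o1, 'm1, ('o2, 'm2) struct_obj, ('o2, 'm2) struct_arr) fnctr" where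
  "add_struct D F s =
     \<lparr>ob = (\<lambda>X. (ob F X, s X)),
      ar = (\<lambda>f. ((ob F (Dom D f), s (Dom D f)), ar F f, (ob F (Cod D f), s (Cod D f))))\<rparr>"

definition func_K :: "('k, 'u) setting \<Rightarrow> (('k, 'u) opalg, (('k, 'u) opalg, 'u) mor, ('k, 'u) talg, ('k, 'u) tmor) fnctr" where
  "func_K S = add_struct (RBA S) U_RBA (\<lambda>(R, P). (Sha S R, evaluation S (R, P), R))"

definition func_H :: "('k, 'u) setting \<Rightarrow> (('k, 'u) opalg, (('k, 'u) opalg, 'u) mor, ('k, 'u) talg, ('k, 'u) tmor) fnctr" where
  "func_H S = add_struct (DIF S) V_DIF (\<lambda>(R, d). (R, orbit_map S R d, Seq S R))"

definition func_H' ::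
  "('k, 'u) setting \<Rightarrow> (('k, 'u) op2alg, (('k, 'u) op2alg, 'u) mor,
     (('k, 'u) opalg, (('k, 'u) opalg, 'u) mor) struct_obj, (('k, 'u) opalg, (('k, 'u) opalg, 'u) mor) struct_arr) fnctr" where
  "func_H' S = add_struct (DRB S) V'_DRB (\<lambda>(R, d, P). ((R, P), orbit_map S R d, Seq_RBA S (R, P)))"

definition func_K' ::
  "('k, 'u) setting \<Rightarrow> (('k, 'u) op2alg, (('k, 'u) op2alg, 'u) mor,
     (('k, 'u) opalg, (('k, 'u) opalg, 'u) mor) struct_obj, (('k, 'u) opalg, (('k, 'u) opalg, 'u) mor) struct_arr) fnctr" where
  "func_K' S = add_struct (DRB S) U'_DRB (\<lambda>(R, d, P). (Sha_DIF S (R, d), evaluation S (R, P), (R, d)))"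

abbreviation func_Kt where "func_Kt S \<equiv> lift_functor (func_K S)"
abbreviation func_Ht where "func_Ht S \<equiv> lift_functor (func_H S)"

text \<open>\<open>\<langle>\<langle>A, h\<rangle>, f\<rangle> \<mapsto> \<langle>\<langle>A, f\<rangle>, h\<rangle>\<close>: the arrow \<open>f\<close> of \<open>ALG_T S\<close> is replaced by its underlying algebra
  homomorphism, and \<open>h\<close> is regarded as an arrow of \<open>ALG_C S\<close>.\<close>

definition Phi_ob ::
  "('k, 'u) setting \<Rightarrow> (('k, 'u) talg, ('k, 'u) tmor) struct_obj \<Rightarrow> (('k, 'u) talg, ('k, 'u) tmor) struct_obj" where
  "Phi_ob S = (\<lambda>((A, h), f).
     let B = (A, ar (U_T S) f) in (B, (Tt_ob S B, h, B)))"

definition func_Phi ::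
  "('k, 'u) setting \<Rightarrow> ((('k, 'u) talg, ('k, 'u) tmor) struct_obj, (('k, 'u) talg, ('k, 'u) tmor) struct_arr,
     (('k, 'u) talg, ('k, 'u) tmor) struct_obj, (('k, 'u) talg, ('k, 'u) tmor) struct_arr) fnctr" where
  "func_Phi S =
     \<lparr>ob = Phi_ob S,
      ar = (\<lambda>(X, g, Y). (Phi_ob S X, (fst (Phi_ob S X), ar (U_T S) g, fst (Phi_ob S Y)), Phi_ob S Y))\<rparr>"

end

theory Submission
  imports Defs
begin

text \<open>
  Every part of the diagram comes from two universal properties.

  The first is that of \<open>Sha(A)\<close>. A homomorphism from \<open>A\<close> to a Rota-Baxter algebra extends to \<open>Sha(A)\<close>,
  and a Rota-Baxter homomorphism out of \<open>Sha(A)\<close> is determined by its values on \<open>A\<close>, because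
  \<open>x\<^sub>0 \<otimes> x\<^sub>1 \<otimes> \<dots> = x\<^sub>0 P(x\<^sub>1 \<otimes> \<dots>)\<close> (lemmas \<open>free_unique\<close>, \<open>evaluation_hom\<close>, \<open>Sha_map_hom\<close>). If \<open>A\<close> has
  a derivation, then so does \<open>Sha(A)\<close>, and a Rota-Baxter homomorphism into a differential Rota-Baxter
  algebra commutes with the derivations as soon as it does so on \<open>A\<close> (\<open>free_hom_deriv\<close>). The second
  property is dual: a differential homomorphism into \<open>A\<^sup>\<nat>\<close> is determined by its \<open>0\<close>-th component
  (\<open>counit_eqI\<close>), and iterating a derivation gives one (\<open>orbit_hom\<close>), which is compatible with
  Rota-Baxter operators if \<open>d \<circ> P = id\<close> (\<open>orbit_map_P\<close>). This yields the four adjunctions between \<open>DRB\<close>,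
  \<open>RBA\<close>, \<open>DIF\<close> and \<open>ALG\<close>; the (co)monad laws follow from the adjunctions, and the forgetful functors
  from (co)algebras are handled by the construction of Eilenberg and Moore.

  A \<open>T\<close>-algebra structure \<open>h\<close> on \<open>A\<close> is the same as a Rota-Baxter operator, namely
  \<open>P(a) = h(1 \<otimes> a)\<close> (\<open>T_algebra_op\<close>), and a \<open>C\<close>-coalgebra structure \<open>f\<close> is the same as a derivation,
  namely \<open>d(a) = f(a)(1)\<close> (\<open>C_coalgebra_deriv\<close>). This makes \<open>K\<close>, \<open>K'\<close>, \<open>H\<close> and \<open>H'\<close> isomorphisms.

  The distributive law \<open>\<beta>\<close> enters through the uniqueness in its definition. The maps \<open>ev\<^sup>\<nat> \<circ> \<beta>\<close> and
  \<open>ev\<close> are two Rota-Baxter homomorphisms from \<open>Sha(R\<^sup>\<nat>)\<close> to \<open>R\<^sup>\<nat>\<close> that agree on \<open>R\<^sup>\<nat>\<close>, so the comonad induced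
  by \<open>\<beta>\<close> on \<open>T\<close>-algebras corresponds under \<open>K\<close> to \<open>C'\<close> (\<open>Ct_ob_K\<close>); in the same way the induced
  monad on \<open>C\<close>-coalgebras corresponds under \<open>H\<close> to \<open>T'\<close> (\<open>Tt_ob_H\<close>). An isomorphism of categories
  with this property transports the laws and lifts to an isomorphism between the categories
  of (co)algebras (\<open>monad_transport\<close>, \<open>comonad_transport\<close>), which settles the two remaining comparison
  functors. Finally \<open>\<Phi>\<close> is a functor because its composite with the isomorphism from \<open>DRB\<close> to its
  domain is the composite of the other two sides of the square.
\<close>


section \<open>Arrows, functors and adjunctions\<close>

text \<open>Membership of an arrow together with its two ends: in this form the axioms of a category and of a functor are rules
  that resolution can chain, without side conditions on domains and codomains.\<close>

definition arrow :: "('o, 'm) cat \<Rightarrow> 'm \<Rightarrow> 'o \<Rightarrow> 'o \<Rightarrow> bool" where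
  "arrow C f A B \<longleftrightarrow> f \<in> Arr C \<and> Dom C f = A \<and> Cod C f = B"

context category begin

lemma arrow_obj: "arrow C f A B \<Longrightarrow> A \<in> Obj C" "arrow C f A B \<Longrightarrow> B \<in> Obj C"
  using dom_obj cod_obj by (auto simp: arrow_def)

lemma arrow_id: "A \<in> Obj C \<Longrightarrow> arrow C (Idn C A) A A"
  using idn_arr by (auto simp: arrow_def)

lemma arrow_comp: "arrow C f A B \<Longrightarrow> arrow C g B D \<Longrightarrow> arrow C (g \<bullet> f) A D"
  using cmp_arr by (auto simp: arrow_def)

lemma comp_id: "arrow C f A B \<Longrightarrow> f \<bullet> Idn C A = f" "arrow C f A B \<Longrightarrow> Idn C B \<bullet> f = f"
  using cmp_idn by (auto simp: arrow_def)

lemma comp_assoc: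
  "arrow C f A B \<Longrightarrow> arrow C g B D \<Longrightarrow> arrow C h D E \<Longrightarrow> (h \<bullet> g) \<bullet> f = h \<bullet> (g \<bullet> f)"
  using cmp_assoc by (auto simp: arrow_def)

end

lemma categoryI:
  assumes "\<And>f A B. arrow C f A B \<Longrightarrow> A \<in> Obj C \<and> B \<in> Obj C"
    and "\<And>A. A \<in> Obj C \<Longrightarrow> arrow C (Idn C A) A A"
    and "\<And>f g A B D. arrow C f A B \<Longrightarrow> arrow C g B D \<Longrightarrow> arrow C (g \<bullet>\<^bsub>C\<^esub> f) A D"
    and "\<And>f A B. arrow C f A B \<Longrightarrow> f \<bullet>\<^bsub>C\<^esub> Idn C A = f \<and> Idn C B \<bullet>\<^bsub>C\<^esub> f = f"
    and "\<And>f g h A B D E. arrow C f A B \<Longrightarrow> arrow C g B D \<Longrightarrow> arrow C h D E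
           \<Longrightarrow> (h \<bullet>\<^bsub>C\<^esub> g) \<bullet>\<^bsub>C\<^esub> f = h \<bullet>\<^bsub>C\<^esub> (g \<bullet>\<^bsub>C\<^esub> f)"
  shows "category C"
  using assms unfolding arrow_def by unfold_locales (simp_all)

lemma functorD:
  assumes "is_functor C D F"
  shows "category C" "category D" "A \<in> Obj C \<Longrightarrow> ob F A \<in> Obj D"
    "A \<in> Obj C \<Longrightarrow> ar F (Idn C A) = Idn D (ob F A)"
    "arrow C f A B \<Longrightarrow> arrow D (ar F f) (ob F A) (ob F B)"
    "arrow C f A B \<Longrightarrow> arrow C g B E \<Longrightarrow> ar F (g \<bullet>\<^bsub>C\<^esub> f) = ar F g \<bullet>\<^bsub>D\<^esub> ar F f"
  using assms by (auto simp: is_functor_def arrow_def)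

lemma functorI:
  assumes "category C" "category D" "\<And>A. A \<in> Obj C \<Longrightarrow> ob F A \<in> Obj D"
    "\<And>A. A \<in> Obj C \<Longrightarrow> ar F (Idn C A) = Idn D (ob F A)"
    "\<And>f A B. arrow C f A B \<Longrightarrow> arrow D (ar F f) (ob F A) (ob F B)"
    "\<And>f g A B E. arrow C f A B \<Longrightarrow> arrow C g B E \<Longrightarrow> ar F (g \<bullet>\<^bsub>C\<^esub> f) = ar F g \<bullet>\<^bsub>D\<^esub> ar F f"
  shows "is_functor C D F"
  using assms unfolding is_functor_def arrow_def by auto

lemma fcomp_simps [simp]: "ob (G \<circ>\<^sub>F F) A = ob G (ob F A)" "ar (G \<circ>\<^sub>F F) f = ar G (ar F f)"
  by (simp_all add: fcomp_def)

lemma idf_simps [simp]: "ob idf A = A" "ar idf f = f"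
  by (simp_all add: idf_def)

lemma functor_idf: "category C \<Longrightarrow> is_functor C C idf"
  by (rule functorI) auto

lemma functor_fcomp: "is_functor C D F \<Longrightarrow> is_functor D E G \<Longrightarrow> is_functor C E (G \<circ>\<^sub>F F)"
  by (rule functorI) (simp_all add: functorD functorD(6)[OF _ functorD(5) functorD(5)])

lemma functor_cong:
  assumes "is_functor C D G" "\<And>A. A \<in> Obj C \<Longrightarrow> ob F A = ob G A"
    "\<And>f A B. arrow C f A B \<Longrightarrow> ar F f = ar G f"
  shows "is_functor C D F"
proof -
  note G = functorD[OF assms(1)]
  interpret category C by (rule G(1))
  show ?thesis
  proof (rule functorI)
    show "category C" "category D" by (rule G)+
    show "A \<in> Obj C \<Longrightarrow> ob F A \<in> Obj D" for A using assms(2) G(3) by simp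
    show "A \<in> Obj C \<Longrightarrow> ar F (Idn C A) = Idn D (ob F A)" for A
      using assms(2) assms(3)[OF arrow_id] G(4) by simp
    show "arrow D (ar F f) (ob F A) (ob F B)" if "arrow C f A B" for f A B
      using assms(2)[OF arrow_obj(1)[OF that]] assms(2)[OF arrow_obj(2)[OF that]] assms(3)[OF that]
        G(5)[OF that] by simp
    show "ar F (g \<bullet>\<^bsub>C\<^esub> f) = ar F g \<bullet>\<^bsub>D\<^esub> ar F f" if "arrow C f A B" "arrow C g B E" for f g A B E
      using assms(3)[OF that(1)] assms(3)[OF that(2)] assms(3)[OF arrow_comp[OF that]] G(6)[OF that]
      by simp
  qed
qed

lemma functor_eqI:
  assumes "is_functor C D G" "\<And>A. A \<in> Obj C \<Longrightarrow> ob F A = ob G A"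
    "\<And>f A B. arrow C f A B \<Longrightarrow> ar F f = ar G f"
  shows "functor_eq C D F G"
  using functor_cong[OF assms] assms unfolding functor_eq_def arrow_def by auto

lemma functor_eqD:
  assumes "functor_eq C D F G"
  shows "is_functor C D F" "is_functor C D G" "A \<in> Obj C \<Longrightarrow> ob F A = ob G A"
    "arrow C f A B \<Longrightarrow> ar F f = ar G f"
  using assms unfolding functor_eq_def arrow_def by auto

lemma nat_transI:
  assumes "is_functor C D F" "is_functor C D G"
    "\<And>A. A \<in> Obj C \<Longrightarrow> arrow D (\<tau> A) (ob F A) (ob G A)"
    "\<And>f A B. arrow C f A B \<Longrightarrow> ar G f \<bullet>\<^bsub>D\<^esub> \<tau> A = \<tau> B \<bullet>\<^bsub>D\<^esub> ar F f"
  shows "nat_trans C D F G \<tau>"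
  using assms unfolding nat_trans_def arrow_def by auto

lemma nat_transD:
  assumes "nat_trans C D F G \<tau>"
  shows "is_functor C D F" "is_functor C D G"
    "A \<in> Obj C \<Longrightarrow> arrow D (\<tau> A) (ob F A) (ob G A)"
    "arrow C f A B \<Longrightarrow> ar G f \<bullet>\<^bsub>D\<^esub> \<tau> A = \<tau> B \<bullet>\<^bsub>D\<^esub> ar F f"
  using assms unfolding nat_trans_def arrow_def by auto

text \<open>A morphism out of \<open>F A\<close> is determined by its restriction along \<open>\<eta>\<close>. This single
  uniqueness property forces \<open>F\<close> to be functorial, the counit to be natural, and the second triangle
  identity to hold: in each case the two sides have equal restrictions.\<close>

lemma adjunction_of_universal_arrows:
  assumes C: "category C" and G: "is_functor D C G"
    and obF: "\<And>A. A \<in> Obj C \<Longrightarrow> ob F A \<in> Obj D"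
    and eta: "\<And>A. A \<in> Obj C \<Longrightarrow> arrow C (\<eta> A) A (ob G (ob F A))"
    and arF: "\<And>f A B. arrow C f A B \<Longrightarrow> arrow D (ar F f) (ob F A) (ob F B)"
    and nat: "\<And>f A B. arrow C f A B \<Longrightarrow> ar G (ar F f) \<bullet>\<^bsub>C\<^esub> \<eta> A = \<eta> B \<bullet>\<^bsub>C\<^esub> f"
    and uniq: "\<And>A X g g'. \<lbrakk>A \<in> Obj C; arrow D g (ob F A) X; arrow D g' (ob F A) X;
        ar G g \<bullet>\<^bsub>C\<^esub> \<eta> A = ar G g' \<bullet>\<^bsub>C\<^esub> \<eta> A\<rbrakk> \<Longrightarrow> g = g'"
    and eps: "\<And>X. X \<in> Obj D \<Longrightarrow> arrow D (\<epsilon> X) (ob F (ob G X)) X"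
    and tri: "\<And>X. X \<in> Obj D \<Longrightarrow> ar G (\<epsilon> X) \<bullet>\<^bsub>C\<^esub> \<eta> (ob G X) = Idn C (ob G X)"
  shows "adjunction C D F G \<eta> \<epsilon>"
proof -
  note G' = functorD[OF G]
  interpret C: category C by (rule C)
  interpret D: category D by (rule G')
  have F: "is_functor C D F"
  proof (rule functorI)
    fix A assume A: "A \<in> Obj C"
    show "ar F (Idn C A) = Idn D (ob F A)"
    proof (rule uniq[OF A])
      show "arrow D (ar F (Idn C A)) (ob F A) (ob F A)" by (rule arF[OF C.arrow_id[OF A]])
      show "arrow D (Idn D (ob F A)) (ob F A) (ob F A)" by (rule D.arrow_id[OF obF[OF A]])
      show "ar G (ar F (Idn C A)) \<bullet>\<^bsub>C\<^esub> \<eta> A = ar G (Idn D (ob F A)) \<bullet>\<^bsub>C\<^esub> \<eta> A"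
        using nat[OF C.arrow_id[OF A]] C.comp_id[OF eta[OF A]] G'(4)[OF obF[OF A]] by simp
    qed
  next
    fix f g A B E assume f: "arrow C f A B" and g: "arrow C g B E"
    have A: "A \<in> Obj C" and B: "B \<in> Obj C" and E: "E \<in> Obj C"
      using C.arrow_obj[OF f] C.arrow_obj[OF g] by auto
    note Ff = arF[OF f] and Fg = arF[OF g]
    show "ar F (g \<bullet>\<^bsub>C\<^esub> f) = ar F g \<bullet>\<^bsub>D\<^esub> ar F f"
    proof (rule uniq[OF A])
      show "arrow D (ar F (g \<bullet>\<^bsub>C\<^esub> f)) (ob F A) (ob F E)" by (rule arF[OF C.arrow_comp[OF f g]])
      show "arrow D (ar F g \<bullet>\<^bsub>D\<^esub> ar F f) (ob F A) (ob F E)" by (rule D.arrow_comp[OF Ff Fg])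
      have "ar G (ar F (g \<bullet>\<^bsub>C\<^esub> f)) \<bullet>\<^bsub>C\<^esub> \<eta> A = \<eta> E \<bullet>\<^bsub>C\<^esub> (g \<bullet>\<^bsub>C\<^esub> f)" by (rule nat[OF C.arrow_comp[OF f g]])
      also have "\<dots> = (\<eta> E \<bullet>\<^bsub>C\<^esub> g) \<bullet>\<^bsub>C\<^esub> f" by (rule C.comp_assoc[OF f g eta[OF E], symmetric])
      also have "\<dots> = (ar G (ar F g) \<bullet>\<^bsub>C\<^esub> \<eta> B) \<bullet>\<^bsub>C\<^esub> f" by (simp add: nat[OF g])
      also have "\<dots> = ar G (ar F g) \<bullet>\<^bsub>C\<^esub> (\<eta> B \<bullet>\<^bsub>C\<^esub> f)" by (rule C.comp_assoc[OF f eta[OF B] G'(5)[OF Fg]])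
      also have "\<dots> = ar G (ar F g) \<bullet>\<^bsub>C\<^esub> (ar G (ar F f) \<bullet>\<^bsub>C\<^esub> \<eta> A)" by (simp add: nat[OF f])
      also have "\<dots> = ar G (ar F g \<bullet>\<^bsub>D\<^esub> ar F f) \<bullet>\<^bsub>C\<^esub> \<eta> A"
        using C.comp_assoc[OF eta[OF A] G'(5)[OF Ff] G'(5)[OF Fg]] G'(6)[OF Ff Fg] by simp
      finally show "ar G (ar F (g \<bullet>\<^bsub>C\<^esub> f)) \<bullet>\<^bsub>C\<^esub> \<eta> A = ar G (ar F g \<bullet>\<^bsub>D\<^esub> ar F f) \<bullet>\<^bsub>C\<^esub> \<eta> A" .
    qed
  qed (auto intro: C G' obF arF)
  note F' = functorD[OF F]
  have n1: "nat_trans C C idf (G \<circ>\<^sub>F F) \<eta>"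
    by (rule nat_transI) (auto intro: functor_idf functor_fcomp C F G eta nat)
  have n2: "nat_trans D D (F \<circ>\<^sub>F G) idf \<epsilon>"
  proof (rule nat_transI)
    fix f X Y assume f: "arrow D f X Y"
    have X: "X \<in> Obj D" and Y: "Y \<in> Obj D" using D.arrow_obj[OF f] by auto
    note Gf = G'(5)[OF f] and FGf = F'(5)[OF G'(5)[OF f]]
    note eX = eta[OF G'(3)[OF X]] and eY = eta[OF G'(3)[OF Y]]
    have "f \<bullet>\<^bsub>D\<^esub> \<epsilon> X = \<epsilon> Y \<bullet>\<^bsub>D\<^esub> ar F (ar G f)"
    proof (rule uniq[OF G'(3)[OF X]])
      show a: "arrow D (f \<bullet>\<^bsub>D\<^esub> \<epsilon> X) (ob F (ob G X)) Y" by (rule D.arrow_comp[OF eps[OF X] f])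
      show b: "arrow D (\<epsilon> Y \<bullet>\<^bsub>D\<^esub> ar F (ar G f)) (ob F (ob G X)) Y"
        by (rule D.arrow_comp[OF FGf eps[OF Y]])
      have "ar G (f \<bullet>\<^bsub>D\<^esub> \<epsilon> X) \<bullet>\<^bsub>C\<^esub> \<eta> (ob G X) = ar G f \<bullet>\<^bsub>C\<^esub> (ar G (\<epsilon> X) \<bullet>\<^bsub>C\<^esub> \<eta> (ob G X))"
        using C.comp_assoc[OF eX G'(5)[OF eps[OF X]] Gf] G'(6)[OF eps[OF X] f] by simp
      also have "\<dots> = ar G f" using tri[OF X] C.comp_id[OF Gf] by simp
      also have "\<dots> = (ar G (\<epsilon> Y) \<bullet>\<^bsub>C\<^esub> \<eta> (ob G Y)) \<bullet>\<^bsub>C\<^esub> ar G f" using tri[OF Y] C.comp_id[OF Gf] by simp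
      also have "\<dots> = ar G (\<epsilon> Y) \<bullet>\<^bsub>C\<^esub> (\<eta> (ob G Y) \<bullet>\<^bsub>C\<^esub> ar G f)"
        by (rule C.comp_assoc[OF Gf eY G'(5)[OF eps[OF Y]]])
      also have "\<dots> = ar G (\<epsilon> Y) \<bullet>\<^bsub>C\<^esub> (ar G (ar F (ar G f)) \<bullet>\<^bsub>C\<^esub> \<eta> (ob G X))" by (simp add: nat[OF Gf])
      also have "\<dots> = ar G (\<epsilon> Y \<bullet>\<^bsub>D\<^esub> ar F (ar G f)) \<bullet>\<^bsub>C\<^esub> \<eta> (ob G X)"
        using C.comp_assoc[OF eX G'(5)[OF FGf] G'(5)[OF eps[OF Y]]] G'(6)[OF FGf eps[OF Y]] by simp
      finally show "ar G (f \<bullet>\<^bsub>D\<^esub> \<epsilon> X) \<bullet>\<^bsub>C\<^esub> \<eta> (ob G X)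
        = ar G (\<epsilon> Y \<bullet>\<^bsub>D\<^esub> ar F (ar G f)) \<bullet>\<^bsub>C\<^esub> \<eta> (ob G X)" .
    qed
    then show "ar idf f \<bullet>\<^bsub>D\<^esub> \<epsilon> X = \<epsilon> Y \<bullet>\<^bsub>D\<^esub> ar (F \<circ>\<^sub>F G) f" by simp
  qed (auto intro: functor_idf functor_fcomp G' F G eps)
  have t: "\<epsilon> (ob F A) \<bullet>\<^bsub>D\<^esub> ar F (\<eta> A) = Idn D (ob F A)" if A: "A \<in> Obj C" for A
  proof (rule uniq[OF A])
    note FA = obF[OF A] and eA = eta[OF A]
    note GA = G'(3)[OF FA]
    show "arrow D (\<epsilon> (ob F A) \<bullet>\<^bsub>D\<^esub> ar F (\<eta> A)) (ob F A) (ob F A)"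
      by (rule D.arrow_comp[OF arF[OF eA] eps[OF FA]])
    show "arrow D (Idn D (ob F A)) (ob F A) (ob F A)" by (rule D.arrow_id[OF FA])
    have "ar G (\<epsilon> (ob F A) \<bullet>\<^bsub>D\<^esub> ar F (\<eta> A)) \<bullet>\<^bsub>C\<^esub> \<eta> A
        = ar G (\<epsilon> (ob F A)) \<bullet>\<^bsub>C\<^esub> (ar G (ar F (\<eta> A)) \<bullet>\<^bsub>C\<^esub> \<eta> A)"
      using C.comp_assoc[OF eA G'(5)[OF arF[OF eA]] G'(5)[OF eps[OF FA]]] G'(6)[OF arF[OF eA] eps[OF FA]]
      by simp
    also have "\<dots> = ar G (\<epsilon> (ob F A)) \<bullet>\<^bsub>C\<^esub> (\<eta> (ob G (ob F A)) \<bullet>\<^bsub>C\<^esub> \<eta> A)" by (simp add: nat[OF eA])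
    also have "\<dots> = (ar G (\<epsilon> (ob F A)) \<bullet>\<^bsub>C\<^esub> \<eta> (ob G (ob F A))) \<bullet>\<^bsub>C\<^esub> \<eta> A"
      by (rule C.comp_assoc[OF eA eta[OF GA] G'(5)[OF eps[OF FA]], symmetric])
    also have "\<dots> = ar G (Idn D (ob F A)) \<bullet>\<^bsub>C\<^esub> \<eta> A" using tri[OF FA] G'(4)[OF FA] by simp
    finally show "ar G (\<epsilon> (ob F A) \<bullet>\<^bsub>D\<^esub> ar F (\<eta> A)) \<bullet>\<^bsub>C\<^esub> \<eta> A = ar G (Idn D (ob F A)) \<bullet>\<^bsub>C\<^esub> \<eta> A" .
  qed
  show ?thesis unfolding adjunction_def using F G n1 n2 t tri by blast
qed

lemma left_adjoint_generatesI:
  assumes "adjunction C D F G \<eta> \<epsilon>"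
    and "\<And>A. A \<in> Obj C \<Longrightarrow> ob (mfun M) A = ob G (ob F A)"
    and "\<And>f A B. arrow C f A B \<Longrightarrow> ar (mfun M) f = ar G (ar F f)"
    and "\<And>A. A \<in> Obj C \<Longrightarrow> munit M A = \<eta> A"
    and "\<And>A. A \<in> Obj C \<Longrightarrow> mmult M A = ar G (\<epsilon> (ob F A))"
  shows "left_adjoint_generates D C G M"
proof -
  have "is_functor C C (G \<circ>\<^sub>F F)" using assms(1) by (auto simp: adjunction_def intro: functor_fcomp)
  then have "functor_eq C C (mfun M) (G \<circ>\<^sub>F F)" by (rule functor_eqI) (simp_all add: assms)
  then show ?thesis unfolding left_adjoint_generates_def using assms(1,4,5) by blast
qed

definition is_monad :: "('o, 'm) cat \<Rightarrow> ('o, 'm) monad \<Rightarrow> bool" where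
  "is_monad C M \<longleftrightarrow> nat_trans C C idf (mfun M) (munit M) \<and>
     nat_trans C C (mfun M \<circ>\<^sub>F mfun M) (mfun M) (mmult M) \<and>
     (\<forall>A\<in>Obj C. mmult M A \<bullet>\<^bsub>C\<^esub> munit M (ob (mfun M) A) = Idn C (ob (mfun M) A) \<and>
        mmult M A \<bullet>\<^bsub>C\<^esub> ar (mfun M) (munit M A) = Idn C (ob (mfun M) A) \<and>
        mmult M A \<bullet>\<^bsub>C\<^esub> ar (mfun M) (mmult M A) = mmult M A \<bullet>\<^bsub>C\<^esub> mmult M (ob (mfun M) A))"

lemma nat_trans_cong:
  assumes "nat_trans C D F G \<tau>" "functor_eq C D F' F" "functor_eq C D G' G"
    "\<And>A. A \<in> Obj C \<Longrightarrow> \<tau>' A = \<tau> A"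
  shows "nat_trans C D F' G' \<tau>'"
proof -
  note n = nat_transD[OF assms(1)] and F = functor_eqD[OF assms(2)] and G = functor_eqD[OF assms(3)]
  interpret category C using functorD[OF F(1)] by simp
  show ?thesis
    by (rule nat_transI) (use n F G assms(4) arrow_obj in \<open>simp_all\<close>)
qed

text \<open>Associativity of the multiplication \<open>G \<epsilon> F\<close> is naturality of \<open>\<epsilon>\<close> at an
  arrow \<open>\<epsilon>\<close>; the unit laws are the triangle identities.\<close>

lemma monad_of_adjunction:
  assumes "left_adjoint_generates D C G M"
  shows "is_monad C M"
proof -
  obtain F \<eta> \<epsilon> where adj: "adjunction C D F G \<eta> \<epsilon>" and fe: "functor_eq C C (mfun M) (G \<circ>\<^sub>F F)"
    and u: "\<And>A. A \<in> Obj C \<Longrightarrow> munit M A = \<eta> A"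
    and m: "\<And>A. A \<in> Obj C \<Longrightarrow> mmult M A = ar G (\<epsilon> (ob F A))"
    using assms unfolding left_adjoint_generates_def by blast
  have F: "is_functor C D F" and G: "is_functor D C G"
    and eta: "nat_trans C C idf (G \<circ>\<^sub>F F) \<eta>" and eps: "nat_trans D D (F \<circ>\<^sub>F G) idf \<epsilon>"
    and t1: "\<And>A. A \<in> Obj C \<Longrightarrow> \<epsilon> (ob F A) \<bullet>\<^bsub>D\<^esub> ar F (\<eta> A) = Idn D (ob F A)"
    and t2: "\<And>X. X \<in> Obj D \<Longrightarrow> ar G (\<epsilon> X) \<bullet>\<^bsub>C\<^esub> \<eta> (ob G X) = Idn C (ob G X)"
    using adj unfolding adjunction_def by auto
  note F' = functorD[OF F] and G' = functorD[OF G] and eta' = nat_transD[OF eta] and eps' = nat_transD[OF eps]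
  note fe' = functor_eqD[OF fe]
  interpret C: category C by (rule F')
  interpret D: category D by (rule F')
  have n1: "nat_trans C C idf (mfun M) (munit M)"
    by (rule nat_trans_cong[OF eta _ fe u]) (auto intro!: functor_eqI functor_idf F')
  have "functor_eq C C (mfun M \<circ>\<^sub>F mfun M) ((G \<circ>\<^sub>F F) \<circ>\<^sub>F (G \<circ>\<^sub>F F))"
    by (rule functor_eqI)
      (auto intro: functor_fcomp F G simp: fe'(3) fe'(4) functorD(3)[OF fe'(2), simplified]
        fe'(4)[OF functorD(5)[OF fe'(2)], simplified])
  moreover have "nat_trans C C ((G \<circ>\<^sub>F F) \<circ>\<^sub>F (G \<circ>\<^sub>F F)) (G \<circ>\<^sub>F F) (\<lambda>A. ar G (\<epsilon> (ob F A)))"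
  proof (rule nat_transI)
    fix f A B assume f: "arrow C f A B"
    show "ar (G \<circ>\<^sub>F F) f \<bullet>\<^bsub>C\<^esub> ar G (\<epsilon> (ob F A)) =
       ar G (\<epsilon> (ob F B)) \<bullet>\<^bsub>C\<^esub> ar (G \<circ>\<^sub>F F \<circ>\<^sub>F (G \<circ>\<^sub>F F)) f"
      using eps'(4)[OF F'(5)[OF f]] C.arrow_obj[OF f]
        G'(6)[OF eps'(3)[OF F'(3), simplified] F'(5)[OF f]]
        G'(6)[OF F'(5)[OF G'(5)[OF F'(5)[OF f]]] eps'(3)[OF F'(3), simplified]] by simp
  qed (use eps'(3)[OF F'(3)] in \<open>auto intro: functor_fcomp F G G'(5)\<close>)
  ultimately have n2: "nat_trans C C (mfun M \<circ>\<^sub>F mfun M) (mfun M) (mmult M)"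
    using nat_trans_cong fe m by blast
  show ?thesis unfolding is_monad_def
  proof (intro conjI ballI n1 n2)
    fix A assume A: "A \<in> Obj C"
    note FA = F'(3)[OF A] note GFA = G'(3)[OF FA] note FGFA = F'(3)[OF GFA]
    note eA = eta'(3)[OF A, simplified] and pA = eps'(3)[OF FA, simplified]
    show "mmult M A \<bullet>\<^bsub>C\<^esub> munit M (ob (mfun M) A) = Idn C (ob (mfun M) A)"
      using t2[OF FA] by (simp add: m[OF A] fe'(3)[OF A] u[OF GFA])
    show "mmult M A \<bullet>\<^bsub>C\<^esub> ar (mfun M) (munit M A) = Idn C (ob (mfun M) A)"
      using t1[OF A] G'(6)[OF F'(5)[OF eA] pA] G'(4)[OF FA]
      by (simp add: m[OF A] fe'(3)[OF A] u[OF A] fe'(4)[OF eA])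
    show "mmult M A \<bullet>\<^bsub>C\<^esub> ar (mfun M) (mmult M A) = mmult M A \<bullet>\<^bsub>C\<^esub> mmult M (ob (mfun M) A)"
      using eps'(4)[OF pA, simplified] G'(6)[OF F'(5)[OF G'(5)[OF pA]] pA]
        G'(6)[OF eps'(3)[OF FGFA, simplified] pA]
      by (simp add: m[OF A] fe'(3)[OF A] m[OF GFA] fe'(4)[OF G'(5)[OF pA]])
  qed
qed

lemma arrow_struct_cat:
  "arrow (struct_cat C X mors) g x y \<longleftrightarrow>
     (\<exists>f. g = (x, f, y) \<and> x \<in> X \<and> y \<in> X \<and> arrow C f (fst x) (fst y) \<and> mors x y f)"
  by (auto simp: arrow_def struct_cat_def)

lemma struct_cat_simps [simp]:
  "Obj (struct_cat C X mors) = X"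
  "Idn (struct_cat C X mors) x = (x, Idn C (fst x), x)"
  "(y', g, z) \<bullet>\<^bsub>struct_cat C X mors\<^esub> (x, f, y) = (x, g \<bullet>\<^bsub>C\<^esub> f, z)"
  by (auto simp: struct_cat_def)

lemma category_struct_cat:
  assumes "category C" and X: "\<And>x. x \<in> X \<Longrightarrow> fst x \<in> Obj C"
    and "\<And>x. x \<in> X \<Longrightarrow> mors x x (Idn C (fst x))"
    and "\<And>x y z f g. \<lbrakk>x \<in> X; y \<in> X; z \<in> X; arrow C f (fst x) (fst y); arrow C g (fst y) (fst z);
          mors x y f; mors y z g\<rbrakk> \<Longrightarrow> mors x z (g \<bullet>\<^bsub>C\<^esub> f)"
  shows "category (struct_cat C X mors)"
proof -
  interpret category C by (rule assms(1))
  show ?thesis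
    by (rule categoryI)
      (use assms(3,4) X in \<open>auto simp: arrow_struct_cat arrow_id comp_id intro: arrow_comp comp_assoc\<close>)
qed

lemma alg_cat_obj:
  "(A, h) \<in> Obj (alg_cat C M) \<longleftrightarrow> A \<in> Obj C \<and> arrow C h (ob (mfun M) A) A \<and>
     h \<bullet>\<^bsub>C\<^esub> munit M A = Idn C A \<and> h \<bullet>\<^bsub>C\<^esub> ar (mfun M) h = h \<bullet>\<^bsub>C\<^esub> mmult M A"
  by (auto simp: alg_cat_def arrow_def)

lemma alg_cat_arrow:
  "arrow (alg_cat C M) g (A, h) (B, k) \<longleftrightarrow> (\<exists>f. g = ((A, h), f, (B, k)) \<and> arrow C f A B \<and>
     (A, h) \<in> Obj (alg_cat C M) \<and> (B, k) \<in> Obj (alg_cat C M) \<and> f \<bullet>\<^bsub>C\<^esub> h = k \<bullet>\<^bsub>C\<^esub> ar (mfun M) f)"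
  by (auto simp: alg_cat_def arrow_struct_cat)

lemma forget_alg_simps [simp]: "ob (forget_alg C M) X = fst X" "ar (forget_alg C M) (x, f, y) = f"
  by (simp_all add: forget_alg_def)

lemma forget_coalg_simps [simp]: "ob (forget_coalg C M) X = fst X" "ar (forget_coalg C M) (x, f, y) = f"
  by (simp_all add: forget_coalg_def)

lemma monadD:
  assumes "is_monad C M"
  shows "is_functor C C (mfun M)"
    "A \<in> Obj C \<Longrightarrow> arrow C (munit M A) A (ob (mfun M) A)"
    "A \<in> Obj C \<Longrightarrow> arrow C (mmult M A) (ob (mfun M) (ob (mfun M) A)) (ob (mfun M) A)"
    "arrow C f A B \<Longrightarrow> ar (mfun M) f \<bullet>\<^bsub>C\<^esub> munit M A = munit M B \<bullet>\<^bsub>C\<^esub> f"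
    "arrow C f A B \<Longrightarrow> ar (mfun M) f \<bullet>\<^bsub>C\<^esub> mmult M A = mmult M B \<bullet>\<^bsub>C\<^esub> ar (mfun M) (ar (mfun M) f)"
    "A \<in> Obj C \<Longrightarrow> mmult M A \<bullet>\<^bsub>C\<^esub> munit M (ob (mfun M) A) = Idn C (ob (mfun M) A)"
    "A \<in> Obj C \<Longrightarrow> mmult M A \<bullet>\<^bsub>C\<^esub> ar (mfun M) (munit M A) = Idn C (ob (mfun M) A)"
    "A \<in> Obj C \<Longrightarrow> mmult M A \<bullet>\<^bsub>C\<^esub> ar (mfun M) (mmult M A) = mmult M A \<bullet>\<^bsub>C\<^esub> mmult M (ob (mfun M) A)"
  using assms nat_transD[of C C idf "mfun M" "munit M"]
    nat_transD[of C C "mfun M \<circ>\<^sub>F mfun M" "mfun M" "mmult M"] unfolding is_monad_def by auto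

lemma category_alg_cat:
  assumes M: "is_monad C M"
  shows "category (alg_cat C M)"
proof -
  note T = functorD[OF monadD(1)[OF M]]
  interpret category C by (rule T)
  let ?X = "{(A, h). A \<in> Obj C \<and> h \<in> Arr C \<and> Dom C h = ob (mfun M) A \<and> Cod C h = A \<and>
        h \<bullet>\<^bsub>C\<^esub> munit M A = Idn C A \<and> h \<bullet>\<^bsub>C\<^esub> ar (mfun M) h = h \<bullet>\<^bsub>C\<^esub> mmult M A}"
  show ?thesis
    unfolding alg_cat_def
  proof (rule category_struct_cat)
    fix x y z f g
    assume "x \<in> ?X"
      and "y \<in> ?X"
      and "z \<in> ?X"
      and f: "arrow C f (fst x) (fst y)" and g: "arrow C g (fst y) (fst z)"
      and fm: "(\<lambda>(A, h) (B, k) f. f \<bullet>\<^bsub>C\<^esub> h = k \<bullet>\<^bsub>C\<^esub> ar (mfun M) f) x y f"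
      and gm: "(\<lambda>(A, h) (B, k) f. f \<bullet>\<^bsub>C\<^esub> h = k \<bullet>\<^bsub>C\<^esub> ar (mfun M) f) y z g"
    then obtain A h B k E l where x: "x = (A, h)" and y: "y = (B, k)" and z: "z = (E, l)"
      and h: "arrow C h (ob (mfun M) A) A" and k: "arrow C k (ob (mfun M) B) B"
      and l: "arrow C l (ob (mfun M) E) E"
      by (cases x; cases y; cases z) (auto simp: arrow_def)
    note f = f[unfolded x y fst_conv] and g = g[unfolded y z fst_conv]
    note Tf = T(5)[OF f] and Tg = T(5)[OF g]
    have "(g \<bullet>\<^bsub>C\<^esub> f) \<bullet>\<^bsub>C\<^esub> h = g \<bullet>\<^bsub>C\<^esub> (f \<bullet>\<^bsub>C\<^esub> h)" by (rule comp_assoc[OF h f g])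
    also have "\<dots> = g \<bullet>\<^bsub>C\<^esub> (k \<bullet>\<^bsub>C\<^esub> ar (mfun M) f)" using fm by (simp add: x y)
    also have "\<dots> = (g \<bullet>\<^bsub>C\<^esub> k) \<bullet>\<^bsub>C\<^esub> ar (mfun M) f" by (rule comp_assoc[OF Tf k g, symmetric])
    also have "\<dots> = (l \<bullet>\<^bsub>C\<^esub> ar (mfun M) g) \<bullet>\<^bsub>C\<^esub> ar (mfun M) f" using gm by (simp add: z y)
    also have "\<dots> = l \<bullet>\<^bsub>C\<^esub> ar (mfun M) (g \<bullet>\<^bsub>C\<^esub> f)"
      by (simp add: comp_assoc[OF Tf Tg l] T(6)[OF f g])
    finally show "(\<lambda>(A, h) (B, k) f. f \<bullet>\<^bsub>C\<^esub> h = k \<bullet>\<^bsub>C\<^esub> ar (mfun M) f) x z (g \<bullet>\<^bsub>C\<^esub> f)"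
      by (simp add: x z)
  next
    fix x assume "x \<in> ?X"
    then obtain A h where "x = (A, h)" "arrow C h (ob (mfun M) A) A" "A \<in> Obj C" by (auto simp: arrow_def)
    then show "(\<lambda>(A, h) (B, k) f. f \<bullet>\<^bsub>C\<^esub> h = k \<bullet>\<^bsub>C\<^esub> ar (mfun M) f) x x (Idn C (fst x))"
      by (simp add: comp_id T)
  qed (auto intro: T)
qed

lemma functor_forget_alg:
  assumes M: "is_monad C M"
  shows "is_functor (alg_cat C M) C (forget_alg C M)"
proof (rule functorI)
  show "category (alg_cat C M)" "category C" using category_alg_cat[OF M] functorD[OF monadD(1)[OF M]] by auto
  show "X \<in> Obj (alg_cat C M) \<Longrightarrow> ob (forget_alg C M) X \<in> Obj C" for X
    by (cases X) (simp add: alg_cat_obj)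
  show "ar (forget_alg C M) (Idn (alg_cat C M) X) = Idn C (ob (forget_alg C M) X)" for X
    by (simp add: alg_cat_def)
  show "arrow C (ar (forget_alg C M) f) (ob (forget_alg C M) X) (ob (forget_alg C M) Y)"
    if "arrow (alg_cat C M) f X Y" for f X Y
    using that by (cases X; cases Y) (auto simp: alg_cat_arrow)
  show "ar (forget_alg C M) (g \<bullet>\<^bsub>alg_cat C M\<^esub> f) = ar (forget_alg C M) g \<bullet>\<^bsub>C\<^esub> ar (forget_alg C M) f"
    for f g by (cases f; cases g) (simp add: alg_cat_def)
qed

text \<open>The free algebra on \<open>A\<close> is \<open>(T A, \<mu>)\<close>. An algebra morphism \<open>f\<close> from it to
  \<open>(B, k)\<close> satisfies \<open>f = f \<mu> T(\<eta>) = k T(f \<eta>)\<close>, so it is determined by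
  \<open>f \<eta>\<close>.\<close>

lemma forget_alg_generates:
  assumes M: "is_monad C M"
  shows "left_adjoint_generates (alg_cat C M) C (forget_alg C M) M"
proof -
  note m = monadD[OF M]
  note T = functorD[OF m(1)]
  interpret category C by (rule T)
  define F where "F = \<lparr>ob = (\<lambda>A. (ob (mfun M) A, mmult M A)),
    ar = (\<lambda>f. ((ob (mfun M) (Dom C f), mmult M (Dom C f)), ar (mfun M) f,
               (ob (mfun M) (Cod C f), mmult M (Cod C f))))\<rparr>"
  have Fob: "ob F A = (ob (mfun M) A, mmult M A)" for A by (simp add: F_def)
  have Far: "ar F f = (ob F A, ar (mfun M) f, ob F B)" if "arrow C f A B" for f A B
    using that by (auto simp: F_def arrow_def)
  define \<epsilon> where "\<epsilon> = (\<lambda>X :: 'a \<times> 'b. (ob F (fst X), snd X, X))"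
  have F: "ob F A \<in> Obj (alg_cat C M)" if "A \<in> Obj C" for A
    using that m(3,6,8) T(3) by (simp add: Fob alg_cat_obj)
  have "adjunction C (alg_cat C M) F (forget_alg C M) (munit M) \<epsilon>"
  proof (rule adjunction_of_universal_arrows)
    fix f A B assume f: "arrow C f A B"
    then show "arrow (alg_cat C M) (ar F f) (ob F A) (ob F B)"
      using F arrow_obj[OF f] T(5)[OF f] m(5)[OF f] by (simp add: Far Fob alg_cat_arrow)
    show "ar (forget_alg C M) (ar F f) \<bullet>\<^bsub>C\<^esub> munit M A = munit M B \<bullet>\<^bsub>C\<^esub> f"
      using m(4)[OF f] f by (simp add: Far)
  next
    fix A X g g' assume A: "A \<in> Obj C" and g: "arrow (alg_cat C M) g (ob F A) X"
      and g': "arrow (alg_cat C M) g' (ob F A) X"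
      and e: "ar (forget_alg C M) g \<bullet>\<^bsub>C\<^esub> munit M A = ar (forget_alg C M) g' \<bullet>\<^bsub>C\<^esub> munit M A"
    obtain B k where X: "X = (B, k)" by force
    have *: "fst (snd g) = k \<bullet>\<^bsub>C\<^esub> ar (mfun M) (ar (forget_alg C M) g \<bullet>\<^bsub>C\<^esub> munit M A)"
      if g: "arrow (alg_cat C M) g (ob F A) X" for g
    proof -
      obtain f where f: "g = (ob F A, f, X)" "arrow C f (ob (mfun M) A) B"
          "f \<bullet>\<^bsub>C\<^esub> mmult M A = k \<bullet>\<^bsub>C\<^esub> ar (mfun M) f" and X': "(B, k) \<in> Obj (alg_cat C M)"
        using g unfolding X Fob alg_cat_arrow by auto
      have k: "arrow C k (ob (mfun M) B) B" using X' by (simp add: alg_cat_obj)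
      have "k \<bullet>\<^bsub>C\<^esub> ar (mfun M) (f \<bullet>\<^bsub>C\<^esub> munit M A) = k \<bullet>\<^bsub>C\<^esub> (ar (mfun M) f \<bullet>\<^bsub>C\<^esub> ar (mfun M) (munit M A))"
        using T(6)[OF m(2)[OF A] f(2)] by simp
      also have "\<dots> = (f \<bullet>\<^bsub>C\<^esub> mmult M A) \<bullet>\<^bsub>C\<^esub> ar (mfun M) (munit M A)"
        by (simp add: comp_assoc[OF T(5)[OF m(2)[OF A]] T(5)[OF f(2)] k] f(3))
      also have "\<dots> = f \<bullet>\<^bsub>C\<^esub> (mmult M A \<bullet>\<^bsub>C\<^esub> ar (mfun M) (munit M A))"
        by (rule comp_assoc[OF T(5)[OF m(2)[OF A]] m(3)[OF A] f(2)])
      also have "\<dots> = f" using m(7)[OF A] comp_id(1)[OF f(2)] by simp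
      finally show ?thesis by (simp add: f(1))
    qed
    show "g = g'" using *[OF g] *[OF g'] e g g' by (auto simp: alg_cat_arrow X Fob)
  next
    fix X assume "X \<in> Obj (alg_cat C M)"
    then show "arrow (alg_cat C M) (\<epsilon> X) (ob F (ob (forget_alg C M) X)) X"
      using F by (cases X) (simp add: \<epsilon>_def Fob alg_cat_arrow alg_cat_obj)
    show "ar (forget_alg C M) (\<epsilon> X) \<bullet>\<^bsub>C\<^esub> munit M (ob (forget_alg C M) X) = Idn C (ob (forget_alg C M) X)"
      using \<open>X \<in> Obj (alg_cat C M)\<close> by (cases X) (simp add: \<epsilon>_def alg_cat_obj)
  qed (use T F m(2) functor_forget_alg[OF M] in \<open>auto simp: Fob\<close>)
  then show ?thesis
    by (rule left_adjoint_generatesI) (auto simp: Fob Far \<epsilon>_def)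
qed


section \<open>Isomorphisms of categories and duality\<close>

text \<open>Bijectivity on objects and full faithfulness give an inverse on objects and on arrows; that the inverse is
  functorial is then automatic.\<close>

lemma iso_catI:
  assumes F: "is_functor C D F"
    and inj: "\<And>A B. \<lbrakk>A \<in> Obj C; B \<in> Obj C; ob F A = ob F B\<rbrakk> \<Longrightarrow> A = B"
    and surj: "\<And>B. B \<in> Obj D \<Longrightarrow> \<exists>A\<in>Obj C. ob F A = B"
    and faithful: "\<And>f g A B. \<lbrakk>arrow C f A B; arrow C g A B; ar F f = ar F g\<rbrakk> \<Longrightarrow> f = g"
    and full: "\<And>g A B. \<lbrakk>A \<in> Obj C; B \<in> Obj C; arrow D g (ob F A) (ob F B)\<rbrakk> \<Longrightarrow> \<exists>f. arrow C f A B \<and> ar F f = g"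
  shows "is_iso_of_categories C D F"
proof -
  note F' = functorD[OF F]
  interpret C: category C by (rule F')
  interpret D: category D by (rule F')
  have inj_ar: "f = g" if f: "f \<in> Arr C" and g: "g \<in> Arr C" and e: "ar F f = ar F g" for f g
  proof -
    have af: "arrow C f (Dom C f) (Cod C f)" and ag: "arrow C g (Dom C g) (Cod C g)"
      using f g by (auto simp: arrow_def)
    have "ob F (Dom C f) = ob F (Dom C g)" "ob F (Cod C f) = ob F (Cod C g)"
      using F'(5)[OF af] F'(5)[OF ag] e by (auto simp: arrow_def)
    then have "Dom C f = Dom C g" "Cod C f = Cod C g"
      using inj C.arrow_obj[OF af] C.arrow_obj[OF ag] by auto
    with faithful[OF af _ e] ag show "f = g" by simp
  qed
  define G where "G = \<lparr>ob = inv_into (Obj C) (ob F), ar = inv_into (Arr C) (ar F)\<rparr>"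
  have Gob: "ob G (ob F A) = A" if "A \<in> Obj C" for A
    using that inj by (auto simp: G_def inj_on_def intro: inv_into_f_f)
  have Gar: "ar G (ar F f) = f" if "arrow C f A B" for f A B
    using that inj_ar by (auto simp: G_def inj_on_def arrow_def intro: inv_into_f_f)
  have obE: "\<exists>A\<in>Obj C. ob F A = B \<and> ob G B = A" if "B \<in> Obj D" for B
    using surj[OF that] Gob by auto
  have arE: "\<exists>f A B. arrow C f A B \<and> A' = ob F A \<and> B' = ob F B \<and> g = ar F f"
    if g: "arrow D g A' B'" for g A' B'
    using full g surj D.arrow_obj[OF g] by metis
  have G: "is_functor D C G"
  proof (rule functorI)
    show "ar G (Idn D A) = Idn C (ob G A)" if "A \<in> Obj D" for A
      using obE[OF that] F'(4) Gar[OF C.arrow_id] by metis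
    show "arrow C (ar G f) (ob G A) (ob G B)" if "arrow D f A B" for f A B
      using arE[OF that] Gar Gob C.arrow_obj by metis
    fix f g A B E assume f: "arrow D f A B" and g: "arrow D g B E"
    obtain f' A' B' where f': "arrow C f' A' B'" "B = ob F B'" "f = ar F f'" using arE[OF f] by auto
    obtain g' B'' E' where g': "arrow C g' B'' E'" "B = ob F B''" "g = ar F g'" using arE[OF g] by auto
    have "B'' = B'" using inj f' g' C.arrow_obj by metis
    with g' have g'': "arrow C g' B' E'" by simp
    show "ar G (g \<bullet>\<^bsub>D\<^esub> f) = ar G g \<bullet>\<^bsub>C\<^esub> ar G f"
      using F'(6)[OF f'(1) g''] Gar[OF f'(1)] Gar[OF g''] Gar[OF C.arrow_comp[OF f'(1) g'']] f'(3) g'(3)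
      by simp
  qed (use obE F' in auto)
  have "functor_eq C C (G \<circ>\<^sub>F F) idf"
    by (rule functor_eqI) (auto intro: functor_idf F' simp: Gob Gar)
  moreover have "functor_eq D D (F \<circ>\<^sub>F G) idf"
    by (rule functor_eqI) (use obE arE Gar in \<open>fastforce intro: functor_idf F'\<close>)+
  ultimately show ?thesis unfolding is_iso_of_categories_def using F G by blast
qed

lemma iso_catE:
  assumes "is_iso_of_categories C D F"
  obtains G where "is_functor C D F" "is_functor D C G" "\<And>A. A \<in> Obj C \<Longrightarrow> ob G (ob F A) = A"
    "\<And>f A B. arrow C f A B \<Longrightarrow> ar G (ar F f) = f" "\<And>A. A \<in> Obj D \<Longrightarrow> ob F (ob G A) = A"
    "\<And>f A B. arrow D f A B \<Longrightarrow> ar F (ar G f) = f"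
  using assms functor_eqD[of C C] functor_eqD[of D D] unfolding is_iso_of_categories_def
  by (metis fcomp_simps idf_simps)

lemma iso_catD:
  assumes "is_iso_of_categories C D F"
  shows "is_functor C D F"
    and "\<lbrakk>A \<in> Obj C; B \<in> Obj C; ob F A = ob F B\<rbrakk> \<Longrightarrow> A = B"
    and "Y \<in> Obj D \<Longrightarrow> \<exists>X\<in>Obj C. Y = ob F X"
    and "\<lbrakk>arrow C f A B; arrow C g A B; ar F f = ar F g\<rbrakk> \<Longrightarrow> f = g"
    and "\<lbrakk>A \<in> Obj C; B \<in> Obj C; arrow D h (ob F A) (ob F B)\<rbrakk> \<Longrightarrow> \<exists>f. arrow C f A B \<and> h = ar F f"
  by (rule iso_catE[OF assms], metis functorD(3,5))+

lemma iso_comp: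
  assumes F: "is_iso_of_categories C D F" and G: "is_iso_of_categories D E G"
  shows "is_iso_of_categories C E (G \<circ>\<^sub>F F)"
proof -
  note f = iso_catD[OF F] and g = iso_catD[OF G]
  note f' = functorD[OF f(1)]
  show ?thesis
  proof (rule iso_catI)
    show "is_functor C E (G \<circ>\<^sub>F F)" by (rule functor_fcomp[OF f(1) g(1)])
    show "A = B" if "A \<in> Obj C" "B \<in> Obj C" "ob (G \<circ>\<^sub>F F) A = ob (G \<circ>\<^sub>F F) B" for A B
      using that f(2) g(2) f'(3) by simp
    show "\<exists>A\<in>Obj C. ob (G \<circ>\<^sub>F F) A = B" if "B \<in> Obj E" for B
      using f(3) g(3)[OF that] by auto
    show "h = k" if "arrow C h A B" "arrow C k A B" "ar (G \<circ>\<^sub>F F) h = ar (G \<circ>\<^sub>F F) k" for h k A B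
      using f(4)[OF that(1,2)] g(4)[OF f'(5)[OF that(1)] f'(5)[OF that(2)]] that(3) by simp
    show "\<exists>h. arrow C h A B \<and> ar (G \<circ>\<^sub>F F) h = k"
      if "A \<in> Obj C" "B \<in> Obj C" "arrow E k (ob (G \<circ>\<^sub>F F) A) (ob (G \<circ>\<^sub>F F) B)" for k A B
      using f(5)[OF that(1,2)] g(5)[OF f'(3)[OF that(1)] f'(3)[OF that(2)]] that(3) by fastforce
  qed
qed

lemma iso_functor_eq:
  assumes "is_iso_of_categories C D G" "\<And>A. A \<in> Obj C \<Longrightarrow> ob F A = ob G A"
    "\<And>f A B. arrow C f A B \<Longrightarrow> ar F f = ar G f"
  shows "is_iso_of_categories C D F"
proof -
  note g = iso_catD[OF assms(1)]
  show ?thesis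
  proof (rule iso_catI)
    show "is_functor C D F" by (rule functor_cong[OF g(1) assms(2,3)])
    show "\<exists>A\<in>Obj C. ob F A = B" if "B \<in> Obj D" for B using g(3)[OF that] assms(2) by auto
    show "\<exists>f. arrow C f A B \<and> ar F f = h" if "A \<in> Obj C" "B \<in> Obj C" "arrow D h (ob F A) (ob F B)" for h A B
      using g(5)[OF that(1,2), of h] that assms(2,3) by auto
  qed (use g(2,4) assms(2,3) in auto)
qed

text \<open>This gives functoriality of a map \<open>\<Phi>\<close> from the knowledge of its composite with an isomorphism: on
  the codomain of \<open>E\<close>, \<open>\<Phi>\<close> agrees with \<open>L \<circ> E\<^sup>-\<^sup>1\<close>.\<close>

lemma functor_of_iso_factor:
  assumes E: "is_iso_of_categories C D E" and L: "is_functor C B L"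
    and ob: "\<And>A. A \<in> Obj C \<Longrightarrow> ob \<Phi> (ob E A) = ob L A"
    and ar: "\<And>f X Y. arrow C f X Y \<Longrightarrow> ar \<Phi> (ar E f) = ar L f"
  shows "is_functor D B \<Phi>"
proof -
  obtain G where G: "is_functor D C G" and ob': "\<And>A. A \<in> Obj D \<Longrightarrow> ob E (ob G A) = A"
    and ar': "\<And>f A B. arrow D f A B \<Longrightarrow> ar E (ar G f) = f"
    using iso_catE[OF E] by metis
  note G' = functorD[OF G]
  have "is_functor D B (L \<circ>\<^sub>F G)" by (rule functor_fcomp[OF G L])
  then show ?thesis
  proof (rule functor_cong)
    show "ob \<Phi> A = ob (L \<circ>\<^sub>F G) A" if "A \<in> Obj D" for A
      using ob[OF G'(3)[OF that]] ob'[OF that] by simp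
    show "ar \<Phi> f = ar (L \<circ>\<^sub>F G) f" if "arrow D f A B" for f A B
      using ar[OF G'(5)[OF that]] ar'[OF that] by simp
  qed
qed

text \<open>With \<open>H\<close> inverse to \<open>J\<close>, the left adjoint is \<open>H F\<close> and the counit at
  \<open>X\<close> is \<open>H(\<epsilon> (J X))\<close>; the monad on \<open>C\<close> stays the same.\<close>

lemma left_adjoint_generates_iso:
  assumes J: "is_iso_of_categories D E J" and L: "left_adjoint_generates E C G M"
    and ob: "\<And>X. X \<in> Obj D \<Longrightarrow> ob G' X = ob G (ob J X)"
    and ar: "\<And>f X Y. arrow D f X Y \<Longrightarrow> ar G' f = ar G (ar J f)"
  shows "left_adjoint_generates D C G' M"
proof -
  obtain F \<eta> \<epsilon> where adj: "adjunction C E F G \<eta> \<epsilon>" and fe: "functor_eq C C (mfun M) (G \<circ>\<^sub>F F)"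
    and um: "\<And>A. A \<in> Obj C \<Longrightarrow> munit M A = \<eta> A \<and> mmult M A = ar G (\<epsilon> (ob F A))"
    using L unfolding left_adjoint_generates_def by blast
  have F: "is_functor C E F" and G: "is_functor E C G"
    and eta: "nat_trans C C idf (G \<circ>\<^sub>F F) \<eta>" and eps: "nat_trans E E (F \<circ>\<^sub>F G) idf \<epsilon>"
    and t1: "\<And>A. A \<in> Obj C \<Longrightarrow> \<epsilon> (ob F A) \<bullet>\<^bsub>E\<^esub> ar F (\<eta> A) = Idn E (ob F A)"
    and t2: "\<And>X. X \<in> Obj E \<Longrightarrow> ar G (\<epsilon> X) \<bullet>\<^bsub>C\<^esub> \<eta> (ob G X) = Idn C (ob G X)"
    using adj unfolding adjunction_def by auto
  obtain H where j: "is_functor D E J" and H: "is_functor E D H" and HJ: "\<And>A. A \<in> Obj D \<Longrightarrow> ob H (ob J A) = A"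
    "\<And>f A B. arrow D f A B \<Longrightarrow> ar H (ar J f) = f" and JH: "\<And>A. A \<in> Obj E \<Longrightarrow> ob J (ob H A) = A"
    "\<And>f A B. arrow E f A B \<Longrightarrow> ar J (ar H f) = f"
    using iso_catE[OF J] by metis
  note F' = functorD[OF F] and G'' = functorD[OF G] and H' = functorD[OF H] and J' = functorD[OF j]
  note eta' = nat_transD[OF eta] and eps' = nat_transD[OF eps] and fe' = functor_eqD[OF fe]
  interpret C: category C by (rule F')
  have G'f: "is_functor D C G'"
    by (rule functor_cong[OF functor_fcomp[OF j G]]) (simp_all add: ob ar)
  have G'H: "ob G' (ob H X) = ob G X" if "X \<in> Obj E" for X
    using ob[OF H'(3)[OF that]] JH that by simp
  have G'H': "ar G' (ar H f) = ar G f" if "arrow E f X Y" for f X Y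
    using ar[OF H'(5)[OF that]] JH(2)[OF that] by simp
  define \<epsilon>' where "\<epsilon>' = (\<lambda>X. ar H (\<epsilon> (ob J X)))"
  have "adjunction C D (H \<circ>\<^sub>F F) G' \<eta> \<epsilon>'"
  proof (unfold adjunction_def, intro conjI ballI)
    show HF: "is_functor C D (H \<circ>\<^sub>F F)" by (rule functor_fcomp[OF F H])
    show "is_functor D C G'" by (rule G'f)
    show "nat_trans C C idf (G' \<circ>\<^sub>F (H \<circ>\<^sub>F F)) \<eta>"
      by (rule nat_trans_cong[OF eta])
        (auto intro!: functor_eqI functor_idf F' functor_fcomp[OF F G] simp: G'H F'(3) G'H'[OF F'(5)])
    show "nat_trans D D (H \<circ>\<^sub>F F \<circ>\<^sub>F G') idf \<epsilon>'"
    proof (rule nat_transI)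
      show "is_functor D D (H \<circ>\<^sub>F F \<circ>\<^sub>F G')" by (rule functor_fcomp[OF G'f HF])
      show "is_functor D D idf" by (rule functor_idf[OF J'(1)])
      show "arrow D (\<epsilon>' X) (ob (H \<circ>\<^sub>F F \<circ>\<^sub>F G') X) (ob idf X)" if "X \<in> Obj D" for X
        using H'(5)[OF eps'(3)[OF J'(3)[OF that]]] HJ that ob by (simp add: \<epsilon>'_def)
      fix f X Y assume f: "arrow D f X Y"
      interpret D: category D by (rule J')
      have X: "X \<in> Obj D" and Y: "Y \<in> Obj D" using D.arrow_obj[OF f] by auto
      note Jf = J'(5)[OF f]
      show "ar idf f \<bullet>\<^bsub>D\<^esub> \<epsilon>' X = \<epsilon>' Y \<bullet>\<^bsub>D\<^esub> ar (H \<circ>\<^sub>F F \<circ>\<^sub>F G') f"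
        using eps'(4)[OF Jf] H'(6)[OF eps'(3)[OF J'(3)[OF X], simplified] Jf]
          H'(6)[OF F'(5)[OF G''(5)[OF Jf]] eps'(3)[OF J'(3)[OF Y], simplified]] HJ(2)[OF f] ar[OF f]
        by (simp add: \<epsilon>'_def)
    qed
    show "\<epsilon>' (ob (H \<circ>\<^sub>F F) A) \<bullet>\<^bsub>D\<^esub> ar (H \<circ>\<^sub>F F) (\<eta> A) = Idn D (ob (H \<circ>\<^sub>F F) A)" if A: "A \<in> Obj C" for A
      using t1[OF A] JH(1)[OF F'(3)[OF A]] H'(4)[OF F'(3)[OF A]]
        H'(6)[OF F'(5)[OF eta'(3)[OF A], simplified] eps'(3)[OF F'(3)[OF A], simplified]]
      by (simp add: \<epsilon>'_def)
    show "ar G' (\<epsilon>' X) \<bullet>\<^bsub>C\<^esub> \<eta> (ob G' X) = Idn C (ob G' X)" if X: "X \<in> Obj D" for X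
      using t2[OF J'(3)[OF X]] G'H'[OF eps'(3)[OF J'(3)[OF X]]] ob[OF X] by (simp add: \<epsilon>'_def)
  qed
  moreover have "functor_eq C C (mfun M) (G' \<circ>\<^sub>F (H \<circ>\<^sub>F F))"
    by (rule functor_eqI)
      (auto intro: functor_fcomp[OF functor_fcomp[OF F H] G'f] simp: fe'(3,4) G'H F'(3) G'H'[OF F'(5)])
  moreover have "munit M A = \<eta> A \<and> mmult M A = ar G' (\<epsilon>' (ob (H \<circ>\<^sub>F F) A))" if A: "A \<in> Obj C" for A
    using um[OF A] JH(1)[OF F'(3)[OF A]] G'H'[OF eps'(3)[OF F'(3)[OF A]]] by (simp add: \<epsilon>'_def)
  ultimately show ?thesis unfolding left_adjoint_generates_def by blast
qed

text \<open>Right adjoints, comonads and coalgebras are treated as left adjoints, monads and algebras in the opposite category.\<close>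

definition op :: "('o, 'm) cat \<Rightarrow> ('o, 'm) cat" where
  "op C = \<lparr>Obj = Obj C, Arr = Arr C, Dom = Cod C, Cod = Dom C, Idn = Idn C, Cmp = (\<lambda>g f. f \<bullet>\<^bsub>C\<^esub> g)\<rparr>"

lemma op_simps [simp]: "Obj (op C) = Obj C" "Idn (op C) = Idn C" "g \<bullet>\<^bsub>op C\<^esub> f = f \<bullet>\<^bsub>C\<^esub> g"
  "arrow (op C) f A B = arrow C f B A"
  by (auto simp: op_def arrow_def)

lemma op_op [simp]: "op (op C) = C"
  by (simp add: op_def)

lemma category_op_iff: "category (op C) \<longleftrightarrow> category C"
proof -
  have "category (op C)" if "category C" for C :: "('o, 'm) cat"
  proof -
    interpret category C by (rule that)
    show ?thesis
      by (rule categoryI) (auto simp: comp_assoc comp_id arrow_id arrow_obj intro: arrow_comp)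
  qed
  from this[of C] this[of "op C"] show ?thesis by auto
qed

lemma functor_op_iff: "is_functor (op C) (op D) F \<longleftrightarrow> is_functor C D F"
proof -
  have "is_functor (op C) (op D) F" if "is_functor C D F" for C :: "('a, 'b) cat" and D :: "('c, 'd) cat"
    by (rule functorI) (use functorD[OF that] in \<open>auto simp: category_op_iff\<close>)
  from this[of C D] this[of "op C" "op D"] show ?thesis by auto
qed

lemma functor_eq_op_iff: "functor_eq (op C) (op D) F G \<longleftrightarrow> functor_eq C D F G"
  by (auto simp: functor_eq_def functor_op_iff) (auto simp: op_def)

lemma nat_trans_op_iff: "nat_trans (op C) (op D) F G \<tau> \<longleftrightarrow> nat_trans C D G F \<tau>"
  by (auto simp: nat_trans_def functor_op_iff) (auto simp: op_def)

lemma adjunction_op_iff: "adjunction (op D) (op C) G F \<epsilon> \<eta> \<longleftrightarrow> adjunction C D F G \<eta> \<epsilon>"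
  by (auto simp: adjunction_def functor_op_iff nat_trans_op_iff)

lemma iso_op_iff: "is_iso_of_categories (op C) (op D) F \<longleftrightarrow> is_iso_of_categories C D F"
  by (simp add: is_iso_of_categories_def functor_op_iff functor_eq_op_iff)

definition dual_monad :: "('o, 'm) comonad \<Rightarrow> ('o, 'm) monad" where
  "dual_monad W = \<lparr>mfun = wfun W, munit = wcounit W, mmult = wcomult W\<rparr>"

lemma dual_monad_simps [simp]: "mfun (dual_monad W) = wfun W" "munit (dual_monad W) = wcounit W"
  "mmult (dual_monad W) = wcomult W"
  by (simp_all add: dual_monad_def)

lemma right_adjoint_generates_op:
  "right_adjoint_generates D C V W \<longleftrightarrow> left_adjoint_generates (op D) (op C) V (dual_monad W)"
  unfolding right_adjoint_generates_def left_adjoint_generates_def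
  by (auto simp: adjunction_op_iff functor_eq_op_iff)

definition is_comonad :: "('o, 'm) cat \<Rightarrow> ('o, 'm) comonad \<Rightarrow> bool" where
  "is_comonad C W \<longleftrightarrow> is_monad (op C) (dual_monad W)"

lemma comonad_of_adjunction: "right_adjoint_generates D C V W \<Longrightarrow> is_comonad C W"
  unfolding right_adjoint_generates_op is_comonad_def by (rule monad_of_adjunction)

text \<open>An arrow of a category of (co)algebras records its source and its target, so the coalgebras in \<open>C\<close> and
  the algebras in the opposite of \<open>C\<close> have the same arrows only after exchange of these two entries.\<close>

definition flip :: "(('o, 'm) struct_obj, ('o, 'm) struct_arr, ('o, 'm) struct_obj, ('o, 'm) struct_arr) fnctr"
  where "flip = \<lparr>ob = (\<lambda>x. x), ar = (\<lambda>(x, f, y). (y, f, x))\<rparr>"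

lemma flip_simps [simp]: "ob flip x = x" "ar flip (x, f, y) = (y, f, x)"
  by (simp_all add: flip_def)

lemma coalg_cat_obj:
  "(A, h) \<in> Obj (coalg_cat C W) \<longleftrightarrow> A \<in> Obj C \<and> arrow C h A (ob (wfun W) A) \<and>
     wcounit W A \<bullet>\<^bsub>C\<^esub> h = Idn C A \<and> ar (wfun W) h \<bullet>\<^bsub>C\<^esub> h = wcomult W A \<bullet>\<^bsub>C\<^esub> h"
  by (auto simp: coalg_cat_def arrow_def)

lemma coalg_cat_arrow:
  "arrow (coalg_cat C W) g (A, h) (B, k) \<longleftrightarrow> (\<exists>f. g = ((A, h), f, (B, k)) \<and> arrow C f A B \<and>
     (A, h) \<in> Obj (coalg_cat C W) \<and> (B, k) \<in> Obj (coalg_cat C W) \<and> k \<bullet>\<^bsub>C\<^esub> f = ar (wfun W) f \<bullet>\<^bsub>C\<^esub> h)"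
  by (auto simp: coalg_cat_def arrow_struct_cat)

lemma coalg_alg_op_obj: "Obj (coalg_cat C W) = Obj (alg_cat (op C) (dual_monad W))"
  by (auto simp: coalg_cat_obj alg_cat_obj)

lemma flip_iso:
  assumes "is_comonad C W"
  shows "is_iso_of_categories (op (coalg_cat C W)) (alg_cat (op C) (dual_monad W)) flip"
    (is "is_iso_of_categories ?D ?E _")
proof (rule iso_catI)
  have arr: "arrow ?E g x y \<longleftrightarrow> (\<exists>f. g = (x, f, y) \<and> arrow ?D (y, f, x) x y)" for g x y
    by (cases x; cases y) (auto simp: alg_cat_arrow coalg_cat_arrow coalg_alg_op_obj)
  have arr': "arrow ?D g x y \<longleftrightarrow> (\<exists>f. g = (y, f, x) \<and> arrow ?E (x, f, y) x y)" for g x y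
    by (cases x; cases y) (auto simp: alg_cat_arrow coalg_cat_arrow coalg_alg_op_obj)
  have idn: "Idn ?E x = (x, Idn C (fst x), x)" "Idn (coalg_cat C W) x = (x, Idn C (fst x), x)" for x
    by (simp_all add: alg_cat_def coalg_cat_def)
  have E: "category ?E" by (rule category_alg_cat[OF assms[unfolded is_comonad_def]])
  interpret E: category ?E by (rule E)
  have fl: "is_functor ?E ?D flip"
  proof (rule functorI)
    show D: "category ?D"
    proof (rule categoryI)
      fix f A B assume f: "arrow ?D f A B"
      obtain u where u: "f = (B, u, A)" "arrow ?E (A, u, B) A B" using f arr' by auto
      show "A \<in> Obj ?D \<and> B \<in> Obj ?D" using E.arrow_obj[OF u(2)] by (simp add: coalg_alg_op_obj)
      show "f \<bullet>\<^bsub>?D\<^esub> Idn ?D A = f \<and> Idn ?D B \<bullet>\<^bsub>?D\<^esub> f = f"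
        using E.comp_id[OF u(2)] u(1) by (simp add: alg_cat_def coalg_cat_def)
      fix g E assume g: "arrow ?D g B E"
      obtain v where v: "g = (E, v, B)" "arrow ?E (B, v, E) B E" using g arr' by auto
      show "arrow ?D (g \<bullet>\<^bsub>?D\<^esub> f) A E"
        using E.arrow_comp[OF u(2) v(2)] u(1) v(1) arr by (simp add: alg_cat_def coalg_cat_def)
      fix h H assume h: "arrow ?D h E H"
      obtain w where w: "h = (H, w, E)" "arrow ?E (E, w, H) E H" using h arr' by auto
      show "(h \<bullet>\<^bsub>?D\<^esub> g) \<bullet>\<^bsub>?D\<^esub> f = h \<bullet>\<^bsub>?D\<^esub> (g \<bullet>\<^bsub>?D\<^esub> f)"
        using E.comp_assoc[OF u(2) v(2) w(2)] u(1) v(1) w(1) by (simp add: alg_cat_def coalg_cat_def)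
    next
      fix A assume "A \<in> Obj ?D"
      then show "arrow ?D (Idn ?D A) A A"
        using E.arrow_id[of A] arr by (simp add: coalg_alg_op_obj) (simp add: alg_cat_def coalg_cat_def)
    qed
    fix f A B assume f: "arrow ?E f A B"
    show "arrow ?D (ar flip f) (ob flip A) (ob flip B)" using f arr by auto
    fix g E assume g: "arrow ?E g B E"
    show "ar flip (g \<bullet>\<^bsub>?E\<^esub> f) = ar flip g \<bullet>\<^bsub>?D\<^esub> ar flip f"
      using f g arr by (auto simp: alg_cat_def coalg_cat_def)
  qed (auto simp: coalg_alg_op_obj E idn)
  then have D: "category ?D" by (rule functorD)
  show "is_functor ?D ?E flip"
  proof (rule functorI)
    fix f A B assume f: "arrow ?D f A B"
    show "arrow ?E (ar flip f) (ob flip A) (ob flip B)" using f arr' by auto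
    fix g E assume g: "arrow ?D g B E"
    show "ar flip (g \<bullet>\<^bsub>?D\<^esub> f) = ar flip g \<bullet>\<^bsub>?E\<^esub> ar flip f"
      using f g arr' by (auto simp: alg_cat_def coalg_cat_def)
  qed (auto simp: coalg_alg_op_obj E D idn)
  show "\<exists>f. arrow ?D f A B \<and> ar flip f = g" if "arrow ?E g (ob flip A) (ob flip B)" for g A B
    using that arr by (cases A; cases B) auto
  show "f = g" if "arrow ?D f A B" "arrow ?D g A B" "ar flip f = ar flip g" for f g A B
    using that arr' by auto
qed (auto simp: coalg_alg_op_obj)

lemma forget_coalg_generates:
  assumes W: "is_comonad C W"
  shows "right_adjoint_generates (coalg_cat C W) C (forget_coalg C W) W"
  unfolding right_adjoint_generates_op
proof (rule left_adjoint_generates_iso[OF flip_iso[OF W] forget_alg_generates[OF W[unfolded is_comonad_def]]])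
  fix f X Y assume "arrow (op (coalg_cat C W)) f X Y"
  then show "ar (forget_coalg C W) f = ar (forget_alg (op C) (dual_monad W)) (ar flip f)"
    by (cases X; cases Y) (auto simp: coalg_cat_arrow)
qed simp


section \<open>Transport of monads and comonads along isomorphisms\<close>

lemma lift_functor_simps [simp]: "ob (lift_functor F) (A, h) = (ob F A, ar F h)"
  "ar (lift_functor F) ((A, h), f, (B, k)) = ((ob F A, ar F h), ar F f, (ob F B, ar F k))"
  by (simp_all add: lift_functor_def)

text \<open>Every object and every arrow of \<open>D\<close> is the image of a unique one of \<open>C\<close>, so each law for
  \<open>M'\<close>, and each equation that defines algebras and their morphisms, is the image under \<open>F\<close>
  of the same equation for \<open>M\<close>.\<close>

lemma monad_transport:
  assumes F: "is_iso_of_categories C D F" and M: "is_monad C M"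
    and tob: "\<And>A. A \<in> Obj C \<Longrightarrow> ob (mfun M') (ob F A) = ob F (ob (mfun M) A)"
    and tar: "\<And>f A B. arrow C f A B \<Longrightarrow> ar (mfun M') (ar F f) = ar F (ar (mfun M) f)"
    and un: "\<And>A. A \<in> Obj C \<Longrightarrow> munit M' (ob F A) = ar F (munit M A)"
    and mu: "\<And>A. A \<in> Obj C \<Longrightarrow> mmult M' (ob F A) = ar F (mmult M A)"
  shows "is_monad D M'" and "is_iso_of_categories (alg_cat C M) (alg_cat D M') (lift_functor F)"
proof -
  note i = iso_catD[OF F] and m = monadD[OF M]
  note F' = functorD[OF i(1)] and T = functorD[OF m(1)]
  interpret C: category C by (rule T)
  interpret D: category D by (rule F')
  note Fcomp = F'(6)[symmetric]
  have obE: "\<exists>A. A \<in> Obj C \<and> B = ob F A" if "B \<in> Obj D" for B using i(3)[OF that] by auto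
  have arE: "\<exists>f A B. arrow C f A B \<and> A' = ob F A \<and> B' = ob F B \<and> g = ar F f"
    if g: "arrow D g A' B'" for g A' B'
    using i(5) g obE[OF D.arrow_obj(1)[OF g]] obE[OF D.arrow_obj(2)[OF g]] by blast
  have T': "is_functor D D (mfun M')"
    by (rule functor_of_iso_factor[OF F functor_fcomp[OF m(1) i(1)]]) (simp_all add: tob tar)
  show M': "is_monad D M'"
    unfolding is_monad_def
  proof (intro conjI ballI)
    show "nat_trans D D idf (mfun M') (munit M')"
    proof (rule nat_transI)
      show "arrow D (munit M' A) (ob idf A) (ob (mfun M') A)" if "A \<in> Obj D" for A
        using obE[OF that] F'(5)[OF m(2)] by (auto simp: un tob)
      show "ar (mfun M') f \<bullet>\<^bsub>D\<^esub> munit M' A = munit M' B \<bullet>\<^bsub>D\<^esub> ar idf f" if af: "arrow D f A B" for f A B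
      proof -
        obtain f' A' B' where f: "arrow C f' A' B'" "A = ob F A'" "B = ob F B'" "f = ar F f'" 
          using arE[OF af] by blast
        note o = C.arrow_obj[OF f(1)]
        show ?thesis using m(4)[OF f(1)] Fcomp[OF m(2)[OF o(1)] T(5)[OF f(1)]] Fcomp[OF f(1) m(2)[OF o(2)]]
          by (simp add: f un o tar[OF f(1)])
      qed
    qed (auto intro: functor_idf F' T')
    show "nat_trans D D (mfun M' \<circ>\<^sub>F mfun M') (mfun M') (mmult M')"
    proof (rule nat_transI)
      show "arrow D (mmult M' A) (ob (mfun M' \<circ>\<^sub>F mfun M') A) (ob (mfun M') A)" if "A \<in> Obj D" for A
        using obE[OF that] F'(5)[OF m(3)] T(3) by (auto simp: mu tob)
      show "ar (mfun M') f \<bullet>\<^bsub>D\<^esub> mmult M' A = mmult M' B \<bullet>\<^bsub>D\<^esub> ar (mfun M' \<circ>\<^sub>F mfun M') f"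
        if af: "arrow D f A B" for f A B
      proof -
        obtain f' A' B' where f: "arrow C f' A' B'" "A = ob F A'" "B = ob F B'" "f = ar F f'" 
          using arE[OF af] by blast
        note o = C.arrow_obj[OF f(1)]
        show ?thesis using m(5)[OF f(1)] Fcomp[OF m(3)[OF o(1)] T(5)[OF f(1)]]
            Fcomp[OF T(5)[OF T(5)[OF f(1)]] m(3)[OF o(2)]]
          by (simp add: f mu o tar[OF f(1)] tar[OF T(5)[OF f(1)]])
      qed
    qed (auto intro: functor_fcomp T')
    fix B assume "B \<in> Obj D"
    then obtain A where A: "A \<in> Obj C" and B: "B = ob F A" using obE by auto
    note TA = T(3)[OF A]
    show "mmult M' B \<bullet>\<^bsub>D\<^esub> munit M' (ob (mfun M') B) = Idn D (ob (mfun M') B)"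
      using m(6)[OF A] Fcomp[OF m(2)[OF TA] m(3)[OF A]] F'(4)[OF TA] by (simp add: B mu un tob A TA)
    show "mmult M' B \<bullet>\<^bsub>D\<^esub> ar (mfun M') (munit M' B) = Idn D (ob (mfun M') B)"
      using m(7)[OF A] Fcomp[OF T(5)[OF m(2)[OF A]] m(3)[OF A]] F'(4)[OF TA]
      by (simp add: B mu un tob A TA tar[OF m(2)[OF A]])
    show "mmult M' B \<bullet>\<^bsub>D\<^esub> ar (mfun M') (mmult M' B) = mmult M' B \<bullet>\<^bsub>D\<^esub> mmult M' (ob (mfun M') B)"
      using m(8)[OF A] Fcomp[OF T(5)[OF m(3)[OF A]] m(3)[OF A]] Fcomp[OF m(3)[OF TA] m(3)[OF A]]
      by (simp add: B mu un tob A TA tar[OF m(3)[OF A]])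
  qed
  have obj: "(ob F A, ar F h) \<in> Obj (alg_cat D M') \<longleftrightarrow> (A, h) \<in> Obj (alg_cat C M)"
    if A: "A \<in> Obj C" and h: "arrow C h (ob (mfun M) A) A" for A h
  proof -
    note TA = T(3)[OF A] note TTA = T(3)[OF TA]
    have "ar F h \<bullet>\<^bsub>D\<^esub> munit M' (ob F A) = Idn D (ob F A) \<longleftrightarrow> h \<bullet>\<^bsub>C\<^esub> munit M A = Idn C A"
      using i(4)[OF C.arrow_comp[OF m(2)[OF A] h] C.arrow_id[OF A]] F'(6)[OF m(2)[OF A] h] F'(4)[OF A]
      by (auto simp: un A)
    moreover have "ar F h \<bullet>\<^bsub>D\<^esub> ar (mfun M') (ar F h) = ar F h \<bullet>\<^bsub>D\<^esub> mmult M' (ob F A) \<longleftrightarrow>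
        h \<bullet>\<^bsub>C\<^esub> ar (mfun M) h = h \<bullet>\<^bsub>C\<^esub> mmult M A"
      using i(4)[OF C.arrow_comp[OF T(5)[OF h] h] C.arrow_comp[OF m(3)[OF A] h]]
        F'(6)[OF T(5)[OF h] h] F'(6)[OF m(3)[OF A] h] by (auto simp: mu A tar[OF h])
    ultimately show ?thesis using F'(5)[OF h] A h F'(3) by (auto simp: alg_cat_obj tob)
  qed
  have mors: "ar F f \<bullet>\<^bsub>D\<^esub> ar F h = ar F k \<bullet>\<^bsub>D\<^esub> ar (mfun M') (ar F f) \<longleftrightarrow> f \<bullet>\<^bsub>C\<^esub> h = k \<bullet>\<^bsub>C\<^esub> ar (mfun M) f"
    if h: "arrow C h (ob (mfun M) A) A" and k: "arrow C k (ob (mfun M) B) B" and f: "arrow C f A B" for A h B k f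
    using i(4)[OF C.arrow_comp[OF h f] C.arrow_comp[OF T(5)[OF f] k]] F'(6)[OF h f] F'(6)[OF T(5)[OF f] k]
    by (auto simp: tar[OF f])
  have objD: "A \<in> Obj C" "arrow C h (ob (mfun M) A) A" if "(A, h) \<in> Obj (alg_cat C M)" for A h
    using that by (auto simp: alg_cat_obj)
  have arr: "arrow (alg_cat D M') g (ob F A, ar F h) (ob F B, ar F k) \<longleftrightarrow>
      (\<exists>f. arrow (alg_cat C M) ((A, h), f, (B, k)) (A, h) (B, k) \<and> g = ((ob F A, ar F h), ar F f, (ob F B, ar F k)))"
    if Ah: "(A, h) \<in> Obj (alg_cat C M)" and Bk: "(B, k) \<in> Obj (alg_cat C M)" for A h B k g
  proof -
    note a = objD[OF Ah] and b = objD[OF Bk]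
    \<comment> \<open>Arrows between images are the images of arrows.\<close>
    have x: "(\<exists>g. P g \<and> arrow D g (ob F A) (ob F B)) \<longleftrightarrow> (\<exists>f. P (ar F f) \<and> arrow C f A B)" for P
      using i(5)[OF a(1) b(1)] F'(5) by metis
    have "arrow (alg_cat D M') g (ob F A, ar F h) (ob F B, ar F k) \<longleftrightarrow>
       (\<exists>f. (g = ((ob F A, ar F h), f, (ob F B, ar F k)) \<and> f \<bullet>\<^bsub>D\<^esub> ar F h = ar F k \<bullet>\<^bsub>D\<^esub> ar (mfun M') f)
          \<and> arrow D f (ob F A) (ob F B))"
      using Ah Bk by (auto simp: alg_cat_arrow obj a b)
    also have "\<dots> \<longleftrightarrow> (\<exists>f. (g = ((ob F A, ar F h), ar F f, (ob F B, ar F k)) \<and>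
        ar F f \<bullet>\<^bsub>D\<^esub> ar F h = ar F k \<bullet>\<^bsub>D\<^esub> ar (mfun M') (ar F f)) \<and> arrow C f A B)" by (rule x)
    also have "\<dots> \<longleftrightarrow> (\<exists>f. arrow (alg_cat C M) ((A, h), f, (B, k)) (A, h) (B, k) \<and>
        g = ((ob F A, ar F h), ar F f, (ob F B, ar F k)))"
      using mors[OF a(2) b(2)] Ah Bk by (auto simp: alg_cat_arrow)
    finally show ?thesis .
  qed
  have arr2: "arrow (alg_cat C M) g (A, h) (B, k) \<longleftrightarrow> (\<exists>f. g = ((A, h), f, (B, k)) \<and>
      arrow C f A B \<and> arrow (alg_cat C M) ((A, h), f, (B, k)) (A, h) (B, k) \<and>
      (A, h) \<in> Obj (alg_cat C M) \<and> (B, k) \<in> Obj (alg_cat C M))" for g A h B k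
    by (auto simp: alg_cat_arrow)
  show "is_iso_of_categories (alg_cat C M) (alg_cat D M') (lift_functor F)"
  proof (rule iso_catI)
    show "is_functor (alg_cat C M) (alg_cat D M') (lift_functor F)"
    proof (rule functorI)
      show "category (alg_cat C M)" "category (alg_cat D M')" using category_alg_cat M M' by auto
      fix X assume X: "X \<in> Obj (alg_cat C M)"
      then obtain A h where "X = (A, h)" "A \<in> Obj C" "arrow C h (ob (mfun M) A) A"
        by (cases X) (auto simp: alg_cat_obj)
      then show "ob (lift_functor F) X \<in> Obj (alg_cat D M')"
        and "ar (lift_functor F) (Idn (alg_cat C M) X) = Idn (alg_cat D M') (ob (lift_functor F) X)"
        using X obj by (simp_all, simp add: alg_cat_def F'(4))
    next
      fix f X Y assume f: "arrow (alg_cat C M) f X Y"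
      obtain A h B k where X: "X = (A, h)" and Y: "Y = (B, k)" by (metis surj_pair)
      show "arrow (alg_cat D M') (ar (lift_functor F) f) (ob (lift_functor F) X) (ob (lift_functor F) Y)"
        using f arr2[of f A h B k] arr[of A h B k] by (auto simp: X Y)
      fix g Z assume g: "arrow (alg_cat C M) g Y Z"
      obtain E l where Z: "Z = (E, l)" by (metis surj_pair)
      obtain u where u: "f = ((A, h), u, (B, k))" "arrow C u A B"
        using f unfolding X Y arr2[of f] by auto
      obtain v where v: "g = ((B, k), v, (E, l))" "arrow C v B E"
        using g unfolding Z Y arr2[of g] by auto
      show "ar (lift_functor F) (g \<bullet>\<^bsub>alg_cat C M\<^esub> f) = ar (lift_functor F) g \<bullet>\<^bsub>alg_cat D M'\<^esub> ar (lift_functor F) f"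
        using u v F'(6)[OF u(2) v(2)] by (simp add: alg_cat_def)
    qed
  next
    fix X Y assume X: "X \<in> Obj (alg_cat C M)" and Y: "Y \<in> Obj (alg_cat C M)"
      and e: "ob (lift_functor F) X = ob (lift_functor F) Y"
    obtain A h B k where [simp]: "X = (A, h)" "Y = (B, k)" by (metis surj_pair)
    have "A = B" using i(2) objD X Y e by auto
    then show "X = Y" using i(4)[of h "ob (mfun M) A" A k] objD X Y e by auto
  next
    fix X assume X: "X \<in> Obj (alg_cat D M')"
    obtain B k where [simp]: "X = (B, k)" by (metis surj_pair)
    have "B \<in> Obj D" using X by (auto simp: alg_cat_obj)
    then obtain A where A: "A \<in> Obj C" "B = ob F A" using obE by auto
    have "arrow D k (ob F (ob (mfun M) A)) (ob F A)" using X A by (auto simp: alg_cat_obj tob)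
    then obtain h where h: "arrow C h (ob (mfun M) A) A" "k = ar F h" using i(5) T(3) A by blast
    show "\<exists>A\<in>Obj (alg_cat C M). ob (lift_functor F) A = X"
      by (rule bexI[of _ "(A, h)"]) (use X obj A h in auto)
  next
    fix f g X Y assume f: "arrow (alg_cat C M) f X Y" and g: "arrow (alg_cat C M) g X Y"
      and e: "ar (lift_functor F) f = ar (lift_functor F) g"
    obtain A h B k where [simp]: "X = (A, h)" "Y = (B, k)" by (metis surj_pair)
    show "f = g" using f g e i(4) arr2[of f A h B k] arr2[of g A h B k] by auto
  next
    fix g X Y assume X: "X \<in> Obj (alg_cat C M)" and Y: "Y \<in> Obj (alg_cat C M)"
      and g: "arrow (alg_cat D M') g (ob (lift_functor F) X) (ob (lift_functor F) Y)"
    obtain A h B k where [simp]: "X = (A, h)" "Y = (B, k)" by (metis surj_pair)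
    from g X Y obtain f where f: "arrow (alg_cat C M) ((A, h), f, (B, k)) (A, h) (B, k)"
        "g = ((ob F A, ar F h), ar F f, (ob F B, ar F k))"
      using arr[of A h B k g] by auto
    show "\<exists>f. arrow (alg_cat C M) f X Y \<and> ar (lift_functor F) f = g"
      by (rule exI[of _ "((A, h), f, (B, k))"]) (simp add: f)
  qed
qed

text \<open>The dual statement, obtained from the one for monads in the opposite categories by conjugation with
  \<open>flip\<close>, which commutes with \<open>lift_functor F\<close>.\<close>

lemma comonad_transport:
  assumes F: "is_iso_of_categories C D F" and W: "is_comonad C W"
    and tob: "\<And>A. A \<in> Obj C \<Longrightarrow> ob (wfun W') (ob F A) = ob F (ob (wfun W) A)"
    and tar: "\<And>f A B. arrow C f A B \<Longrightarrow> ar (wfun W') (ar F f) = ar F (ar (wfun W) f)"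
    and un: "\<And>A. A \<in> Obj C \<Longrightarrow> wcounit W' (ob F A) = ar F (wcounit W A)"
    and mu: "\<And>A. A \<in> Obj C \<Longrightarrow> wcomult W' (ob F A) = ar F (wcomult W A)"
  shows "is_comonad D W'" and "is_iso_of_categories (coalg_cat C W) (coalg_cat D W') (lift_functor F)"
proof -
  have "is_monad (op D) (dual_monad W')"
    and l: "is_iso_of_categories (alg_cat (op C) (dual_monad W)) (alg_cat (op D) (dual_monad W')) (lift_functor F)"
    by (rule monad_transport[of "op C" "op D" F "dual_monad W"];
        use assms in \<open>auto simp: iso_op_iff is_comonad_def\<close>)+
  then show W': "is_comonad D W'" by (simp add: is_comonad_def)
  obtain G where G: "is_functor (alg_cat (op D) (dual_monad W')) (op (coalg_cat D W')) G"
    "\<And>A. A \<in> Obj (op (coalg_cat D W')) \<Longrightarrow> ob G (ob flip A) = A"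
    "\<And>f A B. arrow (op (coalg_cat D W')) f A B \<Longrightarrow> ar G (ar flip f) = f"
    using iso_catE[OF flip_iso[OF W']] by metis
  have flf: "is_iso_of_categories (op (coalg_cat C W)) (alg_cat (op D) (dual_monad W')) (lift_functor F \<circ>\<^sub>F flip)"
    by (rule iso_comp[OF flip_iso[OF W] l])
  note f = functorD[OF iso_catD(1)[OF flf]] and fl = iso_catD[OF flip_iso[OF W']]
  have eq: "ar flip (ar (lift_functor F) g) = ar (lift_functor F) (ar flip g)" for g
    by (cases g) (auto simp: lift_functor_def flip_def)
  have arr: "arrow (op (coalg_cat D W')) (ar (lift_functor F) g) (ob (lift_functor F) X) (ob (lift_functor F) Y)"
    if g: "arrow (op (coalg_cat C W)) g X Y" for g X Y
  proof -
    have "arrow (alg_cat (op D) (dual_monad W')) (ar flip (ar (lift_functor F) g))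
        (ob flip (ob (lift_functor F) X)) (ob flip (ob (lift_functor F) Y))"
      using f(5)[OF g] by (simp add: eq)
    moreover have "X \<in> Obj (op (coalg_cat C W))" "Y \<in> Obj (op (coalg_cat C W))"
      using category.arrow_obj[OF f(1) g] by auto
    moreover have "ob (lift_functor F) X \<in> Obj (op (coalg_cat D W'))"
      "ob (lift_functor F) Y \<in> Obj (op (coalg_cat D W'))"
      using f(3)[OF calculation(2)] f(3)[OF calculation(3)] by (simp_all add: coalg_alg_op_obj)
    ultimately obtain h where h: "arrow (op (coalg_cat D W')) h (ob (lift_functor F) X) (ob (lift_functor F) Y)"
      "ar flip (ar (lift_functor F) g) = ar flip h"
      using fl(5) by blast
    have "ar (lift_functor F) g = h"
      using h(2) by (cases h; cases "ar (lift_functor F) g") simp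
    with h(1) show ?thesis by simp
  qed
  have Gi: "is_iso_of_categories (alg_cat (op D) (dual_monad W')) (op (coalg_cat D W')) G"
  proof -
    obtain G' where G': "is_functor (alg_cat (op D) (dual_monad W')) (op (coalg_cat D W')) G'"
      "functor_eq (op (coalg_cat D W')) (op (coalg_cat D W')) (G' \<circ>\<^sub>F flip) idf"
      "functor_eq (alg_cat (op D) (dual_monad W')) (alg_cat (op D) (dual_monad W')) (flip \<circ>\<^sub>F G') idf"
      using flip_iso[OF W'] unfolding is_iso_of_categories_def by blast
    then have "is_iso_of_categories (alg_cat (op D) (dual_monad W')) (op (coalg_cat D W')) G'"
      unfolding is_iso_of_categories_def using fl(1) by blast
    then show ?thesis
    proof (rule iso_functor_eq)
      fix A assume A: "A \<in> Obj (alg_cat (op D) (dual_monad W'))"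
      show "ob G A = ob G' A" using fl(3)[OF A] G(2) functor_eqD(3)[OF G'(2)] by auto
    next
      fix g A B assume g: "arrow (alg_cat (op D) (dual_monad W')) g A B"
      have "ar flip (ar G' g) = g" using functor_eqD(4)[OF G'(3) g] by simp
      then show "ar G g = ar G' g" using G(3)[OF functorD(5)[OF G'(1) g]] by simp
    qed
  qed
  have "is_iso_of_categories (op (coalg_cat C W)) (op (coalg_cat D W')) (lift_functor F)"
  proof (rule iso_functor_eq[OF iso_comp[OF flf Gi]])
    show "ob (lift_functor F) X = ob (G \<circ>\<^sub>F (lift_functor F \<circ>\<^sub>F flip)) X" if "X \<in> Obj (op (coalg_cat C W))" for X
      using G(2)[of "ob (lift_functor F) X"] f(3)[OF that] by (simp add: coalg_alg_op_obj)
    show "ar (lift_functor F) g = ar (G \<circ>\<^sub>F (lift_functor F \<circ>\<^sub>F flip)) g"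
      if "arrow (op (coalg_cat C W)) g X Y" for g X Y
      using G(3)[OF arr[OF that]] by (simp add: eq)
  qed
  then show "is_iso_of_categories (coalg_cat C W) (coalg_cat D W') (lift_functor F)"
    by (simp add: iso_op_iff)
qed


section \<open>The tensor module and multilinear maps\<close>

definition words :: "('k, 'a) module \<Rightarrow> 'a list set" where
  "words A = {w. w \<noteq> [] \<and> set w \<subseteq> carrier A}"

definition linear_on :: "('k, 'n) ring_scheme \<Rightarrow> ('k, 'a) module \<Rightarrow> ('k, 'b) module \<Rightarrow> ('a \<Rightarrow> 'b) \<Rightarrow> bool" where
  "linear_on k M N L \<longleftrightarrow> L \<in> carrier M \<rightarrow> carrier N \<and>
     (\<forall>x\<in>carrier M. \<forall>y\<in>carrier M. L (x \<oplus>\<^bsub>M\<^esub> y) = L x \<oplus>\<^bsub>N\<^esub> L y) \<and>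
     (\<forall>c\<in>carrier k. \<forall>x\<in>carrier M. L (c \<odot>\<^bsub>M\<^esub> x) = c \<odot>\<^bsub>N\<^esub> L x)"

text \<open>Linearity in the middle letter \<open>a\<close> of \<open>u @ a # v\<close>, for all \<open>u\<close> and
  \<open>v\<close>, is linearity in every letter of a nonempty word. The value at the empty word, which spans no
  summand of \<open>Sha(A)\<close>, is arbitrary.\<close>

definition multilinear :: "('k, 'n) ring_scheme \<Rightarrow> ('k, 'a) module \<Rightarrow> ('k, 'b) module \<Rightarrow> ('a list \<Rightarrow> 'b) \<Rightarrow> bool" where
  "multilinear k A M \<phi> \<longleftrightarrow> (\<forall>u v. set u \<subseteq> carrier A \<longrightarrow> set v \<subseteq> carrier A \<longrightarrow> linear_on k A M (\<lambda>a. \<phi> (u @ a # v)))"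

definition lin_comb :: "('k, 'n) ring_scheme \<Rightarrow> ('k, 'b) module \<Rightarrow> ('a list \<Rightarrow> 'b) \<Rightarrow> ('a list \<Rightarrow> 'k) \<Rightarrow> 'b" where
  "lin_comb k M \<phi> f = (\<Oplus>\<^bsub>M\<^esub>w\<in>{w. f w \<noteq> \<zero>\<^bsub>k\<^esub>}. f w \<odot>\<^bsub>M\<^esub> \<phi> w)"

lemma linear_onI:
  assumes "\<And>x. x \<in> carrier M \<Longrightarrow> L x \<in> carrier N"
    "\<And>x y. \<lbrakk>x \<in> carrier M; y \<in> carrier M\<rbrakk> \<Longrightarrow> L (x \<oplus>\<^bsub>M\<^esub> y) = L x \<oplus>\<^bsub>N\<^esub> L y"
    "\<And>c x. \<lbrakk>c \<in> carrier k; x \<in> carrier M\<rbrakk> \<Longrightarrow> L (c \<odot>\<^bsub>M\<^esub> x) = c \<odot>\<^bsub>N\<^esub> L x"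
  shows "linear_on k M N L"
  using assms by (auto simp: linear_on_def)

lemma linear_onD:
  assumes "linear_on k M N L"
  shows "x \<in> carrier M \<Longrightarrow> L x \<in> carrier N"
    "\<lbrakk>x \<in> carrier M; y \<in> carrier M\<rbrakk> \<Longrightarrow> L (x \<oplus>\<^bsub>M\<^esub> y) = L x \<oplus>\<^bsub>N\<^esub> L y"
    "\<lbrakk>c \<in> carrier k; x \<in> carrier M\<rbrakk> \<Longrightarrow> L (c \<odot>\<^bsub>M\<^esub> x) = c \<odot>\<^bsub>N\<^esub> L x"
  using assms by (auto simp: linear_on_def)

lemma linear_on_comp: "linear_on k M N L \<Longrightarrow> linear_on k N Q K \<Longrightarrow> linear_on k M Q (\<lambda>x. K (L x))"
  by (auto simp: linear_on_def Pi_def)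

lemma linear_on_add:
  assumes "module k N" "linear_on k M N L" "linear_on k M N K"
  shows "linear_on k M N (\<lambda>x. L x \<oplus>\<^bsub>N\<^esub> K x)"
proof -
  interpret N: module k N by (rule assms(1))
  show ?thesis
    by (rule linear_onI)
      (use linear_onD[OF assms(2)] linear_onD[OF assms(3)] in \<open>simp_all add: N.M.a_ac N.smult_r_distr\<close>)
qed

lemma linear_on_smult:
  assumes "module k N" "linear_on k M N L" "c \<in> carrier k"
  shows "linear_on k M N (\<lambda>x. c \<odot>\<^bsub>N\<^esub> L x)"
proof -
  interpret N: module k N by (rule assms(1))
  show ?thesis
    by (rule linear_onI)
      (use linear_onD[OF assms(2)] assms(3) in \<open>simp_all add: N.smult_r_distr N.smult_assoc1[symmetric] N.R.m_comm\<close>)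
qed

lemma linear_on_mult:
  assumes "algebra k B" "b \<in> carrier B"
  shows "linear_on k B B (\<lambda>z. z \<otimes>\<^bsub>B\<^esub> b)" "linear_on k B B (\<lambda>z. b \<otimes>\<^bsub>B\<^esub> z)"
proof -
  interpret B: algebra k B by (rule assms(1))
  show l: "linear_on k B B (\<lambda>z. z \<otimes>\<^bsub>B\<^esub> b)"
    by (rule linear_onI) (use assms(2) in \<open>auto simp: B.l_distr B.smult_assoc2\<close>)
  show "linear_on k B B (\<lambda>z. b \<otimes>\<^bsub>B\<^esub> z)"
    by (rule linear_onI) (use linear_onD[OF l] assms(2) in \<open>simp_all add: B.m_comm[of b]\<close>)
qed

lemma multilinear_at:
  "\<lbrakk>multilinear k A M \<phi>; set u \<subseteq> carrier A; set v \<subseteq> carrier A\<rbrakk> \<Longrightarrow> linear_on k A M (\<lambda>a. \<phi> (u @ a # v))"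
  by (simp add: multilinear_def)

lemma multilinearI:
  "(\<And>u v. \<lbrakk>set u \<subseteq> carrier A; set v \<subseteq> carrier A\<rbrakk> \<Longrightarrow> linear_on k A M (\<lambda>a. \<phi> (u @ a # v))) \<Longrightarrow> multilinear k A M \<phi>"
  by (simp add: multilinear_def)

lemma multilinearD:
  assumes "multilinear k A M \<phi>"
  shows "w \<in> words A \<Longrightarrow> \<phi> w \<in> carrier M"
    "\<lbrakk>set u \<subseteq> carrier A; set v \<subseteq> carrier A; a \<in> carrier A; b \<in> carrier A\<rbrakk> \<Longrightarrow>
        \<phi> (u @ (a \<oplus>\<^bsub>A\<^esub> b) # v) = \<phi> (u @ a # v) \<oplus>\<^bsub>M\<^esub> \<phi> (u @ b # v)"
    "\<lbrakk>set u \<subseteq> carrier A; set v \<subseteq> carrier A; a \<in> carrier A; c \<in> carrier k\<rbrakk> \<Longrightarrow>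
        \<phi> (u @ (c \<odot>\<^bsub>A\<^esub> a) # v) = c \<odot>\<^bsub>M\<^esub> \<phi> (u @ a # v)"
proof -
  show "\<phi> w \<in> carrier M" if "w \<in> words A"
    using that linear_onD(1)[OF multilinear_at[OF assms, of "[]" "tl w"], of "hd w"] by (cases w) (auto simp: words_def)
qed (use linear_onD[OF multilinear_at[OF assms]] in simp_all)

locale tensor_words = module k A for k :: "('k, 'n) ring_scheme" (structure) and A :: "('k, 'a) module" (structure)
begin

abbreviation "F \<equiv> formal_sums k A"
abbreviation "N \<equiv> null_sums k A"
abbreviation "T \<equiv> sha_module k A"

lemma formal_sumsD: "f \<in> F \<Longrightarrow> f w \<in> carrier k" "f \<in> F \<Longrightarrow> finite {w. f w \<noteq> \<zero>}"
  "f \<in> F \<Longrightarrow> {w. f w \<noteq> \<zero>} \<subseteq> words A"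
  by (auto simp: formal_sums_def words_def)

lemma formal_sumsI:
  assumes "\<And>w. f w \<in> carrier k" "\<And>w. w \<notin> W \<Longrightarrow> f w = \<zero>" "finite W" "W \<subseteq> words A"
  shows "f \<in> F"
proof -
  have "{w. f w \<noteq> \<zero>} \<subseteq> W" using assms(2) by auto
  then show ?thesis using assms finite_subset unfolding formal_sums_def words_def by blast
qed

lemma formal_zero: "(\<lambda>w. \<zero>) \<in> F"
  by (rule formal_sumsI[of _ "{}"]) auto

lemma formal_add:
  assumes "f \<in> F" "g \<in> F" shows "(\<lambda>w. f w \<oplus> g w) \<in> F"
  by (rule formal_sumsI[of _ "{w. f w \<noteq> \<zero>} \<union> {w. g w \<noteq> \<zero>}"]) (use assms formal_sumsD in auto)

lemma formal_scale:
  assumes "f \<in> F" "c \<in> carrier k" shows "(\<lambda>w. c \<otimes> f w) \<in> F"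
  by (rule formal_sumsI[of _ "{w. f w \<noteq> \<zero>}"]) (use assms formal_sumsD in auto)

lemma formal_neg:
  assumes "f \<in> F" shows "(\<lambda>w. \<ominus> f w) \<in> F"
  by (rule formal_sumsI[of _ "{w. f w \<noteq> \<zero>}"]) (use assms formal_sumsD in auto)

lemma formal_minus:
  assumes "f \<in> F" "g \<in> F" shows "(\<lambda>w. f w \<ominus> g w) \<in> F"
  by (rule formal_sumsI[of _ "{w. f w \<noteq> \<zero>} \<union> {w. g w \<noteq> \<zero>}"])
    (use assms formal_sumsD in \<open>auto simp: R.minus_eq\<close>)

lemma formal_single: "w \<in> words A \<Longrightarrow> single k w \<in> F"
  by (rule formal_sumsI[of _ "{w}"]) (auto simp: single_def)

lemma wordsI: "set u \<subseteq> carrier A \<Longrightarrow> set v \<subseteq> carrier A \<Longrightarrow> a \<in> carrier A \<Longrightarrow> u @ a # v \<in> words A"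
  "set v \<subseteq> carrier A \<Longrightarrow> a \<in> carrier A \<Longrightarrow> a # v \<in> words A"
  by (auto simp: words_def)

lemma null_formal: "f \<in> N \<Longrightarrow> f \<in> F"
  by (induction rule: null_sums.induct)
    (auto intro!: formal_zero formal_add formal_scale formal_minus formal_single wordsI)

lemma null_neg: "f \<in> N \<Longrightarrow> (\<lambda>w. \<ominus> f w) \<in> N"
  using null_scale[of "\<ominus> \<one>" k f A] null_formal[of f] formal_sumsD(1)[of f] by (simp add: R.l_minus)

lemma coset_eq_iff:
  assumes "f \<in> F" "g \<in> F"
  shows "coset k A f = coset k A g \<longleftrightarrow> (\<lambda>w. f w \<ominus> g w) \<in> N"
proof
  note fg = formal_sumsD(1)[OF assms(1)] formal_sumsD(1)[OF assms(2)]
  { assume "coset k A f = coset k A g"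
    moreover have "f \<in> coset k A f" using assms fg null_zero[of k A] by (simp add: coset_def R.minus_eq R.r_neg)
    ultimately show "(\<lambda>w. f w \<ominus> g w) \<in> N" by (auto simp: coset_def) }
  { assume n: "(\<lambda>w. f w \<ominus> g w) \<in> N"
    { fix h assume h: "h \<in> F"
      note h' = formal_sumsD(1)[OF h]
      have e: "h w \<ominus> g w = (h w \<ominus> f w) \<oplus> (f w \<ominus> g w)" "h w \<ominus> f w = (h w \<ominus> g w) \<oplus> \<ominus> (f w \<ominus> g w)" for w
        using h'[of w] fg(1)[of w] fg(2)[of w] by algebra+
      have "(\<lambda>w. h w \<ominus> f w) \<in> N \<longleftrightarrow> (\<lambda>w. h w \<ominus> g w) \<in> N"
      proof
        assume "(\<lambda>w. h w \<ominus> f w) \<in> N"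
        from null_plus[OF this n] show "(\<lambda>w. h w \<ominus> g w) \<in> N" by (simp only: e(1))
      next
        assume "(\<lambda>w. h w \<ominus> g w) \<in> N"
        from null_plus[OF this null_neg[OF n]] show "(\<lambda>w. h w \<ominus> f w) \<in> N" by (simp only: e(2))
      qed }
    then show "coset k A f = coset k A g" by (auto simp: coset_def) }
qed

lemma rep_coset:
  assumes "f \<in> F"
  shows "rep (coset k A f) \<in> F" "coset k A (rep (coset k A f)) = coset k A f"
proof -
  have "f \<in> coset k A f"
    using assms formal_sumsD(1)[OF assms] null_zero[of k A] by (simp add: coset_def R.minus_eq R.r_neg)
  then have "rep (coset k A f) \<in> coset k A f" unfolding rep_def by (rule someI[where P = "\<lambda>f. f \<in> _"])
  then have r: "rep (coset k A f) \<in> F" "(\<lambda>w. rep (coset k A f) w \<ominus> f w) \<in> N" by (auto simp: coset_def)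
  show "rep (coset k A f) \<in> F" by (rule r)
  show "coset k A (rep (coset k A f)) = coset k A f" using coset_eq_iff[OF r(1) assms] r(2) by simp
qed

lemma T_carrier: "carrier T = coset k A ` F" and T_zero: "\<zero>\<^bsub>T\<^esub> = coset k A (\<lambda>w. \<zero>)"
  by (simp_all add: sha_module_def)

lemma T_add:
  assumes "f \<in> F" "g \<in> F"
  shows "coset k A f \<oplus>\<^bsub>T\<^esub> coset k A g = coset k A (\<lambda>w. f w \<oplus> g w)"
proof -
  let ?f = "rep (coset k A f)" and ?g = "rep (coset k A g)"
  note f = rep_coset[OF assms(1)] and g = rep_coset[OF assms(2)]
  have n: "(\<lambda>w. ?f w \<ominus> f w) \<in> N" "(\<lambda>w. ?g w \<ominus> g w) \<in> N"
    using coset_eq_iff f g assms by auto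
  have "(?f w \<ominus> f w) \<oplus> (?g w \<ominus> g w) = (?f w \<oplus> ?g w) \<ominus> (f w \<oplus> g w)" for w
    using formal_sumsD(1)[OF f(1), of w] formal_sumsD(1)[OF g(1), of w]
      formal_sumsD(1)[OF assms(1), of w] formal_sumsD(1)[OF assms(2), of w] by algebra
  with null_plus[OF n] have "(\<lambda>w. (?f w \<oplus> ?g w) \<ominus> (f w \<oplus> g w)) \<in> N" by simp
  then have "coset k A (\<lambda>w. ?f w \<oplus> ?g w) = coset k A (\<lambda>w. f w \<oplus> g w)"
    using coset_eq_iff[OF formal_add[OF f(1) g(1)] formal_add[OF assms]] by simp
  then show ?thesis by (simp add: sha_module_def)
qed

lemma T_smult:
  assumes "f \<in> F" "c \<in> carrier k"
  shows "c \<odot>\<^bsub>T\<^esub> coset k A f = coset k A (\<lambda>w. c \<otimes> f w)"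
proof -
  let ?f = "rep (coset k A f)"
  note f = rep_coset[OF assms(1)]
  have n: "(\<lambda>w. ?f w \<ominus> f w) \<in> N"
    using coset_eq_iff f assms by auto
  have "c \<otimes> (?f w \<ominus> f w) = c \<otimes> ?f w \<ominus> c \<otimes> f w" for w
    using formal_sumsD(1)[OF f(1), of w] formal_sumsD(1)[OF assms(1), of w] assms(2) by algebra
  with null_scale[OF assms(2) n] have "(\<lambda>w. c \<otimes> ?f w \<ominus> c \<otimes> f w) \<in> N" by simp
  then have "coset k A (\<lambda>w. c \<otimes> ?f w) = coset k A (\<lambda>w. c \<otimes> f w)"
    using coset_eq_iff[OF formal_scale[OF f(1) assms(2)] formal_scale[OF assms]] by simp
  then show ?thesis by (simp add: sha_module_def)
qed

lemma T_module: "module k T"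
proof (rule moduleI)
  show "cring k" by (rule R.cring_axioms)
  note D = formal_sumsD(1) and cl = formal_add formal_scale formal_zero formal_neg
  show "abelian_group T"
  proof (rule abelian_groupI)
    fix x assume "x \<in> carrier T"
    then obtain f where f: "f \<in> F" "x = coset k A f" by (auto simp: T_carrier)
    show "\<exists>y\<in>carrier T. y \<oplus>\<^bsub>T\<^esub> x = \<zero>\<^bsub>T\<^esub>"
    proof (rule bexI)
      show "coset k A (\<lambda>w. \<ominus> f w) \<in> carrier T" using f cl by (auto simp: T_carrier)
      show "coset k A (\<lambda>w. \<ominus> f w) \<oplus>\<^bsub>T\<^esub> x = \<zero>\<^bsub>T\<^esub>"
        using f cl D[OF f(1)] by (simp add: T_add T_zero R.l_neg)
    qed
  qed (auto simp: T_carrier T_add T_zero cl D R.a_ac)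
qed (auto simp: T_carrier T_add T_zero T_smult formal_add formal_scale formal_sumsD(1) R.l_distr R.r_distr R.m_assoc)

sublocale T: module k "sha_module k A" by (rule T_module)

abbreviation "tens \<equiv> pure_tensor k A"

lemma tens_closed: "w \<in> words A \<Longrightarrow> tens w \<in> carrier T"
  by (auto simp: pure_tensor_def T_carrier intro: formal_single)

lemma tens_multilinear: "multilinear k A T tens"
proof (rule multilinearI, rule linear_onI)
  fix u v a assume uv: "set u \<subseteq> carrier A" "set v \<subseteq> carrier A" and a: "a \<in> carrier A"
  have w: "u @ a # v \<in> words A" if "a \<in> carrier A" for a using uv that by (auto simp: words_def)
  show "tens (u @ a # v) \<in> carrier T" by (rule tens_closed[OF w[OF a]])
  show "tens (u @ (a \<oplus>\<^bsub>A\<^esub> b) # v) = tens (u @ a # v) \<oplus>\<^bsub>T\<^esub> tens (u @ b # v)" if b: "b \<in> carrier A" for b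
    using null_add[OF uv a b, of k] a b
    by (simp add: pure_tensor_def T_add coset_eq_iff formal_single formal_add w)
  show "tens (u @ (c \<odot>\<^bsub>A\<^esub> a) # v) = c \<odot>\<^bsub>T\<^esub> tens (u @ a # v)" if c: "c \<in> carrier k" for c
    using null_smult[OF uv a c] a c
    by (simp add: pure_tensor_def T_smult coset_eq_iff formal_single formal_scale w)
qed

text \<open>Pure tensors span: by induction on the support, a formal sum is a sum of multiples of single words. The zero element
  is \<open>0\<close> times a pure tensor.\<close>

lemma T_induct [consumes 1, case_names tens add smult]:
  assumes x: "x \<in> carrier T"
    and t: "\<And>w. w \<in> words A \<Longrightarrow> Q (tens w)"
    and a: "\<And>x y. \<lbrakk>x \<in> carrier T; y \<in> carrier T; Q x; Q y\<rbrakk> \<Longrightarrow> Q (x \<oplus>\<^bsub>T\<^esub> y)"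
    and s: "\<And>c x. \<lbrakk>c \<in> carrier k; x \<in> carrier T; Q x\<rbrakk> \<Longrightarrow> Q (c \<odot>\<^bsub>T\<^esub> x)"
  shows "Q x"
proof -
  have z: "Q \<zero>\<^bsub>T\<^esub>"
  proof -
    have "[\<zero>\<^bsub>A\<^esub>] \<in> words A" by (simp add: words_def)
    from s[OF R.zero_closed tens_closed[OF this] t[OF this]] show ?thesis
      using tens_closed[OF \<open>[\<zero>\<^bsub>A\<^esub>] \<in> words A\<close>] by simp
  qed
  have "f \<in> F \<Longrightarrow> {w. f w \<noteq> \<zero>} \<subseteq> W \<Longrightarrow> Q (coset k A f)" if "finite W" for W f
    using that
  proof (induction W arbitrary: f rule: finite_induct)
    case empty
    then have "f = (\<lambda>w. \<zero>)" by auto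
    then show ?case using z by (simp add: T_zero)
  next
    case (insert v W)
    note f = formal_sumsD[OF insert.prems(1)]
    show ?case
    proof (cases "f v = \<zero>")
      case True
      then show ?thesis using insert by auto
    next
      case False
      then have v: "v \<in> words A" using f(3) by auto
      let ?g = "f(v := \<zero>)"
      have g: "?g \<in> F"
        by (rule formal_sumsI[of _ "{w. f w \<noteq> \<zero>}"]) (use f in auto)
      have Qg: "Q (coset k A ?g)" by (rule insert.IH[OF g]) (use insert.prems in auto)
      have "f = (\<lambda>w. f v \<otimes> single k v w \<oplus> ?g w)" using f(1) by (auto simp: single_def fun_eq_iff)
      then have "coset k A f = f v \<odot>\<^bsub>T\<^esub> tens v \<oplus>\<^bsub>T\<^esub> coset k A ?g"
        using f(1) g v
        by (simp add: pure_tensor_def T_smult T_add formal_single formal_scale del: fun_upd_apply)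
      moreover have "Q (f v \<odot>\<^bsub>T\<^esub> tens v \<oplus>\<^bsub>T\<^esub> coset k A ?g)"
        by (rule a[OF T.smult_closed[OF f(1) tens_closed[OF v]] _ s[OF f(1) tens_closed[OF v] t[OF v]] Qg])
          (use g in \<open>simp add: T_carrier\<close>)
      ultimately show ?thesis by simp
    qed
  qed
  with x show ?thesis using formal_sumsD(2) by (auto simp: T_carrier)
qed

lemma linear_eqI:
  assumes "linear_on k T M L" "linear_on k T M K" "x \<in> carrier T"
    "\<And>w. w \<in> words A \<Longrightarrow> L (tens w) = K (tens w)"
  shows "L x = K x"
  using assms(3)
  by (induction rule: T_induct) (simp_all add: linear_onD[OF assms(1)] linear_onD[OF assms(2)] assms(4))

end

locale tensor_target = tensor_words k A + Q: module k M
  for k :: "('k, 'n) ring_scheme" (structure) and A :: "('k, 'a) module" (structure)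
    and M :: "('k, 'b) module" (structure)
begin

text \<open>Since \<open>lin_comb\<close> sums over the support, which changes under addition, sums are compared over a common
  finite set of words.\<close>

lemma lin_comb_superset:
  assumes f: "f \<in> F" and W: "finite W" "{w. f w \<noteq> \<zero>\<^bsub>k\<^esub>} \<subseteq> W" and \<phi>: "\<And>w. w \<in> words A \<Longrightarrow> \<phi> w \<in> carrier M"
    and WA: "W \<subseteq> words A"
  shows "lin_comb k M \<phi> f = (\<Oplus>\<^bsub>M\<^esub>w\<in>W. f w \<odot>\<^bsub>M\<^esub> \<phi> w)"
  unfolding lin_comb_def
  by (rule Q.M.add.finprod_mono_neutral_cong_left) (use assms formal_sumsD(1)[OF f] in auto)

lemma lin_comb_closed:
  assumes f: "f \<in> F" and \<phi>: "\<And>w. w \<in> words A \<Longrightarrow> \<phi> w \<in> carrier M"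
  shows "lin_comb k M \<phi> f \<in> carrier M"
  unfolding lin_comb_def
  by (rule Q.M.finsum_closed) (use formal_sumsD[OF f] \<phi> in auto)

lemma lin_comb_add:
  assumes f: "f \<in> F" and g: "g \<in> F" and \<phi>: "\<And>w. w \<in> words A \<Longrightarrow> \<phi> w \<in> carrier M"
  shows "lin_comb k M \<phi> (\<lambda>w. f w \<oplus>\<^bsub>k\<^esub> g w) = lin_comb k M \<phi> f \<oplus>\<^bsub>M\<^esub> lin_comb k M \<phi> g"
proof -
  let ?W = "{w. f w \<noteq> \<zero>\<^bsub>k\<^esub>} \<union> {w. g w \<noteq> \<zero>\<^bsub>k\<^esub>}"
  note fD = formal_sumsD[OF f] and gD = formal_sumsD[OF g]
  have W: "finite ?W" "?W \<subseteq> words A" using fD gD by auto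
  have "lin_comb k M \<phi> (\<lambda>w. f w \<oplus>\<^bsub>k\<^esub> g w) = (\<Oplus>\<^bsub>M\<^esub>w\<in>?W. (f w \<oplus>\<^bsub>k\<^esub> g w) \<odot>\<^bsub>M\<^esub> \<phi> w)"
    by (rule lin_comb_superset[OF formal_add[OF f g] W(1) _ \<phi> W(2)]) auto
  also have "\<dots> = (\<Oplus>\<^bsub>M\<^esub>w\<in>?W. f w \<odot>\<^bsub>M\<^esub> \<phi> w \<oplus>\<^bsub>M\<^esub> g w \<odot>\<^bsub>M\<^esub> \<phi> w)"
    by (rule Q.M.finsum_cong') (use W fD(1) gD(1) \<phi> in \<open>auto simp: Q.smult_l_distr\<close>)
  also have "\<dots> = (\<Oplus>\<^bsub>M\<^esub>w\<in>?W. f w \<odot>\<^bsub>M\<^esub> \<phi> w) \<oplus>\<^bsub>M\<^esub> (\<Oplus>\<^bsub>M\<^esub>w\<in>?W. g w \<odot>\<^bsub>M\<^esub> \<phi> w)"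
    by (rule Q.M.finsum_addf) (use W fD(1) gD(1) \<phi> in auto)
  also have "(\<Oplus>\<^bsub>M\<^esub>w\<in>?W. f w \<odot>\<^bsub>M\<^esub> \<phi> w) = lin_comb k M \<phi> f"
    by (rule lin_comb_superset[OF f W(1) _ \<phi> W(2), symmetric]) auto
  also have "(\<Oplus>\<^bsub>M\<^esub>w\<in>?W. g w \<odot>\<^bsub>M\<^esub> \<phi> w) = lin_comb k M \<phi> g"
    by (rule lin_comb_superset[OF g W(1) _ \<phi> W(2), symmetric]) auto
  finally show ?thesis .
qed

lemma lin_comb_scale:
  assumes f: "f \<in> F" and c: "c \<in> carrier k" and \<phi>: "\<And>w. w \<in> words A \<Longrightarrow> \<phi> w \<in> carrier M"
  shows "lin_comb k M \<phi> (\<lambda>w. c \<otimes>\<^bsub>k\<^esub> f w) = c \<odot>\<^bsub>M\<^esub> lin_comb k M \<phi> f"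
proof -
  let ?W = "{w. f w \<noteq> \<zero>\<^bsub>k\<^esub>}"
  note fD = formal_sumsD[OF f]
  have "lin_comb k M \<phi> (\<lambda>w. c \<otimes>\<^bsub>k\<^esub> f w) = (\<Oplus>\<^bsub>M\<^esub>w\<in>?W. (c \<otimes>\<^bsub>k\<^esub> f w) \<odot>\<^bsub>M\<^esub> \<phi> w)"
    by (rule lin_comb_superset[OF formal_scale[OF f c] fD(2) _ \<phi> fD(3)]) (use c in auto)
  also have "\<dots> = (\<Oplus>\<^bsub>M\<^esub>w\<in>?W. c \<odot>\<^bsub>M\<^esub> (f w \<odot>\<^bsub>M\<^esub> \<phi> w))"
    by (rule Q.M.finsum_cong') (use fD \<phi> c in \<open>auto simp: Q.smult_assoc1 subset_iff\<close>)
  also have "\<dots> = c \<odot>\<^bsub>M\<^esub> lin_comb k M \<phi> f"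
    unfolding lin_comb_def by (rule Q.finsum_smult_ldistr[symmetric]) (use fD \<phi> c in auto)
  finally show ?thesis .
qed

text \<open>Over the zero ring the support of \<open>single k w\<close> is empty, but then \<open>M\<close> is trivial as well.\<close>

lemma lin_comb_single:
  assumes "w \<in> words A" "\<phi> w \<in> carrier M"
  shows "lin_comb k M \<phi> (single k w) = \<phi> w"
proof (cases "\<one>\<^bsub>k\<^esub> = \<zero>\<^bsub>k\<^esub>")
  case True
  then have "\<phi> w = \<zero>\<^bsub>M\<^esub>" using Q.smult_one[OF assms(2)] Q.smult_l_null[OF assms(2)] by simp
  then show ?thesis using True by (simp add: lin_comb_def single_def)
next
  case False
  then have "{v. single k w v \<noteq> \<zero>\<^bsub>k\<^esub>} = {w}" by (auto simp: single_def)
  then show ?thesis using assms by (simp add: lin_comb_def Q.M.finsum_insert single_def)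
qed

lemma lin_comb_minus:
  assumes f: "f \<in> F" and g: "g \<in> F" and \<phi>: "\<And>w. w \<in> words A \<Longrightarrow> \<phi> w \<in> carrier M"
  shows "lin_comb k M \<phi> (\<lambda>w. f w \<ominus>\<^bsub>k\<^esub> g w) = lin_comb k M \<phi> f \<ominus>\<^bsub>M\<^esub> lin_comb k M \<phi> g"
proof -
  have "(\<lambda>w. f w \<ominus>\<^bsub>k\<^esub> g w) = (\<lambda>w. f w \<oplus>\<^bsub>k\<^esub> (\<ominus>\<^bsub>k\<^esub> \<one>\<^bsub>k\<^esub>) \<otimes>\<^bsub>k\<^esub> g w)"
    using formal_sumsD(1)[OF g] by (simp add: R.minus_eq R.l_minus)
  then show ?thesis
    using lin_comb_closed[of g \<phi>] f g \<phi>
    by (simp add: lin_comb_add lin_comb_scale formal_scale Q.M.minus_eq Q.smult_l_minus)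
qed

context
  fixes \<phi> assumes ml: "multilinear k A M \<phi>"
begin

text \<open>Each relation that defines the tensor module is an instance of linearity in one letter.\<close>

lemma lin_comb_null: "f \<in> N \<Longrightarrow> lin_comb k M \<phi> f = \<zero>\<^bsub>M\<^esub>"
proof (induction rule: null_sums.induct)
  case null_zero
  then show ?case by (simp add: lin_comb_def)
next
  case (null_plus f g)
  then show ?case using lin_comb_add[of f g \<phi>] null_formal multilinearD(1)[OF ml] by simp
next
  case (null_scale c f)
  then show ?case using lin_comb_scale[of f c \<phi>] null_formal multilinearD(1)[OF ml] by simp
next
  case (null_add u v a b)
  then have w: "u @ a # v \<in> words A" "u @ b # v \<in> words A" "u @ (a \<oplus>\<^bsub>A\<^esub> b) # v \<in> words A"
    by (auto simp: words_def)
  show ?case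
    using w null_add multilinearD[OF ml]
    by (simp add: lin_comb_minus lin_comb_add formal_single formal_add lin_comb_single Q.M.r_neg Q.M.minus_eq)
next
  case (null_smult u v a c)
  then have w: "u @ a # v \<in> words A" "u @ (c \<odot>\<^bsub>A\<^esub> a) # v \<in> words A"
    by (auto simp: words_def)
  show ?case
    using w null_smult multilinearD[OF ml]
    by (simp add: lin_comb_minus lin_comb_scale formal_single formal_scale lin_comb_single Q.M.r_neg Q.M.minus_eq)
qed

lemma lin_ext_coset:
  assumes f: "f \<in> F"
  shows "lin_ext k M \<phi> (coset k A f) = lin_comb k M \<phi> f"
proof -
  let ?f = "rep (coset k A f)"
  note r = rep_coset[OF f]
  have "(\<lambda>w. ?f w \<ominus>\<^bsub>k\<^esub> f w) \<in> N" using coset_eq_iff r f by auto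
  from lin_comb_null[OF this] have "lin_comb k M \<phi> ?f \<ominus>\<^bsub>M\<^esub> lin_comb k M \<phi> f = \<zero>\<^bsub>M\<^esub>"
    using lin_comb_minus[OF r(1) f multilinearD(1)[OF ml]] by simp
  moreover have cl: "lin_comb k M \<phi> ?f \<in> carrier M" "lin_comb k M \<phi> f \<in> carrier M"
    by (simp_all add: lin_comb_closed r(1) f multilinearD(1)[OF ml])
  moreover have "lin_comb k M \<phi> ?f = (lin_comb k M \<phi> ?f \<ominus>\<^bsub>M\<^esub> lin_comb k M \<phi> f) \<oplus>\<^bsub>M\<^esub> lin_comb k M \<phi> f"
    using cl by (simp add: Q.M.minus_eq Q.M.a_assoc Q.M.l_neg)
  ultimately have "lin_comb k M \<phi> ?f = lin_comb k M \<phi> f" by simp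
  then show ?thesis by (simp add: lin_ext_def lin_comb_def)
qed

lemma lin_ext_tens: "w \<in> words A \<Longrightarrow> lin_ext k M \<phi> (tens w) = \<phi> w"
  by (simp add: pure_tensor_def lin_ext_coset formal_single lin_comb_single multilinearD(1)[OF ml])

lemma lin_ext_linear: "linear_on k T M (lin_ext k M \<phi>)"
  by (rule linear_onI)
    (auto simp: T_carrier T_add T_smult lin_ext_coset formal_add formal_scale
      intro!: lin_comb_closed lin_comb_add lin_comb_scale multilinearD(1)[OF ml])

end

end


section \<open>The mixable shuffle algebra\<close>

locale weighted_algebra = algebra k A for k :: "('k, 'n) ring_scheme" (structure) and A :: "('k, 'a) module" (structure) +
  fixes lam assumes lam [simp, intro]: "lam \<in> carrier k"

sublocale weighted_algebra \<subseteq> tensor_words k A ..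

sublocale weighted_algebra \<subseteq> TT: tensor_target k A "sha_module k A" ..

lemma sha_simps [simp]: "carrier (sha k lam A) = carrier (sha_module k A)"
  "x \<oplus>\<^bsub>sha k lam A\<^esub> y = x \<oplus>\<^bsub>sha_module k A\<^esub> y" "\<zero>\<^bsub>sha k lam A\<^esub> = \<zero>\<^bsub>sha_module k A\<^esub>"
  "c \<odot>\<^bsub>sha k lam A\<^esub> x = c \<odot>\<^bsub>sha_module k A\<^esub> x" "\<one>\<^bsub>sha k lam A\<^esub> = pure_tensor k A [\<one>\<^bsub>A\<^esub>]"
  by (simp_all add: sha_def)

lemma words_Cons: "a # w \<in> words A \<longleftrightarrow> a \<in> carrier A \<and> set w \<subseteq> carrier A"
  by (auto simp: words_def)

lemma words_cases: "w \<in> words A \<Longrightarrow> \<exists>a. a \<in> carrier A \<and> (w = [a] \<or> (\<exists>w'\<in>words A. w = a # w'))"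
  by (cases w; cases "tl w") (auto simp: words_def)

context weighted_algebra begin

abbreviation "pre \<equiv> prepend k A"
abbreviation "Sh \<equiv> shuffle_word k lam A"
abbreviation "SA \<equiv> sha k lam A"
abbreviation sha_product (infixl "\<diamondop>" 70) where "x \<diamondop> y \<equiv> x \<otimes>\<^bsub>SA\<^esub> y"

lemma tens_head_linear: "set w \<subseteq> carrier A \<Longrightarrow> linear_on k A T (\<lambda>a. tens (a # w))"
  using multilinear_at[OF tens_multilinear, of "[]" w] by simp

lemma pre_multilinear: "a \<in> carrier A \<Longrightarrow> multilinear k A T (\<lambda>w. tens (a # w))"
proof (rule multilinearI)
  fix u v assume "a \<in> carrier A" "set u \<subseteq> carrier A" "set v \<subseteq> carrier A"
  then show "linear_on k A T (\<lambda>b. tens (a # u @ b # v))"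
    using multilinear_at[OF tens_multilinear, of "a # u" v] by simp
qed

lemma pre_tens: "a \<in> carrier A \<Longrightarrow> w \<in> words A \<Longrightarrow> pre a (tens w) = tens (a # w)"
  unfolding prepend_def by (rule TT.lin_ext_tens[OF pre_multilinear])

lemma pre_linear: "a \<in> carrier A \<Longrightarrow> linear_on k T T (pre a)"
  unfolding prepend_def by (rule TT.lin_ext_linear[OF pre_multilinear])

lemmas pre_lin = linear_onD[OF pre_linear]

lemma pre_linear_left:
  assumes x: "x \<in> carrier T" shows "linear_on k A T (\<lambda>a. pre a x)"
proof (rule linear_onI)
  fix a assume a: "a \<in> carrier A"
  show "pre a x \<in> carrier T" by (rule pre_lin(1)[OF a x])
  note t = linear_onD[OF tens_head_linear]
  show "pre (a \<oplus>\<^bsub>A\<^esub> b) x = pre a x \<oplus>\<^bsub>T\<^esub> pre b x" if b: "b \<in> carrier A" for b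
  proof (rule linear_eqI[OF pre_linear linear_on_add[OF T_module pre_linear[OF a] pre_linear[OF b]] x])
    show "pre (a \<oplus>\<^bsub>A\<^esub> b) (tens w) = pre a (tens w) \<oplus>\<^bsub>T\<^esub> pre b (tens w)" if "w \<in> words A" for w
      using that a b t(2)[of w a b] by (simp add: pre_tens words_def)
  qed (use a b in simp)
  show "pre (c \<odot>\<^bsub>A\<^esub> a) x = c \<odot>\<^bsub>T\<^esub> pre a x" if c: "c \<in> carrier k" for c
  proof (rule linear_eqI[OF pre_linear linear_on_smult[OF T_module pre_linear[OF a] c] x])
    show "pre (c \<odot>\<^bsub>A\<^esub> a) (tens w) = c \<odot>\<^bsub>T\<^esub> pre a (tens w)" if "w \<in> words A" for w
      using that a c t(3)[of w c a] by (simp add: pre_tens words_def)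
  qed (use a c in simp)
qed

lemma Sh_single_left: "Sh [a] (b # w) = tens ((a \<otimes>\<^bsub>A\<^esub> b) # w)"
  and Sh_single_right: "Sh (a # w) [b] = tens ((a \<otimes>\<^bsub>A\<^esub> b) # w)"
  and Sh_step: "\<lbrakk>u \<noteq> []; v \<noteq> []\<rbrakk> \<Longrightarrow> Sh (a # u) (b # v) = pre (a \<otimes>\<^bsub>A\<^esub> b)
    (Sh u (\<one>\<^bsub>A\<^esub> # v) \<oplus>\<^bsub>T\<^esub> Sh (\<one>\<^bsub>A\<^esub> # u) v \<oplus>\<^bsub>T\<^esub> lam \<odot>\<^bsub>T\<^esub> Sh u v)"
proof -
  show "Sh [a] (b # w) = tens ((a \<otimes>\<^bsub>A\<^esub> b) # w)" by simp
  show "Sh (a # w) [b] = tens ((a \<otimes>\<^bsub>A\<^esub> b) # w)" by (cases w) simp_all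
  show "Sh (a # u) (b # v) = pre (a \<otimes>\<^bsub>A\<^esub> b)
    (Sh u (\<one>\<^bsub>A\<^esub> # v) \<oplus>\<^bsub>T\<^esub> Sh (\<one>\<^bsub>A\<^esub> # u) v \<oplus>\<^bsub>T\<^esub> lam \<odot>\<^bsub>T\<^esub> Sh u v)" if "u \<noteq> []" "v \<noteq> []"
    using that by (cases u; cases v) simp_all
qed

lemma word_pair_cases:
  assumes "u \<in> words A" "v \<in> words A"
  obtains a b w where "u = [a]" "v = b # w" "a \<in> carrier A" "b \<in> carrier A" "set w \<subseteq> carrier A"
    | a w b where "u = a # w" "v = [b]" "a \<in> carrier A" "b \<in> carrier A" "set w \<subseteq> carrier A"
    | a u' b v' where "u = a # u'" "v = b # v'" "a \<in> carrier A" "b \<in> carrier A" "u' \<noteq> []" "v' \<noteq> []"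
      "u' \<in> words A" "v' \<in> words A" "\<one>\<^bsub>A\<^esub> # u' \<in> words A" "\<one>\<^bsub>A\<^esub> # v' \<in> words A"
proof -
  obtain a u' b v' where uv: "u = a # u'" "v = b # v'" using assms by (cases u; cases v) (auto simp: words_def)
  then have w: "a \<in> carrier A" "b \<in> carrier A" "set u' \<subseteq> carrier A" "set v' \<subseteq> carrier A"
    using assms by (auto simp: words_def)
  consider "u' = []" | "v' = []" | "u' \<noteq> []" "v' \<noteq> []" by blast
  then show thesis
  proof cases
    case 1 then show ?thesis using uv w by (intro that(1)[of a b v']) simp_all
  next
    case 2 then show ?thesis using uv w by (intro that(2)[of a u' b]) simp_all
  next
    case 3 then show ?thesis using uv w by (intro that(3)[of a u' b v']) (simp_all add: words_def)
  qed
qed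

text \<open>The recursion replaces the two words by words of smaller total length: a letter \<open>\<one>\<close> is put back on
  one side only. The same measure drives all inductions on pairs or triples of words below.\<close>

lemma Sh_closed: "u \<in> words A \<Longrightarrow> v \<in> words A \<Longrightarrow> Sh u v \<in> carrier T"
proof (induction "length u + length v" arbitrary: u v rule: less_induct)
  case less
  from less.prems show ?case
  proof (cases rule: word_pair_cases)
    case (3 a u' b v')
    have "Sh u' (\<one>\<^bsub>A\<^esub> # v') \<in> carrier T" "Sh (\<one>\<^bsub>A\<^esub> # u') v' \<in> carrier T" "Sh u' v' \<in> carrier T"
      by (rule less.hyps; use 3 in simp)+
    then show ?thesis using 3 by (simp add: Sh_step pre_lin(1))
  qed (auto simp: Sh_single_left Sh_single_right words_Cons intro!: tens_closed)
qed

lemma Sh_comm: "u \<in> words A \<Longrightarrow> v \<in> words A \<Longrightarrow> Sh u v = Sh v u"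
proof (induction "length u + length v" arbitrary: u v rule: less_induct)
  case less
  from less.prems show ?case
  proof (cases rule: word_pair_cases)
    case (3 a u' b v')
    have IH: "Sh u' (\<one>\<^bsub>A\<^esub> # v') = Sh (\<one>\<^bsub>A\<^esub> # v') u'" "Sh (\<one>\<^bsub>A\<^esub> # u') v' = Sh v' (\<one>\<^bsub>A\<^esub> # u')" "Sh u' v' = Sh v' u'"
      by (rule less.hyps; use 3 in simp)+
    show ?thesis using 3(3-) Sh_closed
      by (simp add: 3(1,2) Sh_step IH m_comm[of a b] T.M.a_comm[of "Sh (\<one>\<^bsub>A\<^esub> # v') u'"])
  qed (auto simp: Sh_single_left Sh_single_right m_comm)
qed

lemma Sh_head_linear:
  assumes q: "set q \<subseteq> carrier A" and v: "v \<in> words A"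
  shows "linear_on k A T (\<lambda>a. Sh (a # q) v)"
proof -
  obtain c vs where vs: "v = c # vs" "c \<in> carrier A" "set vs \<subseteq> carrier A" using v by (cases v) (auto simp: words_def)
  note m = linear_on_mult(1)[OF algebra_axioms vs(2)]
  show ?thesis
  proof (cases "q = [] \<or> vs = []")
    case True
    then show ?thesis
      using linear_on_comp[OF m tens_head_linear[OF vs(3)]] linear_on_comp[OF m tens_head_linear[OF q]]
      by (auto simp: vs(1) Sh_single_left Sh_single_right)
  next
    case False
    then have w: "q \<in> words A" "vs \<in> words A" "\<one>\<^bsub>A\<^esub> # q \<in> words A" "\<one>\<^bsub>A\<^esub> # vs \<in> words A"
      using q vs by (auto simp: words_def)
    have "Sh q (\<one>\<^bsub>A\<^esub> # vs) \<oplus>\<^bsub>T\<^esub> Sh (\<one>\<^bsub>A\<^esub> # q) vs \<oplus>\<^bsub>T\<^esub> lam \<odot>\<^bsub>T\<^esub> Sh q vs \<in> carrier T" using w Sh_closed by simp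
    then show ?thesis using linear_on_comp[OF m pre_linear_left] False by (simp add: vs(1) Sh_step)
  qed
qed

lemma Sh_linear:
  assumes "set p \<subseteq> carrier A" "set q \<subseteq> carrier A" "v \<in> words A"
  shows "linear_on k A T (\<lambda>a. Sh (p @ a # q) v)"
  using assms
proof (induction "length p + length v" arbitrary: p v rule: less_induct)
  case less
  obtain c vs where vs: "v = c # vs" "c \<in> carrier A" "set vs \<subseteq> carrier A"
    using less.prems by (cases v) (auto simp: words_def)
  show ?case
  proof (cases p)
    case Nil
    then show ?thesis using Sh_head_linear less.prems by simp
  next
    case (Cons p0 p')
    have p: "p0 \<otimes>\<^bsub>A\<^esub> c \<in> carrier A" "set p' \<subseteq> carrier A" using less.prems vs Cons by auto
    show ?thesis
    proof (cases "vs = []")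
      case True
      show ?thesis using multilinear_at[OF tens_multilinear, of "(p0 \<otimes>\<^bsub>A\<^esub> c) # p'" q] p less.prems(2)
        by (simp add: Cons vs(1) True Sh_single_right)
    next
      case False
      have "linear_on k A T (\<lambda>a. Sh (p' @ a # q) (\<one>\<^bsub>A\<^esub> # vs))" "linear_on k A T (\<lambda>a. Sh ((\<one>\<^bsub>A\<^esub> # p') @ a # q) vs)"
        "linear_on k A T (\<lambda>a. Sh (p' @ a # q) vs)"
        by (rule less.hyps; use p less.prems(2) False vs in \<open>simp add: Cons words_def\<close>)+
      from linear_on_comp[OF linear_on_add[OF T_module linear_on_add[OF T_module this(1,2)]
            linear_on_smult[OF T_module this(3) lam]] pre_linear[OF p(1)]]
      show ?thesis using False by (simp add: Cons vs(1) Sh_step)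
    qed
  qed
qed

lemma Sh_multilinear: "v \<in> words A \<Longrightarrow> multilinear k A T (\<lambda>u. Sh u v)"
  by (rule multilinearI) (rule Sh_linear)

lemma Sh_multilinear_right:
  assumes u: "u \<in> words A" shows "multilinear k A T (Sh u)"
proof (rule multilinearI)
  fix p q assume pq: "set p \<subseteq> carrier A" "set q \<subseteq> carrier A"
  have "Sh u (p @ a # q) = Sh (p @ a # q) u" if "a \<in> carrier A" for a
    by (rule Sh_comm[OF u]) (use pq that in \<open>auto simp: words_def\<close>)
  then show "linear_on k A T (\<lambda>a. Sh u (p @ a # q))"
    using Sh_linear[OF pq u] by (simp add: linear_on_def Pi_def)
qed

text \<open>The product is defined by two nested linear extensions; this makes the inner one a legitimate argument of the outer
  one.\<close>

lemma sha_mult_multilinear: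
  assumes y: "y \<in> carrier T"
  shows "multilinear k A T (\<lambda>u. lin_ext k T (Sh u) y)"
proof (rule multilinearI, rule linear_onI)
  note lin = TT.lin_ext_linear[OF Sh_multilinear_right] and te = TT.lin_ext_tens[OF Sh_multilinear_right]
  fix p q a assume w: "set p \<subseteq> carrier A" "set q \<subseteq> carrier A" "a \<in> carrier A"
  have pw: "p @ a # q \<in> words A" if "a \<in> carrier A" for a using w that by (auto simp: words_def)
  note wa = pw[OF w(3)] and S = multilinearD[OF Sh_multilinear]
  show "lin_ext k T (Sh (p @ a # q)) y \<in> carrier T" by (rule linear_onD(1)[OF lin[OF wa] y])
  show "lin_ext k T (Sh (p @ (a \<oplus>\<^bsub>A\<^esub> b) # q)) y = lin_ext k T (Sh (p @ a # q)) y \<oplus>\<^bsub>T\<^esub> lin_ext k T (Sh (p @ b # q)) y"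
    if b: "b \<in> carrier A" for b
    by (rule linear_eqI[OF lin linear_on_add[OF T_module lin[OF wa] lin[OF pw[OF b]]] y])
      (use w b in \<open>simp_all add: te pw S(2)\<close>)
  show "lin_ext k T (Sh (p @ (c \<odot>\<^bsub>A\<^esub> a) # q)) y = c \<odot>\<^bsub>T\<^esub> lin_ext k T (Sh (p @ a # q)) y" if c: "c \<in> carrier k" for c
    by (rule linear_eqI[OF lin linear_on_smult[OF T_module lin[OF wa] c] y])
      (use w c in \<open>simp_all add: te pw S(3)\<close>)
qed

lemma sha_mult: "x \<diamondop> y = lin_ext k T (\<lambda>u. lin_ext k T (Sh u) y) x"
  by (simp add: sha_def)

lemma mult_tens: "u \<in> words A \<Longrightarrow> v \<in> words A \<Longrightarrow> tens u \<diamondop> tens v = Sh u v"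
  by (simp add: sha_mult TT.lin_ext_tens[OF sha_mult_multilinear] tens_closed
      TT.lin_ext_tens[OF Sh_multilinear_right])

lemma mult_linear_left: "y \<in> carrier T \<Longrightarrow> linear_on k T T (\<lambda>x. x \<diamondop> y)"
  unfolding sha_mult by (rule TT.lin_ext_linear[OF sha_mult_multilinear])

lemmas mult_left = linear_onD[OF mult_linear_left]

lemma mult_linear_right:
  assumes x: "x \<in> carrier T" shows "linear_on k T T (\<lambda>y. x \<diamondop> y)"
proof (rule linear_onI)
  show "x \<diamondop> y \<in> carrier T" if "y \<in> carrier T" for y using mult_left(1)[OF that x] .
  note te = TT.lin_ext_tens[OF sha_mult_multilinear] and r = TT.lin_ext_linear[OF Sh_multilinear_right]
  show "x \<diamondop> (y \<oplus>\<^bsub>T\<^esub> z) = x \<diamondop> y \<oplus>\<^bsub>T\<^esub> x \<diamondop> z" if y: "y \<in> carrier T" "z \<in> carrier T" for y z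
    using x
  proof (induction rule: T_induct)
    case (tens w)
    then show ?case unfolding sha_mult using y linear_onD(2)[OF r[OF tens]] by (simp add: te)
  next
    case (add x x')
    then show ?case using y mult_left by (simp add: T.M.a_ac)
  next
    case (smult c x)
    then show ?case using y mult_left by (simp add: T.smult_r_distr)
  qed
  show "x \<diamondop> (c \<odot>\<^bsub>T\<^esub> y) = c \<odot>\<^bsub>T\<^esub> (x \<diamondop> y)" if y: "c \<in> carrier k" "y \<in> carrier T" for c y
    using x
  proof (induction rule: T_induct)
    case (tens w)
    then show ?case unfolding sha_mult using y linear_onD(3)[OF r[OF tens]] by (simp add: te)
  next
    case (add x x')
    then show ?case using y mult_left by (simp add: T.smult_r_distr)
  next
    case (smult d x)
    then show ?case using y mult_left by (simp add: T.smult_assoc1[symmetric] R.m_comm)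
  qed
qed

lemmas mult_right = linear_onD[OF mult_linear_right]

lemma sha_m_comm:
  assumes x: "x \<in> carrier T" and y: "y \<in> carrier T"
  shows "x \<diamondop> y = y \<diamondop> x"
proof (rule linear_eqI[OF mult_linear_left[OF y] mult_linear_right[OF y] x])
  fix u assume u: "u \<in> words A"
  note tu = tens_closed[OF u]
  show "tens u \<diamondop> y = y \<diamondop> tens u"
    by (rule linear_eqI[OF mult_linear_right[OF tu] mult_linear_left[OF tu] y])
      (simp add: mult_tens u Sh_comm)
qed

abbreviation "\<eta> a \<equiv> tens [a]"
abbreviation "PA \<equiv> sha_P k A"

lemma eta_closed [simp, intro]: "a \<in> carrier A \<Longrightarrow> \<eta> a \<in> carrier T"
  by (auto intro: tens_closed simp: words_def)

lemma PA_linear: "linear_on k T T PA"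
  unfolding sha_P_def by (rule pre_linear) simp

lemmas PA = linear_onD[OF PA_linear]

lemma PA_tens: "w \<in> words A \<Longrightarrow> PA (tens w) = tens (\<one>\<^bsub>A\<^esub> # w)"
  by (simp add: sha_P_def pre_tens)

lemma eta_mult_tens: "a \<in> carrier A \<Longrightarrow> b # w \<in> words A \<Longrightarrow> \<eta> a \<diamondop> tens (b # w) = tens ((a \<otimes>\<^bsub>A\<^esub> b) # w)"
  by (simp add: mult_tens words_def Sh_single_left)

lemma eta_mult: "a \<in> carrier A \<Longrightarrow> b \<in> carrier A \<Longrightarrow> \<eta> a \<diamondop> \<eta> b = \<eta> (a \<otimes>\<^bsub>A\<^esub> b)"
  by (simp add: eta_mult_tens words_def)

lemma eta_pre:
  assumes "a \<in> carrier A" "b \<in> carrier A" "x \<in> carrier T"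
  shows "\<eta> a \<diamondop> pre b x = pre (a \<otimes>\<^bsub>A\<^esub> b) x"
  by (rule linear_eqI[OF linear_on_comp[OF pre_linear[OF assms(2)] mult_linear_right[OF eta_closed[OF assms(1)]]] pre_linear assms(3)])
    (use assms in \<open>auto simp: pre_tens eta_mult_tens words_def\<close>)

lemma pre_eq: "a \<in> carrier A \<Longrightarrow> x \<in> carrier T \<Longrightarrow> pre a x = \<eta> a \<diamondop> PA x"
  by (simp add: sha_P_def eta_pre)

text \<open>The recursive definition of the product, extended from words to all elements: with \<open>pre a x = a P(x)\<close>
  it reads
  \<open>aP(x) \<diamondop> bP(y) = ab P(x \<diamondop> P(y) + P(x) \<diamondop> y + \<lambda> x \<diamondop> y)\<close>.\<close>

lemma pre_mult_pre:
  assumes a: "a \<in> carrier A" and b: "b \<in> carrier A" and x: "x \<in> carrier T" and y: "y \<in> carrier T"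
  shows "pre a x \<diamondop> pre b y = pre (a \<otimes>\<^bsub>A\<^esub> b)
    (x \<diamondop> PA y \<oplus>\<^bsub>T\<^esub> PA x \<diamondop> y \<oplus>\<^bsub>T\<^esub> lam \<odot>\<^bsub>T\<^esub> (x \<diamondop> y))"
proof -
  have ab: "a \<otimes>\<^bsub>A\<^esub> b \<in> carrier A" using a b by simp
  have lin: "linear_on k T T (\<lambda>x. pre (a \<otimes>\<^bsub>A\<^esub> b)
      (x \<diamondop> PA y \<oplus>\<^bsub>T\<^esub> PA x \<diamondop> y \<oplus>\<^bsub>T\<^esub> lam \<odot>\<^bsub>T\<^esub> (x \<diamondop> y)))" if y: "y \<in> carrier T" for y
    by (rule linear_on_comp[OF _ pre_linear[OF ab]])
      (intro linear_on_add linear_on_smult T_module mult_linear_left y PA(1) lam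
        linear_on_comp[OF PA_linear mult_linear_left])
  have lin': "linear_on k T T (\<lambda>y. pre (a \<otimes>\<^bsub>A\<^esub> b)
      (x \<diamondop> PA y \<oplus>\<^bsub>T\<^esub> PA x \<diamondop> y \<oplus>\<^bsub>T\<^esub> lam \<odot>\<^bsub>T\<^esub> (x \<diamondop> y)))" if x: "x \<in> carrier T" for x
    by (rule linear_on_comp[OF _ pre_linear[OF ab]])
      (intro linear_on_add linear_on_smult T_module mult_linear_right x PA(1) lam
        linear_on_comp[OF PA_linear mult_linear_right])
  show ?thesis
  proof (rule linear_eqI[OF linear_on_comp[OF pre_linear[OF a] mult_linear_left[OF pre_lin(1)[OF b y]]] lin[OF y] x])
    fix u assume u: "u \<in> words A"
    note tu = tens_closed[OF u]
    show "pre a (tens u) \<diamondop> pre b y = pre (a \<otimes>\<^bsub>A\<^esub> b)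
       (tens u \<diamondop> PA y \<oplus>\<^bsub>T\<^esub> PA (tens u) \<diamondop> y \<oplus>\<^bsub>T\<^esub> lam \<odot>\<^bsub>T\<^esub> (tens u \<diamondop> y))"
    proof (rule linear_eqI[OF linear_on_comp[OF pre_linear[OF b] mult_linear_right[OF pre_lin(1)[OF a tu]]] lin'[OF tu] y])
      fix v assume v: "v \<in> words A"
      have ne: "u \<noteq> []" "v \<noteq> []" using u v by (auto simp: words_def)
      have w: "a # u \<in> words A" "b # v \<in> words A" "\<one>\<^bsub>A\<^esub> # u \<in> words A" "\<one>\<^bsub>A\<^esub> # v \<in> words A"
        using u v a b by (auto simp: words_def)
      show "pre a (tens u) \<diamondop> pre b (tens v) = pre (a \<otimes>\<^bsub>A\<^esub> b)
         (tens u \<diamondop> PA (tens v) \<oplus>\<^bsub>T\<^esub> PA (tens u) \<diamondop> tens v \<oplus>\<^bsub>T\<^esub> lam \<odot>\<^bsub>T\<^esub> (tens u \<diamondop> tens v))"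
        using w u v by (simp add: pre_tens PA_tens mult_tens a b Sh_step ne)
    qed
  qed
qed

lemma PA_mult:
  assumes "x \<in> carrier T" "y \<in> carrier T"
  shows "PA x \<diamondop> PA y = PA (x \<diamondop> PA y \<oplus>\<^bsub>T\<^esub> PA x \<diamondop> y \<oplus>\<^bsub>T\<^esub> lam \<odot>\<^bsub>T\<^esub> (x \<diamondop> y))"
  using pre_mult_pre[OF _ _ assms, of "\<one>\<^bsub>A\<^esub>" "\<one>\<^bsub>A\<^esub>"] by (simp add: sha_P_def)

lemma tens_cases:
  assumes "w \<in> words A"
  obtains a where "a \<in> carrier A" "tens w = \<eta> a" "length w = 1"
    | a v where "a \<in> carrier A" "v \<in> words A" "tens w = pre a (tens v)" "length w = Suc (length v)"
  using words_cases[OF assms] by (metis One_nat_def length_Cons list.size(3) pre_tens)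

text \<open>A factor from \<open>A\<close> only multiplies the first letter, so associativity with such a factor reduces to
  associativity in \<open>A\<close>.\<close>

lemma eta_assoc:
  assumes a: "a \<in> carrier A" and x: "x \<in> carrier T" and y: "y \<in> carrier T"
  shows "(\<eta> a \<diamondop> x) \<diamondop> y = \<eta> a \<diamondop> (x \<diamondop> y)"
proof -
  note ea = eta_closed[OF a] note lr = mult_linear_right[OF ea]
  have t: "(\<eta> a \<diamondop> tens u) \<diamondop> tens v = \<eta> a \<diamondop> (tens u \<diamondop> tens v)"
    if u: "u \<in> words A" and v: "v \<in> words A" for u v
    using u
  proof (cases rule: tens_cases)
    case b: (1 b)
    show ?thesis using v
    proof (cases rule: tens_cases)
      case c: (1 c)
      then show ?thesis using a b by (simp add: eta_mult m_assoc)
    next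
      case c: (2 c w)
      then show ?thesis using a b by (simp add: eta_mult eta_pre tens_closed m_assoc)
    qed
  next
    case b: (2 b u')
    note tb = tens_closed[OF b(2)] note pb = pre_lin(1)[OF _ tb]
    show ?thesis using v
    proof (cases rule: tens_cases)
      case c: (1 c)
      have "pre b (tens u') \<diamondop> \<eta> c = \<eta> c \<diamondop> pre b (tens u')"
        "pre (a \<otimes>\<^bsub>A\<^esub> b) (tens u') \<diamondop> \<eta> c = \<eta> c \<diamondop> pre (a \<otimes>\<^bsub>A\<^esub> b) (tens u')"
        using a b c pb by (auto intro!: sha_m_comm)
      then show ?thesis using a b c tb by (simp add: eta_pre m_ac)
    next
      case c: (2 c w)
      note tc = tens_closed[OF c(2)]
      have cl: "tens u' \<diamondop> PA (tens w) \<oplus>\<^bsub>T\<^esub> PA (tens u') \<diamondop> tens w \<oplus>\<^bsub>T\<^esub> lam \<odot>\<^bsub>T\<^esub> (tens u' \<diamondop> tens w) \<in> carrier T"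
        using tb tc by (simp add: mult_left(1) PA(1))
      show ?thesis using a b c tb tc cl by (simp add: eta_pre pre_mult_pre m_assoc)
    qed
  qed
  show ?thesis
  proof (rule linear_eqI[OF linear_on_comp[OF lr mult_linear_left[OF y]] linear_on_comp[OF mult_linear_left[OF y] lr] x])
    fix u assume u: "u \<in> words A"
    note tu = tens_closed[OF u]
    show "(\<eta> a \<diamondop> tens u) \<diamondop> y = \<eta> a \<diamondop> (tens u \<diamondop> y)"
      by (rule linear_eqI[OF mult_linear_right[OF mult_right(1)[OF ea tu]] linear_on_comp[OF mult_linear_right[OF tu] lr] y])
        (rule t[OF u])
  qed
qed

text \<open>By \<open>eta_assoc\<close> and commutativity, words of length one can be split off, which leaves three factors
  \<open>aP(x)\<close>, \<open>bP(y)\<close>, \<open>cP(z)\<close>. Expanding both bracketings by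
  \<open>pre_mult_pre\<close> gives seven products under \<open>P\<close> on each side, with factors among
  \<open>x\<close>, \<open>P(x)\<close> and so on, each of smaller total length than before; they match by the
  induction hypothesis.\<close>

lemma tens_assoc:
  assumes "u \<in> words A" "v \<in> words A" "w \<in> words A"
  shows "(tens u \<diamondop> tens v) \<diamondop> tens w = tens u \<diamondop> (tens v \<diamondop> tens w)"
  using assms
proof (induction "length u + length v + length w" arbitrary: u v w rule: less_induct)
  case less
  note u = less.prems(1) and v = less.prems(2) and w = less.prems(3)
  note tu = tens_closed[OF u] and tv = tens_closed[OF v] and tw = tens_closed[OF w]
  note cl = mult_left(1)
  show ?case using u
  proof (cases rule: tens_cases)
    case (1 a)
    then show ?thesis using eta_assoc tv tw by simp
  next
    case a: (2 a u')
    show ?thesis using v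
    proof (cases rule: tens_cases)
      case b: (1 b)
      have "(tens u \<diamondop> \<eta> b) \<diamondop> tens w = \<eta> b \<diamondop> (tens u \<diamondop> tens w)"
        using eta_assoc[OF b(1) tu tw] sha_m_comm[OF tu eta_closed[OF b(1)]] by simp
      also have "tens u \<diamondop> tens w = tens w \<diamondop> tens u" by (rule sha_m_comm[OF tu tw])
      also have "\<eta> b \<diamondop> (tens w \<diamondop> tens u) = (\<eta> b \<diamondop> tens w) \<diamondop> tens u"
        using eta_assoc[OF b(1) tw tu] by simp
      also have "\<dots> = tens u \<diamondop> (\<eta> b \<diamondop> tens w)"
        using sha_m_comm[OF cl[OF tw eta_closed[OF b(1)]] tu] by simp
      finally show ?thesis using b by simp
    next
      case b: (2 b v')
      show ?thesis using w
      proof (cases rule: tens_cases)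
        case c: (1 c)
        have "(tens u \<diamondop> tens v) \<diamondop> \<eta> c = \<eta> c \<diamondop> (tens v \<diamondop> tens u)"
          using sha_m_comm[OF cl[OF tv tu] eta_closed[OF c(1)]] sha_m_comm[OF tu tv] by simp
        also have "\<dots> = (\<eta> c \<diamondop> tens v) \<diamondop> tens u" using eta_assoc[OF c(1) tv tu] by simp
        also have "\<dots> = tens u \<diamondop> (tens v \<diamondop> \<eta> c)"
          using sha_m_comm[OF cl[OF tv eta_closed[OF c(1)]] tu] sha_m_comm[OF eta_closed[OF c(1)] tv] by simp
        finally show ?thesis using c by simp
      next
        case c: (2 c w')
        let ?x = "tens u'" and ?y = "tens v'" and ?z = "tens w'"
        note x = tens_closed[OF a(2)] and y = tens_closed[OF b(2)] and z = tens_closed[OF c(2)]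
        have wd: "\<one>\<^bsub>A\<^esub> # u' \<in> words A" "\<one>\<^bsub>A\<^esub> # v' \<in> words A" "\<one>\<^bsub>A\<^esub> # w' \<in> words A"
          using a b c by (auto simp: words_def)
        have IH: "(?x \<diamondop> PA ?y) \<diamondop> PA ?z = ?x \<diamondop> (PA ?y \<diamondop> PA ?z)"
          "(PA ?x \<diamondop> ?y) \<diamondop> PA ?z = PA ?x \<diamondop> (?y \<diamondop> PA ?z)"
          "(PA ?x \<diamondop> PA ?y) \<diamondop> ?z = PA ?x \<diamondop> (PA ?y \<diamondop> ?z)"
          "(?x \<diamondop> ?y) \<diamondop> PA ?z = ?x \<diamondop> (?y \<diamondop> PA ?z)"
          "(?x \<diamondop> PA ?y) \<diamondop> ?z = ?x \<diamondop> (PA ?y \<diamondop> ?z)"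
          "(PA ?x \<diamondop> ?y) \<diamondop> ?z = PA ?x \<diamondop> (?y \<diamondop> ?z)"
          "(?x \<diamondop> ?y) \<diamondop> ?z = ?x \<diamondop> (?y \<diamondop> ?z)"
          using less.hyps[OF _ a(2) wd(2) wd(3)] less.hyps[OF _ wd(1) b(2) wd(3)] less.hyps[OF _ wd(1) wd(2) c(2)]
            less.hyps[OF _ a(2) b(2) wd(3)] less.hyps[OF _ a(2) wd(2) c(2)] less.hyps[OF _ wd(1) b(2) c(2)]
            less.hyps[OF _ a(2) b(2) c(2)] a(4) b(4) c(4)
          by (simp_all add: PA_tens a b c)
        let ?xy = "?x \<diamondop> PA ?y \<oplus>\<^bsub>T\<^esub> PA ?x \<diamondop> ?y \<oplus>\<^bsub>T\<^esub> lam \<odot>\<^bsub>T\<^esub> (?x \<diamondop> ?y)"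
        let ?yz = "?y \<diamondop> PA ?z \<oplus>\<^bsub>T\<^esub> PA ?y \<diamondop> ?z \<oplus>\<^bsub>T\<^esub> lam \<odot>\<^bsub>T\<^esub> (?y \<diamondop> ?z)"
        have xy: "?xy \<in> carrier T" and yz: "?yz \<in> carrier T" using x y z by (simp_all add: cl PA(1))
        have "(pre a ?x \<diamondop> pre b ?y) \<diamondop> pre c ?z = pre (a \<otimes>\<^bsub>A\<^esub> b \<otimes>\<^bsub>A\<^esub> c)
            (?xy \<diamondop> PA ?z \<oplus>\<^bsub>T\<^esub> PA ?xy \<diamondop> ?z \<oplus>\<^bsub>T\<^esub> lam \<odot>\<^bsub>T\<^esub> (?xy \<diamondop> ?z))"
          using a b c x y z xy by (simp add: pre_mult_pre)
        also have "PA ?xy = PA ?x \<diamondop> PA ?y" by (rule PA_mult[OF x y, symmetric])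
        also have "?xy \<diamondop> PA ?z \<oplus>\<^bsub>T\<^esub> (PA ?x \<diamondop> PA ?y) \<diamondop> ?z \<oplus>\<^bsub>T\<^esub> lam \<odot>\<^bsub>T\<^esub> (?xy \<diamondop> ?z)
          = ?x \<diamondop> (PA ?y \<diamondop> PA ?z) \<oplus>\<^bsub>T\<^esub> PA ?x \<diamondop> ?yz \<oplus>\<^bsub>T\<^esub> lam \<odot>\<^bsub>T\<^esub> (?x \<diamondop> ?yz)"
          using x y z by (simp add: cl PA(1) mult_left(2,3) mult_right(2,3) IH T.smult_r_distr T.M.a_ac)
        also have "PA ?y \<diamondop> PA ?z = PA ?yz" by (rule PA_mult[OF y z])
        also have "pre (a \<otimes>\<^bsub>A\<^esub> b \<otimes>\<^bsub>A\<^esub> c) (?x \<diamondop> PA ?yz \<oplus>\<^bsub>T\<^esub> PA ?x \<diamondop> ?yz \<oplus>\<^bsub>T\<^esub> lam \<odot>\<^bsub>T\<^esub> (?x \<diamondop> ?yz))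
          = pre a ?x \<diamondop> (pre b ?y \<diamondop> pre c ?z)"
          using a b c x y z yz by (simp add: pre_mult_pre m_assoc)
        finally show ?thesis using a b c by simp
      qed
    qed
  qed
qed

lemma sha_m_assoc:
  assumes x: "x \<in> carrier T" and y: "y \<in> carrier T" and z: "z \<in> carrier T"
  shows "(x \<diamondop> y) \<diamondop> z = x \<diamondop> (y \<diamondop> z)"
proof (rule linear_eqI[OF linear_on_comp[OF mult_linear_left[OF y] mult_linear_left[OF z]]
      mult_linear_left[OF mult_left(1)[OF z y]] x])
  fix u assume u: "u \<in> words A"
  note tu = tens_closed[OF u]
  show "(tens u \<diamondop> y) \<diamondop> z = tens u \<diamondop> (y \<diamondop> z)"
  proof (rule linear_eqI[OF linear_on_comp[OF mult_linear_right[OF tu] mult_linear_left[OF z]]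
        linear_on_comp[OF mult_linear_left[OF z] mult_linear_right[OF tu]] y])
    fix v assume v: "v \<in> words A"
    note tv = tens_closed[OF v]
    show "(tens u \<diamondop> tens v) \<diamondop> z = tens u \<diamondop> (tens v \<diamondop> z)"
      by (rule linear_eqI[OF mult_linear_right[OF mult_left(1)[OF tv tu]]
            linear_on_comp[OF mult_linear_right[OF tv] mult_linear_right[OF tu]] z])
        (rule tens_assoc[OF u v])
  qed
qed

lemma sha_one:
  assumes "x \<in> carrier T" shows "\<eta> \<one>\<^bsub>A\<^esub> \<diamondop> x = x"
proof (rule linear_eqI[OF mult_linear_right _ assms])
  show "linear_on k T T (\<lambda>x. x)" by (rule linear_onI) auto
  show "\<eta> \<one>\<^bsub>A\<^esub> \<diamondop> tens w = tens w" if "w \<in> words A" for w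
    using that by (cases w) (auto simp: eta_mult_tens words_def)
qed simp

lemma sha_algebra: "algebra k SA"
proof (rule algebraI)
  show "cring SA"
  proof (rule cringI)
    show "abelian_group SA"
      by (rule abelian_groupI)
        (use T.M.a_ac T.M.a_closed T.M.l_neg T.M.a_inv_closed in \<open>auto intro: exI\<close>)
    show "Group.comm_monoid SA"
    proof (rule comm_monoidI)
      show "x \<diamondop> y = y \<diamondop> x" if "x \<in> carrier SA" "y \<in> carrier SA" for x y
        using that sha_m_comm by simp
    qed (simp_all add: mult_left(1) sha_m_assoc sha_one)
  qed (simp add: mult_left)
qed (auto simp: T.smult_l_distr T.smult_r_distr T.smult_assoc1 mult_left R.cring_axioms)

end


section \<open>The free Rota-Baxter algebra and its derivation\<close>

definition alg_map :: "('k, 'n) ring_scheme \<Rightarrow> ('k, 'a) module \<Rightarrow> ('k, 'b) module \<Rightarrow> ('a \<Rightarrow> 'b) \<Rightarrow> bool" where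
  "alg_map k A B f \<longleftrightarrow> f \<in> ring_hom A B \<and> (\<forall>c\<in>carrier k. \<forall>x\<in>carrier A. f (c \<odot>\<^bsub>A\<^esub> x) = c \<odot>\<^bsub>B\<^esub> f x)"

lemma alg_mapD:
  assumes "alg_map k A B f"
  shows "x \<in> carrier A \<Longrightarrow> f x \<in> carrier B"
    "\<lbrakk>x \<in> carrier A; y \<in> carrier A\<rbrakk> \<Longrightarrow> f (x \<otimes>\<^bsub>A\<^esub> y) = f x \<otimes>\<^bsub>B\<^esub> f y"
    "\<lbrakk>x \<in> carrier A; y \<in> carrier A\<rbrakk> \<Longrightarrow> f (x \<oplus>\<^bsub>A\<^esub> y) = f x \<oplus>\<^bsub>B\<^esub> f y"
    "f \<one>\<^bsub>A\<^esub> = \<one>\<^bsub>B\<^esub>"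
    "\<lbrakk>c \<in> carrier k; x \<in> carrier A\<rbrakk> \<Longrightarrow> f (c \<odot>\<^bsub>A\<^esub> x) = c \<odot>\<^bsub>B\<^esub> f x"
  using assms by (auto simp: alg_map_def ring_hom_def)

lemma alg_mapI:
  assumes "\<And>x. x \<in> carrier A \<Longrightarrow> f x \<in> carrier B"
    "\<And>x y. \<lbrakk>x \<in> carrier A; y \<in> carrier A\<rbrakk> \<Longrightarrow> f (x \<otimes>\<^bsub>A\<^esub> y) = f x \<otimes>\<^bsub>B\<^esub> f y"
    "\<And>x y. \<lbrakk>x \<in> carrier A; y \<in> carrier A\<rbrakk> \<Longrightarrow> f (x \<oplus>\<^bsub>A\<^esub> y) = f x \<oplus>\<^bsub>B\<^esub> f y"
    "f \<one>\<^bsub>A\<^esub> = \<one>\<^bsub>B\<^esub>"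
    "\<And>c x. \<lbrakk>c \<in> carrier k; x \<in> carrier A\<rbrakk> \<Longrightarrow> f (c \<odot>\<^bsub>A\<^esub> x) = c \<odot>\<^bsub>B\<^esub> f x"
  shows "alg_map k A B f"
  using assms by (auto simp: alg_map_def ring_hom_def)

lemma alg_map_linear: "alg_map k A B f \<Longrightarrow> linear_on k A B f"
  by (rule linear_onI) (auto simp: alg_mapD)

text \<open>Rota-Baxter operators and derivations whose values outside the carrier are arbitrary. The operators on
  \<open>Sha(A)\<close> and on sequences have this form before they are restricted to a carrier.\<close>

definition rb_op :: "('k, 'n) ring_scheme \<Rightarrow> 'k \<Rightarrow> ('k, 'a) module \<Rightarrow> ('a \<Rightarrow> 'a) \<Rightarrow> bool" where
  "rb_op k lam R P \<longleftrightarrow> linear_on k R R P \<and> (\<forall>x\<in>carrier R. \<forall>y\<in>carrier R.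
     P x \<otimes>\<^bsub>R\<^esub> P y = P (x \<otimes>\<^bsub>R\<^esub> P y) \<oplus>\<^bsub>R\<^esub> P (y \<otimes>\<^bsub>R\<^esub> P x) \<oplus>\<^bsub>R\<^esub> lam \<odot>\<^bsub>R\<^esub> P (x \<otimes>\<^bsub>R\<^esub> y))"

definition wt_deriv :: "('k, 'n) ring_scheme \<Rightarrow> 'k \<Rightarrow> ('k, 'a) module \<Rightarrow> ('a \<Rightarrow> 'a) \<Rightarrow> bool" where
  "wt_deriv k lam R d \<longleftrightarrow> linear_on k R R d \<and> (\<forall>x\<in>carrier R. \<forall>y\<in>carrier R.
     d (x \<otimes>\<^bsub>R\<^esub> y) = d x \<otimes>\<^bsub>R\<^esub> y \<oplus>\<^bsub>R\<^esub> x \<otimes>\<^bsub>R\<^esub> d y \<oplus>\<^bsub>R\<^esub> lam \<odot>\<^bsub>R\<^esub> (d x \<otimes>\<^bsub>R\<^esub> d y)) \<and> d \<one>\<^bsub>R\<^esub> = \<zero>\<^bsub>R\<^esub>"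

lemma rota_baxter_iff: "rota_baxter k lam R P \<longleftrightarrow> rb_op k lam R P \<and> P \<in> extensional (carrier R)"
  by (auto simp: rota_baxter_def rb_op_def linear_op_def linear_on_def PiE_def)

lemma weighted_derivation_iff: "weighted_derivation k lam R d \<longleftrightarrow> wt_deriv k lam R d \<and> d \<in> extensional (carrier R)"
  by (auto simp: weighted_derivation_def wt_deriv_def linear_op_def linear_on_def PiE_def)

lemma ev_word_Cons: "w \<noteq> [] \<Longrightarrow> ev_word B Q (x # w) = x \<otimes>\<^bsub>B\<^esub> Q (ev_word B Q w)"
  by (cases w) auto

context weighted_algebra begin

lemma sha_PA_rb: "rb_op k lam SA PA"
proof -
  have "PA x \<diamondop> PA y = PA (x \<diamondop> PA y) \<oplus>\<^bsub>T\<^esub> PA (y \<diamondop> PA x) \<oplus>\<^bsub>T\<^esub> lam \<odot>\<^bsub>T\<^esub> PA (x \<diamondop> y)"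
    if "x \<in> carrier T" "y \<in> carrier T" for x y
    using that by (simp add: PA_mult PA mult_left(1) sha_m_comm[of "PA x" y])
  then show ?thesis using PA_linear by (simp add: rb_op_def linear_on_def)
qed

lemma eta_alg_map: "alg_map k A SA \<eta>"
proof (rule alg_mapI)
  show "\<eta> (x \<oplus>\<^bsub>A\<^esub> y) = \<eta> x \<oplus>\<^bsub>SA\<^esub> \<eta> y" if "x \<in> carrier A" "y \<in> carrier A" for x y
    using multilinearD(2)[OF tens_multilinear, of "[]" "[]"] that by simp
  show "\<eta> (c \<odot>\<^bsub>A\<^esub> x) = c \<odot>\<^bsub>SA\<^esub> \<eta> x" if "c \<in> carrier k" "x \<in> carrier A" for x c
    using multilinearD(3)[OF tens_multilinear, of "[]" "[]"] that by simp
qed (auto simp: eta_mult)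

lemma tens_Cons: "a \<in> carrier A \<Longrightarrow> w \<in> words A \<Longrightarrow> tens (a # w) = \<eta> a \<diamondop> PA (tens w)"
  using pre_tens pre_eq tens_closed by simp

text \<open>A pure tensor is \<open>a \<diamondop> P(w)\<close> with \<open>w\<close> a shorter one.\<close>

lemma free_hom_unique:
  assumes h: "alg_map k SA B h" and g: "alg_map k SA B g"
    and hP: "\<And>x. x \<in> carrier T \<Longrightarrow> h (PA x) = Q (h x)" and gP: "\<And>x. x \<in> carrier T \<Longrightarrow> g (PA x) = Q (g x)"
    and e: "\<And>a. a \<in> carrier A \<Longrightarrow> h (\<eta> a) = g (\<eta> a)" and x: "x \<in> carrier T"
  shows "h x = g x"
proof -
  note hD = alg_mapD[OF h] and gD = alg_mapD[OF g]
  have l: "linear_on k T B h" "linear_on k T B g"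
    using alg_map_linear[OF h] alg_map_linear[OF g] by (auto simp: linear_on_def)
  have "h (tens w) = g (tens w)" if "w \<in> words A" for w
    using that
  proof (induction w)
    case (Cons a w)
    show ?case
    proof (cases w)
      case Nil then show ?thesis using e Cons by (simp add: words_def)
    next
      case (Cons b w')
      then have w: "w \<in> words A" "a \<in> carrier A" using Cons.prems by (auto simp: words_def)
      note tw = tens_closed[OF w(1)]
      show ?thesis using w tw Cons.IH hD(2) gD(2) PA(1)[OF tw] hP gP e by (simp add: tens_Cons)
    qed
  qed (simp add: words_def)
  then show ?thesis by (rule linear_eqI[OF l x])
qed

end

text \<open>The extension of \<open>f : A \<rightarrow> B\<close> to \<open>Sha(A)\<close>. For \<open>B = A\<close> and
  \<open>f = id\<close> it is the evaluation, and for a homomorphism from \<open>A\<close> to \<open>A'\<close>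
  followed by the inclusion of \<open>A'\<close> into \<open>Sha(A')\<close> it is the induced map from
  \<open>Sha(A)\<close> to \<open>Sha(A')\<close>.\<close>

locale rb_extension = weighted_algebra k A lam + B: algebra k B
  for k :: "('k, 'n) ring_scheme" (structure) and A :: "('k, 'a) module" (structure) and lam
    and B :: "('k, 'b) module" +
  fixes Q f
  assumes Q: "rb_op k lam B Q" and f: "alg_map k A B f"

sublocale rb_extension \<subseteq> TB: tensor_target k A B ..

context rb_extension begin

lemma Q_linear: "linear_on k B B Q"
  and Q_rb: "\<lbrakk>x \<in> carrier B; y \<in> carrier B\<rbrakk> \<Longrightarrow>
     Q x \<otimes>\<^bsub>B\<^esub> Q y = Q (x \<otimes>\<^bsub>B\<^esub> Q y) \<oplus>\<^bsub>B\<^esub> Q (y \<otimes>\<^bsub>B\<^esub> Q x) \<oplus>\<^bsub>B\<^esub> lam \<odot>\<^bsub>B\<^esub> Q (x \<otimes>\<^bsub>B\<^esub> y)"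
  using Q by (auto simp: rb_op_def)

lemmas QL = linear_onD[OF Q_linear]
lemmas fD = alg_mapD[OF f]

definition "word_value w = ev_word B Q (map f w)"

lemma word_value_Cons: "w \<noteq> [] \<Longrightarrow> word_value (x # w) = f x \<otimes>\<^bsub>B\<^esub> Q (word_value w)"
  and word_value_single: "word_value [x] = f x"
  by (simp_all add: word_value_def ev_word_Cons)

lemma word_value_closed: "w \<in> words A \<Longrightarrow> word_value w \<in> carrier B"
proof (induction w)
  case (Cons a w)
  then show ?case using QL(1) fD(1)
    by (cases "w = []") (auto simp: word_value_Cons word_value_single words_def)
qed (simp add: words_def)

lemma word_value_multilinear: "multilinear k A B word_value"
proof (rule multilinearI)
  fix p q assume p: "set p \<subseteq> carrier A" and q: "set q \<subseteq> carrier A"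
  note mult = linear_on_mult[OF B.algebra_axioms]
  show "linear_on k A B (\<lambda>a. word_value (p @ a # q))"
    using p
  proof (induction p)
    case Nil
    have "Q (word_value q) \<in> carrier B" if "q \<noteq> []"
      by (intro QL(1) word_value_closed) (use that q in \<open>simp add: words_def\<close>)
    then show ?case using alg_map_linear[OF f] linear_on_comp[OF alg_map_linear[OF f] mult(1)]
      by (cases "q = []") (simp_all add: word_value_Cons word_value_single)
  next
    case (Cons c p)
    then have IH: "linear_on k A B (\<lambda>a. word_value (p @ a # q))" and c: "c \<in> carrier A" by simp_all
    show ?case using linear_on_comp[OF linear_on_comp[OF IH Q_linear] mult(2)[OF fD(1)[OF c]]]
      by (simp add: word_value_Cons)
  qed
qed

definition "lift = lin_ext k B word_value"

lemma lift_tens: "w \<in> words A \<Longrightarrow> lift (tens w) = word_value w"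
  unfolding lift_def by (rule TB.lin_ext_tens[OF word_value_multilinear])

lemma lift_linear: "linear_on k T B lift"
  unfolding lift_def by (rule TB.lin_ext_linear[OF word_value_multilinear])

lemmas extL = linear_onD[OF lift_linear]

lemma lift_eta: "a \<in> carrier A \<Longrightarrow> lift (\<eta> a) = f a"
  by (simp add: lift_tens word_value_single words_def)

lemma lift_pre:
  assumes a: "a \<in> carrier A" and x: "x \<in> carrier T"
  shows "lift (pre a x) = f a \<otimes>\<^bsub>B\<^esub> Q (lift x)"
proof (rule linear_eqI[OF linear_on_comp[OF pre_linear[OF a] lift_linear] _ x])
  show "linear_on k T B (\<lambda>x. f a \<otimes>\<^bsub>B\<^esub> Q (lift x))"
    by (rule linear_on_comp[OF linear_on_comp[OF lift_linear Q_linear] linear_on_mult(2)[OF B.algebra_axioms fD(1)[OF a]]])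
  show "lift (pre a (tens w)) = f a \<otimes>\<^bsub>B\<^esub> Q (lift (tens w))" if "w \<in> words A" for w
    using that a by (simp add: pre_tens lift_tens words_def word_value_Cons)
qed

lemma lift_PA: "x \<in> carrier T \<Longrightarrow> lift (PA x) = Q (lift x)"
  using lift_pre[of "\<one>\<^bsub>A\<^esub>" x] fD(4) QL(1)[OF extL(1), of x] by (simp add: sha_P_def)

text \<open>On \<open>aP(x) \<diamondop> bP(y)\<close> both sides expand in the same way, the left one by
  \<open>pre_mult_pre\<close> and the induction hypothesis for shorter words, the right one by the Rota-Baxter
  identity in \<open>B\<close>.\<close>

lemma lift_mult_tens:
  assumes "u \<in> words A" "v \<in> words A"
  shows "lift (tens u \<diamondop> tens v) = lift (tens u) \<otimes>\<^bsub>B\<^esub> lift (tens v)"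
  using assms
proof (induction "length u + length v" arbitrary: u v rule: less_induct)
  case less
  note tu = tens_closed[OF less.prems(1)] and tv = tens_closed[OF less.prems(2)]
  show ?case using less.prems(1)
  proof (cases rule: tens_cases)
    case a: (1 a)
    show ?thesis using less.prems(2)
    proof (cases rule: tens_cases)
      case b: (1 b)
      then show ?thesis using a fD(2) by (simp add: eta_mult lift_eta)
    next
      case b: (2 b v')
      note t = tens_closed[OF b(2)]
      then show ?thesis using a b fD(1,2) QL(1) extL(1)[OF t]
        by (simp add: eta_pre lift_eta lift_pre B.m_assoc)
    qed
  next
    case a: (2 a u')
    note t = tens_closed[OF a(2)]
    show ?thesis using less.prems(2)
    proof (cases rule: tens_cases)
      case b: (1 b)
      have "lift (tens u \<diamondop> tens v) = lift (\<eta> b \<diamondop> pre a (tens u'))"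
        using sha_m_comm[OF tu tv] a b by simp
      also have "\<dots> = lift (tens u) \<otimes>\<^bsub>B\<^esub> lift (tens v)"
        using a b t fD(1,2) QL(1) extL(1)[OF t] by (simp add: eta_pre lift_eta lift_pre B.m_ac)
      finally show ?thesis .
    next
      case b: (2 b v')
      note t' = tens_closed[OF b(2)]
      let ?x = "tens u'" and ?y = "tens v'"
      have wd: "\<one>\<^bsub>A\<^esub> # u' \<in> words A" "\<one>\<^bsub>A\<^esub> # v' \<in> words A" using a b by (auto simp: words_def)
      have IH: "lift (?x \<diamondop> PA ?y) = lift ?x \<otimes>\<^bsub>B\<^esub> Q (lift ?y)"
        "lift (PA ?x \<diamondop> ?y) = Q (lift ?x) \<otimes>\<^bsub>B\<^esub> lift ?y"
        "lift (?x \<diamondop> ?y) = lift ?x \<otimes>\<^bsub>B\<^esub> lift ?y"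
        using less.hyps[OF _ a(2) wd(2)] less.hyps[OF _ wd(1) b(2)] less.hyps[OF _ a(2) b(2)] a(4) b(4)
          lift_PA[OF t] lift_PA[OF t']
        by (simp_all add: PA_tens a b)
      note e = extL(1)[OF t] extL(1)[OF t'] note eq = QL(1)[OF e(1)] QL(1)[OF e(2)]
      have "Q (lift (?x \<diamondop> PA ?y \<oplus>\<^bsub>T\<^esub> PA ?x \<diamondop> ?y \<oplus>\<^bsub>T\<^esub> lam \<odot>\<^bsub>T\<^esub> (?x \<diamondop> ?y)))
        = Q (lift ?x) \<otimes>\<^bsub>B\<^esub> Q (lift ?y)"
        using t t' e eq Q_rb[OF e]
        by (simp add: extL IH QL mult_left(1) PA(1) B.m_comm[of "lift ?y"])
      then show ?thesis using a b t t' e eq fD(1,2)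
        by (simp add: pre_mult_pre lift_pre mult_left(1) PA(1) B.m_ac)
    qed
  qed
qed

lemma lift_alg_map: "alg_map k SA B lift"
proof (rule alg_mapI)
  fix x y assume "x \<in> carrier SA" "y \<in> carrier SA"
  then have x: "x \<in> carrier T" and y: "y \<in> carrier T" by simp_all
  note bl = linear_on_mult[OF B.algebra_axioms]
  show "lift (x \<diamondop> y) = lift x \<otimes>\<^bsub>B\<^esub> lift y"
  proof (rule linear_eqI[OF linear_on_comp[OF mult_linear_left[OF y] lift_linear]
        linear_on_comp[OF lift_linear bl(1)[OF extL(1)[OF y]]] x])
    fix u assume u: "u \<in> words A"
    note tu = tens_closed[OF u]
    show "lift (tens u \<diamondop> y) = lift (tens u) \<otimes>\<^bsub>B\<^esub> lift y"
      by (rule linear_eqI[OF linear_on_comp[OF mult_linear_right[OF tu] lift_linear]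
          linear_on_comp[OF lift_linear bl(2)[OF extL(1)[OF tu]]] y])
        (rule lift_mult_tens[OF u])
  qed
qed (auto simp: extL lift_eta fD)

end

text \<open>The second component of the product of \<open>(u, u')\<close> and \<open>(v, v')\<close> in the commutative ring of
  pairs in which \<open>u \<mapsto> (u, d u)\<close> is multiplicative exactly if \<open>d\<close> is a derivation of
  weight \<open>l\<close>.\<close>

definition (in cring) leib :: "'a \<Rightarrow> 'a \<Rightarrow> 'a \<Rightarrow> 'a \<Rightarrow> 'a \<Rightarrow> 'a" where
  "leib l u u' v v' = u' \<otimes> v \<oplus> u \<otimes> v' \<oplus> l \<otimes> (u' \<otimes> v')"

context cring begin

lemma leib_closed: "\<lbrakk>l \<in> carrier R; u \<in> carrier R; u' \<in> carrier R; v \<in> carrier R; v' \<in> carrier R\<rbrakk> \<Longrightarrow> leib l u u' v v' \<in> carrier R"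
  by (simp add: leib_def)

lemma leib_comm: "\<lbrakk>l \<in> carrier R; u \<in> carrier R; u' \<in> carrier R; v \<in> carrier R; v' \<in> carrier R\<rbrakk>
    \<Longrightarrow> leib l u u' v v' = leib l v v' u u'"
  by (simp add: leib_def m_comm a_comm)

lemma leib_assoc:
  assumes "l \<in> carrier R" "u \<in> carrier R" "u' \<in> carrier R" "v \<in> carrier R" "v' \<in> carrier R" "w \<in> carrier R" "w' \<in> carrier R"
  shows "leib l (u \<otimes> v) (leib l u u' v v') w w' = leib l u u' (v \<otimes> w) (leib l v v' w w')"
  using assms by (simp add: leib_def l_distr r_distr m_ac a_ac)

text \<open>Exchange of the two middle factors in a product of four pairs.\<close>

lemma leib_medial:
  assumes "l \<in> carrier R" "a \<in> carrier R" "a' \<in> carrier R" "b \<in> carrier R" "b' \<in> carrier R"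
    "x \<in> carrier R" "x' \<in> carrier R" "y \<in> carrier R" "y' \<in> carrier R"
  shows "leib l (a \<otimes> b) (leib l a a' b b') (x \<otimes> y) (leib l x x' y y')
    = leib l (a \<otimes> x) (leib l a a' x x') (b \<otimes> y) (leib l b b' y y')"
proof -
  have "leib l b b' (x \<otimes> y) (leib l x x' y y') = leib l (b \<otimes> x) (leib l b b' x x') y y'"
    using assms by (simp add: leib_assoc)
  also have "\<dots> = leib l (x \<otimes> b) (leib l x x' b b') y y'"
    using assms by (simp add: leib_comm[of l b b' x x'] m_comm)
  also have "\<dots> = leib l x x' (b \<otimes> y) (leib l b b' y y')"
    using assms by (simp add: leib_assoc)
  finally have e: "leib l b b' (x \<otimes> y) (leib l x x' y y') = leib l x x' (b \<otimes> y) (leib l b b' y y')" .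
  have "leib l (a \<otimes> b) (leib l a a' b b') (x \<otimes> y) (leib l x x' y y')
    = leib l a a' (b \<otimes> (x \<otimes> y)) (leib l b b' (x \<otimes> y) (leib l x x' y y'))"
    using assms by (simp add: leib_assoc leib_closed)
  also have "\<dots> = leib l a a' (x \<otimes> (b \<otimes> y)) (leib l x x' (b \<otimes> y) (leib l b b' y y'))"
    using assms by (simp add: e m_lcomm)
  also have "\<dots> = leib l (a \<otimes> x) (leib l a a' x x') (b \<otimes> y) (leib l b b' y y')"
    using assms by (simp add: leib_assoc leib_closed)
  finally show ?thesis .
qed

end

locale wt_derivation = weighted_algebra k A lam
  for k :: "('k, 'n) ring_scheme" (structure) and A :: "('k, 'a) module" (structure) and lam +
  fixes d assumes d: "wt_deriv k lam A d"
begin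

lemma d_linear: "linear_on k A A d" and d_one: "d \<one>\<^bsub>A\<^esub> = \<zero>\<^bsub>A\<^esub>"
  and d_mult: "\<lbrakk>x \<in> carrier A; y \<in> carrier A\<rbrakk> \<Longrightarrow>
     d (x \<otimes>\<^bsub>A\<^esub> y) = d x \<otimes>\<^bsub>A\<^esub> y \<oplus>\<^bsub>A\<^esub> x \<otimes>\<^bsub>A\<^esub> d y \<oplus>\<^bsub>A\<^esub> lam \<odot>\<^bsub>A\<^esub> (d x \<otimes>\<^bsub>A\<^esub> d y)"
  using d by (auto simp: wt_deriv_def)

lemmas dL = linear_onD[OF d_linear]

abbreviation "dw \<equiv> sha_d_word k lam A d"
abbreviation "D \<equiv> sha_d k lam A d"

text \<open>With \<open>a \<otimes> w = aP(w)\<close> this is the Leibniz rule together with \<open>d(P(w)) = w\<close>.\<close>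

lemma dw_Cons:
  assumes "a \<in> carrier A" "w \<in> words A"
  shows "dw (a # w) = pre (d a) (tens w) \<oplus>\<^bsub>T\<^esub> \<eta> a \<diamondop> tens w \<oplus>\<^bsub>T\<^esub> lam \<odot>\<^bsub>T\<^esub> (\<eta> (d a) \<diamondop> tens w)"
proof -
  obtain b w' where w: "w = b # w'" using assms(2) by (cases w) (auto simp: words_def)
  show ?thesis using assms dL(1) by (simp add: w pre_tens eta_mult_tens)
qed

lemma dw_multilinear: "multilinear k A T dw"
proof (rule multilinearI)
  fix p q assume p: "set p \<subseteq> carrier A" and q: "set q \<subseteq> carrier A"
  have e: "linear_on k A T \<eta>" using tens_head_linear[of "[]"] by simp
  show "linear_on k A T (\<lambda>a. dw (p @ a # q))"
  proof (cases p)
    case Nil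
    show ?thesis
    proof (cases "q = []")
      case True
      then show ?thesis using linear_on_comp[OF d_linear e] by (simp add: Nil)
    next
      case False
      then have qw: "q \<in> words A" using q by (simp add: words_def)
      note t = tens_closed[OF qw]
      have "linear_on k A T (\<lambda>a. pre (d a) (tens q) \<oplus>\<^bsub>T\<^esub> \<eta> a \<diamondop> tens q \<oplus>\<^bsub>T\<^esub> lam \<odot>\<^bsub>T\<^esub> (\<eta> (d a) \<diamondop> tens q))"
        by (intro linear_on_add linear_on_smult T_module lam linear_on_comp[OF d_linear pre_linear_left[OF t]]
            linear_on_comp[OF e mult_linear_left[OF t]] linear_on_comp[OF linear_on_comp[OF d_linear e] mult_linear_left[OF t]])
      then show ?thesis by (simp add: Nil linear_on_def Pi_def dw_Cons qw)
    qed
  next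
    case (Cons c p')
    have c: "c \<in> carrier A" "set p' \<subseteq> carrier A" using p Cons by auto
    have "linear_on k T T (\<lambda>x. pre (d c) x \<oplus>\<^bsub>T\<^esub> \<eta> c \<diamondop> x \<oplus>\<^bsub>T\<^esub> lam \<odot>\<^bsub>T\<^esub> (\<eta> (d c) \<diamondop> x))"
      by (intro linear_on_add linear_on_smult T_module lam pre_linear mult_linear_right eta_closed dL(1) c)
    from linear_on_comp[OF multilinear_at[OF tens_multilinear c(2) q] this]
    show ?thesis using c q by (simp add: Cons linear_on_def Pi_def dw_Cons words_def)
  qed
qed

lemma D_tens: "w \<in> words A \<Longrightarrow> D (tens w) = dw w"
  unfolding sha_d_def by (rule TT.lin_ext_tens[OF dw_multilinear])

lemma D_linear: "linear_on k T T D"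
  unfolding sha_d_def by (rule TT.lin_ext_linear[OF dw_multilinear])

lemmas DL = linear_onD[OF D_linear]

lemma D_eta: "a \<in> carrier A \<Longrightarrow> D (\<eta> a) = \<eta> (d a)"
  by (simp add: D_tens words_def)

lemma D_pre:
  assumes a: "a \<in> carrier A" and x: "x \<in> carrier T"
  shows "D (pre a x) = pre (d a) x \<oplus>\<^bsub>T\<^esub> \<eta> a \<diamondop> x \<oplus>\<^bsub>T\<^esub> lam \<odot>\<^bsub>T\<^esub> (\<eta> (d a) \<diamondop> x)"
proof (rule linear_eqI[OF linear_on_comp[OF pre_linear[OF a] D_linear] _ x])
  show "linear_on k T T (\<lambda>x. pre (d a) x \<oplus>\<^bsub>T\<^esub> \<eta> a \<diamondop> x \<oplus>\<^bsub>T\<^esub> lam \<odot>\<^bsub>T\<^esub> (\<eta> (d a) \<diamondop> x))"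
    by (intro linear_on_add linear_on_smult T_module mult_linear_right pre_linear eta_closed dL(1) a lam)
  show "D (pre a (tens w)) = pre (d a) (tens w) \<oplus>\<^bsub>T\<^esub> \<eta> a \<diamondop> tens w \<oplus>\<^bsub>T\<^esub> lam \<odot>\<^bsub>T\<^esub> (\<eta> (d a) \<diamondop> tens w)"
    if "w \<in> words A" for w
    using that a by (simp add: pre_tens D_tens dw_Cons words_def[of A])
qed

lemma D_PA:
  assumes x: "x \<in> carrier T" shows "D (PA x) = x"
proof -
  interpret S: algebra k SA by (rule sha_algebra)
  have "pre \<zero>\<^bsub>A\<^esub> x = \<zero>\<^bsub>T\<^esub>"
    using linear_onD(3)[OF pre_linear_left[OF x], of "\<zero>\<^bsub>k\<^esub>" "\<one>\<^bsub>A\<^esub>"] x pre_lin(1) by simp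
  moreover have "\<eta> \<zero>\<^bsub>A\<^esub> = \<zero>\<^bsub>T\<^esub>"
    using alg_mapD(5)[OF eta_alg_map, of "\<zero>\<^bsub>k\<^esub>" "\<one>\<^bsub>A\<^esub>"] eta_closed[of "\<one>\<^bsub>A\<^esub>"] by simp
  moreover have "\<zero>\<^bsub>T\<^esub> \<diamondop> x = \<zero>\<^bsub>T\<^esub>" using S.l_null x by simp
  ultimately show ?thesis using D_pre[of "\<one>\<^bsub>A\<^esub>" x] x by (simp add: sha_P_def d_one sha_one)
qed

text \<open>The value of \<open>D\<close> at \<open>aP(x)\<close> is \<open>leib\<close> of the pairs \<open>(a, d a)\<close>
  and \<open>(P(x), x)\<close>, and \<open>P(x) \<diamondop> P(y) = P(z)\<close> with \<open>z\<close> the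
  \<open>leib\<close> of \<open>(P(x), x)\<close> and \<open>(P(y), y)\<close>. Hence the Leibniz rule at
  \<open>aP(x)\<close>, \<open>bP(y)\<close> is \<open>leib_medial\<close>, and at \<open>a\<close>,
  \<open>bP(y)\<close> it is \<open>leib_assoc\<close>.\<close>

lemma D_mult_tens:
  assumes u: "u \<in> words A" and v: "v \<in> words A"
  shows "D (tens u \<diamondop> tens v) = D (tens u) \<diamondop> tens v \<oplus>\<^bsub>T\<^esub> tens u \<diamondop> D (tens v)
      \<oplus>\<^bsub>T\<^esub> lam \<odot>\<^bsub>T\<^esub> (D (tens u) \<diamondop> D (tens v))"
proof -
  interpret S: algebra k SA by (rule sha_algebra)
  have S: "cring SA" by (rule S.M_cring)
  note eD = alg_mapD[OF eta_alg_map, simplified]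
  \<comment> \<open>The scalar \<open>\<lambda>\<close> becomes an element of \<open>Sha(A)\<close>, so that the identities for \<open>leib\<close> apply.\<close>
  define l where "l = lam \<odot>\<^bsub>T\<^esub> \<eta> \<one>\<^bsub>A\<^esub>"
  have l: "l \<in> carrier SA" by (simp add: l_def)
  have lx: "lam \<odot>\<^bsub>T\<^esub> x = l \<diamondop> x" if "x \<in> carrier T" for x
    using that by (simp add: l_def mult_left sha_one)
  have ed: "\<eta> (d (a \<otimes>\<^bsub>A\<^esub> b)) = \<eta> (d a) \<diamondop> \<eta> b \<oplus>\<^bsub>T\<^esub> \<eta> a \<diamondop> \<eta> (d b) \<oplus>\<^bsub>T\<^esub> l \<diamondop> (\<eta> (d a) \<diamondop> \<eta> (d b))"
    if "a \<in> carrier A" "b \<in> carrier A" for a b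
    using that dL(1) by (simp add: d_mult eD lx[symmetric] mult_left(1))
  have Dp: "D (pre a x) = \<eta> (d a) \<diamondop> PA x \<oplus>\<^bsub>T\<^esub> \<eta> a \<diamondop> x \<oplus>\<^bsub>T\<^esub> l \<diamondop> (\<eta> (d a) \<diamondop> x)"
    if "a \<in> carrier A" "x \<in> carrier T" for a x
    unfolding D_pre[OF that] using that dL(1) by (simp add: pre_eq lx mult_left(1))
  have Dp': "D (\<eta> a \<diamondop> PA x) = \<eta> (d a) \<diamondop> PA x \<oplus>\<^bsub>T\<^esub> \<eta> a \<diamondop> x \<oplus>\<^bsub>T\<^esub> l \<diamondop> (\<eta> (d a) \<diamondop> x)"
    if "a \<in> carrier A" "x \<in> carrier T" for a x
    using Dp[OF that] pre_eq[OF that] by simp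
  have ep: "D (\<eta> a \<diamondop> pre b y) = D (\<eta> a) \<diamondop> pre b y \<oplus>\<^bsub>T\<^esub> \<eta> a \<diamondop> D (pre b y)
      \<oplus>\<^bsub>T\<^esub> l \<diamondop> (D (\<eta> a) \<diamondop> D (pre b y))"
    if a: "a \<in> carrier A" and b: "b \<in> carrier A" and y: "y \<in> carrier T" for a b y
  proof -
    have "D (\<eta> a \<diamondop> pre b y) = D (pre (a \<otimes>\<^bsub>A\<^esub> b) y)" using a b y by (simp add: eta_pre)
    also have "\<dots> = \<eta> (d (a \<otimes>\<^bsub>A\<^esub> b)) \<diamondop> PA y \<oplus>\<^bsub>T\<^esub> (\<eta> a \<diamondop> \<eta> b) \<diamondop> y \<oplus>\<^bsub>T\<^esub> l \<diamondop> (\<eta> (d (a \<otimes>\<^bsub>A\<^esub> b)) \<diamondop> y)"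
      using a b y by (simp add: Dp eD)
    also have "\<dots> = D (\<eta> a) \<diamondop> pre b y \<oplus>\<^bsub>T\<^esub> \<eta> a \<diamondop> D (pre b y)
      \<oplus>\<^bsub>T\<^esub> l \<diamondop> (D (\<eta> a) \<diamondop> D (pre b y))"
      using cring.leib_assoc[OF S, of l "\<eta> a" "\<eta> (d a)" "\<eta> b" "\<eta> (d b)" "PA y" y] a b y l dL(1) PA(1)
      by (simp add: Dp' ed D_eta pre_eq cring.leib_def[OF S])
    finally show ?thesis .
  qed
  note cl = DL(1)[OF tens_closed[OF u]] DL(1)[OF tens_closed[OF v]]
  have "D (tens u \<diamondop> tens v) = D (tens u) \<diamondop> tens v \<oplus>\<^bsub>T\<^esub> tens u \<diamondop> D (tens v)
      \<oplus>\<^bsub>T\<^esub> l \<diamondop> (D (tens u) \<diamondop> D (tens v))"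
    using u
  proof (cases rule: tens_cases)
    case a: (1 a)
    show ?thesis using v
    proof (cases rule: tens_cases)
      case b: (1 b)
      then show ?thesis using a by (simp add: eta_mult D_eta ed)
    next
      case b: (2 b v')
      then show ?thesis using a ep tens_closed[OF b(2)] by simp
    qed
  next
    case a: (2 a u')
    note x = tens_closed[OF a(2)]
    show ?thesis using v
    proof (cases rule: tens_cases)
      case b: (1 b)
      have "D (tens u \<diamondop> tens v) = D (\<eta> b \<diamondop> pre a (tens u'))"
        using a b x pre_lin(1) sha_m_comm[of "\<eta> b" "pre a (tens u')"] by simp
      also have "\<dots> = D (\<eta> b) \<diamondop> pre a (tens u') \<oplus>\<^bsub>T\<^esub> \<eta> b \<diamondop> D (pre a (tens u'))
      \<oplus>\<^bsub>T\<^esub> l \<diamondop> (D (\<eta> b) \<diamondop> D (pre a (tens u')))" by (rule ep[OF b(1) a(1) x])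
      also have "\<dots> = D (tens u) \<diamondop> tens v \<oplus>\<^bsub>T\<^esub> tens u \<diamondop> D (tens v)
      \<oplus>\<^bsub>T\<^esub> l \<diamondop> (D (tens u) \<diamondop> D (tens v))"
        using S.m_comm S.M.a_comm cl tens_closed[OF u] tens_closed[OF v] a(3) b(2) mult_left(1) by simp
      finally show ?thesis .
    next
      case b: (2 b v')
      note y = tens_closed[OF b(2)]
      let ?x = "tens u'" and ?y = "tens v'"
      let ?z = "?x \<diamondop> PA ?y \<oplus>\<^bsub>T\<^esub> PA ?x \<diamondop> ?y \<oplus>\<^bsub>T\<^esub> l \<diamondop> (?x \<diamondop> ?y)"
      have z: "?z \<in> carrier T" using x y l by (simp add: PA(1) mult_left(1))
      have Pz: "PA ?z = PA ?x \<diamondop> PA ?y" using PA_mult[OF x y] x y by (simp add: lx mult_left(1))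
      have "D (pre a ?x \<diamondop> pre b ?y) = D (pre (a \<otimes>\<^bsub>A\<^esub> b) ?z)"
        using a b x y by (simp add: pre_mult_pre lx mult_left(1))
      also have "\<dots> = \<eta> (d (a \<otimes>\<^bsub>A\<^esub> b)) \<diamondop> (PA ?x \<diamondop> PA ?y) \<oplus>\<^bsub>T\<^esub> (\<eta> a \<diamondop> \<eta> b) \<diamondop> ?z \<oplus>\<^bsub>T\<^esub> l \<diamondop> (\<eta> (d (a \<otimes>\<^bsub>A\<^esub> b)) \<diamondop> ?z)"
        using a b z by (simp add: Dp Pz eD)
      also have "\<dots> = D (pre a ?x) \<diamondop> pre b ?y \<oplus>\<^bsub>T\<^esub> pre a ?x \<diamondop> D (pre b ?y)
        \<oplus>\<^bsub>T\<^esub> l \<diamondop> (D (pre a ?x) \<diamondop> D (pre b ?y))"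
        using cring.leib_medial[OF S, of l "\<eta> a" "\<eta> (d a)" "\<eta> b" "\<eta> (d b)" "PA ?x" ?x "PA ?y" ?y]
          a b x y l dL(1) PA(1)
        by (simp add: Dp' ed pre_eq cring.leib_def[OF S] S.M.a_comm[of "?x \<diamondop> PA ?y"] mult_left(1))
      finally show ?thesis using a b by simp
    qed
  qed
  then show ?thesis using cl by (simp add: lx mult_left(1))
qed

lemma D_deriv: "wt_deriv k lam SA D"
proof -
  have "D (x \<diamondop> y) = D x \<diamondop> y \<oplus>\<^bsub>T\<^esub> x \<diamondop> D y \<oplus>\<^bsub>T\<^esub> lam \<odot>\<^bsub>T\<^esub> (D x \<diamondop> D y)"
    if x: "x \<in> carrier T" and y: "y \<in> carrier T" for x y
  proof (rule linear_eqI[OF linear_on_comp[OF mult_linear_left[OF y] D_linear] _ x])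
    show "linear_on k T T (\<lambda>x. D x \<diamondop> y \<oplus>\<^bsub>T\<^esub> x \<diamondop> D y \<oplus>\<^bsub>T\<^esub> lam \<odot>\<^bsub>T\<^esub> (D x \<diamondop> D y))"
      by (intro linear_on_add linear_on_smult T_module lam linear_on_comp[OF D_linear mult_linear_left]
          mult_linear_left y DL(1))
    fix u assume u: "u \<in> words A"
    note tu = tens_closed[OF u]
    show "D (tens u \<diamondop> y) = D (tens u) \<diamondop> y \<oplus>\<^bsub>T\<^esub> tens u \<diamondop> D y \<oplus>\<^bsub>T\<^esub> lam \<odot>\<^bsub>T\<^esub> (D (tens u) \<diamondop> D y)"
    proof (rule linear_eqI[OF linear_on_comp[OF mult_linear_right[OF tu] D_linear] _ y])
      show "linear_on k T T (\<lambda>y. D (tens u) \<diamondop> y \<oplus>\<^bsub>T\<^esub> tens u \<diamondop> D y \<oplus>\<^bsub>T\<^esub> lam \<odot>\<^bsub>T\<^esub> (D (tens u) \<diamondop> D y))"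
        by (intro linear_on_add linear_on_smult T_module lam linear_on_comp[OF D_linear mult_linear_right]
            mult_linear_right DL(1) tu)
    qed (rule D_mult_tens[OF u])
  qed
  moreover have "D (\<eta> \<one>\<^bsub>A\<^esub>) = \<zero>\<^bsub>T\<^esub>"
    using D_eta[of "\<one>\<^bsub>A\<^esub>"] d_one alg_mapD(5)[OF eta_alg_map, of "\<zero>\<^bsub>k\<^esub>" "\<one>\<^bsub>A\<^esub>"] eta_closed[of "\<one>\<^bsub>A\<^esub>"] by simp
  ultimately show ?thesis using D_linear by (simp add: wt_deriv_def linear_on_def)
qed

end


section \<open>The algebra of sequences\<close>

context weighted_algebra begin

abbreviation "SQ \<equiv> seq_alg k lam A"

lemma seq_simps [simp]:
  "f \<oplus>\<^bsub>SQ\<^esub> g = (\<lambda>n. f n \<oplus>\<^bsub>A\<^esub> g n)" "\<zero>\<^bsub>SQ\<^esub> = (\<lambda>n. \<zero>\<^bsub>A\<^esub>)"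
  "c \<odot>\<^bsub>SQ\<^esub> f = (\<lambda>n. c \<odot>\<^bsub>A\<^esub> f n)" "\<one>\<^bsub>SQ\<^esub> = (\<lambda>n. if n = 0 then \<one>\<^bsub>A\<^esub> else \<zero>\<^bsub>A\<^esub>)"
  by (simp_all add: seq_alg_def)

lemma seq_carrier: "f \<in> carrier SQ \<longleftrightarrow> (\<forall>n. f n \<in> carrier A)"
  by (auto simp: seq_alg_def)

lemma seqD [simp]: "f \<in> carrier SQ \<Longrightarrow> f n \<in> carrier A"
  by (simp add: seq_carrier)

text \<open>The multinomial coefficient \<open>n! / (i! j! (n - i - j)!)\<close>, which vanishes if \<open>i + j > n\<close>.\<close>

definition trinom :: "nat \<Rightarrow> nat \<Rightarrow> nat \<Rightarrow> nat" where
  "trinom n i j = (n choose i) * ((n - i) choose j)"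

lemma trinom_zero: "n < i \<Longrightarrow> trinom n i j = 0" "n - i < j \<Longrightarrow> trinom n i j = 0"
  by (auto simp: trinom_def)

lemma trinom_pascal:
  "trinom (Suc n) 0 0 = trinom n 0 0"
  "trinom (Suc n) 0 (Suc j) = trinom n 0 (Suc j) + trinom n 0 j"
  "trinom (Suc n) (Suc i) 0 = trinom n (Suc i) 0 + trinom n i 0"
  "trinom (Suc n) (Suc i) (Suc j) = trinom n (Suc i) (Suc j) + trinom n (Suc i) j + trinom n i (Suc j)"
proof -
  show "trinom (Suc n) (Suc i) (Suc j) = trinom n (Suc i) (Suc j) + trinom n (Suc i) j + trinom n i (Suc j)"
  proof (cases "i < n")
    case True
    then obtain m where m: "n - i = Suc m" "n - Suc i = m" by (metis Suc_diff_Suc)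
    show ?thesis by (simp add: trinom_def m algebra_simps)
  qed (simp add: trinom_def)
qed (simp_all add: trinom_def algebra_simps)

definition mterm :: "(nat \<Rightarrow> 'a) \<Rightarrow> (nat \<Rightarrow> 'a) \<Rightarrow> nat \<Rightarrow> nat \<Rightarrow> nat \<Rightarrow> 'a" where
  "mterm f g n i j = (lam [^]\<^bsub>k\<^esub> i) \<odot>\<^bsub>A\<^esub> (f (n - j) \<otimes>\<^bsub>A\<^esub> g (i + j))"

lemma mterm_closed [simp]: "f \<in> carrier SQ \<Longrightarrow> g \<in> carrier SQ \<Longrightarrow> mterm f g n i j \<in> carrier A"
  by (simp add: mterm_def)

text \<open>As the coefficients vanish outside the triangle, the double sum can be taken over any rectangle that contains it;
  this makes shifts of the summation indices harmless.\<close>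

lemma seq_mult_rect:
  assumes f: "f \<in> carrier SQ" and g: "g \<in> carrier SQ" and I: "n \<le> I" and J: "n \<le> J"
  shows "(f \<otimes>\<^bsub>SQ\<^esub> g) n = (\<Oplus>\<^bsub>A\<^esub>i\<in>{..I}. \<Oplus>\<^bsub>A\<^esub>j\<in>{..J}. [trinom n i j] \<cdot>\<^bsub>A\<^esub> mterm f g n i j)"
proof -
  have inner: "(\<Oplus>\<^bsub>A\<^esub>j\<in>{0..n-i}. [trinom n i j] \<cdot>\<^bsub>A\<^esub> mterm f g n i j)
      = (\<Oplus>\<^bsub>A\<^esub>j\<in>{..J}. [trinom n i j] \<cdot>\<^bsub>A\<^esub> mterm f g n i j)" for i
    by (rule M.add.finprod_mono_neutral_cong_left)
      (use f g J in \<open>auto simp: trinom_zero M.add.nat_pow_0\<close>)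
  have "(f \<otimes>\<^bsub>SQ\<^esub> g) n = (\<Oplus>\<^bsub>A\<^esub>i\<in>{0..n}. \<Oplus>\<^bsub>A\<^esub>j\<in>{0..n-i}. [trinom n i j] \<cdot>\<^bsub>A\<^esub> mterm f g n i j)"
    by (simp add: seq_alg_def trinom_def mterm_def)
  also have "\<dots> = (\<Oplus>\<^bsub>A\<^esub>i\<in>{0..n}. \<Oplus>\<^bsub>A\<^esub>j\<in>{..J}. [trinom n i j] \<cdot>\<^bsub>A\<^esub> mterm f g n i j)"
    by (simp only: inner)
  also have "\<dots> = (\<Oplus>\<^bsub>A\<^esub>i\<in>{..I}. \<Oplus>\<^bsub>A\<^esub>j\<in>{..J}. [trinom n i j] \<cdot>\<^bsub>A\<^esub> mterm f g n i j)"
    by (rule M.add.finprod_mono_neutral_cong_left)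
      (use f g I in \<open>auto simp: trinom_zero M.add.nat_pow_0\<close>)
  finally show ?thesis .
qed

lemma seq_mult_closed: "f \<in> carrier SQ \<Longrightarrow> g \<in> carrier SQ \<Longrightarrow> f \<otimes>\<^bsub>SQ\<^esub> g \<in> carrier SQ"
  unfolding seq_carrier[of "f \<otimes>\<^bsub>SQ\<^esub> g"] by (auto simp: seq_mult_rect[OF _ _ order_refl order_refl])

lemma seq_mult_0:
  assumes "f \<in> carrier SQ" "g \<in> carrier SQ" shows "(f \<otimes>\<^bsub>SQ\<^esub> g) 0 = f 0 \<otimes>\<^bsub>A\<^esub> g 0"
  using seq_mult_rect[OF assms order_refl order_refl, of 0] assms by (simp add: trinom_def mterm_def)

abbreviation shift :: "(nat \<Rightarrow> 'a) \<Rightarrow> nat \<Rightarrow> 'a" ("\<partial>") where "\<partial> f \<equiv> (\<lambda>n. f (Suc n))"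

lemma shift_closed: "f \<in> carrier SQ \<Longrightarrow> \<partial> f \<in> carrier SQ"
  by (simp add: seq_carrier)

text \<open>The shift is a derivation of weight \<open>\<lambda>\<close>. The three summands correspond to the three terms in
  the Pascal rule for trinomial coefficients, after a shift of \<open>j\<close> in the second and of \<open>i\<close>
  in the third. Together with \<open>seq_mult_0\<close> this determines the product recursively, and the laws of the
  product are proved by induction on the index from these two rules.\<close>

lemma seq_mult_Suc:
  assumes f: "f \<in> carrier SQ" and g: "g \<in> carrier SQ"
  shows "(f \<otimes>\<^bsub>SQ\<^esub> g) (Suc n) = (\<partial> f \<otimes>\<^bsub>SQ\<^esub> g) n \<oplus>\<^bsub>A\<^esub> (f \<otimes>\<^bsub>SQ\<^esub> \<partial> g) n \<oplus>\<^bsub>A\<^esub> lam \<odot>\<^bsub>A\<^esub> (\<partial> f \<otimes>\<^bsub>SQ\<^esub> \<partial> g) n"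
proof -
  note f' = shift_closed[OF f] and g' = shift_closed[OF g]
  let ?t = "mterm f g (Suc n)"
  let ?s = "\<lambda>h. \<Oplus>\<^bsub>A\<^esub>i\<in>{..Suc n}. \<Oplus>\<^bsub>A\<^esub>j\<in>{..Suc n}. h i j"
  \<comment> \<open>The coefficients of the second and the third summand after the shift of the index; the value \<open>0\<close> belongs to
    the terms that the shift does not reach.\<close>
  define c2 where "c2 i j = (case j of 0 \<Rightarrow> 0 | Suc j' \<Rightarrow> trinom n i j')" for i j
  define c3 where "c3 i j = (case i of 0 \<Rightarrow> 0 | Suc i' \<Rightarrow> trinom n i' j)" for i j
  have pascal: "trinom (Suc n) i j = trinom n i j + c2 i j + c3 i j" for i j
    by (cases i; cases j) (simp_all add: trinom_pascal c2_def c3_def)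
  have e1: "(\<partial> f \<otimes>\<^bsub>SQ\<^esub> g) n = ?s (\<lambda>i j. [trinom n i j] \<cdot>\<^bsub>A\<^esub> ?t i j)"
  proof -
    have "[trinom n i j] \<cdot>\<^bsub>A\<^esub> mterm (\<partial> f) g n i j = [trinom n i j] \<cdot>\<^bsub>A\<^esub> ?t i j" for i j
    proof (cases "j \<le> n")
      case True then show ?thesis by (simp add: mterm_def Suc_diff_le)
    next
      case False then show ?thesis by (simp add: trinom_zero)
    qed
    then show ?thesis by (simp add: seq_mult_rect[OF f' g, of n "Suc n" "Suc n"])
  qed
  have e2: "(f \<otimes>\<^bsub>SQ\<^esub> \<partial> g) n = ?s (\<lambda>i j. [c2 i j] \<cdot>\<^bsub>A\<^esub> ?t i j)"
  proof -
    have "(\<Oplus>\<^bsub>A\<^esub>j\<in>{..Suc n}. [c2 i j] \<cdot>\<^bsub>A\<^esub> ?t i j) = (\<Oplus>\<^bsub>A\<^esub>j\<in>{..n}. [trinom n i j] \<cdot>\<^bsub>A\<^esub> mterm f (\<partial> g) n i j)" for i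
      using f g f' g' by (subst M.finsum_Suc2) (auto simp: c2_def mterm_def)
    then show ?thesis by (simp add: seq_mult_rect[OF f g', of n "Suc n" n])
  qed
  have e3: "lam \<odot>\<^bsub>A\<^esub> (\<partial> f \<otimes>\<^bsub>SQ\<^esub> \<partial> g) n = ?s (\<lambda>i j. [c3 i j] \<cdot>\<^bsub>A\<^esub> ?t i j)"
  proof -
    have np: "lam \<odot>\<^bsub>A\<^esub> ([m] \<cdot>\<^bsub>A\<^esub> x) = [m] \<cdot>\<^bsub>A\<^esub> (lam \<odot>\<^bsub>A\<^esub> x)" if "x \<in> carrier A" for m :: nat and x
      by (induction m) (use that in \<open>simp_all add: smult_r_distr\<close>)
    have t: "[trinom n i j] \<cdot>\<^bsub>A\<^esub> (lam \<odot>\<^bsub>A\<^esub> mterm (\<partial> f) (\<partial> g) n i j) = [c3 (Suc i) j] \<cdot>\<^bsub>A\<^esub> ?t (Suc i) j" for i j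
    proof (cases "j \<le> n")
      case True
      then show ?thesis using f g by (simp add: c3_def mterm_def Suc_diff_le smult_assoc1[symmetric] R.m_comm)
    next
      case False then show ?thesis by (simp add: c3_def trinom_zero)
    qed
    have "?s (\<lambda>i j. [c3 i j] \<cdot>\<^bsub>A\<^esub> ?t i j) = (\<Oplus>\<^bsub>A\<^esub>i\<in>{..n}. \<Oplus>\<^bsub>A\<^esub>j\<in>{..Suc n}. [c3 (Suc i) j] \<cdot>\<^bsub>A\<^esub> ?t (Suc i) j)"
      using f g by (subst M.finsum_Suc2) (auto simp: c3_def)
    also have "\<dots> = (\<Oplus>\<^bsub>A\<^esub>i\<in>{..n}. \<Oplus>\<^bsub>A\<^esub>j\<in>{..Suc n}. lam \<odot>\<^bsub>A\<^esub> ([trinom n i j] \<cdot>\<^bsub>A\<^esub> mterm (\<partial> f) (\<partial> g) n i j))"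
      using f' g' by (simp add: np t)
    also have "\<dots> = lam \<odot>\<^bsub>A\<^esub> (\<partial> f \<otimes>\<^bsub>SQ\<^esub> \<partial> g) n"
    proof -
      have i: "(\<Oplus>\<^bsub>A\<^esub>j\<in>{..Suc n}. lam \<odot>\<^bsub>A\<^esub> ([trinom n i j] \<cdot>\<^bsub>A\<^esub> mterm (\<partial> f) (\<partial> g) n i j))
         = lam \<odot>\<^bsub>A\<^esub> (\<Oplus>\<^bsub>A\<^esub>j\<in>{..Suc n}. [trinom n i j] \<cdot>\<^bsub>A\<^esub> mterm (\<partial> f) (\<partial> g) n i j)" for i
        by (rule finsum_smult_ldistr[symmetric]) (use f' g' in auto)
      show ?thesis
        unfolding i seq_mult_rect[OF f' g' order_refl, of n "Suc n", simplified]
        by (rule finsum_smult_ldistr[symmetric]) (use f' g' in auto)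
    qed
    finally show ?thesis by simp
  qed
  have "(f \<otimes>\<^bsub>SQ\<^esub> g) (Suc n) = ?s (\<lambda>i j. [trinom n i j] \<cdot>\<^bsub>A\<^esub> ?t i j \<oplus>\<^bsub>A\<^esub> [c2 i j] \<cdot>\<^bsub>A\<^esub> ?t i j \<oplus>\<^bsub>A\<^esub> [c3 i j] \<cdot>\<^bsub>A\<^esub> ?t i j)"
    using f g by (simp add: seq_mult_rect[OF f g order_refl order_refl] pascal M.add.nat_pow_mult[symmetric] del: M.finsum_Suc)
  also have "\<dots> = ?s (\<lambda>i j. [trinom n i j] \<cdot>\<^bsub>A\<^esub> ?t i j) \<oplus>\<^bsub>A\<^esub> ?s (\<lambda>i j. [c2 i j] \<cdot>\<^bsub>A\<^esub> ?t i j) \<oplus>\<^bsub>A\<^esub> ?s (\<lambda>i j. [c3 i j] \<cdot>\<^bsub>A\<^esub> ?t i j)"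
  proof -
    have cl: "(\<lambda>j. [c i j] \<cdot>\<^bsub>A\<^esub> ?t i j) \<in> X \<rightarrow> carrier A" for i X and c :: "nat \<Rightarrow> nat \<Rightarrow> nat" using f g by auto
    have cl': "(\<lambda>i. \<Oplus>\<^bsub>A\<^esub>j\<in>Y. [c i j] \<cdot>\<^bsub>A\<^esub> ?t i j) \<in> X \<rightarrow> carrier A" for X Y and c :: "nat \<Rightarrow> nat \<Rightarrow> nat" using f g by auto
    have "(\<Oplus>\<^bsub>A\<^esub>j\<in>{..Suc n}. [trinom n i j] \<cdot>\<^bsub>A\<^esub> ?t i j \<oplus>\<^bsub>A\<^esub> [c2 i j] \<cdot>\<^bsub>A\<^esub> ?t i j \<oplus>\<^bsub>A\<^esub> [c3 i j] \<cdot>\<^bsub>A\<^esub> ?t i j)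
      = (\<Oplus>\<^bsub>A\<^esub>j\<in>{..Suc n}. [trinom n i j] \<cdot>\<^bsub>A\<^esub> ?t i j) \<oplus>\<^bsub>A\<^esub> (\<Oplus>\<^bsub>A\<^esub>j\<in>{..Suc n}. [c2 i j] \<cdot>\<^bsub>A\<^esub> ?t i j)
        \<oplus>\<^bsub>A\<^esub> (\<Oplus>\<^bsub>A\<^esub>j\<in>{..Suc n}. [c3 i j] \<cdot>\<^bsub>A\<^esub> ?t i j)" for i
      using f g by (subst M.finsum_addf, force, force, subst M.finsum_addf) auto
    then show ?thesis
      using f g by (simp only:, subst M.finsum_addf, force, force, subst M.finsum_addf) auto
  qed
  finally show ?thesis by (simp only: e1 e2 e3)
qed

lemma shift_mult:
  assumes "f \<in> carrier SQ" "g \<in> carrier SQ"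
  shows "\<partial> (f \<otimes>\<^bsub>SQ\<^esub> g) = \<partial> f \<otimes>\<^bsub>SQ\<^esub> g \<oplus>\<^bsub>SQ\<^esub> f \<otimes>\<^bsub>SQ\<^esub> \<partial> g \<oplus>\<^bsub>SQ\<^esub> lam \<odot>\<^bsub>SQ\<^esub> (\<partial> f \<otimes>\<^bsub>SQ\<^esub> \<partial> g)"
  using seq_mult_Suc[OF assms] by (simp add: fun_eq_iff)

lemma seq_closed: "f \<in> carrier SQ \<Longrightarrow> g \<in> carrier SQ \<Longrightarrow> (\<lambda>n. f n \<oplus>\<^bsub>A\<^esub> g n) \<in> carrier SQ"
  "c \<in> carrier k \<Longrightarrow> f \<in> carrier SQ \<Longrightarrow> (\<lambda>n. c \<odot>\<^bsub>A\<^esub> f n) \<in> carrier SQ"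
  "(\<lambda>n. \<zero>\<^bsub>A\<^esub>) \<in> carrier SQ" "(\<lambda>n. if n = 0 then \<one>\<^bsub>A\<^esub> else \<zero>\<^bsub>A\<^esub>) \<in> carrier SQ"
  by (auto simp: seq_carrier)

lemma seq_mult_at [simp]: "f \<in> carrier SQ \<Longrightarrow> g \<in> carrier SQ \<Longrightarrow> (f \<otimes>\<^bsub>SQ\<^esub> g) n \<in> carrier A"
  using seq_mult_closed by simp

lemma seq_m_comm:
  assumes "f \<in> carrier SQ" "g \<in> carrier SQ" shows "f \<otimes>\<^bsub>SQ\<^esub> g = g \<otimes>\<^bsub>SQ\<^esub> f"
proof
  fix n show "(f \<otimes>\<^bsub>SQ\<^esub> g) n = (g \<otimes>\<^bsub>SQ\<^esub> f) n"
    using assms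
  proof (induction n arbitrary: f g)
    case 0 then show ?case by (simp add: seq_mult_0 m_comm)
  next
    case (Suc n)
    note IH = Suc.IH[OF shift_closed[OF Suc.prems(1)] Suc.prems(2)]
      Suc.IH[OF Suc.prems(1) shift_closed[OF Suc.prems(2)]]
      Suc.IH[OF shift_closed[OF Suc.prems(1)] shift_closed[OF Suc.prems(2)]]
    show ?case using Suc.prems by (simp add: seq_mult_Suc IH shift_closed M.a_comm)
  qed
qed

lemma seq_l_distr:
  assumes "f \<in> carrier SQ" "g \<in> carrier SQ" "h \<in> carrier SQ"
  shows "(f \<oplus>\<^bsub>SQ\<^esub> g) \<otimes>\<^bsub>SQ\<^esub> h = f \<otimes>\<^bsub>SQ\<^esub> h \<oplus>\<^bsub>SQ\<^esub> g \<otimes>\<^bsub>SQ\<^esub> h"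
proof
  fix n show "((f \<oplus>\<^bsub>SQ\<^esub> g) \<otimes>\<^bsub>SQ\<^esub> h) n = (f \<otimes>\<^bsub>SQ\<^esub> h \<oplus>\<^bsub>SQ\<^esub> g \<otimes>\<^bsub>SQ\<^esub> h) n"
    using assms unfolding seq_simps
  proof (induction n arbitrary: f g h)
    case 0 then show ?case by (simp add: seq_mult_0 seq_closed l_distr)
  next
    case (Suc n)
    note s = shift_closed[OF Suc.prems(1)] shift_closed[OF Suc.prems(2)] shift_closed[OF Suc.prems(3)]
    show ?case using Suc.prems s
      by (simp add: seq_mult_Suc seq_closed Suc.IH smult_r_distr M.a_ac)
  qed
qed

lemma seq_smult_assoc:
  assumes "c \<in> carrier k" "f \<in> carrier SQ" "h \<in> carrier SQ"
  shows "(c \<odot>\<^bsub>SQ\<^esub> f) \<otimes>\<^bsub>SQ\<^esub> h = c \<odot>\<^bsub>SQ\<^esub> (f \<otimes>\<^bsub>SQ\<^esub> h)"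
proof
  fix n show "((c \<odot>\<^bsub>SQ\<^esub> f) \<otimes>\<^bsub>SQ\<^esub> h) n = (c \<odot>\<^bsub>SQ\<^esub> (f \<otimes>\<^bsub>SQ\<^esub> h)) n"
    using assms(2,3) unfolding seq_simps
  proof (induction n arbitrary: f h)
    case 0 then show ?case using assms(1) by (simp add: seq_mult_0 seq_closed smult_assoc2)
  next
    case (Suc n)
    note s = shift_closed[OF Suc.prems(1)] shift_closed[OF Suc.prems(2)]
    have ll: "lam \<odot>\<^bsub>A\<^esub> (c \<odot>\<^bsub>A\<^esub> z) = c \<odot>\<^bsub>A\<^esub> (lam \<odot>\<^bsub>A\<^esub> z)" if "z \<in> carrier A" for z
      using assms(1) that lam by (simp add: smult_assoc1[symmetric] R.m_comm)
    show ?case using Suc.prems s assms(1)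
      by (simp add: seq_mult_Suc seq_closed Suc.IH smult_r_distr ll)
  qed
qed

lemma seq_r_distr:
  assumes "f \<in> carrier SQ" "g \<in> carrier SQ" "h \<in> carrier SQ"
  shows "h \<otimes>\<^bsub>SQ\<^esub> (f \<oplus>\<^bsub>SQ\<^esub> g) = h \<otimes>\<^bsub>SQ\<^esub> f \<oplus>\<^bsub>SQ\<^esub> h \<otimes>\<^bsub>SQ\<^esub> g"
  using seq_l_distr[OF assms] assms by (simp add: seq_m_comm[of h] seq_closed)

lemma seq_smult_assoc':
  assumes "c \<in> carrier k" "f \<in> carrier SQ" "h \<in> carrier SQ"
  shows "h \<otimes>\<^bsub>SQ\<^esub> (c \<odot>\<^bsub>SQ\<^esub> f) = c \<odot>\<^bsub>SQ\<^esub> (h \<otimes>\<^bsub>SQ\<^esub> f)"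
  using seq_smult_assoc[OF assms] assms by (simp add: seq_m_comm[of h] seq_closed)

lemma seq_zero_mult: "f \<in> carrier SQ \<Longrightarrow> (\<lambda>n. \<zero>\<^bsub>A\<^esub>) \<otimes>\<^bsub>SQ\<^esub> f = (\<lambda>n. \<zero>\<^bsub>A\<^esub>)"
  using seq_smult_assoc[of "\<zero>\<^bsub>k\<^esub>" "\<lambda>n. \<zero>\<^bsub>A\<^esub>" f] by (simp add: seq_closed)

lemma seq_one:
  assumes "f \<in> carrier SQ" shows "\<one>\<^bsub>SQ\<^esub> \<otimes>\<^bsub>SQ\<^esub> f = f"
proof
  fix n show "(\<one>\<^bsub>SQ\<^esub> \<otimes>\<^bsub>SQ\<^esub> f) n = f n"
    using assms
  proof (induction n arbitrary: f)
    case 0 then show ?case by (simp add: seq_mult_0 seq_closed)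
  next
    case (Suc n)
    note s = shift_closed[OF Suc.prems]
    show ?case using Suc.prems s Suc.IH[OF s]
      by (simp add: seq_mult_Suc seq_closed seq_zero_mult)
  qed
qed

text \<open>By the Leibniz rule and bilinearity, the component at \<open>n + 1\<close> of each side is the same combination of
  seven components at \<open>n\<close> of triple products with some factors shifted.\<close>

lemma seq_m_assoc:
  assumes "f \<in> carrier SQ" "g \<in> carrier SQ" "h \<in> carrier SQ"
  shows "(f \<otimes>\<^bsub>SQ\<^esub> g) \<otimes>\<^bsub>SQ\<^esub> h = f \<otimes>\<^bsub>SQ\<^esub> (g \<otimes>\<^bsub>SQ\<^esub> h)"
proof
  fix n show "((f \<otimes>\<^bsub>SQ\<^esub> g) \<otimes>\<^bsub>SQ\<^esub> h) n = (f \<otimes>\<^bsub>SQ\<^esub> (g \<otimes>\<^bsub>SQ\<^esub> h)) n"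
    using assms
  proof (induction n arbitrary: f g h)
    case 0 then show ?case by (simp add: seq_mult_0 seq_mult_closed m_assoc)
  next
    case (Suc n)
    note s = shift_closed[OF Suc.prems(1)] shift_closed[OF Suc.prems(2)] shift_closed[OF Suc.prems(3)]
    note d = seq_l_distr[unfolded seq_simps] seq_r_distr[unfolded seq_simps]
      seq_smult_assoc[unfolded seq_simps] seq_smult_assoc'[unfolded seq_simps]
    show ?case using Suc.prems s
      by (simp add: seq_mult_Suc seq_mult_closed shift_mult d seq_closed Suc.IH smult_r_distr M.a_ac)
  qed
qed

lemma seq_algebra: "algebra k SQ"
proof (rule algebraI)
  show "cring SQ"
  proof (rule cringI)
    show "abelian_group SQ"
    proof (rule abelian_groupI)
      fix f assume f: "f \<in> carrier SQ"
      show "\<exists>g\<in>carrier SQ. g \<oplus>\<^bsub>SQ\<^esub> f = \<zero>\<^bsub>SQ\<^esub>"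
        by (rule bexI[of _ "\<lambda>n. \<ominus>\<^bsub>A\<^esub> f n"]) (use f in \<open>auto simp: seq_carrier M.l_neg\<close>)
    qed (auto simp: seq_closed M.a_ac)
    show "Group.comm_monoid SQ"
    proof (rule comm_monoidI)
      show "x \<otimes>\<^bsub>SQ\<^esub> y = y \<otimes>\<^bsub>SQ\<^esub> x" if "x \<in> carrier SQ" "y \<in> carrier SQ" for x y
        using that by (rule seq_m_comm)
    qed (use seq_one seq_closed in \<open>simp_all add: seq_mult_closed seq_m_assoc\<close>)
  qed (rule seq_l_distr)
  show "(c \<odot>\<^bsub>SQ\<^esub> x) \<otimes>\<^bsub>SQ\<^esub> y = c \<odot>\<^bsub>SQ\<^esub> (x \<otimes>\<^bsub>SQ\<^esub> y)" if "c \<in> carrier k" "x \<in> carrier SQ" "y \<in> carrier SQ" for c x y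
    using that by (rule seq_smult_assoc)
qed (auto simp: R.cring_axioms seq_carrier smult_l_distr smult_r_distr smult_assoc1)

lemma shift_deriv: "wt_deriv k lam SQ \<partial>"
  unfolding wt_deriv_def
  using shift_mult shift_closed by (auto intro!: linear_onI simp: seq_closed)

lemma at_0_alg_map: "alg_map k SQ A (\<lambda>f. f 0)"
  by (rule alg_mapI) (auto simp: seq_mult_0)

text \<open>At index \<open>0\<close> this is the identity for \<open>P\<close>; at \<open>n + 1\<close> it is the Leibniz rule,
  since the shift undoes \<open>seq_P P\<close>.\<close>

lemma seq_P_rb:
  assumes P: "rb_op k lam A P"
  shows "rb_op k lam SQ (seq_P P)"
proof -
  have lin: "linear_on k A A P" using P by (simp add: rb_op_def)
  note L = linear_onD[OF lin]
  have rb: "P x \<otimes>\<^bsub>A\<^esub> P y = P (x \<otimes>\<^bsub>A\<^esub> P y) \<oplus>\<^bsub>A\<^esub> P (y \<otimes>\<^bsub>A\<^esub> P x) \<oplus>\<^bsub>A\<^esub> lam \<odot>\<^bsub>A\<^esub> P (x \<otimes>\<^bsub>A\<^esub> y)"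
    if "x \<in> carrier A" "y \<in> carrier A" for x y using P that by (simp add: rb_op_def)
  have cl: "seq_P P f \<in> carrier SQ" if "f \<in> carrier SQ" for f
    using that L(1) by (auto simp: seq_carrier seq_P_def)
  have at: "seq_P P f 0 = P (f 0)" "\<partial> (seq_P P f) = f" "seq_P P f (Suc n) = f n" for f n by (auto simp: seq_P_def)
  have l: "linear_on k SQ SQ (seq_P P)"
    by (rule linear_onI) (use cl L in \<open>auto simp: fun_eq_iff seq_P_def\<close>)
  moreover have "seq_P P f \<otimes>\<^bsub>SQ\<^esub> seq_P P g = seq_P P (f \<otimes>\<^bsub>SQ\<^esub> seq_P P g) \<oplus>\<^bsub>SQ\<^esub> seq_P P (g \<otimes>\<^bsub>SQ\<^esub> seq_P P f)
     \<oplus>\<^bsub>SQ\<^esub> lam \<odot>\<^bsub>SQ\<^esub> seq_P P (f \<otimes>\<^bsub>SQ\<^esub> g)" if fg: "f \<in> carrier SQ" "g \<in> carrier SQ" for f g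
  proof
    fix n
    show "(seq_P P f \<otimes>\<^bsub>SQ\<^esub> seq_P P g) n = (seq_P P (f \<otimes>\<^bsub>SQ\<^esub> seq_P P g) \<oplus>\<^bsub>SQ\<^esub> seq_P P (g \<otimes>\<^bsub>SQ\<^esub> seq_P P f)
       \<oplus>\<^bsub>SQ\<^esub> lam \<odot>\<^bsub>SQ\<^esub> seq_P P (f \<otimes>\<^bsub>SQ\<^esub> g)) n"
    proof (cases n)
      case 0
      then show ?thesis using fg rb[of "f 0" "g 0"] by (simp add: seq_mult_0 cl at)
    next
      case (Suc m)
      then show ?thesis using fg by (simp add: seq_mult_Suc cl at seq_m_comm[of "seq_P P f" g])
    qed
  qed
  ultimately show ?thesis by (simp add: rb_op_def del: seq_simps)
qed

end

lemma seq_map_alg_map: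
  assumes A: "weighted_algebra k A lam" and B: "weighted_algebra k B lam" and h: "alg_map k A B h"
  shows "alg_map k (seq_alg k lam A) (seq_alg k lam B) (\<lambda>f n. h (f n))"
proof -
  interpret A: weighted_algebra k A lam by (rule A)
  interpret B: weighted_algebra k B lam by (rule B)
  note hD = alg_mapD[OF h]
  have hz: "h \<zero>\<^bsub>A\<^esub> = \<zero>\<^bsub>B\<^esub>"
    using hD(5)[OF A.R.zero_closed A.one_closed] hD(1)[OF A.one_closed] by simp
  have cl: "(\<lambda>n. h (f n)) \<in> carrier B.SQ" if "f \<in> carrier A.SQ" for f
    using that hD(1) by (auto simp: B.seq_carrier A.seq_carrier)
  have "h ((f \<otimes>\<^bsub>A.SQ\<^esub> g) n) = ((\<lambda>n. h (f n)) \<otimes>\<^bsub>B.SQ\<^esub> (\<lambda>n. h (g n))) n"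
    if "f \<in> carrier A.SQ" "g \<in> carrier A.SQ" for f g n
    using that
  proof (induction n arbitrary: f g)
    case 0 then show ?case using cl by (simp add: A.seq_mult_0 B.seq_mult_0 hD)
  next
    case (Suc n)
    note s = A.shift_closed[OF Suc.prems(1)] A.shift_closed[OF Suc.prems(2)]
    show ?case using Suc.prems s cl[OF Suc.prems(1)] cl[OF Suc.prems(2)] Suc.IH
      by (simp add: A.seq_mult_Suc B.seq_mult_Suc hD)
  qed
  then show ?thesis
    by (intro alg_mapI) (use cl hD hz in \<open>auto simp: fun_eq_iff\<close>)
qed

lemma (in wt_derivation) funpow_closed: "a \<in> carrier A \<Longrightarrow> (d ^^ n) a \<in> carrier A"
  by (induction n) (auto intro: dL)

text \<open>Multiplicativity is proved by induction on the index: \<open>d\<close> on \<open>A\<close> and the shift on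
  sequences satisfy the same Leibniz rule.\<close>

lemma (in wt_derivation) orbit_alg_map: "alg_map k A SQ (\<lambda>a n. (d ^^ n) a)"
proof -
  have cl: "(\<lambda>n. (d ^^ n) a) \<in> carrier SQ" if "a \<in> carrier A" for a
    using that funpow_closed by (auto simp: seq_carrier)
  have add: "(d ^^ n) (a \<oplus>\<^bsub>A\<^esub> b) = (d ^^ n) a \<oplus>\<^bsub>A\<^esub> (d ^^ n) b" if "a \<in> carrier A" "b \<in> carrier A" for a b n
    by (induction n) (use that funpow_closed dL in auto)
  have sm: "(d ^^ n) (c \<odot>\<^bsub>A\<^esub> a) = c \<odot>\<^bsub>A\<^esub> (d ^^ n) a" if "c \<in> carrier k" "a \<in> carrier A" for c a n
    by (induction n) (use that funpow_closed dL in auto)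
  have mult: "(d ^^ n) (a \<otimes>\<^bsub>A\<^esub> b) = ((\<lambda>n. (d ^^ n) a) \<otimes>\<^bsub>SQ\<^esub> (\<lambda>n. (d ^^ n) b)) n"
    if "a \<in> carrier A" "b \<in> carrier A" for a b n
    using that
  proof (induction n arbitrary: a b)
    case 0 then show ?case using cl by (simp add: seq_mult_0)
  next
    case (Suc n)
    then show ?case using cl[OF Suc.prems(1)] cl[OF Suc.prems(2)] dL(1)
      by (simp add: seq_mult_Suc funpow_swap1 d_mult add sm del: funpow.simps)
        (simp add: funpow_Suc_right d_mult add sm del: funpow.simps)
  qed
  have one: "(d ^^ n) \<one>\<^bsub>A\<^esub> = (if n = 0 then \<one>\<^bsub>A\<^esub> else \<zero>\<^bsub>A\<^esub>)" for n
  proof (induction n)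
    case (Suc n)
    have "d \<zero>\<^bsub>A\<^esub> = \<zero>\<^bsub>A\<^esub>" using dL(3)[of "\<zero>\<^bsub>k\<^esub>" "\<one>\<^bsub>A\<^esub>"] dL(1)[of "\<one>\<^bsub>A\<^esub>"] by simp
    then show ?case using Suc d_one by (cases n) auto
  qed simp
  show ?thesis by (rule alg_mapI) (use cl add sm mult one in \<open>auto simp: fun_eq_iff\<close>)
qed


section \<open>Transport into the universe\<close>

lemma alg_map_comp: "alg_map k A B f \<Longrightarrow> alg_map k B C g \<Longrightarrow> alg_map k A C (\<lambda>x. g (f x))"
  by (rule alg_mapI) (simp_all add: alg_mapD)

lemma alg_map_id: "alg_map k A A (\<lambda>x. x)"
  by (rule alg_mapI) simp_all

lemma alg_map_cong:
  assumes "algebra k A" "alg_map k A B f" "\<And>x. x \<in> carrier A \<Longrightarrow> g x = f x"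
  shows "alg_map k A B g"
proof -
  interpret algebra k A by (rule assms(1))
  show ?thesis by (rule alg_mapI) (simp_all add: alg_mapD[OF assms(2)] assms(3))
qed

lemma alg_hom_iff: "f \<in> alg_hom k A B \<longleftrightarrow> alg_map k A B f \<and> f \<in> extensional (carrier A)"
  by (auto simp: alg_hom_def alg_map_def)

lemma restrict_alg_hom: "algebra k A \<Longrightarrow> alg_map k A B f \<Longrightarrow> restrict f (carrier A) \<in> alg_hom k A B"
  by (simp add: alg_hom_iff alg_map_cong[of k A B f])

lemma alg_hom_closed: "f \<in> alg_hom k A B \<Longrightarrow> x \<in> carrier A \<Longrightarrow> f x \<in> carrier B"
  by (auto simp: alg_hom_iff alg_mapD)

lemma compose_alg_hom:
  assumes "algebra k A" "f \<in> alg_hom k A B" "g \<in> alg_hom k B C"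
  shows "compose (carrier A) g f \<in> alg_hom k A C"
  using restrict_alg_hom[OF assms(1) alg_map_comp[of k A B f C g]] assms by (simp add: alg_hom_iff compose_def)

locale image_algebra = algebra k M for k :: "('k, 'n) ring_scheme" (structure) and M :: "('k, 'a) module" (structure) +
  fixes e :: "'a \<Rightarrow> 'b" assumes inj: "inj_on e (carrier M)"
begin

abbreviation "IM \<equiv> image_alg e M"
abbreviation "dec \<equiv> inv_into (carrier M) e"

lemma dec [simp]: "x \<in> carrier M \<Longrightarrow> dec (e x) = x"
  using inj by simp

lemma im_simps:
  "carrier IM = e ` carrier M" "\<one>\<^bsub>IM\<^esub> = e \<one>\<^bsub>M\<^esub>" "\<zero>\<^bsub>IM\<^esub> = e \<zero>\<^bsub>M\<^esub>"
  "\<lbrakk>x \<in> carrier M; y \<in> carrier M\<rbrakk> \<Longrightarrow> e x \<otimes>\<^bsub>IM\<^esub> e y = e (x \<otimes>\<^bsub>M\<^esub> y)"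
  "\<lbrakk>x \<in> carrier M; y \<in> carrier M\<rbrakk> \<Longrightarrow> e x \<oplus>\<^bsub>IM\<^esub> e y = e (x \<oplus>\<^bsub>M\<^esub> y)"
  "x \<in> carrier M \<Longrightarrow> c \<odot>\<^bsub>IM\<^esub> e x = e (c \<odot>\<^bsub>M\<^esub> x)"
  by (simp_all add: image_alg_def Let_def)

lemma im_cases: "x \<in> carrier IM \<Longrightarrow> (\<And>y. x = e y \<Longrightarrow> y \<in> carrier M \<Longrightarrow> thesis) \<Longrightarrow> thesis"
  by (auto simp: im_simps)

lemma im_algebra: "algebra k IM"
proof (rule algebraI)
  show "cring IM"
  proof (rule cringI)
    show "abelian_group IM"
    proof (rule abelian_groupI)
      fix x assume "x \<in> carrier IM"
      then show "\<exists>y\<in>carrier IM. y \<oplus>\<^bsub>IM\<^esub> x = \<zero>\<^bsub>IM\<^esub>"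
      proof (rule im_cases)
        fix y assume "x = e y" "y \<in> carrier M"
        then show ?thesis by (intro bexI[of _ "e (\<ominus>\<^bsub>M\<^esub> y)"]) (auto simp: im_simps M.l_neg)
      qed
    qed (auto simp: im_simps M.a_ac)
    show "Group.comm_monoid IM"
      by (rule comm_monoidI) (auto simp: im_simps m_ac)
  qed (auto simp: im_simps l_distr)
qed (auto simp: im_simps R.cring_axioms smult_l_distr smult_r_distr smult_assoc1 smult_assoc2)

lemma enc_alg_map: "alg_map k M IM e"
  by (rule alg_mapI) (auto simp: im_simps)

lemma dec_alg_map: "alg_map k IM M dec"
  by (rule alg_mapI) (auto simp: im_simps)

lemma dec_closed: "x \<in> carrier IM \<Longrightarrow> dec x \<in> carrier M"
  by (auto simp: im_simps)

lemma image_map [simp]: "x \<in> carrier M \<Longrightarrow> image_map e M p (e x) = e (p x)"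
  by (simp add: image_map_def)

lemma image_map_linear:
  assumes "linear_on k M M p" shows "linear_on k IM IM (image_map e M p)"
  by (rule linear_onI) (auto simp: im_simps linear_onD[OF assms])

lemma image_map_rb:
  assumes "rb_op k lam M p" "lam \<in> carrier k"
  shows "rota_baxter k lam IM (image_map e M p)"
proof -
  have l: "linear_on k M M p" using assms by (simp add: rb_op_def)
  show ?thesis unfolding rota_baxter_iff rb_op_def
  proof (intro conjI ballI image_map_linear[OF l])
    show "image_map e M p \<in> extensional (carrier IM)" by (simp add: image_map_def im_simps)
    fix x y assume "x \<in> carrier IM" "y \<in> carrier IM"
    then obtain x' y' where [simp]: "x = e x'" "y = e y'" "x' \<in> carrier M" "y' \<in> carrier M" by (auto simp: im_simps)
    have "p x' \<otimes>\<^bsub>M\<^esub> p y' = p (x' \<otimes>\<^bsub>M\<^esub> p y') \<oplus>\<^bsub>M\<^esub> p (y' \<otimes>\<^bsub>M\<^esub> p x') \<oplus>\<^bsub>M\<^esub> lam \<odot>\<^bsub>M\<^esub> p (x' \<otimes>\<^bsub>M\<^esub> y')"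
      using assms by (simp add: rb_op_def)
    then show "image_map e M p x \<otimes>\<^bsub>IM\<^esub> image_map e M p y = image_map e M p (x \<otimes>\<^bsub>IM\<^esub> image_map e M p y) \<oplus>\<^bsub>IM\<^esub>
        image_map e M p (y \<otimes>\<^bsub>IM\<^esub> image_map e M p x) \<oplus>\<^bsub>IM\<^esub> lam \<odot>\<^bsub>IM\<^esub> image_map e M p (x \<otimes>\<^bsub>IM\<^esub> y)"
      using assms linear_onD[OF l] by (simp add: im_simps)
  qed
qed

lemma image_map_deriv:
  assumes "wt_deriv k lam M p" "lam \<in> carrier k"
  shows "weighted_derivation k lam IM (image_map e M p)"
proof -
  have l: "linear_on k M M p" using assms by (simp add: wt_deriv_def)
  show ?thesis unfolding weighted_derivation_iff wt_deriv_def
  proof (intro conjI ballI image_map_linear[OF l])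
    show "image_map e M p \<in> extensional (carrier IM)" by (simp add: image_map_def im_simps)
    show "image_map e M p \<one>\<^bsub>IM\<^esub> = \<zero>\<^bsub>IM\<^esub>" using assms by (simp add: im_simps wt_deriv_def)
    fix x y assume "x \<in> carrier IM" "y \<in> carrier IM"
    then obtain x' y' where [simp]: "x = e x'" "y = e y'" "x' \<in> carrier M" "y' \<in> carrier M" by (auto simp: im_simps)
    have "p (x' \<otimes>\<^bsub>M\<^esub> y') = p x' \<otimes>\<^bsub>M\<^esub> y' \<oplus>\<^bsub>M\<^esub> x' \<otimes>\<^bsub>M\<^esub> p y' \<oplus>\<^bsub>M\<^esub> lam \<odot>\<^bsub>M\<^esub> (p x' \<otimes>\<^bsub>M\<^esub> p y')"
      using assms by (simp add: wt_deriv_def)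
    then show "image_map e M p (x \<otimes>\<^bsub>IM\<^esub> y) = image_map e M p x \<otimes>\<^bsub>IM\<^esub> y \<oplus>\<^bsub>IM\<^esub> x \<otimes>\<^bsub>IM\<^esub> image_map e M p y
        \<oplus>\<^bsub>IM\<^esub> lam \<odot>\<^bsub>IM\<^esub> (image_map e M p x \<otimes>\<^bsub>IM\<^esub> image_map e M p y)"
      using assms linear_onD[OF l] by (simp add: im_simps)
  qed
qed

end

text \<open>On \<open>aP(x)\<close> both sides are computed by the Leibniz rule and by \<open>d(P(x)) = x\<close>, once in
  \<open>Sha(A)\<close> and once in \<open>B\<close>.\<close>

lemma (in wt_derivation) free_hom_derivation:
  assumes B: "algebra k B" and h: "alg_map k SA B h" and hP: "\<And>x. x \<in> carrier T \<Longrightarrow> h (PA x) = Q (h x)"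
    and Q: "\<And>x. x \<in> carrier B \<Longrightarrow> Q x \<in> carrier B" and d': "wt_deriv k lam B d'"
    and dQ: "\<And>x. x \<in> carrier B \<Longrightarrow> d' (Q x) = x"
    and gen: "\<And>a. a \<in> carrier A \<Longrightarrow> h (\<eta> (d a)) = d' (h (\<eta> a))" and x: "x \<in> carrier T"
  shows "h (D x) = d' (h x)"
proof -
  interpret B: algebra k B by (rule B)
  have h': "linear_on k T B h" using alg_map_linear[OF h] by (simp add: linear_on_def)
  have d'': "linear_on k B B d'" using d' by (simp add: wt_deriv_def)
  have leib: "d' (x \<otimes>\<^bsub>B\<^esub> y) = d' x \<otimes>\<^bsub>B\<^esub> y \<oplus>\<^bsub>B\<^esub> x \<otimes>\<^bsub>B\<^esub> d' y \<oplus>\<^bsub>B\<^esub> lam \<odot>\<^bsub>B\<^esub> (d' x \<otimes>\<^bsub>B\<^esub> d' y)"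
    if "x \<in> carrier B" "y \<in> carrier B" for x y using d' that by (simp add: wt_deriv_def)
  note hD = alg_mapD[OF h, simplified]
  show ?thesis
  proof (rule linear_eqI[OF linear_on_comp[OF D_linear h'] linear_on_comp[OF h' d''] x])
    fix w assume "w \<in> words A"
    then show "h (D (tens w)) = d' (h (tens w))"
    proof (cases rule: tens_cases)
      case (1 a) then show ?thesis by (simp add: D_eta gen)
    next
      case (2 a v)
      note t = tens_closed[OF 2(2)]
      have "h (D (pre a (tens v))) = h (\<eta> (d a)) \<otimes>\<^bsub>B\<^esub> Q (h (tens v)) \<oplus>\<^bsub>B\<^esub> h (\<eta> a) \<otimes>\<^bsub>B\<^esub> h (tens v)
          \<oplus>\<^bsub>B\<^esub> lam \<odot>\<^bsub>B\<^esub> (h (\<eta> (d a)) \<otimes>\<^bsub>B\<^esub> h (tens v))"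
        unfolding D_pre[OF 2(1) t] using 2 t dL(1)[OF 2(1)] by (simp add: pre_eq hD hP mult_left(1) PA(1))
      also have "\<dots> = d' (h (pre a (tens v)))"
        using 2(1) t leib[of "h (\<eta> a)" "Q (h (tens v))"] by (simp add: pre_eq hD hP PA(1) Q dQ gen)
      finally show ?thesis using 2 by simp
    qed
  qed
qed

context weighted_algebra begin

lemma sha_map_lift:
  assumes B: "weighted_algebra k B lam" and f: "alg_map k A B f" and x: "x \<in> carrier T"
  shows "sha_map k B f x = rb_extension.lift k (sha k lam B) (sha_P k B) (\<lambda>a. pure_tensor k B [f a]) x"
proof -
  interpret B: weighted_algebra k B lam by (rule B)
  interpret E: rb_extension k A lam "sha k lam B" "sha_P k B" "\<lambda>a. pure_tensor k B [f a]"
  proof -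
    interpret S: algebra k "sha k lam B" by (rule B.sha_algebra)
    show "rb_extension k A lam (sha k lam B) (sha_P k B) (\<lambda>a. pure_tensor k B [f a])"
      by unfold_locales (use B.sha_PA_rb alg_map_comp[OF f B.eta_alg_map] in auto)
  qed
  note fD = alg_mapD[OF f]
  have w: "map f w \<in> words B" if "w \<in> words A" for w using that fD(1) by (auto simp: words_def)
  have ml: "multilinear k A (sha_module k B) (\<lambda>w. pure_tensor k B (map f w))"
  proof (rule multilinearI)
    fix p q assume "set p \<subseteq> carrier A" "set q \<subseteq> carrier A"
    then have "set (map f p) \<subseteq> carrier B" "set (map f q) \<subseteq> carrier B" using fD(1) by auto
    from linear_on_comp[OF alg_map_linear[OF f] multilinear_at[OF B.tens_multilinear this]]
    show "linear_on k A (sha_module k B) (\<lambda>a. pure_tensor k B (map f (p @ a # q)))" by simp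
  qed
  interpret TB: tensor_target k A "sha_module k B" ..
  have l: "linear_on k T (sha_module k B) E.lift"
    using E.lift_linear by (simp add: linear_on_def)
  have wv: "E.word_value w = pure_tensor k B (map f w)" if "w \<in> words A" for w
    using that
  proof (induction w)
    case (Cons a w)
    then show ?case
      using w[of w] fD(1)
      by (cases "w = []") (auto simp: E.word_value_Cons E.word_value_single words_def[of A] B.tens_Cons)
  qed (simp add: words_def)
  show ?thesis
    unfolding sha_map_def
    by (rule linear_eqI[OF TB.lin_ext_linear[OF ml] l x]) (simp add: TB.lin_ext_tens[OF ml] E.lift_tens wv)
qed

end

locale universe = fixes S :: "('k, 'u) setting" assumes valid: "valid_setting S"
begin

abbreviation "k \<equiv> base S"
abbreviation "lam \<equiv> weight S"

lemma weighted: "algebra k A \<Longrightarrow> weighted_algebra k A lam"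
  using valid by (simp add: weighted_algebra_def weighted_algebra_axioms_def valid_setting_def)

lemma lam: "lam \<in> carrier k" using valid by (simp add: valid_setting_def)

lemma inj_seq: "inj_on (seq_code S) X" using valid by (auto simp: valid_setting_def intro: inj_on_subset)

text \<open>A coset is recovered from its chosen representative, and that representative from its code.\<close>

lemma inj_sha:
  assumes "algebra k A" shows "inj_on (enc_sha S) (carrier (sha k lam A))"
proof (rule inj_onI)
  interpret weighted_algebra k A lam by (rule weighted[OF assms])
  fix X Y assume X: "X \<in> carrier (sha k lam A)" and Y: "Y \<in> carrier (sha k lam A)" and e: "enc_sha S X = enc_sha S Y"
  obtain f g where f: "f \<in> F" "X = coset k A f" and g: "g \<in> F" "Y = coset k A g"
    using X Y by (auto simp: T_carrier)
  have "rep X \<in> F" "rep Y \<in> F" using rep_coset f g by auto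
  then have "rep X = rep Y"
    using e valid unfolding valid_setting_def enc_sha_def
    by (auto simp: formal_sums_def dest: inj_onD)
  then show "X = Y" using rep_coset(2) f g by metis
qed

lemma image_sha: "algebra k A \<Longrightarrow> image_algebra k (sha k lam A) (enc_sha S)"
  using weighted_algebra.sha_algebra[OF weighted] inj_sha by (simp add: image_algebra_def image_algebra_axioms_def)

lemma image_seq: "algebra k A \<Longrightarrow> image_algebra k (seq_alg k lam A) (seq_code S)"
  using weighted_algebra.seq_algebra[OF weighted] inj_seq by (simp add: image_algebra_def image_algebra_axioms_def)

text \<open>The operators that make \<open>Sha(A)\<close> free and \<open>A\<^sup>\<nat>\<close> cofree, inside the universe;
  \<open>d_seq A\<close> is the shift.\<close>

definition "P_free A = snd (free_RBA S A)"
definition "d_free A d = snd (Sha_DIF S (A, d))"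
definition "d_seq A = image_map (seq_code S) (seq_alg k lam A) (\<lambda>f n. f (Suc n))"
definition "P_seq A P = snd (Seq_RBA S (A, P))"

lemma free_RBA_eq: "free_RBA S A = (Sha S A, P_free A)"
  and Sha_DIF_eq: "Sha_DIF S (A, d) = (Sha S A, d_free A d)"
  and Seq_RBA_eq: "Seq_RBA S (A, P) = (Seq S A, P_seq A P)"
  by (simp_all add: P_free_def d_free_def P_seq_def free_RBA_def Sha_DIF_def Seq_RBA_def)

context
  fixes A :: "('k, 'u) module" assumes A: "algebra k A"
begin

interpretation A: weighted_algebra k A lam by (rule weighted[OF A])
interpretation I: image_algebra k "sha k lam A" "enc_sha S" by (rule image_sha[OF A])

lemma dec_enc_sha: "y \<in> carrier A.T \<Longrightarrow> inv_into (carrier A.T) (enc_sha S) (enc_sha S y) = y"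
  using I.dec by simp

lemma Sha_algebra: "algebra k (Sha S A)"
  unfolding Sha_def by (rule I.im_algebra)

lemma P_free_rb: "rota_baxter k lam (Sha S A) (P_free A)"
  using I.image_map_rb[OF A.sha_PA_rb lam] by (simp add: Sha_def P_free_def free_RBA_def)

lemma eta_hom: "eta S A \<in> alg_hom k A (Sha S A)"
  unfolding eta_def Sha_def
  by (rule restrict_alg_hom[OF A alg_map_comp[OF A.eta_alg_map I.enc_alg_map]])

lemma free_unique:
  assumes g: "alg_map k (Sha S A) R g" and g': "alg_map k (Sha S A) R g'"
    and gP: "\<And>x. x \<in> carrier (Sha S A) \<Longrightarrow> g (P_free A x) = P (g x)"
    and g'P: "\<And>x. x \<in> carrier (Sha S A) \<Longrightarrow> g' (P_free A x) = P (g' x)"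
    and e: "\<And>a. a \<in> carrier A \<Longrightarrow> g (eta S A a) = g' (eta S A a)" and x: "x \<in> carrier (Sha S A)"
  shows "g x = g' x"
proof -
  obtain y where y: "x = enc_sha S y" "y \<in> carrier A.T" using x by (auto simp: Sha_def I.im_simps)
  have c: "enc_sha S y \<in> carrier (Sha S A)" if "y \<in> carrier A.T" for y using that by (simp add: Sha_def I.im_simps)
  have p: "P_free A (enc_sha S y) = enc_sha S (A.PA y)" if "y \<in> carrier A.T" for y
    using that by (simp add: P_free_def free_RBA_def)
  have "g (enc_sha S y) = g' (enc_sha S y)"
    using alg_map_comp[OF I.enc_alg_map, folded Sha_def, OF g] alg_map_comp[OF I.enc_alg_map, folded Sha_def, OF g']
    by (rule A.free_hom_unique[where Q = P])
      (use gP g'P c p y e in \<open>auto simp: p[symmetric] eta_def\<close>)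
  then show ?thesis by (simp add: y)
qed

lemma evaluation_hom:
  assumes P: "rota_baxter k lam A P"
  shows "evaluation S (A, P) \<in> alg_hom k (Sha S A) A"
    "x \<in> carrier (Sha S A) \<Longrightarrow> evaluation S (A, P) (P_free A x) = P (evaluation S (A, P) x)"
    "a \<in> carrier A \<Longrightarrow> evaluation S (A, P) (eta S A a) = a"
proof -
  interpret E: rb_extension k A lam A P "\<lambda>a. a"
    by unfold_locales (use P alg_map_id in \<open>auto simp: rota_baxter_iff\<close>)
  have ev: "ev k A P = E.lift"
    by (simp add: ev_def E.lift_def E.word_value_def[abs_def])
  have e: "evaluation S (A, P) = (\<lambda>x\<in>carrier (Sha S A). E.lift (I.dec x))"
    by (simp add: evaluation_def ev dec_sha_def)
  show "evaluation S (A, P) \<in> alg_hom k (Sha S A) A"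
    unfolding e
    by (rule restrict_alg_hom[OF Sha_algebra alg_map_comp[OF I.dec_alg_map[folded Sha_def] E.lift_alg_map]])
  have cl: "enc_sha S y \<in> carrier (Sha S A)" if "y \<in> carrier A.T" for y using that by (simp add: Sha_def I.im_simps)
  show "evaluation S (A, P) (P_free A x) = P (evaluation S (A, P) x)" if x: "x \<in> carrier (Sha S A)"
  proof -
    obtain y where "x = enc_sha S y" "y \<in> carrier A.T" using x by (auto simp: Sha_def I.im_simps)
    then show ?thesis using A.PA(1)[of y] by (simp add: e P_free_def free_RBA_def cl E.lift_PA dec_enc_sha)
  qed
  show "evaluation S (A, P) (eta S A a) = a" if "a \<in> carrier A"
    using that by (simp add: e eta_def cl E.lift_eta dec_enc_sha)
qed

lemma Sha_map_hom:
  assumes B: "algebra k B" and f: "f \<in> alg_hom k A B"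
  shows "Sha_map S A B f \<in> alg_hom k (Sha S A) (Sha S B)"
    "x \<in> carrier (Sha S A) \<Longrightarrow> Sha_map S A B f (P_free A x) = P_free B (Sha_map S A B f x)"
    "a \<in> carrier A \<Longrightarrow> Sha_map S A B f (eta S A a) = eta S B (f a)"
proof -
  interpret B: weighted_algebra k B lam by (rule weighted[OF B])
  interpret J: image_algebra k "sha k lam B" "enc_sha S" by (rule image_sha[OF B])
  have f': "alg_map k A B f" using f by (simp add: alg_hom_iff)
  interpret E: rb_extension k A lam "sha k lam B" "sha_P k B" "\<lambda>a. pure_tensor k B [f a]"
    by unfold_locales (use B.sha_PA_rb alg_map_comp[OF f' B.eta_alg_map] in auto)
  have e: "Sha_map S A B f = (\<lambda>x\<in>carrier (Sha S A). enc_sha S (E.lift (I.dec x)))"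
    by (rule ext) (use A.sha_map_lift[OF B.weighted_algebra_axioms f'] I.dec_closed in
      \<open>auto simp: Sha_map_def dec_sha_def Sha_def restrict_def\<close>)
  show "Sha_map S A B f \<in> alg_hom k (Sha S A) (Sha S B)"
    unfolding e
    by (rule restrict_alg_hom[OF Sha_algebra alg_map_comp[OF alg_map_comp[OF I.dec_alg_map[folded Sha_def] E.lift_alg_map]
        J.enc_alg_map[folded Sha_def]]])
  have cl: "enc_sha S y \<in> carrier (Sha S A)" if "y \<in> carrier A.T" for y using that by (simp add: Sha_def I.im_simps)
  show "Sha_map S A B f (P_free A x) = P_free B (Sha_map S A B f x)" if x: "x \<in> carrier (Sha S A)"
  proof -
    obtain y where "x = enc_sha S y" "y \<in> carrier A.T" using x by (auto simp: Sha_def I.im_simps)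
    then show ?thesis using A.PA(1)[of y] E.extL(1)[of y] by (simp add: e P_free_def free_RBA_def cl E.lift_PA dec_enc_sha)
  qed
  show "Sha_map S A B f (eta S A a) = eta S B (f a)" if "a \<in> carrier A"
    using that E.fD(1) alg_mapD(1)[OF f'] by (simp add: e eta_def cl E.lift_eta dec_enc_sha)
qed

lemma d_free_deriv:
  assumes d: "weighted_derivation k lam A d"
  shows "weighted_derivation k lam (Sha S A) (d_free A d)"
    "x \<in> carrier (Sha S A) \<Longrightarrow> d_free A d (P_free A x) = x"
    "a \<in> carrier A \<Longrightarrow> d_free A d (eta S A a) = eta S A (d a)"
proof -
  interpret W: wt_derivation k A lam d
    by unfold_locales (use d in \<open>simp add: weighted_derivation_iff\<close>)
  show "weighted_derivation k lam (Sha S A) (d_free A d)"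
    using I.image_map_deriv[OF W.D_deriv lam] by (simp add: Sha_def d_free_def Sha_DIF_def)
  show "d_free A d (P_free A x) = x" if x: "x \<in> carrier (Sha S A)"
  proof -
    obtain y where "x = enc_sha S y" "y \<in> carrier A.T" using x by (auto simp: Sha_def I.im_simps)
    then show ?thesis using A.PA(1)[of y] by (simp add: d_free_def Sha_DIF_def P_free_def free_RBA_def W.D_PA)
  qed
  show "d_free A d (eta S A a) = eta S A (d a)" if "a \<in> carrier A"
    using that W.dL(1) by (simp add: d_free_def Sha_DIF_def eta_def W.D_eta)
qed

lemma free_hom_deriv:
  assumes d: "weighted_derivation k lam A d" and R: "algebra k R" and h: "alg_map k (Sha S A) R h"
    and hP: "\<And>x. x \<in> carrier (Sha S A) \<Longrightarrow> h (P_free A x) = P (h x)"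
    and P: "rota_baxter k lam R P" and d': "weighted_derivation k lam R d'"
    and dP: "\<And>x. x \<in> carrier R \<Longrightarrow> d' (P x) = x"
    and gen: "\<And>a. a \<in> carrier A \<Longrightarrow> h (eta S A (d a)) = d' (h (eta S A a))" and x: "x \<in> carrier (Sha S A)"
  shows "h (d_free A d x) = d' (h x)"
proof -
  interpret W: wt_derivation k A lam d
    by unfold_locales (use d in \<open>simp add: weighted_derivation_iff\<close>)
  obtain y where y: "x = enc_sha S y" "y \<in> carrier A.T" using x by (auto simp: Sha_def I.im_simps)
  have cl: "enc_sha S y \<in> carrier (Sha S A)" if "y \<in> carrier A.T" for y using that by (simp add: Sha_def I.im_simps)
  have p: "P_free A (enc_sha S y) = enc_sha S (A.PA y)" if "y \<in> carrier A.T" for y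
    using that by (simp add: P_free_def free_RBA_def)
  have PL: "P x \<in> carrier R" if "x \<in> carrier R" for x
    using P that by (auto simp: rota_baxter_iff rb_op_def linear_on_def)
  have "h (enc_sha S (W.D y)) = d' (h (enc_sha S y))"
    by (rule W.free_hom_derivation[OF R alg_map_comp[OF I.enc_alg_map, folded Sha_def, OF h], where Q = P])
      (use hP cl p y gen PL dP d' W.dL(1) in \<open>auto simp: p[symmetric] eta_def weighted_derivation_iff\<close>)
  then show ?thesis using y by (simp add: d_free_def Sha_DIF_def)
qed

end

context
  fixes A :: "('k, 'u) module" assumes A: "algebra k A"
begin

interpretation A: weighted_algebra k A lam by (rule weighted[OF A])
interpretation I: image_algebra k "seq_alg k lam A" "seq_code S" by (rule image_seq[OF A])

lemma Seq_algebra: "algebra k (Seq S A)"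
  unfolding Seq_def by (rule I.im_algebra)

lemma Seq_closed: "(\<And>n. f n \<in> carrier A) \<Longrightarrow> seq_code S f \<in> carrier (Seq S A)"
  by (auto simp: Seq_def I.im_simps A.seq_carrier)

lemma Seq_cases:
  assumes "x \<in> carrier (Seq S A)"
  obtains f where "x = seq_code S f" "\<And>n. f n \<in> carrier A"
  using assms by (auto simp: Seq_def I.im_simps A.seq_carrier)

lemma dec_seq_code [simp]: "(\<And>n. f n \<in> carrier A) \<Longrightarrow> dec_seq S A (seq_code S f) = f"
  by (simp add: dec_seq_def A.seq_carrier)

lemma d_seq_deriv: "weighted_derivation k lam (Seq S A) (d_seq A)"
  using I.image_map_deriv[OF A.shift_deriv lam] by (simp add: Seq_def d_seq_def)

lemma d_seq_code: "(\<And>n. f n \<in> carrier A) \<Longrightarrow> d_seq A (seq_code S f) = seq_code S (\<lambda>n. f (Suc n))"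
  by (simp add: d_seq_def A.seq_carrier)

lemma d_seq_funpow:
  assumes "\<And>n. f n \<in> carrier A" shows "(d_seq A ^^ m) (seq_code S f) = seq_code S (\<lambda>n. f (m + n))"
  by (induction m) (simp_all add: assms d_seq_code)

lemma P_seq_rb:
  assumes "rota_baxter k lam A P" shows "rota_baxter k lam (Seq S A) (P_seq A P)"
  using I.image_map_rb[OF A.seq_P_rb lam] assms by (simp add: Seq_def P_seq_def Seq_RBA_def rota_baxter_iff)

lemma P_seq_code: "(\<And>n. f n \<in> carrier A) \<Longrightarrow> P_seq A P (seq_code S f) = seq_code S (seq_P P f)"
  by (simp add: P_seq_def Seq_RBA_def A.seq_carrier)

lemma seq_counit_hom: "seq_counit S A \<in> alg_hom k (Seq S A) A"
  unfolding seq_counit_def dec_seq_def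
  by (rule restrict_alg_hom[OF Seq_algebra alg_map_comp[OF I.dec_alg_map[folded Seq_def] A.at_0_alg_map]])

lemma seq_counit_code: "(\<And>n. f n \<in> carrier A) \<Longrightarrow> seq_counit S A (seq_code S f) = f 0"
  by (simp add: seq_counit_def Seq_closed)

lemma Seq_map_code: "(\<And>n. f n \<in> carrier A) \<Longrightarrow> Seq_map S A h (seq_code S f) = seq_code S (\<lambda>n. h (f n))"
  by (simp add: Seq_map_def Seq_closed)

lemma Seq_map_hom:
  assumes B: "algebra k B" and h: "h \<in> alg_hom k A B"
  shows "Seq_map S A h \<in> alg_hom k (Seq S A) (Seq S B)"
proof -
  interpret J: image_algebra k "seq_alg k lam B" "seq_code S" by (rule image_seq[OF B])
  have h': "alg_map k A B h" using h by (simp add: alg_hom_iff)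
  show ?thesis unfolding Seq_map_def dec_seq_def
    by (rule restrict_alg_hom[OF Seq_algebra alg_map_comp[OF alg_map_comp[OF I.dec_alg_map[folded Seq_def]
          seq_map_alg_map[OF weighted[OF A] weighted[OF B] h']] J.enc_alg_map[folded Seq_def]]])
qed

lemma orbit_hom:
  assumes d: "weighted_derivation k lam A d"
  shows "orbit_map S A d \<in> alg_hom k A (Seq S A)"
proof -
  interpret W: wt_derivation k A lam d
    by unfold_locales (use d in \<open>simp add: weighted_derivation_iff\<close>)
  show ?thesis unfolding orbit_map_def
    by (rule restrict_alg_hom[OF A alg_map_comp[OF W.orbit_alg_map I.enc_alg_map[folded Seq_def]]])
qed

lemma deriv_funpow_closed: "weighted_derivation k lam A d \<Longrightarrow> a \<in> carrier A \<Longrightarrow> (d ^^ n) a \<in> carrier A"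
  by (induction n) (auto simp: weighted_derivation_iff wt_deriv_def linear_on_def)

end

lemma seq_code_eq: "seq_code S f = seq_code S g \<longleftrightarrow> f = g"
  using inj_seq[of UNIV] by (auto dest: injD)

end


section \<open>The concrete categories and their adjunctions\<close>

lemma concrete_simps [simp]:
  "Obj (concrete_cat X car mors) = X"
  "Idn (concrete_cat X car mors) x = (x, \<lambda>a\<in>car x. a, x)"
  "(y', g, z) \<bullet>\<^bsub>concrete_cat X car mors\<^esub> (x, f, y) = (x, compose (car x) g f, z)"
  by (simp_all add: concrete_cat_def)

lemma arrow_concrete:
  "arrow (concrete_cat X car mors) g x y \<longleftrightarrow> (\<exists>f. g = (x, f, y) \<and> x \<in> X \<and> y \<in> X \<and> f \<in> mors x y)"
  by (auto simp: arrow_def concrete_cat_def)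

lemma category_concrete:
  assumes "\<And>x y f. \<lbrakk>x \<in> X; y \<in> X; f \<in> mors x y\<rbrakk> \<Longrightarrow> f \<in> car x \<rightarrow>\<^sub>E car y"
    and "\<And>x. x \<in> X \<Longrightarrow> (\<lambda>a\<in>car x. a) \<in> mors x x"
    and "\<And>x y z f g. \<lbrakk>x \<in> X; y \<in> X; z \<in> X; f \<in> mors x y; g \<in> mors y z\<rbrakk> \<Longrightarrow> compose (car x) g f \<in> mors x z"
  shows "category (concrete_cat X car mors)"
proof (rule categoryI)
  fix f A B assume f: "arrow (concrete_cat X car mors) f A B"
  then show "A \<in> Obj (concrete_cat X car mors) \<and> B \<in> Obj (concrete_cat X car mors)"
    by (auto simp: arrow_concrete)
  obtain f' where f': "f = (A, f', B)" "A \<in> X" "B \<in> X" "f' \<in> mors A B" using f by (auto simp: arrow_concrete)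
  note e = assms(1)[OF f'(2-4)]
  show "f \<bullet>\<^bsub>concrete_cat X car mors\<^esub> Idn (concrete_cat X car mors) A = f \<and>
        Idn (concrete_cat X car mors) B \<bullet>\<^bsub>concrete_cat X car mors\<^esub> f = f"
    using e by (auto simp: f'(1) compose_def fun_eq_iff PiE_def extensional_def)
  fix g D assume g: "arrow (concrete_cat X car mors) g B D"
  obtain g' where g': "g = (B, g', D)" "D \<in> X" "g' \<in> mors B D" using g by (auto simp: arrow_concrete)
  show "arrow (concrete_cat X car mors) (g \<bullet>\<^bsub>concrete_cat X car mors\<^esub> f) A D"
    using f' g' assms(3) by (simp add: arrow_concrete)
  fix h E assume h: "arrow (concrete_cat X car mors) h D E"
  obtain h' where h': "h = (D, h', E)" using h by (auto simp: arrow_concrete)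
  show "(h \<bullet>\<^bsub>concrete_cat X car mors\<^esub> g) \<bullet>\<^bsub>concrete_cat X car mors\<^esub> f =
     h \<bullet>\<^bsub>concrete_cat X car mors\<^esub> (g \<bullet>\<^bsub>concrete_cat X car mors\<^esub> f)"
    using e by (auto simp: f'(1) g'(1) h' compose_def fun_eq_iff PiE_def)
qed (use assms(2) in \<open>auto simp: arrow_concrete\<close>)

lemma functor_same_map:
  assumes "category (concrete_cat X car mors)" "category (concrete_cat Y car' mors')"
    and "\<And>x. x \<in> X \<Longrightarrow> \<phi> x \<in> Y" "\<And>x. x \<in> X \<Longrightarrow> car' (\<phi> x) = car x"
    and "\<And>x y f. \<lbrakk>x \<in> X; y \<in> X; f \<in> mors x y\<rbrakk> \<Longrightarrow> f \<in> mors' (\<phi> x) (\<phi> y)"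
  shows "is_functor (concrete_cat X car mors) (concrete_cat Y car' mors') (same_map \<phi>)"
proof (rule functorI)
  fix f A B assume f: "arrow (concrete_cat X car mors) f A B"
  show "arrow (concrete_cat Y car' mors') (ar (same_map \<phi>) f) (ob (same_map \<phi>) A) (ob (same_map \<phi>) B)"
    using f assms(3,5) by (auto simp: arrow_concrete same_map_def)
  fix g E assume g: "arrow (concrete_cat X car mors) g B E"
  show "ar (same_map \<phi>) (g \<bullet>\<^bsub>concrete_cat X car mors\<^esub> f) =
     ar (same_map \<phi>) g \<bullet>\<^bsub>concrete_cat Y car' mors'\<^esub> ar (same_map \<phi>) f"
    using f g assms(4) by (auto simp: arrow_concrete same_map_def)
qed (use assms in \<open>auto simp: same_map_def\<close>)

lemma same_map_simps [simp]: "ob (same_map \<phi>) x = \<phi> x" "ar (same_map \<phi>) (x, f, y) = (\<phi> x, f, \<phi> y)"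
  by (simp_all add: same_map_def)

lemma compose_eq_iff: "compose X g f = compose X g' f' \<longleftrightarrow> (\<forall>x\<in>X. g (f x) = g' (f' x))"
  by (auto simp: compose_def fun_eq_iff)

lemma compose_eq_restrict_iff: "compose X g f = (\<lambda>a\<in>X. h a) \<longleftrightarrow> (\<forall>x\<in>X. g (f x) = h x)"
  by (auto simp: compose_def fun_eq_iff)

lemma alg_hom_ext:
  "f \<in> alg_hom k A B \<Longrightarrow> g \<in> alg_hom k A B \<Longrightarrow> (\<And>x. x \<in> carrier A \<Longrightarrow> f x = g x) \<Longrightarrow> f = g"
  by (auto simp: alg_hom_iff intro: extensionalityI)

lemma alg_hom_PiE: "f \<in> alg_hom k A B \<Longrightarrow> f \<in> carrier A \<rightarrow>\<^sub>E carrier B"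
  by (auto simp: alg_hom_iff alg_mapD PiE_def)

lemma id_alg_hom: "algebra k A \<Longrightarrow> (\<lambda>a\<in>carrier A. a) \<in> alg_hom k A A"
  by (rule restrict_alg_hom[OF _ alg_map_id])

lemma rota_baxter_closed: "rota_baxter k lam R P \<Longrightarrow> x \<in> carrier R \<Longrightarrow> P x \<in> carrier R"
  by (auto simp: rota_baxter_iff rb_op_def linear_on_def)

lemma weighted_derivation_closed: "weighted_derivation k lam R d \<Longrightarrow> x \<in> carrier R \<Longrightarrow> d x \<in> carrier R"
  by (auto simp: weighted_derivation_iff wt_deriv_def linear_on_def)

context universe begin

lemma ALG_obj [simp]: "A \<in> Obj (ALG S) \<longleftrightarrow> algebra k A"
  by (simp add: ALG_def)

lemma ALG_arrow: "arrow (ALG S) f A B \<longleftrightarrow> (\<exists>g. f = (A, g, B) \<and> algebra k A \<and> algebra k B \<and> g \<in> alg_hom k A B)"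
  by (auto simp: ALG_def arrow_concrete)

lemma ALG_simps [simp]: "Idn (ALG S) A = (A, \<lambda>a\<in>carrier A. a, A)"
  "(B', g, E) \<bullet>\<^bsub>ALG S\<^esub> (A, f, B) = (A, compose (carrier A) g f, E)"
  by (simp_all add: ALG_def)

lemma RBA_obj [simp]: "(R, P) \<in> Obj (RBA S) \<longleftrightarrow> algebra k R \<and> rota_baxter k lam R P"
  by (simp add: RBA_def)

lemma RBA_arrow: "arrow (RBA S) f (R, P) (R', P') \<longleftrightarrow> (\<exists>g. f = ((R, P), g, (R', P')) \<and> (R, P) \<in> Obj (RBA S) \<and>
    (R', P') \<in> Obj (RBA S) \<and> g \<in> alg_hom k R R' \<and> (\<forall>x\<in>carrier R. g (P x) = P' (g x)))"
  by (auto simp: RBA_def arrow_concrete)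

lemma RBA_simps [simp]: "Idn (RBA S) (R, P) = ((R, P), \<lambda>a\<in>carrier R. a, (R, P))"
  "(Y', g, Z) \<bullet>\<^bsub>RBA S\<^esub> ((R, P), f, Y) = ((R, P), compose (carrier R) g f, Z)"
  by (simp_all add: RBA_def)

lemma DIF_obj [simp]: "(R, d) \<in> Obj (DIF S) \<longleftrightarrow> algebra k R \<and> weighted_derivation k lam R d"
  by (simp add: DIF_def)

lemma DIF_arrow: "arrow (DIF S) f (R, d) (R', d') \<longleftrightarrow> (\<exists>g. f = ((R, d), g, (R', d')) \<and> (R, d) \<in> Obj (DIF S) \<and>
    (R', d') \<in> Obj (DIF S) \<and> g \<in> alg_hom k R R' \<and> (\<forall>x\<in>carrier R. g (d x) = d' (g x)))"
  by (auto simp: DIF_def arrow_concrete)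

lemma DIF_simps [simp]: "Idn (DIF S) (R, d) = ((R, d), \<lambda>a\<in>carrier R. a, (R, d))"
  "(Y', g, Z) \<bullet>\<^bsub>DIF S\<^esub> ((R, d), f, Y) = ((R, d), compose (carrier R) g f, Z)"
  by (simp_all add: DIF_def)

lemma DRB_obj [simp]: "(R, d, P) \<in> Obj (DRB S) \<longleftrightarrow> algebra k R \<and> weighted_derivation k lam R d \<and>
    rota_baxter k lam R P \<and> (\<forall>x\<in>carrier R. d (P x) = x)"
  by (simp add: DRB_def)

lemma DRB_arrow: "arrow (DRB S) f (R, d, P) (R', d', P') \<longleftrightarrow> (\<exists>g. f = ((R, d, P), g, (R', d', P')) \<and>
    (R, d, P) \<in> Obj (DRB S) \<and> (R', d', P') \<in> Obj (DRB S) \<and> g \<in> alg_hom k R R' \<and>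
    (\<forall>x\<in>carrier R. g (d x) = d' (g x)) \<and> (\<forall>x\<in>carrier R. g (P x) = P' (g x)))"
  by (auto simp: DRB_def arrow_concrete)

lemma category_ALG: "category (ALG S)"
  unfolding ALG_def
  by (rule category_concrete) (auto simp: alg_hom_PiE id_alg_hom intro: compose_alg_hom dest: alg_hom_PiE)

lemma category_RBA: "category (RBA S)"
  unfolding RBA_def
  by (rule category_concrete)
    (auto simp: id_alg_hom rota_baxter_closed compose_def[symmetric] compose_eq alg_hom_closed
      intro: compose_alg_hom dest: alg_hom_PiE)

lemma category_DIF: "category (DIF S)"
  unfolding DIF_def
  by (rule category_concrete)
    (auto simp: id_alg_hom weighted_derivation_closed compose_def[symmetric] compose_eq alg_hom_closed
      intro: compose_alg_hom dest: alg_hom_PiE)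

lemma category_DRB: "category (DRB S)"
  unfolding DRB_def
  by (rule category_concrete)
    (auto simp: id_alg_hom weighted_derivation_closed rota_baxter_closed compose_eq alg_hom_closed
      intro: compose_alg_hom dest: alg_hom_PiE)

lemma functor_U_RBA: "is_functor (RBA S) (ALG S) U_RBA"
  using category_RBA category_ALG unfolding RBA_def ALG_def U_RBA_def by (rule functor_same_map) auto

lemma functor_V_DIF: "is_functor (DIF S) (ALG S) V_DIF"
  using category_DIF category_ALG unfolding DIF_def ALG_def V_DIF_def by (rule functor_same_map) auto

lemma functor_U'_DRB: "is_functor (DRB S) (DIF S) U'_DRB"
  using category_DRB category_DIF unfolding DRB_def DIF_def U'_DRB_def by (rule functor_same_map) auto

lemma functor_V'_DRB: "is_functor (DRB S) (RBA S) V'_DRB"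
  using category_DRB category_RBA unfolding DRB_def RBA_def V'_DRB_def by (rule functor_same_map) auto

lemma forget_simps [simp]:
  "ob U_RBA (R, P) = R" "ar U_RBA ((R, P), f, (R', P')) = (R, f, R')"
  "ob V_DIF (R, d) = R" "ar V_DIF ((R, d), f, (R', d')) = (R, f, R')"
  "ob U'_DRB (R, d, P) = (R, d)" "ar U'_DRB ((R, d, P), f, (R', d', P')) = ((R, d), f, (R', d'))"
  "ob V'_DRB (R, d, P) = (R, P)" "ar V'_DRB ((R, d, P), f, (R', d', P')) = ((R, P), f, (R', P'))"
  by (simp_all add: U_RBA_def V_DIF_def U'_DRB_def V'_DRB_def)

lemma monad_T_simps [simp]: "ob (mfun (monad_T S)) A = Sha S A"
  "ar (mfun (monad_T S)) (A, f, B) = (Sha S A, Sha_map S A B f, Sha S B)"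
  "munit (monad_T S) A = (A, eta S A, Sha S A)"
  "mmult (monad_T S) A = (Sha S (Sha S A), evaluation S (Sha S A, P_free A), Sha S A)"
  by (simp_all add: monad_T_def free_RBA_eq)

lemma monad_T'_simps [simp]: "ob (mfun (monad_T' S)) (A, d) = (Sha S A, d_free A d)"
  "ar (mfun (monad_T' S)) ((A, d), f, (B, d')) = ((Sha S A, d_free A d), Sha_map S A B f, (Sha S B, d_free B d'))"
  "munit (monad_T' S) (A, d) = ((A, d), eta S A, (Sha S A, d_free A d))"
  "mmult (monad_T' S) (A, d) = ((Sha S (Sha S A), d_free (Sha S A) (d_free A d)), evaluation S (Sha S A, P_free A), (Sha S A, d_free A d))"
  by (simp_all add: monad_T'_def free_RBA_eq Sha_DIF_eq)

lemma comonad_C_simps [simp]: "ob (wfun (comonad_C S)) A = Seq S A"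
  "ar (wfun (comonad_C S)) (A, f, B) = (Seq S A, Seq_map S A f, Seq S B)"
  "wcounit (comonad_C S) A = (Seq S A, seq_counit S A, A)"
  "wcomult (comonad_C S) A = (Seq S A, seq_comult S A, Seq S (Seq S A))"
  by (simp_all add: comonad_C_def)

lemma comonad_C'_simps [simp]: "ob (wfun (comonad_C' S)) (A, P) = (Seq S A, P_seq A P)"
  "ar (wfun (comonad_C' S)) ((A, P), f, (B, P')) = ((Seq S A, P_seq A P), Seq_map S A f, (Seq S B, P_seq B P'))"
  "wcounit (comonad_C' S) (A, P) = ((Seq S A, P_seq A P), seq_counit S A, (A, P))"
  "wcomult (comonad_C' S) (A, P) = ((Seq S A, P_seq A P), seq_comult S A, (Seq S (Seq S A), P_seq (Seq S A) (P_seq A P)))"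
  by (simp_all add: comonad_C'_def Seq_RBA_eq)

lemma rb_homs_equal:
  assumes A: "algebra k A" and g: "g \<in> alg_hom k (Sha S A) R" and g': "g' \<in> alg_hom k (Sha S A) R"
    and "\<And>x. x \<in> carrier (Sha S A) \<Longrightarrow> g (P_free A x) = P (g x)"
    and "\<And>x. x \<in> carrier (Sha S A) \<Longrightarrow> g' (P_free A x) = P (g' x)"
    and "\<And>a. a \<in> carrier A \<Longrightarrow> g (eta S A a) = g' (eta S A a)"
  shows "g = g'"
proof (rule alg_hom_ext[OF g g'])
  show "g x = g' x" if "x \<in> carrier (Sha S A)" for x
    by (rule free_unique[OF A, where P = P and R = R]) (use assms that in \<open>auto simp: alg_hom_iff\<close>)
qed

lemma eta_closed: "algebra k A \<Longrightarrow> a \<in> carrier A \<Longrightarrow> eta S A a \<in> carrier (Sha S A)"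
  by (rule alg_hom_closed[OF eta_hom])

lemma RBA_generates_T: "left_adjoint_generates (RBA S) (ALG S) U_RBA (monad_T S)"
proof -
  define F :: "(('k, 'u) alg, (('k, 'u) alg, 'u) mor, ('k, 'u) opalg, (('k, 'u) opalg, 'u) mor) fnctr"
    where "F = \<lparr>ob = free_RBA S, ar = (\<lambda>(A, f, B). (free_RBA S A, Sha_map S A B f, free_RBA S B))\<rparr>"
  have Fs [simp]: "ob F A = (Sha S A, P_free A)" "ar F (A, f, B) = ((Sha S A, P_free A), Sha_map S A B f, (Sha S B, P_free B))"
    for A f B by (simp_all add: F_def free_RBA_eq)
  define \<epsilon> where "\<epsilon> = (\<lambda>(R, P). ((Sha S R, P_free R), evaluation S (R, P), (R, P)))"
  have "adjunction (ALG S) (RBA S) F U_RBA (munit (monad_T S)) \<epsilon>"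
  proof (rule adjunction_of_universal_arrows[OF category_ALG functor_U_RBA])
    show "ob F A \<in> Obj (RBA S)" "arrow (ALG S) (munit (monad_T S) A) A (ob U_RBA (ob F A))" if "A \<in> Obj (ALG S)" for A
      using that by (simp_all add: Sha_algebra P_free_rb ALG_arrow eta_hom)
    show "arrow (RBA S) (ar F f) (ob F A) (ob F B)"
      "ar U_RBA (ar F f) \<bullet>\<^bsub>ALG S\<^esub> munit (monad_T S) A = munit (monad_T S) B \<bullet>\<^bsub>ALG S\<^esub> f" if "arrow (ALG S) f A B" for f A B
      using that by (auto simp: ALG_arrow RBA_arrow Sha_algebra P_free_rb Sha_map_hom compose_eq_iff)
    fix A X g g' assume A: "A \<in> Obj (ALG S)" and g: "arrow (RBA S) g (ob F A) X"
      and g': "arrow (RBA S) g' (ob F A) X"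
      and e: "ar U_RBA g \<bullet>\<^bsub>ALG S\<^esub> munit (monad_T S) A = ar U_RBA g' \<bullet>\<^bsub>ALG S\<^esub> munit (monad_T S) A"
    obtain R P where [simp]: "X = (R, P)" by force
    obtain h h' where h: "g = (ob F A, h, X)" "g' = (ob F A, h', X)" using g g' by (auto simp: RBA_arrow)
    have "h = h'"
      by (rule rb_homs_equal[of A h R h' P])
        (use A g g' e h in \<open>auto simp: RBA_arrow compose_eq_iff\<close>)
    then show "g = g'" using h by simp
  next
    fix X assume "X \<in> Obj (RBA S)"
    then obtain R P where "X = (R, P)" "algebra k R" "rota_baxter k lam R P" by (cases X) auto
    then show "arrow (RBA S) (\<epsilon> X) (ob F (ob U_RBA X)) X"
      "ar U_RBA (\<epsilon> X) \<bullet>\<^bsub>ALG S\<^esub> munit (monad_T S) (ob U_RBA X) = Idn (ALG S) (ob U_RBA X)"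
      by (auto simp: \<epsilon>_def RBA_arrow Sha_algebra P_free_rb evaluation_hom compose_eq_restrict_iff)
  qed
  then show ?thesis by (rule left_adjoint_generatesI) (auto simp: ALG_arrow \<epsilon>_def)
qed

lemma DRB_generates_T': "left_adjoint_generates (DRB S) (DIF S) U'_DRB (monad_T' S)"
proof -
  define F :: "(('k, 'u) opalg, (('k, 'u) opalg, 'u) mor, ('k, 'u) op2alg, (('k, 'u) op2alg, 'u) mor) fnctr"
    where "F = \<lparr>ob = (\<lambda>(A, d). (Sha S A, d_free A d, P_free A)),
      ar = (\<lambda>((A, d), f, (B, d')). ((Sha S A, d_free A d, P_free A), Sha_map S A B f, (Sha S B, d_free B d', P_free B)))\<rparr>"
  have Fs [simp]: "ob F (A, d) = (Sha S A, d_free A d, P_free A)"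
    "ar F ((A, d), f, (B, d')) = ((Sha S A, d_free A d, P_free A), Sha_map S A B f, (Sha S B, d_free B d', P_free B))"
    for A d f B d' by (simp_all add: F_def)
  define \<epsilon> where "\<epsilon> = (\<lambda>(R, d, P). ((Sha S R, d_free R d, P_free R), evaluation S (R, P), (R, d, P)))"
  have "adjunction (DIF S) (DRB S) F U'_DRB (munit (monad_T' S)) \<epsilon>"
  proof (rule adjunction_of_universal_arrows[OF category_DIF functor_U'_DRB])
    fix X assume "X \<in> Obj (DIF S)"
    then obtain A d where "X = (A, d)" "algebra k A" "weighted_derivation k lam A d" by (cases X) auto
    then show "ob F X \<in> Obj (DRB S)" "arrow (DIF S) (munit (monad_T' S) X) X (ob U'_DRB (ob F X))"
      by (simp_all add: Sha_algebra P_free_rb d_free_deriv DIF_arrow eta_hom)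
  next
    fix f X Y assume f: "arrow (DIF S) f X Y"
    obtain A d B d' where [simp]: "X = (A, d)" "Y = (B, d')" by (metis surj_pair)
    obtain g where g: "f = (X, g, Y)" "algebra k A" "weighted_derivation k lam A d" "algebra k B"
      "weighted_derivation k lam B d'" "g \<in> alg_hom k A B" "\<And>x. x \<in> carrier A \<Longrightarrow> g (d x) = d' (g x)"
      using f by (auto simp: DIF_arrow)
    have "Sha_map S A B g (d_free A d x) = d_free B d' (Sha_map S A B g x)" if "x \<in> carrier (Sha S A)" for x
      by (rule free_hom_deriv[where P = "P_free B" and R = "Sha S B"])
        (use g that Sha_map_hom[of A B g] alg_hom_closed[OF g(6)] in \<open>simp_all add: Sha_algebra alg_hom_iff P_free_rb d_free_deriv
            weighted_derivation_closed alg_mapD(1)\<close>)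
    then show "arrow (DRB S) (ar F f) (ob F X) (ob F Y)"
      using g by (simp add: DRB_arrow Sha_algebra P_free_rb d_free_deriv Sha_map_hom)
    show "ar U'_DRB (ar F f) \<bullet>\<^bsub>DIF S\<^esub> munit (monad_T' S) X = munit (monad_T' S) Y \<bullet>\<^bsub>DIF S\<^esub> f"
      using g by (simp add: compose_eq_iff Sha_map_hom)
  next
    fix Z X g g' assume Z: "Z \<in> Obj (DIF S)" and g: "arrow (DRB S) g (ob F Z) X"
      and g': "arrow (DRB S) g' (ob F Z) X"
      and e: "ar U'_DRB g \<bullet>\<^bsub>DIF S\<^esub> munit (monad_T' S) Z = ar U'_DRB g' \<bullet>\<^bsub>DIF S\<^esub> munit (monad_T' S) Z"
    obtain R d P A d' where [simp]: "X = (R, d, P)" "Z = (A, d')" by (metis surj_pair)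
    obtain h h' where h: "g = (ob F Z, h, X)" "g' = (ob F Z, h', X)" using g g' by (auto simp: DRB_arrow)
    have "h = h'"
      by (rule rb_homs_equal[of A h R h' P])
        (use Z g g' e h in \<open>auto simp: DRB_arrow compose_eq_iff\<close>)
    then show "g = g'" using h by simp
  next
    fix X assume "X \<in> Obj (DRB S)"
    then obtain R d P where X: "X = (R, d, P)" "algebra k R" "rota_baxter k lam R P" "weighted_derivation k lam R d"
       "\<And>x. x \<in> carrier R \<Longrightarrow> d (P x) = x" by (cases X) auto
    have "evaluation S (R, P) (d_free R d x) = d (evaluation S (R, P) x)" if "x \<in> carrier (Sha S R)" for x
      by (rule free_hom_deriv[where P = P and R = R])
        (use X that evaluation_hom[of R P] in \<open>simp_all add: alg_hom_iff weighted_derivation_closed\<close>)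
    with X show "arrow (DRB S) (\<epsilon> X) (ob F (ob U'_DRB X)) X"
      "ar U'_DRB (\<epsilon> X) \<bullet>\<^bsub>DIF S\<^esub> munit (monad_T' S) (ob U'_DRB X) = Idn (DIF S) (ob U'_DRB X)"
      by (auto simp: \<epsilon>_def DRB_arrow Sha_algebra P_free_rb d_free_deriv evaluation_hom compose_eq_restrict_iff)
  qed
  then show ?thesis
    by (rule left_adjoint_generatesI) (auto simp: \<epsilon>_def DIF_arrow)
qed

lemma seq_comult_code:
  assumes "algebra k A" "\<And>n. f n \<in> carrier A"
  shows "seq_comult S A (seq_code S f) = seq_code S (\<lambda>m. seq_code S (\<lambda>n. f (m + n)))"
  using assms by (simp add: seq_comult_def Seq_closed)

lemma seq_comult_orbit:
  assumes A: "algebra k A" shows "seq_comult S A = orbit_map S (Seq S A) (d_seq A)"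
proof (rule extensionalityI[of _ "carrier (Seq S A)"])
  fix x assume x: "x \<in> carrier (Seq S A)"
  then show "seq_comult S A x = orbit_map S (Seq S A) (d_seq A) x"
    by (rule Seq_cases[OF A]) (use x A in \<open>simp add: orbit_map_def seq_comult_code d_seq_funpow\<close>)
qed (simp_all add: seq_comult_def orbit_map_def)

lemma orbit_map_simp: "a \<in> carrier R \<Longrightarrow> orbit_map S R d a = seq_code S (\<lambda>n. (d ^^ n) a)"
  by (simp add: orbit_map_def)

lemma hom_funpow:
  assumes "\<And>x. x \<in> carrier R \<Longrightarrow> g (d x) = d' (g x)" "\<And>x. x \<in> carrier R \<Longrightarrow> d x \<in> carrier R" "x \<in> carrier R"
  shows "g ((d ^^ n) x) = (d' ^^ n) (g x)"
proof (induction n)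
  case (Suc n)
  have "(d ^^ n) x \<in> carrier R" by (induction n) (use assms in auto)
  then show ?case using Suc assms(1) by simp
qed simp

lemma Seq_map_d_seq:
  assumes "algebra k A" "algebra k B" "h \<in> alg_hom k A B" "x \<in> carrier (Seq S A)"
  shows "Seq_map S A h (d_seq A x) = d_seq B (Seq_map S A h x)"
  using assms(4) by (rule Seq_cases[OF assms(1)]) (simp add: assms d_seq_code Seq_map_code alg_hom_closed[OF assms(3)])

lemma Seq_map_P_seq:
  assumes "algebra k A" "algebra k B" "h \<in> alg_hom k A B" "x \<in> carrier (Seq S A)"
    "\<And>x. x \<in> carrier A \<Longrightarrow> P x \<in> carrier A" "\<And>x. x \<in> carrier A \<Longrightarrow> h (P x) = P' (h x)"
  shows "Seq_map S A h (P_seq A P x) = P_seq B P' (Seq_map S A h x)"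
  using assms(4)
proof (rule Seq_cases[OF assms(1)])
  fix f assume x: "x = seq_code S f" and f: "\<And>n. f n \<in> carrier A"
  have "seq_P P f n \<in> carrier A" for n using f assms(5) by (simp add: seq_P_def)
  moreover have "(\<lambda>n. h (seq_P P f n)) = seq_P P' (\<lambda>n. h (f n))" using f assms(6) by (auto simp: seq_P_def)
  ultimately show ?thesis using f by (simp add: x assms(1,2) P_seq_code Seq_map_code alg_hom_closed[OF assms(3)])
qed

text \<open>The \<open>n\<close>-th component of \<open>g x\<close> is the \<open>0\<close>-th component of
  \<open>g (d\<^sup>n x)\<close>.\<close>

lemma counit_eqI:
  assumes A: "algebra k A" and g: "\<And>x. x \<in> carrier R \<Longrightarrow> g x \<in> carrier (Seq S A)" "\<And>x. x \<in> carrier R \<Longrightarrow> g' x \<in> carrier (Seq S A)"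
    and d: "\<And>x. x \<in> carrier R \<Longrightarrow> d x \<in> carrier R"
    and gd: "\<And>x. x \<in> carrier R \<Longrightarrow> g (d x) = d_seq A (g x)" "\<And>x. x \<in> carrier R \<Longrightarrow> g' (d x) = d_seq A (g' x)"
    and e: "\<And>x. x \<in> carrier R \<Longrightarrow> seq_counit S A (g x) = seq_counit S A (g' x)" and x: "x \<in> carrier R"
  shows "g x = g' x"
proof -
  have cl: "(d ^^ n) x \<in> carrier R" for n by (induction n) (use d x in auto)
  obtain f where f: "g x = seq_code S f" "\<And>n. f n \<in> carrier A" using Seq_cases[OF A g(1)[OF x]] by metis
  obtain f' where f': "g' x = seq_code S f'" "\<And>n. f' n \<in> carrier A" using Seq_cases[OF A g(2)[OF x]] by metis
  have "f n = f' n" for n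
    using e[OF cl[of n]] hom_funpow[of R g d "d_seq A" x n, OF gd(1) d x] hom_funpow[of R g' d "d_seq A" x n, OF gd(2) d x] f f'
    by (simp add: d_seq_funpow[OF A] seq_counit_code[OF A])
  then show ?thesis using f f' by (metis ext)
qed

text \<open>In the opposite categories the algebra of sequences with the shift is a free object: the counit is a universal
  arrow, and the orbit maps are the components of the counit of the opposite adjunction.\<close>

lemma DIF_generates_C: "right_adjoint_generates (DIF S) (ALG S) V_DIF (comonad_C S)"
  unfolding right_adjoint_generates_op
proof -
  define F :: "(('k, 'u) alg, (('k, 'u) alg, 'u) mor, ('k, 'u) opalg, (('k, 'u) opalg, 'u) mor) fnctr"
    where "F = \<lparr>ob = (\<lambda>A. (Seq S A, d_seq A)), ar = (\<lambda>(A, f, B). ((Seq S A, d_seq A), Seq_map S A f, (Seq S B, d_seq B)))\<rparr>"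
  have Fs [simp]: "ob F A = (Seq S A, d_seq A)" "ar F (A, f, B) = ((Seq S A, d_seq A), Seq_map S A f, (Seq S B, d_seq B))"
    for A f B by (simp_all add: F_def)
  define \<epsilon> where "\<epsilon> = (\<lambda>(R, d). ((R, d), orbit_map S R d, (Seq S R, d_seq R)))"
  have "adjunction (op (ALG S)) (op (DIF S)) F V_DIF (wcounit (comonad_C S)) \<epsilon>"
  proof (rule adjunction_of_universal_arrows)
    show "category (op (ALG S))" "is_functor (op (DIF S)) (op (ALG S)) V_DIF"
      by (simp_all add: category_op_iff functor_op_iff category_ALG functor_V_DIF)
    show "ob F A \<in> Obj (op (DIF S))" "arrow (op (ALG S)) (wcounit (comonad_C S) A) A (ob V_DIF (ob F A))"
      if "A \<in> Obj (op (ALG S))" for A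
      using that by (simp_all add: Seq_algebra d_seq_deriv ALG_arrow seq_counit_hom)
    show "arrow (op (DIF S)) (ar F f) (ob F A) (ob F B)"
      "ar V_DIF (ar F f) \<bullet>\<^bsub>op (ALG S)\<^esub> wcounit (comonad_C S) A = wcounit (comonad_C S) B \<bullet>\<^bsub>op (ALG S)\<^esub> f"
      if "arrow (op (ALG S)) f A B" for f A B
      using that by (auto simp: ALG_arrow DIF_arrow Seq_algebra d_seq_deriv Seq_map_hom Seq_map_d_seq compose_eq_iff
          Seq_map_code seq_counit_code alg_hom_closed elim!: Seq_cases[rotated])
    fix A X g g' assume A: "A \<in> Obj (op (ALG S))" and g: "arrow (op (DIF S)) g (ob F A) X"
      and g': "arrow (op (DIF S)) g' (ob F A) X"
      and e: "ar V_DIF g \<bullet>\<^bsub>op (ALG S)\<^esub> wcounit (comonad_C S) A = ar V_DIF g' \<bullet>\<^bsub>op (ALG S)\<^esub> wcounit (comonad_C S) A"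
    obtain R d where [simp]: "X = (R, d)" by force
    obtain h h' where h: "g = (X, h, ob F A)" "g' = (X, h', ob F A)" using g g' by (auto simp: DIF_arrow)
    have "h = h'"
    proof (rule alg_hom_ext[of h k R "Seq S A"])
      show "h x = h' x" if "x \<in> carrier R" for x
        by (rule counit_eqI[of A R h h' d])
          (use A g g' e h that in \<open>auto simp: DIF_arrow compose_eq_iff weighted_derivation_closed alg_hom_closed\<close>)
    qed (use g g' h in \<open>auto simp: DIF_arrow\<close>)
    then show "g = g'" using h by simp
  next
    fix X assume "X \<in> Obj (op (DIF S))"
    then obtain R d where X: "X = (R, d)" "algebra k R" "weighted_derivation k lam R d" by (cases X) auto
    note cl = deriv_funpow_closed[OF X(2,3)] weighted_derivation_closed[OF X(3)]
    show "arrow (op (DIF S)) (\<epsilon> X) (ob F (ob V_DIF X)) X"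
      "ar V_DIF (\<epsilon> X) \<bullet>\<^bsub>op (ALG S)\<^esub> wcounit (comonad_C S) (ob V_DIF X) = Idn (op (ALG S)) (ob V_DIF X)"
      using X by (auto simp: \<epsilon>_def DIF_arrow Seq_algebra d_seq_deriv orbit_hom compose_eq_restrict_iff orbit_map_simp
          cl d_seq_code seq_counit_code funpow_swap1)
  qed
  then show "left_adjoint_generates (op (DIF S)) (op (ALG S)) V_DIF (dual_monad (comonad_C S))"
    by (rule left_adjoint_generatesI) (auto simp: ALG_arrow \<epsilon>_def seq_comult_orbit)
qed

lemma orbit_map_P:
  assumes "algebra k R" "weighted_derivation k lam R d" "\<And>x. x \<in> carrier R \<Longrightarrow> P x \<in> carrier R"
    "\<And>x. x \<in> carrier R \<Longrightarrow> d (P x) = x" "x \<in> carrier R"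
  shows "orbit_map S R d (P x) = P_seq R P (orbit_map S R d x)"
proof -
  have "(d ^^ n) (P x) = seq_P P (\<lambda>n. (d ^^ n) x) n" for n
    by (cases n) (simp_all add: seq_P_def funpow_Suc_right assms del: funpow.simps)
  then show ?thesis
    using assms by (simp add: orbit_map_simp P_seq_code deriv_funpow_closed fun_eq_iff)
qed

lemma d_P_seq:
  assumes "algebra k A" "rota_baxter k lam A P" "x \<in> carrier (Seq S A)"
  shows "d_seq A (P_seq A P x) = x"
  using assms(3)
proof (rule Seq_cases[OF assms(1)])
  fix f assume x: "x = seq_code S f" and f: "\<And>n. f n \<in> carrier A"
  have "seq_P P f n \<in> carrier A" for n using f rota_baxter_closed[OF assms(2)] by (simp add: seq_P_def)
  then show ?thesis using f by (simp add: x assms(1) P_seq_code d_seq_code) (simp add: seq_P_def)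
qed

lemma counit_P_seq:
  assumes "algebra k A" "rota_baxter k lam A P" "x \<in> carrier (Seq S A)"
  shows "seq_counit S A (P_seq A P x) = P (seq_counit S A x)"
  using assms(3)
proof (rule Seq_cases[OF assms(1)])
  fix f assume x: "x = seq_code S f" and f: "\<And>n. f n \<in> carrier A"
  have "seq_P P f n \<in> carrier A" for n using f rota_baxter_closed[OF assms(2)] by (simp add: seq_P_def)
  then show ?thesis using f by (simp add: x assms(1) P_seq_code seq_counit_code) (simp add: seq_P_def)
qed

lemma DRB_generates_C': "right_adjoint_generates (DRB S) (RBA S) V'_DRB (comonad_C' S)"
  unfolding right_adjoint_generates_op
proof -
  define F :: "(('k, 'u) opalg, (('k, 'u) opalg, 'u) mor, ('k, 'u) op2alg, (('k, 'u) op2alg, 'u) mor) fnctr"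
    where "F = \<lparr>ob = (\<lambda>(A, P). (Seq S A, d_seq A, P_seq A P)),
      ar = (\<lambda>((A, P), f, (B, P')). ((Seq S A, d_seq A, P_seq A P), Seq_map S A f, (Seq S B, d_seq B, P_seq B P')))\<rparr>"
  have Fs [simp]: "ob F (A, P) = (Seq S A, d_seq A, P_seq A P)"
    "ar F ((A, P), f, (B, P')) = ((Seq S A, d_seq A, P_seq A P), Seq_map S A f, (Seq S B, d_seq B, P_seq B P'))"
    for A P f B P' by (simp_all add: F_def)
  define \<epsilon> where "\<epsilon> = (\<lambda>(R, d, P). ((R, d, P), orbit_map S R d, (Seq S R, d_seq R, P_seq R P)))"
  have "adjunction (op (RBA S)) (op (DRB S)) F V'_DRB (wcounit (comonad_C' S)) \<epsilon>"
  proof (rule adjunction_of_universal_arrows)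
    show "category (op (RBA S))" "is_functor (op (DRB S)) (op (RBA S)) V'_DRB"
      by (simp_all add: category_op_iff functor_op_iff category_RBA functor_V'_DRB)
    fix X assume "X \<in> Obj (op (RBA S))"
    then obtain A P where "X = (A, P)" "algebra k A" "rota_baxter k lam A P" by (cases X) auto
    then show "ob F X \<in> Obj (op (DRB S))" "arrow (op (RBA S)) (wcounit (comonad_C' S) X) X (ob V'_DRB (ob F X))"
      by (simp_all add: Seq_algebra d_seq_deriv P_seq_rb d_P_seq RBA_arrow seq_counit_hom counit_P_seq)
  next
    fix f X Y assume f: "arrow (op (RBA S)) f X Y"
    obtain A P B P' where [simp]: "X = (A, P)" "Y = (B, P')" by (metis surj_pair)
    obtain g where g: "f = (Y, g, X)" "algebra k A" "rota_baxter k lam A P" "algebra k B"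
      "rota_baxter k lam B P'" "g \<in> alg_hom k B A" "\<And>x. x \<in> carrier B \<Longrightarrow> g (P' x) = P (g x)"
      using f by (auto simp: RBA_arrow)
    show "arrow (op (DRB S)) (ar F f) (ob F X) (ob F Y)"
      using g by (auto simp: DRB_arrow Seq_algebra d_seq_deriv P_seq_rb d_P_seq Seq_map_hom Seq_map_d_seq
          intro: Seq_map_P_seq rota_baxter_closed)
    show "ar V'_DRB (ar F f) \<bullet>\<^bsub>op (RBA S)\<^esub> wcounit (comonad_C' S) X = wcounit (comonad_C' S) Y \<bullet>\<^bsub>op (RBA S)\<^esub> f"
      using g by (auto simp: compose_eq_iff Seq_map_code seq_counit_code alg_hom_closed elim!: Seq_cases[rotated])
  next
    fix Z X g g' assume Z: "Z \<in> Obj (op (RBA S))" and g: "arrow (op (DRB S)) g (ob F Z) X"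
      and g': "arrow (op (DRB S)) g' (ob F Z) X"
      and e: "ar V'_DRB g \<bullet>\<^bsub>op (RBA S)\<^esub> wcounit (comonad_C' S) Z = ar V'_DRB g' \<bullet>\<^bsub>op (RBA S)\<^esub> wcounit (comonad_C' S) Z"
    obtain R d P A P' where [simp]: "X = (R, d, P)" "Z = (A, P')" by (metis surj_pair)
    obtain h h' where h: "g = (X, h, ob F Z)" "g' = (X, h', ob F Z)" using g g' by (auto simp: DRB_arrow)
    have "h = h'"
    proof (rule alg_hom_ext[of h k R "Seq S A"])
      show "h x = h' x" if "x \<in> carrier R" for x
        by (rule counit_eqI[of A R h h' d])
          (use Z g g' e h that in \<open>auto simp: DRB_arrow compose_eq_iff weighted_derivation_closed alg_hom_closed\<close>)
    qed (use g g' h in \<open>auto simp: DRB_arrow\<close>)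
    then show "g = g'" using h by simp
  next
    fix X assume "X \<in> Obj (op (DRB S))"
    then obtain R d P where X: "X = (R, d, P)" "algebra k R" "weighted_derivation k lam R d" "rota_baxter k lam R P"
      "\<And>x. x \<in> carrier R \<Longrightarrow> d (P x) = x" by (cases X) auto
    note cl = deriv_funpow_closed[OF X(2,3)] weighted_derivation_closed[OF X(3)] rota_baxter_closed[OF X(4)]
    have "orbit_map S R d (P x) = P_seq R P (orbit_map S R d x)" if "x \<in> carrier R" for x
      using X cl that by (intro orbit_map_P) auto
    then show "arrow (op (DRB S)) (\<epsilon> X) (ob F (ob V'_DRB X)) X"
      "ar V'_DRB (\<epsilon> X) \<bullet>\<^bsub>op (RBA S)\<^esub> wcounit (comonad_C' S) (ob V'_DRB X) = Idn (op (RBA S)) (ob V'_DRB X)"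
      using X by (auto simp: \<epsilon>_def DRB_arrow Seq_algebra d_seq_deriv P_seq_rb d_P_seq orbit_hom compose_eq_restrict_iff
          orbit_map_simp cl d_seq_code seq_counit_code funpow_swap1)
  qed
  then show "left_adjoint_generates (op (DRB S)) (op (RBA S)) V'_DRB (dual_monad (comonad_C' S))"
    by (rule left_adjoint_generatesI) (auto simp: RBA_arrow \<epsilon>_def seq_comult_orbit)
qed

end


section \<open>Comparison functors\<close>

lemma right_adjoint_generates_functor: "right_adjoint_generates D C V W \<Longrightarrow> is_functor D C V"
  by (auto simp: right_adjoint_generates_def adjunction_def)

lemma category_coalg_cat: "is_comonad C W \<Longrightarrow> category (coalg_cat C W)"
  using functorD(1)[OF right_adjoint_generates_functor[OF forget_coalg_generates]] .

lemma add_struct_simps [simp]: "ob (add_struct D G s) X = (ob G X, s X)"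
  "ar (forget_alg C M) (ar (add_struct D G s) f) = ar G f"
  "ar (forget_coalg C W) (ar (add_struct D G s) f) = ar G f"
  by (simp_all add: add_struct_def)

lemma add_struct_arrow: "arrow D f X Y \<Longrightarrow> ar (add_struct D G s) f = ((ob G X, s X), ar G f, (ob G Y, s Y))"
  by (auto simp: add_struct_def arrow_def)

text \<open>All four comparison functors \<open>K\<close>, \<open>H\<close>, \<open>K'\<close>, \<open>H'\<close> have the form
  \<open>X \<mapsto> \<langle>G X, s X\<rangle>\<close> with \<open>G\<close> forgetful. Such a functor is an
  isomorphism if the structures \<open>s X\<close> determine what \<open>G\<close> forgets, all structures arise, and
  the structure morphisms are exactly the morphisms of \<open>D\<close>.\<close>

lemma add_struct_iso:
  assumes cat: "category (struct_cat C X mors)" and G: "is_functor D C G"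
    and obj: "\<And>Z. Z \<in> Obj D \<Longrightarrow> (ob G Z, s Z) \<in> X"
    and mor: "\<And>Y Z f. \<lbrakk>Y \<in> Obj D; Z \<in> Obj D; arrow C f (ob G Y) (ob G Z)\<rbrakk> \<Longrightarrow>
        mors (ob G Y, s Y) (ob G Z, s Z) f \<longleftrightarrow> (\<exists>g. arrow D g Y Z \<and> ar G g = f)"
    and faithful: "\<And>g g' Y Z. \<lbrakk>arrow D g Y Z; arrow D g' Y Z; ar G g = ar G g'\<rbrakk> \<Longrightarrow> g = g'"
    and inj: "\<And>Y Z. \<lbrakk>Y \<in> Obj D; Z \<in> Obj D; ob G Y = ob G Z; s Y = s Z\<rbrakk> \<Longrightarrow> Y = Z"
    and surj: "\<And>A h. (A, h) \<in> X \<Longrightarrow> \<exists>Z\<in>Obj D. ob G Z = A \<and> s Z = h"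
  shows "is_iso_of_categories D (struct_cat C X mors) (add_struct D G s)"
proof (rule iso_catI)
  note G' = functorD[OF G]
  interpret D: category D by (rule G')
  show "is_functor D (struct_cat C X mors) (add_struct D G s)"
  proof (rule functorI)
    show "ar (add_struct D G s) (Idn D Z) = Idn (struct_cat C X mors) (ob (add_struct D G s) Z)" if "Z \<in> Obj D" for Z
      using G'(4)[OF that] by (simp add: add_struct_arrow[OF D.arrow_id[OF that]])
    fix f Y Z assume f: "arrow D f Y Z"
    note o = D.arrow_obj[OF f]
    show "arrow (struct_cat C X mors) (ar (add_struct D G s) f) (ob (add_struct D G s) Y) (ob (add_struct D G s) Z)"
      using f mor[OF o G'(5)[OF f]] obj[OF o(1)] obj[OF o(2)] G'(5)[OF f]
      by (auto simp: add_struct_arrow[OF f] arrow_struct_cat)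
    fix g W assume g: "arrow D g Z W"
    show "ar (add_struct D G s) (g \<bullet>\<^bsub>D\<^esub> f) = ar (add_struct D G s) g \<bullet>\<^bsub>struct_cat C X mors\<^esub> ar (add_struct D G s) f"
      by (simp add: add_struct_arrow[OF f] add_struct_arrow[OF g] add_struct_arrow[OF D.arrow_comp[OF f g]] G'(6)[OF f g])
  qed (use cat G' obj in auto)
  show "Y = Z" if "Y \<in> Obj D" "Z \<in> Obj D" "ob (add_struct D G s) Y = ob (add_struct D G s) Z" for Y Z
    using that inj by simp
  show "\<exists>Z\<in>Obj D. ob (add_struct D G s) Z = B" if "B \<in> Obj (struct_cat C X mors)" for B
    using that surj[of "fst B" "snd B"] by (simp add: prod_eq_iff)
  show "f = g" if "arrow D f Y Z" "arrow D g Y Z" "ar (add_struct D G s) f = ar (add_struct D G s) g" for f g Y Z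
    using that faithful by (auto simp: add_struct_arrow)
  fix g Y Z assume o: "Y \<in> Obj D" "Z \<in> Obj D"
    and g: "arrow (struct_cat C X mors) g (ob (add_struct D G s) Y) (ob (add_struct D G s) Z)"
  obtain f where f: "g = ((ob G Y, s Y), f, (ob G Z, s Z))" "arrow C f (ob G Y) (ob G Z)"
    "mors (ob G Y, s Y) (ob G Z, s Z) f" using g by (auto simp: arrow_struct_cat)
  then obtain g' where "arrow D g' Y Z" "ar G g' = f" using mor[OF o f(2)] by auto
  then show "\<exists>f. arrow D f Y Z \<and> ar (add_struct D G s) f = g" using f by (auto simp: add_struct_arrow)
qed

lemma add_struct_alg_iso:
  assumes M: "is_monad C M" and G: "is_functor D C G"
    and obj: "\<And>Z. Z \<in> Obj D \<Longrightarrow> (ob G Z, s Z) \<in> Obj (alg_cat C M)"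
    and mor: "\<And>Y Z f. \<lbrakk>Y \<in> Obj D; Z \<in> Obj D; arrow C f (ob G Y) (ob G Z)\<rbrakk> \<Longrightarrow>
        f \<bullet>\<^bsub>C\<^esub> s Y = s Z \<bullet>\<^bsub>C\<^esub> ar (mfun M) f \<longleftrightarrow> (\<exists>g. arrow D g Y Z \<and> ar G g = f)"
    and faithful: "\<And>g g' Y Z. \<lbrakk>arrow D g Y Z; arrow D g' Y Z; ar G g = ar G g'\<rbrakk> \<Longrightarrow> g = g'"
    and inj: "\<And>Y Z. \<lbrakk>Y \<in> Obj D; Z \<in> Obj D; ob G Y = ob G Z; s Y = s Z\<rbrakk> \<Longrightarrow> Y = Z"
    and surj: "\<And>A h. (A, h) \<in> Obj (alg_cat C M) \<Longrightarrow> \<exists>Z\<in>Obj D. ob G Z = A \<and> s Z = h"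
  shows "is_iso_of_categories D (alg_cat C M) (add_struct D G s)"
  unfolding alg_cat_def
  by (rule add_struct_iso[OF category_alg_cat[OF M, unfolded alg_cat_def] G])
    (use obj mor faithful inj surj in \<open>simp_all add: alg_cat_def\<close>)

lemma add_struct_coalg_iso:
  assumes W: "is_comonad C W" and G: "is_functor D C G"
    and obj: "\<And>Z. Z \<in> Obj D \<Longrightarrow> (ob G Z, s Z) \<in> Obj (coalg_cat C W)"
    and mor: "\<And>Y Z f. \<lbrakk>Y \<in> Obj D; Z \<in> Obj D; arrow C f (ob G Y) (ob G Z)\<rbrakk> \<Longrightarrow>
        s Z \<bullet>\<^bsub>C\<^esub> f = ar (wfun W) f \<bullet>\<^bsub>C\<^esub> s Y \<longleftrightarrow> (\<exists>g. arrow D g Y Z \<and> ar G g = f)"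
    and faithful: "\<And>g g' Y Z. \<lbrakk>arrow D g Y Z; arrow D g' Y Z; ar G g = ar G g'\<rbrakk> \<Longrightarrow> g = g'"
    and inj: "\<And>Y Z. \<lbrakk>Y \<in> Obj D; Z \<in> Obj D; ob G Y = ob G Z; s Y = s Z\<rbrakk> \<Longrightarrow> Y = Z"
    and surj: "\<And>A h. (A, h) \<in> Obj (coalg_cat C W) \<Longrightarrow> \<exists>Z\<in>Obj D. ob G Z = A \<and> s Z = h"
  shows "is_iso_of_categories D (coalg_cat C W) (add_struct D G s)"
  unfolding coalg_cat_def
  by (rule add_struct_iso[OF category_coalg_cat[OF W, unfolded coalg_cat_def] G])
    (use obj mor faithful inj surj in \<open>simp_all add: coalg_cat_def\<close>)

context universe begin

text \<open>Both sides are Rota-Baxter homomorphisms from \<open>Sha(Sha(A))\<close> to \<open>A\<close> that restrict to the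
  evaluation on \<open>Sha(A)\<close>.\<close>

lemma evaluation_assoc:
  assumes A: "algebra k A" and P: "rota_baxter k lam A P" and x: "x \<in> carrier (Sha S (Sha S A))"
  shows "evaluation S (A, P) (Sha_map S (Sha S A) A (evaluation S (A, P)) x)
    = evaluation S (A, P) (evaluation S (Sha S A, P_free A) x)"
proof -
  note SA = Sha_algebra[OF A] and Pf = P_free_rb[OF A]
  note e = evaluation_hom[OF A P] and e' = evaluation_hom[OF SA Pf] and m = Sha_map_hom[OF SA A e(1)]
  show ?thesis
    by (rule free_unique[OF SA, where P = P and R = A])
      (use e e' m x eta_closed[OF SA] alg_hom_closed[OF e'(1)] alg_hom_closed[OF m(1)] alg_hom_closed[OF e(1)]
        in \<open>auto simp: alg_hom_iff intro: alg_map_comp\<close>)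
qed

text \<open>\<open>P(a) = h(1 \<otimes> a)\<close>.\<close>

definition op_of :: "('k, 'u) alg \<Rightarrow> ('u \<Rightarrow> 'u) \<Rightarrow> 'u \<Rightarrow> 'u" where
  "op_of A h = (\<lambda>a\<in>carrier A. h (P_free A (eta S A a)))"

lemma op_of_evaluation:
  assumes A: "algebra k A" and P: "rota_baxter k lam A P"
  shows "op_of A (evaluation S (A, P)) = P"
  by (rule extensionalityI[of _ "carrier A"])
    (use P evaluation_hom[OF A P] eta_closed[OF A] in \<open>auto simp: op_of_def rota_baxter_iff\<close>)

text \<open>Comparing the two sides of the associativity law at \<open>1 \<otimes> x\<close>, with \<open>x\<close> in
  \<open>Sha(A)\<close>, gives \<open>h(P(x)) = P'(h(x))\<close> for the operator \<open>P'\<close> read off from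
  \<open>h\<close>. As \<open>h\<close> is a homomorphism with \<open>h \<circ> \<eta> = id\<close>, the Rota-Baxter
  identity passes from \<open>Sha(A)\<close> to \<open>A\<close>, and \<open>h\<close> is the evaluation by
  uniqueness.\<close>

lemma T_algebra_op:
  assumes A: "algebra k A" and h: "h \<in> alg_hom k (Sha S A) A"
    and unit: "\<And>a. a \<in> carrier A \<Longrightarrow> h (eta S A a) = a"
    and assoc: "\<And>x. x \<in> carrier (Sha S (Sha S A)) \<Longrightarrow>
      h (Sha_map S (Sha S A) A h x) = h (evaluation S (Sha S A, P_free A) x)"
  shows "rota_baxter k lam A (op_of A h)" "evaluation S (A, op_of A h) = h"
proof -
  note SA = Sha_algebra[OF A] and Pf = P_free_rb[OF A]
  note e = evaluation_hom[OF SA Pf] and m = Sha_map_hom[OF SA A h]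
  note hc = alg_hom_closed[OF h] and Pc = rota_baxter_closed[OF Pf] and ec = eta_closed[OF A]
  have hP: "h (P_free A x) = op_of A h (h x)" if x: "x \<in> carrier (Sha S A)" for x
  proof -
    note ex = eta_closed[OF SA x]
    have "h (P_free A x) = h (evaluation S (Sha S A, P_free A) (P_free (Sha S A) (eta S (Sha S A) x)))"
      using e x ex by simp
    also have "\<dots> = h (Sha_map S (Sha S A) A h (P_free (Sha S A) (eta S (Sha S A) x)))"
      using assoc rota_baxter_closed[OF P_free_rb[OF SA] ex] by simp
    also have "\<dots> = op_of A h (h x)" using m x ex hc by (simp add: op_of_def)
    finally show ?thesis .
  qed
  have h': "alg_map k (Sha S A) A h" using h by (simp add: alg_hom_iff)
  note hD = alg_mapD[OF h'] and eD = alg_mapD[OF eta_hom[OF A, unfolded alg_hom_iff, THEN conjunct1]]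
  have pl: "linear_on k (Sha S A) (Sha S A) (P_free A)" using Pf by (simp add: rota_baxter_iff rb_op_def)
  note PD = linear_onD[OF pl]
  interpret SA: algebra k "Sha S A" by (rule SA)
  interpret A: algebra k A by (rule A)
  show rb: "rota_baxter k lam A (op_of A h)"
    unfolding rota_baxter_iff rb_op_def
  proof (intro conjI ballI)
    show "linear_on k A A (op_of A h)"
      by (rule linear_onI) (use hD eD PD in \<open>simp_all add: op_of_def\<close>)
    show "op_of A h \<in> extensional (carrier A)" by (simp add: op_of_def)
    fix x y assume x: "x \<in> carrier A" and y: "y \<in> carrier A"
    let ?x = "eta S A x" and ?y = "eta S A y" and ?P = "P_free A"
    have "?P ?x \<otimes>\<^bsub>Sha S A\<^esub> ?P ?y = ?P (?x \<otimes>\<^bsub>Sha S A\<^esub> ?P ?y) \<oplus>\<^bsub>Sha S A\<^esub> ?P (?y \<otimes>\<^bsub>Sha S A\<^esub> ?P ?x)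
       \<oplus>\<^bsub>Sha S A\<^esub> lam \<odot>\<^bsub>Sha S A\<^esub> ?P (?x \<otimes>\<^bsub>Sha S A\<^esub> ?y)"
      using Pf ec x y by (simp add: rota_baxter_iff rb_op_def)
    then have "h (?P ?x \<otimes>\<^bsub>Sha S A\<^esub> ?P ?y) = h (?P (?x \<otimes>\<^bsub>Sha S A\<^esub> ?P ?y) \<oplus>\<^bsub>Sha S A\<^esub> ?P (?y \<otimes>\<^bsub>Sha S A\<^esub> ?P ?x)
       \<oplus>\<^bsub>Sha S A\<^esub> lam \<odot>\<^bsub>Sha S A\<^esub> ?P (?x \<otimes>\<^bsub>Sha S A\<^esub> ?y))" by simp
    then show "op_of A h x \<otimes>\<^bsub>A\<^esub> op_of A h y = op_of A h (x \<otimes>\<^bsub>A\<^esub> op_of A h y) \<oplus>\<^bsub>A\<^esub> op_of A h (y \<otimes>\<^bsub>A\<^esub> op_of A h x)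
       \<oplus>\<^bsub>A\<^esub> lam \<odot>\<^bsub>A\<^esub> op_of A h (x \<otimes>\<^bsub>A\<^esub> y)"
      using x y ec PD(1) lam by (simp add: hD hP unit)
  qed
  show "evaluation S (A, op_of A h) = h"
    by (rule rb_homs_equal[OF A _ h, where P = "op_of A h"])
      (use evaluation_hom[OF A rb] hP unit in simp_all)
qed

text \<open>From left to right, take \<open>1 \<otimes> a\<close> for \<open>x\<close>; from right to left, both sides are
  Rota-Baxter homomorphisms out of \<open>Sha(A)\<close>.\<close>

lemma T_morphism_iff:
  assumes A: "algebra k A" and P: "rota_baxter k lam A P" and B: "algebra k B" and Q: "rota_baxter k lam B Q"
    and g: "g \<in> alg_hom k A B"
  shows "(\<forall>x\<in>carrier (Sha S A). g (evaluation S (A, P) x) = evaluation S (B, Q) (Sha_map S A B g x)) \<longleftrightarrow>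
    (\<forall>x\<in>carrier A. g (P x) = Q (g x))"
proof (intro iffI ballI)
  note e = evaluation_hom[OF A P] and e' = evaluation_hom[OF B Q] and m = Sha_map_hom[OF A B g]
  note gc = alg_hom_closed[OF g]
  { fix x assume *: "\<forall>x\<in>carrier (Sha S A). g (evaluation S (A, P) x) = evaluation S (B, Q) (Sha_map S A B g x)"
      and x: "x \<in> carrier A"
    note ex = eta_closed[OF A x]
    show "g (P x) = Q (g x)"
      using bspec[OF * rota_baxter_closed[OF P_free_rb[OF A] ex]] e e' m x ex eta_closed[OF B gc[OF x]] gc by simp }
  { fix x assume *: "\<forall>x\<in>carrier A. g (P x) = Q (g x)" and x: "x \<in> carrier (Sha S A)"
    show "g (evaluation S (A, P) x) = evaluation S (B, Q) (Sha_map S A B g x)"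
      by (rule free_unique[OF A, where P = Q and R = B])
        (use * g e e' m x gc alg_hom_closed[OF m(1)] alg_hom_closed[OF e(1)]
          in \<open>auto simp: alg_hom_iff intro: alg_map_comp\<close>) }
qed

text \<open>From left to right, take \<open>1 \<otimes> a\<close> for \<open>x\<close>. The other direction is
  \<open>free_hom_deriv\<close>. This equivalence is the reason why the algebras over \<open>T'\<close> satisfy
  \<open>d \<circ> P = id\<close>.\<close>

lemma evaluation_derivation_iff:
  assumes A: "algebra k A" and P: "rota_baxter k lam A P" and d: "weighted_derivation k lam A d"
  shows "(\<forall>x\<in>carrier (Sha S A). evaluation S (A, P) (d_free A d x) = d (evaluation S (A, P) x)) \<longleftrightarrow>
    (\<forall>x\<in>carrier A. d (P x) = x)"
proof (intro iffI ballI)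
  note e = evaluation_hom[OF A P] and dd = d_free_deriv[OF A d]
  { fix x assume *: "\<forall>x\<in>carrier (Sha S A). evaluation S (A, P) (d_free A d x) = d (evaluation S (A, P) x)"
      and x: "x \<in> carrier A"
    note ex = eta_closed[OF A x]
    show "d (P x) = x"
      using bspec[OF * rota_baxter_closed[OF P_free_rb[OF A] ex]] e dd x ex by simp }
  { fix x assume *: "\<forall>x\<in>carrier A. d (P x) = x" and x: "x \<in> carrier (Sha S A)"
    show "evaluation S (A, P) (d_free A d x) = d (evaluation S (A, P) x)"
      by (rule free_hom_deriv[OF A d A, where P = P])
        (use * e x P d in \<open>auto simp: alg_hom_iff weighted_derivation_closed\<close>) }
qed

lemma orbit_coassoc:
  assumes A: "algebra k A" and d: "weighted_derivation k lam A d" and x: "x \<in> carrier A"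
  shows "Seq_map S A (orbit_map S A d) (orbit_map S A d x) = seq_comult S A (orbit_map S A d x)"
proof -
  note cl = deriv_funpow_closed[OF A d]
  have "(d ^^ m) ((d ^^ n) x) = (d ^^ (n + m)) x" for m n by (simp add: funpow_add add.commute[of n])
  then show ?thesis using x A cl by (simp add: orbit_map_simp Seq_map_code seq_comult_code)
qed

lemma orbit_counit:
  assumes A: "algebra k A" and d: "weighted_derivation k lam A d" and x: "x \<in> carrier A"
  shows "seq_counit S A (orbit_map S A d x) = x"
  using deriv_funpow_closed[OF A d x] x A by (simp add: orbit_map_simp seq_counit_code)

text \<open>\<open>d(a) = f(a)(1)\<close>.\<close>

definition deriv_of :: "('k, 'u) alg \<Rightarrow> ('u \<Rightarrow> 'u) \<Rightarrow> 'u \<Rightarrow> 'u" where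
  "deriv_of A f = (\<lambda>a\<in>carrier A. seq_counit S A (d_seq A (f a)))"

lemma deriv_of_orbit:
  assumes A: "algebra k A" and d: "weighted_derivation k lam A d"
  shows "deriv_of A (orbit_map S A d) = d"
proof (rule extensionalityI[of _ "carrier A"])
  show "deriv_of A (orbit_map S A d) x = d x" if x: "x \<in> carrier A" for x
    using x A deriv_funpow_closed[OF A d x] deriv_funpow_closed[OF A d weighted_derivation_closed[OF d x]]
    by (simp add: deriv_of_def orbit_map_simp d_seq_code seq_counit_code funpow_swap1)
qed (use d in \<open>simp_all add: deriv_of_def weighted_derivation_iff\<close>)

text \<open>The map is a derivation because the shift is one and the counit is a homomorphism. Coassociativity says that the
  \<open>n\<close>-th component of \<open>f(x)\<close> is mapped by \<open>f\<close> to the sequence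
  \<open>f(x)\<close> shifted \<open>n\<close> times, so by induction this component is \<open>d\<^sup>n(x)\<close>.\<close>

lemma C_coalgebra_deriv:
  assumes A: "algebra k A" and f: "f \<in> alg_hom k A (Seq S A)"
    and counit: "\<And>a. a \<in> carrier A \<Longrightarrow> seq_counit S A (f a) = a"
    and coassoc: "\<And>a. a \<in> carrier A \<Longrightarrow> Seq_map S A f (f a) = seq_comult S A (f a)"
  shows "weighted_derivation k lam A (deriv_of A f)" "orbit_map S A (deriv_of A f) = f"
proof -
  note fc = alg_hom_closed[OF f] and QA = Seq_algebra[OF A] and dq = d_seq_deriv[OF A] and ch = seq_counit_hom[OF A]
  note dc = weighted_derivation_closed[OF dq]
  have f': "alg_map k A (Seq S A) f" and c': "alg_map k (Seq S A) A (seq_counit S A)" using f ch by (auto simp: alg_hom_iff)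
  note fD = alg_mapD[OF f'] and cD = alg_mapD[OF c']
  have dl: "linear_on k (Seq S A) (Seq S A) (d_seq A)" using dq by (simp add: weighted_derivation_iff wt_deriv_def)
  note dD = linear_onD[OF dl]
  interpret QA: algebra k "Seq S A" by (rule QA)
  interpret A: algebra k A by (rule A)
  show "weighted_derivation k lam A (deriv_of A f)"
    unfolding weighted_derivation_iff wt_deriv_def
  proof (intro conjI ballI)
    show "linear_on k A A (deriv_of A f)"
      by (rule linear_onI) (use fD cD dD in \<open>simp_all add: deriv_of_def\<close>)
    show "deriv_of A f \<in> extensional (carrier A)" by (simp add: deriv_of_def)
    have "seq_counit S A \<zero>\<^bsub>Seq S A\<^esub> = \<zero>\<^bsub>A\<^esub>"
      using cD(5)[OF QA.R.zero_closed QA.one_closed] cD(1)[OF QA.one_closed] by simp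
    then show "deriv_of A f \<one>\<^bsub>A\<^esub> = \<zero>\<^bsub>A\<^esub>"
      using dq by (simp add: deriv_of_def fD weighted_derivation_iff wt_deriv_def)
    fix x y assume x: "x \<in> carrier A" and y: "y \<in> carrier A"
    have "d_seq A (f x \<otimes>\<^bsub>Seq S A\<^esub> f y) = d_seq A (f x) \<otimes>\<^bsub>Seq S A\<^esub> f y \<oplus>\<^bsub>Seq S A\<^esub> f x \<otimes>\<^bsub>Seq S A\<^esub> d_seq A (f y)
       \<oplus>\<^bsub>Seq S A\<^esub> lam \<odot>\<^bsub>Seq S A\<^esub> (d_seq A (f x) \<otimes>\<^bsub>Seq S A\<^esub> d_seq A (f y))"
      using dq fc[OF x] fc[OF y] by (simp add: weighted_derivation_iff wt_deriv_def)
    then show "deriv_of A f (x \<otimes>\<^bsub>A\<^esub> y) = deriv_of A f x \<otimes>\<^bsub>A\<^esub> y \<oplus>\<^bsub>A\<^esub> x \<otimes>\<^bsub>A\<^esub> deriv_of A f y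
       \<oplus>\<^bsub>A\<^esub> lam \<odot>\<^bsub>A\<^esub> (deriv_of A f x \<otimes>\<^bsub>A\<^esub> deriv_of A f y)"
      using x y fc dc lam by (simp add: deriv_of_def fD(2) cD counit)
  qed
  have "orbit_map S A (deriv_of A f) x = f x" if x: "x \<in> carrier A" for x
  proof -
    obtain u where u: "f x = seq_code S u" "\<And>n. u n \<in> carrier A" using Seq_cases[OF A fc[OF x]] by metis
    have step: "f (u n) = seq_code S (\<lambda>m. u (n + m))" for n
      using coassoc[OF x] u A by (simp add: Seq_map_code seq_comult_code seq_code_eq fun_eq_iff)
    have "(deriv_of A f ^^ n) x = u n" for n
    proof (induction n)
      case 0 then show ?case using counit[OF x] u A by (simp add: seq_counit_code)
    next
      case (Suc n)
      then show ?case using u A by (simp add: deriv_of_def step d_seq_code seq_counit_code)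
    qed
    then show ?thesis using x u by (simp add: orbit_map_simp)
  qed
  then show "orbit_map S A (deriv_of A f) = f"
    by (intro extensionalityI[of _ "carrier A"]) (use f in \<open>auto simp: orbit_map_def alg_hom_iff\<close>)
qed

lemma C_morphism_iff:
  assumes A: "algebra k A" and d: "weighted_derivation k lam A d" and B: "algebra k B" and e: "weighted_derivation k lam B e"
    and g: "g \<in> alg_hom k A B"
  shows "(\<forall>x\<in>carrier A. orbit_map S B e (g x) = Seq_map S A g (orbit_map S A d x)) \<longleftrightarrow>
    (\<forall>x\<in>carrier A. g (d x) = e (g x))"
proof -
  note gc = alg_hom_closed[OF g]
  have "orbit_map S B e (g x) = Seq_map S A g (orbit_map S A d x) \<longleftrightarrow> (\<forall>n. (e ^^ n) (g x) = g ((d ^^ n) x))"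
    if "x \<in> carrier A" for x
    using that A gc deriv_funpow_closed[OF A d] by (simp add: orbit_map_simp Seq_map_code seq_code_eq fun_eq_iff)
  moreover have "g (d x) = e (g x)" if "\<forall>n. (e ^^ n) (g x) = g ((d ^^ n) x)" for x
    using spec[OF that, of 1] by simp
  moreover have "(e ^^ n) (g x) = g ((d ^^ n) x)" if "\<forall>x\<in>carrier A. g (d x) = e (g x)" "x \<in> carrier A" for x n
    using hom_funpow[of A g d e x n] that weighted_derivation_closed[OF d] by simp
  ultimately show ?thesis by blast
qed

text \<open>At index \<open>1\<close> the equation says \<open>d(P(x)) = x\<close>. This is the reason why the coalgebras over
  \<open>C'\<close> satisfy \<open>d \<circ> P = id\<close>.\<close>

lemma orbit_P_iff:
  assumes A: "algebra k A" and P: "rota_baxter k lam A P" and d: "weighted_derivation k lam A d"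
  shows "(\<forall>x\<in>carrier A. orbit_map S A d (P x) = P_seq A P (orbit_map S A d x)) \<longleftrightarrow> (\<forall>x\<in>carrier A. d (P x) = x)"
proof (intro iffI ballI)
  note Pc = rota_baxter_closed[OF P] and cl = deriv_funpow_closed[OF A d]
  { fix x assume *: "\<forall>x\<in>carrier A. orbit_map S A d (P x) = P_seq A P (orbit_map S A d x)" and x: "x \<in> carrier A"
    have "seq_code S (\<lambda>n. (d ^^ n) (P x)) = seq_code S (seq_P P (\<lambda>n. (d ^^ n) x))"
      using bspec[OF * x] x Pc cl A by (simp add: orbit_map_simp P_seq_code)
    then have "(\<lambda>n. (d ^^ n) (P x)) = seq_P P (\<lambda>n. (d ^^ n) x)" by (simp only: seq_code_eq)
    from fun_cong[OF this, of 1] show "d (P x) = x" by (simp add: seq_P_def) }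
  { fix x assume *: "\<forall>x\<in>carrier A. d (P x) = x" and x: "x \<in> carrier A"
    show "orbit_map S A d (P x) = P_seq A P (orbit_map S A d x)"
      by (rule orbit_map_P) (use * x A d Pc in auto) }
qed

lemma monad_T: "is_monad (ALG S) (monad_T S)" by (rule monad_of_adjunction[OF RBA_generates_T])
lemma monad_T': "is_monad (DIF S) (monad_T' S)" by (rule monad_of_adjunction[OF DRB_generates_T'])
lemma comonad_C: "is_comonad (ALG S) (comonad_C S)" by (rule comonad_of_adjunction[OF DIF_generates_C])
lemma comonad_C': "is_comonad (RBA S) (comonad_C' S)" by (rule comonad_of_adjunction[OF DRB_generates_C'])

abbreviation "K_str \<equiv> \<lambda>(R, P). (Sha S R, evaluation S (R, P), R)"
abbreviation "H_str \<equiv> \<lambda>(R, d). (R, orbit_map S R d, Seq S R)"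
abbreviation "K'_str \<equiv> \<lambda>(R, d, P). (Sha_DIF S (R, d), evaluation S (R, P), (R, d))"
abbreviation "H'_str \<equiv> \<lambda>(R, d, P). ((R, P), orbit_map S R d, Seq_RBA S (R, P))"

lemma ALG_T_obj: "(A, h) \<in> Obj (ALG_T S) \<longleftrightarrow> algebra k A \<and> (\<exists>f. h = (Sha S A, f, A) \<and> f \<in> alg_hom k (Sha S A) A \<and>
    (\<forall>a\<in>carrier A. f (eta S A a) = a) \<and>
    (\<forall>x\<in>carrier (Sha S (Sha S A)). f (Sha_map S (Sha S A) A f x) = f (evaluation S (Sha S A, P_free A) x)))"
  by (auto simp: alg_cat_obj ALG_arrow Sha_algebra compose_eq_iff compose_eq_restrict_iff)

lemma K_iso: "is_iso_of_categories (RBA S) (ALG_T S) (func_K S)"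
  unfolding func_K_def
proof (rule add_struct_alg_iso[OF monad_T functor_U_RBA])
  fix Z assume "Z \<in> Obj (RBA S)"
  then show "(ob U_RBA Z, K_str Z) \<in> Obj (ALG_T S)"
    by (cases Z) (simp add: ALG_T_obj evaluation_hom evaluation_assoc)
next
  fix Y Z f assume *: "Y \<in> Obj (RBA S)" "Z \<in> Obj (RBA S)" "arrow (ALG S) f (ob U_RBA Y) (ob U_RBA Z)"
  obtain A P B Q where [simp]: "Y = (A, P)" "Z = (B, Q)" by (metis surj_pair)
  show "(f \<bullet>\<^bsub>ALG S\<^esub> K_str Y =
     K_str Z \<bullet>\<^bsub>ALG S\<^esub> ar (mfun (monad_T S)) f) \<longleftrightarrow>
     (\<exists>g. arrow (RBA S) g Y Z \<and> ar U_RBA g = f)"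
    using * by (auto simp: ALG_arrow RBA_arrow compose_eq_iff T_morphism_iff)
next
  fix Y Z assume "Y \<in> Obj (RBA S)" "Z \<in> Obj (RBA S)" "ob U_RBA Y = ob U_RBA Z"
    "K_str Y = K_str Z"
  then show "Y = Z" by (cases Y; cases Z) (auto, metis op_of_evaluation)
next
  fix A h assume "(A, h) \<in> Obj (ALG_T S)"
  then obtain f where f: "algebra k A" "h = (Sha S A, f, A)" "f \<in> alg_hom k (Sha S A) A"
    "\<And>a. a\<in>carrier A \<Longrightarrow> f (eta S A a) = a"
    "\<And>x. x\<in>carrier (Sha S (Sha S A)) \<Longrightarrow> f (Sha_map S (Sha S A) A f x) = f (evaluation S (Sha S A, P_free A) x)"
    by (auto simp: ALG_T_obj)
  show "\<exists>Z\<in>Obj (RBA S). ob U_RBA Z = A \<and> K_str Z = h"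
    using f T_algebra_op[OF f(1,3-5)] by (intro bexI[of _ "(A, op_of A f)"]) auto
next
  show "g = g'" if "arrow (RBA S) g Y Z" "arrow (RBA S) g' Y Z" "ar U_RBA g = ar U_RBA g'" for g g' Y Z
    using that by (cases Y; cases Z) (auto simp: RBA_arrow)
qed

lemma H_iso: "is_iso_of_categories (DIF S) (ALG_C S) (func_H S)"
  unfolding func_H_def
proof (rule add_struct_coalg_iso[OF comonad_C functor_V_DIF])
  fix Z assume "Z \<in> Obj (DIF S)"
  then show "(ob V_DIF Z, H_str Z) \<in> Obj (ALG_C S)"
    by (cases Z) (simp add: coalg_cat_obj ALG_arrow Seq_algebra orbit_hom compose_eq_iff compose_eq_restrict_iff
        orbit_coassoc orbit_counit)
next
  fix Y Z f assume *: "Y \<in> Obj (DIF S)" "Z \<in> Obj (DIF S)" "arrow (ALG S) f (ob V_DIF Y) (ob V_DIF Z)"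
  obtain A d B e where [simp]: "Y = (A, d)" "Z = (B, e)" by (metis surj_pair)
  show "(H_str Z \<bullet>\<^bsub>ALG S\<^esub> f =
     ar (wfun (comonad_C S)) f \<bullet>\<^bsub>ALG S\<^esub> H_str Y) \<longleftrightarrow>
     (\<exists>g. arrow (DIF S) g Y Z \<and> ar V_DIF g = f)"
    using * by (auto simp: ALG_arrow DIF_arrow compose_eq_iff C_morphism_iff)
next
  fix Y Z assume "Y \<in> Obj (DIF S)" "Z \<in> Obj (DIF S)" "ob V_DIF Y = ob V_DIF Z"
    "H_str Y = H_str Z"
  then show "Y = Z" by (cases Y; cases Z) (auto, metis deriv_of_orbit)
next
  fix A h assume "(A, h) \<in> Obj (ALG_C S)"
  then obtain f where f: "algebra k A" "h = (A, f, Seq S A)" "f \<in> alg_hom k A (Seq S A)"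
    "\<And>a. a\<in>carrier A \<Longrightarrow> seq_counit S A (f a) = a"
    "\<And>a. a\<in>carrier A \<Longrightarrow> Seq_map S A f (f a) = seq_comult S A (f a)"
    by (auto simp: coalg_cat_obj ALG_arrow compose_eq_iff compose_eq_restrict_iff)
  show "\<exists>Z\<in>Obj (DIF S). ob V_DIF Z = A \<and> H_str Z = h"
    using f C_coalgebra_deriv[OF f(1,3-5)] by (intro bexI[of _ "(A, deriv_of A f)"]) auto
next
  show "g = g'" if "arrow (DIF S) g Y Z" "arrow (DIF S) g' Y Z" "ar V_DIF g = ar V_DIF g'" for g g' Y Z
    using that by (cases Y; cases Z) (auto simp: DIF_arrow)
qed

lemma K'_iso: "is_iso_of_categories (DRB S) (DIF_T' S) (func_K' S)"
  unfolding func_K'_def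
proof (rule add_struct_alg_iso[OF monad_T' functor_U'_DRB])
  fix Z assume "Z \<in> Obj (DRB S)"
  then show "(ob U'_DRB Z, K'_str Z) \<in> Obj (DIF_T' S)"
    by (cases Z) (simp add: alg_cat_obj DIF_arrow Sha_DIF_eq Sha_algebra d_free_deriv evaluation_hom evaluation_assoc
       evaluation_derivation_iff compose_eq_iff compose_eq_restrict_iff)
next
  fix Y Z f assume *: "Y \<in> Obj (DRB S)" "Z \<in> Obj (DRB S)" "arrow (DIF S) f (ob U'_DRB Y) (ob U'_DRB Z)"
  obtain A d P B e Q where [simp]: "Y = (A, d, P)" "Z = (B, e, Q)" by (metis surj_pair)
  show "(f \<bullet>\<^bsub>DIF S\<^esub> K'_str Y =
     K'_str Z \<bullet>\<^bsub>DIF S\<^esub> ar (mfun (monad_T' S)) f) \<longleftrightarrow>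
     (\<exists>g. arrow (DRB S) g Y Z \<and> ar U'_DRB g = f)"
    using * by (auto simp: DIF_arrow DRB_arrow Sha_DIF_eq compose_eq_iff T_morphism_iff)
next
  fix Y Z assume "Y \<in> Obj (DRB S)" "Z \<in> Obj (DRB S)" "ob U'_DRB Y = ob U'_DRB Z"
    "K'_str Y
      = K'_str Z"
  then show "Y = Z" by (cases Y; cases Z) (auto, metis op_of_evaluation)
next
  fix Y h assume Y: "(Y, h) \<in> Obj (DIF_T' S)"
  obtain A d where [simp]: "Y = (A, d)" by force
  obtain f where f: "algebra k A" "h = ((Sha S A, d_free A d), f, (A, d))" "f \<in> alg_hom k (Sha S A) A"
    "\<And>a. a\<in>carrier A \<Longrightarrow> f (eta S A a) = a"
    "\<And>x. x\<in>carrier (Sha S (Sha S A)) \<Longrightarrow> f (Sha_map S (Sha S A) A f x) = f (evaluation S (Sha S A, P_free A) x)"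
    and d: "weighted_derivation k lam A d" "\<forall>x\<in>carrier (Sha S A). f (d_free A d x) = d (f x)"
    using Y by (auto simp: alg_cat_obj DIF_arrow compose_eq_iff compose_eq_restrict_iff)
  note P = T_algebra_op[OF f(1,3-5)]
  have "\<forall>x\<in>carrier A. d (op_of A f x) = x"
    using evaluation_derivation_iff[OF f(1) P(1) d(1)] d(2) P(2) by simp
  then show "\<exists>Z\<in>Obj (DRB S). ob U'_DRB Z = Y \<and> K'_str Z = h"
    using f P d(1) by (intro bexI[of _ "(A, d, op_of A f)"]) (auto simp: Sha_DIF_eq)
next
  show "g = g'" if "arrow (DRB S) g Y Z" "arrow (DRB S) g' Y Z" "ar U'_DRB g = ar U'_DRB g'" for g g' Y Z
    using that by (cases Y; cases Z) (auto simp: DRB_arrow)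
qed

lemma H'_iso: "is_iso_of_categories (DRB S) (RBA_C' S) (func_H' S)"
  unfolding func_H'_def
proof (rule add_struct_coalg_iso[OF comonad_C' functor_V'_DRB])
  fix Z assume "Z \<in> Obj (DRB S)"
  then show "(ob V'_DRB Z, H'_str Z) \<in> Obj (RBA_C' S)"
    by (cases Z) (simp add: coalg_cat_obj RBA_arrow Seq_RBA_eq Seq_algebra P_seq_rb orbit_hom compose_eq_iff
        compose_eq_restrict_iff orbit_coassoc orbit_counit orbit_P_iff)
next
  fix Y Z f assume *: "Y \<in> Obj (DRB S)" "Z \<in> Obj (DRB S)" "arrow (RBA S) f (ob V'_DRB Y) (ob V'_DRB Z)"
  obtain A d P B e Q where [simp]: "Y = (A, d, P)" "Z = (B, e, Q)" by (metis surj_pair)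
  show "(H'_str Z \<bullet>\<^bsub>RBA S\<^esub> f =
     ar (wfun (comonad_C' S)) f \<bullet>\<^bsub>RBA S\<^esub> H'_str Y) \<longleftrightarrow>
     (\<exists>g. arrow (DRB S) g Y Z \<and> ar V'_DRB g = f)"
    using * by (auto simp: RBA_arrow DRB_arrow Seq_RBA_eq compose_eq_iff C_morphism_iff)
next
  fix Y Z assume "Y \<in> Obj (DRB S)" "Z \<in> Obj (DRB S)" "ob V'_DRB Y = ob V'_DRB Z"
    "H'_str Y
      = H'_str Z"
  then show "Y = Z" by (cases Y; cases Z) (auto, metis deriv_of_orbit)
next
  fix Y h assume Y: "(Y, h) \<in> Obj (RBA_C' S)"
  obtain A P where [simp]: "Y = (A, P)" by force
  obtain f where f: "algebra k A" "h = ((A, P), f, (Seq S A, P_seq A P))" "f \<in> alg_hom k A (Seq S A)"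
    "\<And>a. a\<in>carrier A \<Longrightarrow> seq_counit S A (f a) = a"
    "\<And>a. a\<in>carrier A \<Longrightarrow> Seq_map S A f (f a) = seq_comult S A (f a)"
    and P: "rota_baxter k lam A P" "\<forall>x\<in>carrier A. f (P x) = P_seq A P (f x)"
    using Y by (auto simp: coalg_cat_obj RBA_arrow compose_eq_iff compose_eq_restrict_iff)
  note d = C_coalgebra_deriv[OF f(1,3-5)]
  have "\<forall>x\<in>carrier A. deriv_of A f (P x) = x"
    using orbit_P_iff[OF f(1) P(1) d(1)] P(2) d(2) by simp
  then show "\<exists>Z\<in>Obj (DRB S). ob V'_DRB Z = Y \<and> H'_str Z = h"
    using f P(1) d by (intro bexI[of _ "(A, deriv_of A f, P)"]) (auto simp: Seq_RBA_eq)
next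
  show "g = g'" if "arrow (DRB S) g Y Z" "arrow (DRB S) g' Y Z" "ar V'_DRB g = ar V'_DRB g'" for g g' Y Z
    using that by (cases Y; cases Z) (auto simp: DRB_arrow)
qed


section \<open>The distributive law and the square\<close>

text \<open>The description in the definition of \<open>\<beta>\<close> is met by one arrow only, the evaluation of
  \<open>Sha(A)\<^sup>\<nat>\<close> after \<open>Sha(\<eta>\<^sup>\<nat>)\<close>.\<close>

lemma beta_hom:
  assumes A: "algebra k A"
  obtains b where "beta S A = (Sha S (Seq S A), b, Seq S (Sha S A))" "b \<in> alg_hom k (Sha S (Seq S A)) (Seq S (Sha S A))"
    "\<And>x. x \<in> carrier (Sha S (Seq S A)) \<Longrightarrow> b (P_free (Seq S A) x) = P_seq (Sha S A) (P_free A) (b x)"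
    "\<And>x. x \<in> carrier (Seq S A) \<Longrightarrow> b (eta S (Seq S A) x) = Seq_map S A (eta S A) x"
proof -
  let ?X = "(Sha S (Seq S A), P_free (Seq S A))" and ?Y = "(Seq S (Sha S A), P_seq (Sha S A) (P_free A))"
  note SA = Sha_algebra[OF A] and QA = Seq_algebra[OF A] and P = P_free_rb[OF A]
  note QSA = Seq_algebra[OF SA] and SQA = Sha_algebra[OF QA] and PQ = P_seq_rb[OF SA P]
  note eh = Seq_map_hom[OF A SA eta_hom[OF A]]
  let ?P = "\<lambda>b. b \<in> alg_hom k (Sha S (Seq S A)) (Seq S (Sha S A)) \<and>
    (\<forall>x\<in>carrier (Sha S (Seq S A)). b (P_free (Seq S A) x) = P_seq (Sha S A) (P_free A) (b x)) \<and>
    (\<forall>x\<in>carrier (Seq S A). b (eta S (Seq S A) x) = Seq_map S A (eta S A) x)"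
  define b where "b = compose (carrier (Sha S (Seq S A))) (evaluation S ?Y) (Sha_map S (Seq S A) (Seq S (Sha S A)) (Seq_map S A (eta S A)))"
  note m = Sha_map_hom[OF QA QSA eh] and e = evaluation_hom[OF QSA PQ]
  have b: "?P b"
  proof (intro conjI ballI)
    show "b \<in> alg_hom k (Sha S (Seq S A)) (Seq S (Sha S A))"
      unfolding b_def by (rule compose_alg_hom[OF SQA m(1) e(1)])
    show "b (P_free (Seq S A) x) = P_seq (Sha S A) (P_free A) (b x)" if "x \<in> carrier (Sha S (Seq S A))" for x
      using that m e alg_hom_closed[OF m(1)] rota_baxter_closed[OF P_free_rb[OF QA]] by (simp add: b_def compose_eq)
    show "b (eta S (Seq S A) x) = Seq_map S A (eta S A) x" if "x \<in> carrier (Seq S A)" for x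
      using that m e alg_hom_closed[OF eh] eta_closed[OF QA] by (simp add: b_def compose_eq)
  qed
  have uniq: "b' = b" if "?P b'" for b'
    by (rule rb_homs_equal[OF QA, where P = "P_seq (Sha S A) (P_free A)" and R = "Seq S (Sha S A)"])
      (simp_all add: that b)
  let ?Q = "\<lambda>b. b \<in> Arr (RBA S) \<and>
     Dom (RBA S) b = free_RBA S (Seq S A) \<and> Cod (RBA S) b = Seq_RBA S (free_RBA S A) \<and>
     ar U_RBA b \<bullet>\<^bsub>ALG S\<^esub> munit (monad_T S) (Seq S A) = ar (wfun (comonad_C S)) (munit (monad_T S) A)"
  have ce: "compose (carrier (Seq S A)) b' (eta S (Seq S A)) = Seq_map S A (eta S A) \<longleftrightarrow>
      (\<forall>x\<in>carrier (Seq S A). b' (eta S (Seq S A) x) = Seq_map S A (eta S A) x)" for b'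
  proof
    assume e: "compose (carrier (Seq S A)) b' (eta S (Seq S A)) = Seq_map S A (eta S A)"
    show "\<forall>x\<in>carrier (Seq S A). b' (eta S (Seq S A) x) = Seq_map S A (eta S A) x"
      by (simp add: e[symmetric] compose_eq)
  next
    assume "\<forall>x\<in>carrier (Seq S A). b' (eta S (Seq S A) x) = Seq_map S A (eta S A) x"
    then show "compose (carrier (Seq S A)) b' (eta S (Seq S A)) = Seq_map S A (eta S A)"
      by (intro extensionalityI[of _ "carrier (Seq S A)"]) (simp_all add: compose_eq, simp add: Seq_map_def)
  qed
  have Q: "?Q c \<longleftrightarrow> (\<exists>b'. c = (?X, b', ?Y) \<and> ?P b')" for c
  proof -
    have "?Q c \<longleftrightarrow> arrow (RBA S) c ?X ?Y \<and>
       ar U_RBA c \<bullet>\<^bsub>ALG S\<^esub> munit (monad_T S) (Seq S A) = ar (wfun (comonad_C S)) (munit (monad_T S) A)"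
      by (auto simp: arrow_def free_RBA_eq Seq_RBA_eq)
    also have "\<dots> \<longleftrightarrow> (\<exists>b'. c = (?X, b', ?Y) \<and> ?P b')"
    proof
      assume c: "arrow (RBA S) c ?X ?Y \<and>
        ar U_RBA c \<bullet>\<^bsub>ALG S\<^esub> munit (monad_T S) (Seq S A) = ar (wfun (comonad_C S)) (munit (monad_T S) A)"
      then obtain b' where "c = (?X, b', ?Y)" by (auto simp: RBA_arrow)
      with c show "\<exists>b'. c = (?X, b', ?Y) \<and> ?P b'" by (intro exI[of _ b']) (simp add: RBA_arrow ce)
    next
      assume "\<exists>b'. c = (?X, b', ?Y) \<and> ?P b'"
      then show "arrow (RBA S) c ?X ?Y \<and>
        ar U_RBA c \<bullet>\<^bsub>ALG S\<^esub> munit (monad_T S) (Seq S A) = ar (wfun (comonad_C S)) (munit (monad_T S) A)"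
        by (elim exE conjE) (simp add: RBA_arrow ce SQA QSA P_free_rb[OF QA] PQ)
    qed
    finally show ?thesis .
  qed
  have "(THE c. ?Q c) = (?X, b, ?Y)"
  proof (rule the_equality)
    show "?Q (?X, b, ?Y)" by (rule iffD2[OF Q]) (use b in blast)
    fix c assume "?Q c"
    from iffD1[OF Q this] obtain b' where c: "c = (?X, b', ?Y)" and b': "?P b'" by blast
    show "c = (?X, b, ?Y)" using uniq[OF b'] c by simp
  qed
  then have "beta S A = (Sha S (Seq S A), b, Seq S (Sha S A))" by (simp add: beta_def)
  then show ?thesis by (rule that) (use b in blast)+
qed

lemma K_simps [simp]: "ob (func_K S) (R, P) = (R, (Sha S R, evaluation S (R, P), R))"
  "ar (func_K S) ((R, P), g, (R', P')) = ((R, (Sha S R, evaluation S (R, P), R)), (R, g, R'), (R', (Sha S R', evaluation S (R', P'), R')))"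
  by (simp_all add: func_K_def add_struct_def RBA_def concrete_cat_def)

lemma H_simps [simp]: "ob (func_H S) (R, d) = (R, (R, orbit_map S R d, Seq S R))"
  "ar (func_H S) ((R, d), g, (R', d')) = ((R, (R, orbit_map S R d, Seq S R)), (R, g, R'), (R', (R', orbit_map S R' d', Seq S R')))"
  by (simp_all add: func_H_def add_struct_def DIF_def concrete_cat_def)

text \<open>The structure map on the left is \<open>ev\<^sup>\<nat> \<circ> \<beta>\<close>. It is a Rota-Baxter homomorphism,
  and on \<open>R\<^sup>\<nat>\<close> it is \<open>ev\<^sup>\<nat> \<circ> \<eta>\<^sup>\<nat> = id\<close>, as for
  the evaluation of \<open>R\<^sup>\<nat>\<close>.\<close>

lemma Ct_ob_K:
  assumes R: "algebra k R" and P: "rota_baxter k lam R P"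
  shows "Ct_ob S (ob (func_K S) (R, P)) = ob (func_K S) (Seq S R, P_seq R P)"
proof -
  obtain b where b: "beta S R = (Sha S (Seq S R), b, Seq S (Sha S R))" "b \<in> alg_hom k (Sha S (Seq S R)) (Seq S (Sha S R))"
    "\<And>x. x \<in> carrier (Sha S (Seq S R)) \<Longrightarrow> b (P_free (Seq S R) x) = P_seq (Sha S R) (P_free R) (b x)"
    "\<And>x. x \<in> carrier (Seq S R) \<Longrightarrow> b (eta S (Seq S R) x) = Seq_map S R (eta S R) x"
    using beta_hom[OF R] by metis
  note SR = Sha_algebra[OF R] and QR = Seq_algebra[OF R]
  note e = evaluation_hom[OF R P] and m = Seq_map_hom[OF SR R evaluation_hom(1)[OF R P]]
  note e' = evaluation_hom[OF QR P_seq_rb[OF R P]]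
  have PQ: "Seq_map S (Sha S R) (evaluation S (R, P)) (P_seq (Sha S R) (P_free R) x) =
      P_seq R P (Seq_map S (Sha S R) (evaluation S (R, P)) x)" if "x \<in> carrier (Seq S (Sha S R))" for x
    by (rule Seq_map_P_seq[OF SR R e(1) that]) (use rota_baxter_closed[OF P_free_rb[OF R]] e(2) in auto)
  have "compose (carrier (Sha S (Seq S R))) (Seq_map S (Sha S R) (evaluation S (R, P))) b = evaluation S (Seq S R, P_seq R P)"
  proof (rule rb_homs_equal[OF QR _ e'(1), where P = "P_seq R P"])
    show "compose (carrier (Sha S (Seq S R))) (Seq_map S (Sha S R) (evaluation S (R, P))) b \<in> alg_hom k (Sha S (Seq S R)) (Seq S R)"
      by (rule compose_alg_hom[OF Sha_algebra[OF QR] b(2) m])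
    show "compose (carrier (Sha S (Seq S R))) (Seq_map S (Sha S R) (evaluation S (R, P))) b (P_free (Seq S R) x)
      = P_seq R P (compose (carrier (Sha S (Seq S R))) (Seq_map S (Sha S R) (evaluation S (R, P))) b x)"
      if x: "x \<in> carrier (Sha S (Seq S R))" for x
      using x rota_baxter_closed[OF P_free_rb[OF QR]] b PQ alg_hom_closed[OF b(2)] by (simp add: compose_eq)
    show "compose (carrier (Sha S (Seq S R))) (Seq_map S (Sha S R) (evaluation S (R, P))) b (eta S (Seq S R) x)
        = evaluation S (Seq S R, P_seq R P) (eta S (Seq S R) x)" if x: "x \<in> carrier (Seq S R)" for x
    proof -
      obtain f where f: "x = seq_code S f" "\<And>n. f n \<in> carrier R" using Seq_cases[OF R x] by metis
      have "Seq_map S (Sha S R) (evaluation S (R, P)) (Seq_map S R (eta S R) x) = x"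
        using f e(3) eta_closed[OF R] by (simp add: Seq_map_code R SR)
      then show ?thesis using x b(4) e'(3) eta_closed[OF QR] by (simp add: compose_eq)
    qed
  qed (use e' in simp_all)
  then show ?thesis by (simp add: Ct_ob_def b(1))
qed

text \<open>Both structure maps are Rota-Baxter homomorphisms from \<open>Sha(A)\<close> to \<open>Sha(A)\<^sup>\<nat>\<close>:
  the one on the left as a composite, the orbit map of the derivation of \<open>Sha(A)\<close> because this derivation
  is left inverse to \<open>P\<close>. On \<open>a\<close> in \<open>A\<close> both give the sequence of the elements
  \<open>\<eta>(d\<^sup>n a)\<close>.\<close>

lemma Tt_ob_H:
  assumes A: "algebra k A" and d: "weighted_derivation k lam A d"
  shows "Tt_ob S (ob (func_H S) (A, d)) = ob (func_H S) (Sha S A, d_free A d)"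
proof -
  obtain b where b: "beta S A = (Sha S (Seq S A), b, Seq S (Sha S A))" "b \<in> alg_hom k (Sha S (Seq S A)) (Seq S (Sha S A))"
    "\<And>x. x \<in> carrier (Sha S (Seq S A)) \<Longrightarrow> b (P_free (Seq S A) x) = P_seq (Sha S A) (P_free A) (b x)"
    "\<And>x. x \<in> carrier (Seq S A) \<Longrightarrow> b (eta S (Seq S A) x) = Seq_map S A (eta S A) x"
    using beta_hom[OF A] by metis
  note SA = Sha_algebra[OF A] and QA = Seq_algebra[OF A] and P = P_free_rb[OF A] and dd = d_free_deriv[OF A d]
  note o = orbit_hom[OF A d] and m = Sha_map_hom[OF A QA orbit_hom[OF A d]]
  have "compose (carrier (Sha S A)) b (Sha_map S A (Seq S A) (orbit_map S A d)) = orbit_map S (Sha S A) (d_free A d)"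
  proof (rule rb_homs_equal[OF A _ orbit_hom[OF SA dd(1)], where P = "P_seq (Sha S A) (P_free A)"])
    show "compose (carrier (Sha S A)) b (Sha_map S A (Seq S A) (orbit_map S A d)) \<in> alg_hom k (Sha S A) (Seq S (Sha S A))"
      by (rule compose_alg_hom[OF SA m(1) b(2)])
    show "compose (carrier (Sha S A)) b (Sha_map S A (Seq S A) (orbit_map S A d)) (P_free A x)
      = P_seq (Sha S A) (P_free A) (compose (carrier (Sha S A)) b (Sha_map S A (Seq S A) (orbit_map S A d)) x)"
      if x: "x \<in> carrier (Sha S A)" for x
      using x rota_baxter_closed[OF P] b m alg_hom_closed[OF m(1)] by (simp add: compose_eq)
    show "orbit_map S (Sha S A) (d_free A d) (P_free A x) = P_seq (Sha S A) (P_free A) (orbit_map S (Sha S A) (d_free A d) x)"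
      if x: "x \<in> carrier (Sha S A)" for x
      by (rule orbit_map_P[OF SA dd(1)]) (use x dd rota_baxter_closed[OF P] in auto)
    show "compose (carrier (Sha S A)) b (Sha_map S A (Seq S A) (orbit_map S A d)) (eta S A x)
        = orbit_map S (Sha S A) (d_free A d) (eta S A x)" if x: "x \<in> carrier A" for x
    proof -
      have "eta S A ((d ^^ n) x) = (d_free A d ^^ n) (eta S A x)" for n
        by (rule hom_funpow[of A]) (use dd(3) x weighted_derivation_closed[OF d] in auto)
      then show ?thesis
        using x eta_closed[OF A x] b(4) m(3) alg_hom_closed[OF o] deriv_funpow_closed[OF A d x]
        by (simp add: compose_eq orbit_map_simp[OF eta_closed[OF A x]] orbit_map_simp[OF x] Seq_map_code A Seq_closed)
    qed
  qed
  then show ?thesis by (simp add: Tt_ob_def b(1))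
qed

lemma Kt_iso: "is_comonad (ALG_T S) (comonad_Ct S)" "is_iso_of_categories (RBA_C' S) (ALG_T_Ct S) (func_Kt S)"
proof -
  have 1: "ob (wfun (comonad_Ct S)) (ob (func_K S) X) = ob (func_K S) (ob (wfun (comonad_C' S)) X)"
    if "X \<in> Obj (RBA S)" for X
    using that Ct_ob_K by (cases X) (simp add: comonad_Ct_def)
  have 2: "ar (wfun (comonad_Ct S)) (ar (func_K S) f) = ar (func_K S) (ar (wfun (comonad_C' S)) f)"
    if "arrow (RBA S) f X Y" for f X Y
    using that Ct_ob_K by (cases X; cases Y) (auto simp: RBA_arrow comonad_Ct_def)
  have 3: "wcounit (comonad_Ct S) (ob (func_K S) X) = ar (func_K S) (wcounit (comonad_C' S) X)"
    if "X \<in> Obj (RBA S)" for X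
    using that Ct_ob_K by (cases X) (simp add: comonad_Ct_def)
  have 4: "wcomult (comonad_Ct S) (ob (func_K S) X) = ar (func_K S) (wcomult (comonad_C' S) X)"
    if "X \<in> Obj (RBA S)" for X
  proof -
    obtain R P where X: "X = (R, P)" "algebra k R" "rota_baxter k lam R P" using \<open>X \<in> Obj (RBA S)\<close> by (cases X) auto
    show ?thesis using X Ct_ob_K[OF X(2,3)] Ct_ob_K[OF Seq_algebra[OF X(2)] P_seq_rb[OF X(2,3)]] by (simp add: comonad_Ct_def)
  qed
  show "is_comonad (ALG_T S) (comonad_Ct S)" "is_iso_of_categories (RBA_C' S) (ALG_T_Ct S) (func_Kt S)"
    by (rule comonad_transport[OF K_iso comonad_C' 1 2 3 4]; assumption)+
qed

lemma Ht_iso: "is_monad (ALG_C S) (monad_Tt S)" "is_iso_of_categories (DIF_T' S) (ALG_C_Tt S) (func_Ht S)"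
proof -
  have 1: "ob (mfun (monad_Tt S)) (ob (func_H S) X) = ob (func_H S) (ob (mfun (monad_T' S)) X)"
    if "X \<in> Obj (DIF S)" for X
    using that Tt_ob_H by (cases X) (simp add: monad_Tt_def)
  have 2: "ar (mfun (monad_Tt S)) (ar (func_H S) f) = ar (func_H S) (ar (mfun (monad_T' S)) f)"
    if "arrow (DIF S) f X Y" for f X Y
    using that Tt_ob_H by (cases X; cases Y) (auto simp: DIF_arrow monad_Tt_def)
  have 3: "munit (monad_Tt S) (ob (func_H S) X) = ar (func_H S) (munit (monad_T' S) X)"
    if "X \<in> Obj (DIF S)" for X
    using that Tt_ob_H by (cases X) (simp add: monad_Tt_def)
  have 4: "mmult (monad_Tt S) (ob (func_H S) X) = ar (func_H S) (mmult (monad_T' S) X)"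
    if "X \<in> Obj (DIF S)" for X
  proof -
    obtain A d where X: "X = (A, d)" "algebra k A" "weighted_derivation k lam A d" using \<open>X \<in> Obj (DIF S)\<close> by (cases X) auto
    show ?thesis using X Tt_ob_H[OF X(2,3)] Tt_ob_H[OF Sha_algebra[OF X(2)] d_free_deriv(1)[OF X(2,3)]] by (simp add: monad_Tt_def)
  qed
  show "is_monad (ALG_C S) (monad_Tt S)" "is_iso_of_categories (DIF_T' S) (ALG_C_Tt S) (func_Ht S)"
    by (rule monad_transport[OF H_iso monad_T' 1 2 3 4]; assumption)+
qed

text \<open>The two objects have the same components; only the free algebra that is the source of the outer structure map is
  described differently, by \<open>\<beta>\<close> on one side and by the derivation of \<open>Sha(R)\<close> on the
  other.\<close>

lemma Phi_square:
  assumes "X \<in> Obj (DRB S)"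
  shows "ob (func_Phi S \<circ>\<^sub>F func_Kt S \<circ>\<^sub>F func_H' S) X = ob (func_Ht S \<circ>\<^sub>F func_K' S) X"
proof -
  obtain R d P where X: "X = (R, d, P)" "algebra k R" "weighted_derivation k lam R d" using assms by (cases X) auto
  show ?thesis using Tt_ob_H[OF X(2,3)]
    by (simp add: X(1) func_H'_def func_K'_def func_Phi_def Phi_ob_def Let_def Sha_DIF_eq Seq_RBA_eq)
qed

lemma Phi_square_arrow:
  assumes f: "arrow (DRB S) f X Y"
  shows "ar (func_Phi S \<circ>\<^sub>F func_Kt S \<circ>\<^sub>F func_H' S) f = ar (func_Ht S \<circ>\<^sub>F func_K' S) f"
proof -
  interpret category "DRB S" by (rule category_DRB)
  obtain R d P R' d' P' where XY [simp]: "X = (R, d, P)" "Y = (R', d', P')" by (metis surj_pair)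
  obtain g where g: "f = (X, g, Y)" using f by (auto simp: DRB_arrow)
  note e = Phi_square[OF arrow_obj(1)[OF f]] Phi_square[OF arrow_obj(2)[OF f]]
  have h: "ar (func_H' S) f = (ob (func_H' S) X, ((R, P), g, (R', P')), ob (func_H' S) Y)"
    using f by (simp add: func_H'_def add_struct_arrow g)
  have k: "ar (func_K' S) f = (ob (func_K' S) X, ((R, d), g, (R', d')), ob (func_K' S) Y)"
    using f by (simp add: func_K'_def add_struct_arrow g)
  have 1: "ar (lift_functor F) (x, u, y) = (ob (lift_functor F) x, ar F u, ob (lift_functor F) y)" for F x u y
    by (cases x; cases y) simp
  have 2: "fst (ob (func_Ht S) (ob (func_K' S) (R, d, P))) = (R, (R, orbit_map S R d, Seq S R))" for R d P
    by (simp add: func_K'_def)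
  have 3: "ar (func_Phi S) (x, u, y) = (ob (func_Phi S) x, (fst (ob (func_Phi S) x), ar (U_T S) u, fst (ob (func_Phi S) y)), ob (func_Phi S) y)" for x u y
    by (simp add: func_Phi_def)
  show ?thesis using e by (simp add: h k 1 2 3)
qed

lemma Phi_functor: "is_functor (ALG_T_Ct S) (ALG_C_Tt S) (func_Phi S)"
proof (rule functor_of_iso_factor[OF iso_comp[OF H'_iso Kt_iso(2)]])
  show "is_functor (DRB S) (ALG_C_Tt S) (func_Ht S \<circ>\<^sub>F func_K' S)"
    by (rule functor_fcomp[OF iso_catD(1)[OF K'_iso] iso_catD(1)[OF Ht_iso(2)]])
qed (use Phi_square Phi_square_arrow in simp_all)

lemma lift_forget_arrow: "arrow (alg_cat C M) f X Y \<Longrightarrow> ar (forget_alg D N) (ar (lift_functor F) f) = ar F (ar (forget_alg C M) f)"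
  "arrow (coalg_cat C W) f X Y \<Longrightarrow> ar (forget_coalg D V) (ar (lift_functor F) f) = ar F (ar (forget_coalg C W) f)"
  by (cases X; cases Y; auto simp: alg_cat_arrow coalg_cat_arrow)+

end

theorem theorem5p9:
  fixes S :: "('k, 'u) setting"
  assumes "valid_setting S"
  shows
   "functor_eq (RBA S) (ALG S) (U_T S \<circ>\<^sub>F func_K S) U_RBA
  \<and> functor_eq (DIF S) (ALG S) (V_C S \<circ>\<^sub>F func_H S) V_DIF
  \<and> functor_eq (DRB S) (RBA S) (V'_C' S \<circ>\<^sub>F func_H' S) V'_DRB
  \<and> functor_eq (RBA_C' S) (ALG_T S) (V_Ct S \<circ>\<^sub>F func_Kt S) (func_K S \<circ>\<^sub>F V'_C' S)
  \<and> functor_eq (DRB S) (DIF S) (U'_T' S \<circ>\<^sub>F func_K' S) U'_DRB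
  \<and> functor_eq (DIF_T' S) (ALG_C S) (U_Tt S \<circ>\<^sub>F func_Ht S) (func_H S \<circ>\<^sub>F U'_T' S)
  \<and> functor_eq (ALG_T_Ct S) (ALG S) (V_C S \<circ>\<^sub>F U_Tt S \<circ>\<^sub>F func_Phi S) (U_T S \<circ>\<^sub>F V_Ct S)
  \<and> functor_eq (DRB S) (ALG_C_Tt S) (func_Phi S \<circ>\<^sub>F func_Kt S \<circ>\<^sub>F func_H' S) (func_Ht S \<circ>\<^sub>F func_K' S)
  \<and> functor_eq (DRB S) (ALG S) (U_RBA \<circ>\<^sub>F V'_DRB) (V_DIF \<circ>\<^sub>F U'_DRB)
  \<and> is_functor (ALG_T_Ct S) (ALG_C_Tt S) (func_Phi S)
  \<and> left_adjoint_generates (RBA S) (ALG S) U_RBA (monad_T S)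
  \<and> left_adjoint_generates (ALG_T S) (ALG S) (U_T S) (monad_T S)
  \<and> left_adjoint_generates (DRB S) (DIF S) U'_DRB (monad_T' S)
  \<and> left_adjoint_generates (DIF_T' S) (DIF S) (U'_T' S) (monad_T' S)
  \<and> left_adjoint_generates (ALG_C_Tt S) (ALG_C S) (U_Tt S) (monad_Tt S)
  \<and> right_adjoint_generates (DIF S) (ALG S) V_DIF (comonad_C S)
  \<and> right_adjoint_generates (ALG_C S) (ALG S) (V_C S) (comonad_C S)
  \<and> right_adjoint_generates (DRB S) (RBA S) V'_DRB (comonad_C' S)
  \<and> right_adjoint_generates (RBA_C' S) (RBA S) (V'_C' S) (comonad_C' S)
  \<and> right_adjoint_generates (ALG_T_Ct S) (ALG_T S) (V_Ct S) (comonad_Ct S)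
  \<and> is_iso_of_categories (RBA S) (ALG_T S) (func_K S)
  \<and> is_iso_of_categories (DRB S) (DIF_T' S) (func_K' S)
  \<and> is_iso_of_categories (RBA_C' S) (ALG_T_Ct S) (func_Kt S)
  \<and> is_iso_of_categories (DIF S) (ALG_C S) (func_H S)
  \<and> is_iso_of_categories (DRB S) (RBA_C' S) (func_H' S)
  \<and> is_iso_of_categories (DIF_T' S) (ALG_C_Tt S) (func_Ht S)"
proof (intro conjI)
  interpret universe S by (rule universe.intro[OF assms])
  show "functor_eq (RBA S) (ALG S) (U_T S \<circ>\<^sub>F func_K S) U_RBA"
    by (rule functor_eqI[OF functor_U_RBA]) (simp_all add: func_K_def)
  show "functor_eq (DIF S) (ALG S) (V_C S \<circ>\<^sub>F func_H S) V_DIF"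
    by (rule functor_eqI[OF functor_V_DIF]) (simp_all add: func_H_def)
  show "functor_eq (DRB S) (RBA S) (V'_C' S \<circ>\<^sub>F func_H' S) V'_DRB"
    by (rule functor_eqI[OF functor_V'_DRB]) (simp_all add: func_H'_def)
  show "functor_eq (DRB S) (DIF S) (U'_T' S \<circ>\<^sub>F func_K' S) U'_DRB"
    by (rule functor_eqI[OF functor_U'_DRB]) (simp_all add: func_K'_def)
  show "functor_eq (RBA_C' S) (ALG_T S) (V_Ct S \<circ>\<^sub>F func_Kt S) (func_K S \<circ>\<^sub>F V'_C' S)"
    by (rule functor_eqI[OF functor_fcomp[OF right_adjoint_generates_functor[OF forget_coalg_generates[OF comonad_C']]
          iso_catD(1)[OF K_iso]]]) (auto simp: lift_forget_arrow(2))
  show "functor_eq (DIF_T' S) (ALG_C S) (U_Tt S \<circ>\<^sub>F func_Ht S) (func_H S \<circ>\<^sub>F U'_T' S)"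
    by (rule functor_eqI[OF functor_fcomp[OF functor_forget_alg[OF monad_T'] iso_catD(1)[OF H_iso]]])
      (auto simp: lift_forget_arrow(1))
  show "functor_eq (ALG_T_Ct S) (ALG S) (V_C S \<circ>\<^sub>F U_Tt S \<circ>\<^sub>F func_Phi S) (U_T S \<circ>\<^sub>F V_Ct S)"
    by (rule functor_eqI[OF functor_fcomp[OF right_adjoint_generates_functor[OF forget_coalg_generates[OF Kt_iso(1)]]
          functor_forget_alg[OF monad_T]]])
      (auto simp: func_Phi_def Phi_ob_def Let_def)
  show "functor_eq (DRB S) (ALG_C_Tt S) (func_Phi S \<circ>\<^sub>F func_Kt S \<circ>\<^sub>F func_H' S) (func_Ht S \<circ>\<^sub>F func_K' S)"
    by (rule functor_eqI[OF functor_fcomp[OF iso_catD(1)[OF K'_iso] iso_catD(1)[OF Ht_iso(2)]]])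
      (fact Phi_square Phi_square_arrow)+
  show "functor_eq (DRB S) (ALG S) (U_RBA \<circ>\<^sub>F V'_DRB) (V_DIF \<circ>\<^sub>F U'_DRB)"
    by (rule functor_eqI[OF functor_fcomp[OF functor_U'_DRB functor_V_DIF]])
      (auto simp: DRB_arrow)
  show "is_functor (ALG_T_Ct S) (ALG_C_Tt S) (func_Phi S)" by (fact Phi_functor)
  show "left_adjoint_generates (RBA S) (ALG S) U_RBA (monad_T S)"
    "left_adjoint_generates (DRB S) (DIF S) U'_DRB (monad_T' S)"
    "right_adjoint_generates (DIF S) (ALG S) V_DIF (comonad_C S)"
    "right_adjoint_generates (DRB S) (RBA S) V'_DRB (comonad_C' S)"
    by (fact RBA_generates_T DRB_generates_T' DIF_generates_C DRB_generates_C')+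
  show "left_adjoint_generates (ALG_T S) (ALG S) (U_T S) (monad_T S)"
    "left_adjoint_generates (DIF_T' S) (DIF S) (U'_T' S) (monad_T' S)"
    "left_adjoint_generates (ALG_C_Tt S) (ALG_C S) (U_Tt S) (monad_Tt S)"
    by (rule forget_alg_generates, fact monad_T monad_T' Ht_iso(1))+
  show "right_adjoint_generates (ALG_C S) (ALG S) (V_C S) (comonad_C S)"
    "right_adjoint_generates (RBA_C' S) (RBA S) (V'_C' S) (comonad_C' S)"
    "right_adjoint_generates (ALG_T_Ct S) (ALG_T S) (V_Ct S) (comonad_Ct S)"
    by (rule forget_coalg_generates, fact comonad_C comonad_C' Kt_iso(1))+
  show "is_iso_of_categories (RBA S) (ALG_T S) (func_K S)"
    "is_iso_of_categories (DRB S) (DIF_T' S) (func_K' S)"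
    "is_iso_of_categories (RBA_C' S) (ALG_T_Ct S) (func_Kt S)"
    "is_iso_of_categories (DIF S) (ALG_C S) (func_H S)"
    "is_iso_of_categories (DRB S) (RBA_C' S) (func_H' S)"
    "is_iso_of_categories (DIF_T' S) (ALG_C_Tt S) (func_Ht S)"
    by (fact K_iso K'_iso Kt_iso(2) H_iso H'_iso Ht_iso(2))+
qed

end
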